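(* Let $r\ge 2$ be an integer and $T>0$. Let $(m,u)$, with $m=m(x,t)$, $u=u(x,t)$ 1-periodic in $x$, be the solution, assumed to be sufficiently smooth on $[0,1]\times[0,T]$, of the periodic initial-value problem $$m=u-u_{xx},\qquad m_t+(mu)_x+mu_x=0,\qquad 0\le x\le1,\ 0\le t\le T,$$ $$u(x,0)=u_0(x),\qquad m(x,0)=u_0(x)-u_0''(x),\qquad 0\le x\le 1.$$ For $h=1/N$, let $S_h$ be the space of smooth 1-periodic splines of order $r$ on the uniform mesh of size $h$. Then, for $h$ sufficiently small, the semidiscrete problem of finding $m_h,u_h:[0,T]\to S_h$ such that for $0\le t\le T$ $$(m_h,\phi)=(u_h,\phi)+(u_{hx},\phi')\qquad\forall\phi\in S_h,$$ $$(m_{ht},\phi)+((m_hu_h)_x,\phi)+(m_hu_{hx},\phi)=0\qquad\forall\phi\in S_h,$$ with initial value given by $$(m_h(0),\phi)=(u_0,\phi)+(u_0',\phi')\qquad\forall\phi\in S_h,$$ has a unique solution on $[0,T]$, and this solution satisfies $$\max_{0\le t\le T}\big(\|m(t)-m_h(t)\|+\|u(t)-u_h(t)\|\big)\le Ch^r$$ for some constant $C$ independent of $h$.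
   Context: Notation: $(\cdot,\cdot)$ and $\|\cdot\|$ are the inner product and norm of $L^2(0,1)$. "Sufficiently smooth" means having as many continuous derivatives (in $x$ and $t$) as needed for the estimate. Periodic splines: for a positive integer $N$ let $h=1/N$, $x_i=ih$, $i=0,\dots,N$, and for an integer $r\ge2$ let $$S_h=\{\phi\in C^{r-2}_{per}[0,1]:\ \phi|_{[x_{i-1},x_i]}\in\mathbb P_{r-1},\ 1\le i\le N\},$$ where $C^{k}_{per}$ denotes 1-periodic $k$-times continuously differentiable functions and $\mathbb P_{r-1}$ the polynomials of degree at most $r-1$. *)

theory Defs
  imports "HOL-Analysis.Analysis" "HOL-Computational_Algebra.Polynomial"
begin

text \<open>
  Functions of \<open>(x, t)\<close> are written with time first, so that \<open>u t\<close> is the spatial profile at time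
  \<open>t\<close>. Functions on \<open>[0,1]\<close> satisfying periodic boundary conditions are represented by their
  1-periodic extensions to the real line.
\<close>

definition periodic1 :: "(real \<Rightarrow> real) \<Rightarrow> bool" where
  "periodic1 f \<longleftrightarrow> (\<forall>x. f (x + 1) = f x)"

definition L2_inner :: "(real \<Rightarrow> real) \<Rightarrow> (real \<Rightarrow> real) \<Rightarrow> real" where
  "L2_inner f g = (LBINT x:{0..1}. f x * g x)"

definition L2_nrm :: "(real \<Rightarrow> real) \<Rightarrow> real" where
  "L2_nrm f = sqrt (L2_inner f f)"

definition C_per :: "nat \<Rightarrow> (real \<Rightarrow> real) set" where
  "C_per k = {f. periodic1 f \<and>
     (\<forall>j<k. \<forall>x. (deriv ^^ j) f field_differentiable (at x)) \<and>
     continuous_on UNIV ((deriv ^^ k) f)}"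

text \<open>
  Periodic splines of order \<open>r \<ge> 2\<close> on the uniform mesh of size \<open>1 / N\<close>. For \<open>r = 2\<close> a spline need
  not be differentiable at the mesh points; \<open>deriv\<close> then has unspecified values at these finitely
  many points of \<open>[0,1]\<close>, which do not influence the integrals below.
\<close>

definition spline_space :: "nat \<Rightarrow> nat \<Rightarrow> (real \<Rightarrow> real) set" where
  "spline_space r N = {\<phi> \<in> C_per (r - 2).
     \<forall>i\<in>{1..N}. \<exists>p::real poly. degree p \<le> r - 1 \<and>
       (\<forall>x\<in>{(real i - 1) / real N .. real i / real N}. \<phi> x = poly p x)}"

definition time_deriv :: "real \<Rightarrow> (real \<Rightarrow> real \<Rightarrow> real) \<Rightarrow> real \<Rightarrow> real \<Rightarrow> real" where
  "time_deriv T v t x = vector_derivative (\<lambda>s. v s x) (at t within {0..T})"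

text \<open>
  \<open>smooth_upto T k v\<close>: all partial derivatives of \<open>v\<close> in \<open>t\<close> and \<open>x\<close> of total order at most \<open>k\<close>
  exist and are continuous for \<open>0 \<le> t \<le> T\<close> and all real \<open>x\<close>, with one-sided time derivatives at
  \<open>t = 0\<close> and \<open>t = T\<close>.
\<close>

primrec smooth_upto :: "real \<Rightarrow> nat \<Rightarrow> (real \<Rightarrow> real \<Rightarrow> real) \<Rightarrow> bool" where
  "smooth_upto T 0 v \<longleftrightarrow> continuous_on ({0..T} \<times> UNIV) (\<lambda>(t, x). v t x)"
| "smooth_upto T (Suc k) v \<longleftrightarrow>
     continuous_on ({0..T} \<times> UNIV) (\<lambda>(t, x). v t x) \<and>
     (\<exists>vt vx.
       (\<forall>t\<in>{0..T}. \<forall>x.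
          ((\<lambda>s. v s x) has_real_derivative vt t x) (at t within {0..T}) \<and>
          (v t has_real_derivative vx t x) (at x)) \<and>
       smooth_upto T k vt \<and> smooth_upto T k vx)"

definition periodic_ivp_solution ::
  "real \<Rightarrow> (real \<Rightarrow> real) \<Rightarrow> (real \<Rightarrow> real \<Rightarrow> real) \<Rightarrow> (real \<Rightarrow> real \<Rightarrow> real) \<Rightarrow> bool" where
  "periodic_ivp_solution T u0 m u \<longleftrightarrow>
     periodic1 u0 \<and> (\<forall>t\<in>{0..T}. periodic1 (m t) \<and> periodic1 (u t)) \<and>
     (\<forall>t\<in>{0..T}. \<forall>x\<in>{0..1}.
        m t x = u t x - deriv (deriv (u t)) x \<and>
        time_deriv T m t x + deriv (\<lambda>y. m t y * u t y) x + m t x * deriv (u t) x = 0) \<and>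
     (\<forall>x\<in>{0..1}. u 0 x = u0 x \<and> m 0 x = u0 x - deriv (deriv u0) x)"

text \<open>
  Differentiability in time of the map \<open>mh\<close> into the finite-dimensional space of splines is
  expressed pointwise in \<open>x\<close>.
\<close>

definition semidiscrete_solution ::
  "nat \<Rightarrow> nat \<Rightarrow> real \<Rightarrow> (real \<Rightarrow> real) \<Rightarrow> (real \<Rightarrow> real \<Rightarrow> real) \<Rightarrow> (real \<Rightarrow> real \<Rightarrow> real) \<Rightarrow> bool"
where
  "semidiscrete_solution r N T u0 mh uh \<longleftrightarrow>
     (\<forall>t\<in>{0..T}. mh t \<in> spline_space r N \<and> uh t \<in> spline_space r N \<and>
        (\<forall>x. (\<lambda>s. mh s x) differentiable (at t within {0..T}))) \<and>
     (\<forall>t\<in>{0..T}. \<forall>\<phi>\<in>spline_space r N.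
        L2_inner (mh t) \<phi> = L2_inner (uh t) \<phi> + L2_inner (deriv (uh t)) (deriv \<phi>) \<and>
        L2_inner (time_deriv T mh t) \<phi>
          + L2_inner (deriv (\<lambda>x. mh t x * uh t x)) \<phi>
          + L2_inner (\<lambda>x. mh t x * deriv (uh t) x) \<phi> = 0) \<and>
     (\<forall>\<phi>\<in>spline_space r N.
        L2_inner (mh 0) \<phi> = L2_inner u0 \<phi> + L2_inner (deriv u0) (deriv \<phi>))"

end

theory Submission
  imports Defs
begin

text \<open>
  The Galerkin solution is compared with \<open>M = Q m\<close> and with the discrete elliptic solution \<open>U\<close> of
  data \<open>M\<close>, where \<open>Q\<close> is a quasi-interpolation operator that is local, exact on polynomials of
  degree less than \<open>r\<close> and commutes with translation by the mesh width \<open>h\<close>. The transport terms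
  put a derivative on the interpolation error \<open>e = m - Q m\<close>, which would cost one power of \<open>h\<close>. On
  a uniform mesh it does not: the derivative of a spline \<open>\<phi>\<close> is a difference quotient
  \<open>(\<psi>(x) - \<psi>(x - h)) / h\<close> of a spline \<open>\<psi>\<close> of lower order with \<open>\<parallel>\<psi>\<parallel> \<le> C \<parallel>\<phi>\<parallel>\<close>, so shifting the
  difference onto \<open>f e\<close> leaves \<open>e(x + h) - e(x)\<close>, which is the interpolation error of
  \<open>m(x + h) - m(x)\<close> and hence \<open>O(h\<^sup>r\<^sup>+\<^sup>1)\<close>. Thus \<open>(M, U)\<close> satisfies the scheme up to \<open>O(h\<^sup>r)\<close>.

  The error \<open>\<theta> = m\<^sub>h - M\<close> obeys an energy inequality whose nonlinear terms are controlled as long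
  as \<open>\<parallel>\<theta>\<parallel> \<le> h\<^sup>3\<^sup>/\<^sup>2\<close>, because then \<open>u\<^sub>h\<close> has a bounded derivative by an inverse inequality. Gronwall's
  inequality improves this to \<open>\<parallel>\<theta>\<parallel> \<le> C h\<^sup>r\<close>, so a continuity argument covers all of \<open>[0, T]\<close> once
  \<open>h\<close> is small. The a priori bound also yields existence: it shows that the solution of a system
  truncated to a ball never meets the truncation.
\<close>

section \<open>Cardinal splines\<close>

text \<open>The work is done on B-spline coefficients instead of the piecewise description in
  \<open>spline_space\<close>. There a derivative is \<open>N\<close> times \<open>nabla\<close>, a
  translation by the mesh width is an index shift, and one functional on a unit cell recovers every
  coefficient, which makes the norm equivalences uniform in \<open>N\<close>. \<open>U\<close> is
  the discrete elliptic solution for \<open>M\<close> and not the quasi-interpolant of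
  \<open>u\<close>: the error in \<open>uh\<close> is then \<open>elliptic\<close> applied to
  \<theta>, with H1 norm at most the L2 norm of \<theta>. The price is that \<open>U\<close> and the
  quasi-interpolant of \<open>u\<close> must differ by O(h^r) in H1, one power better than
  interpolation in H1; the same cancellation on the uniform mesh pays for it. The exponent 3/2 is
  the cost of bounding the maximum of a spline derivative by the L2 norm of the spline, and r >= 2 >
  3/2 is the room in which the continuity argument closes. The initial condition makes
  \<open>mh 0\<close> the L2 projection of \<open>m 0\<close>. Of the r + 2 derivatives demanded, r
  + 1 in space serve the increment of the interpolation error and one in time gives the same for the
  time derivative of \<open>m\<close>.\<close>

definition nabla :: "(int \<Rightarrow> real) \<Rightarrow> int \<Rightarrow> real" where
  "nabla c j = c j - c (j - 1)"

text \<open>Added to \<open>s * nabla c j\<close> this gives the weights \<open>s - j\<close> on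
  \<open>c j\<close> and \<open>k + j - s\<close> on \<open>c (j - 1)\<close>: the usual convex
  combination of de Boor's algorithm, up to the factor \<open>k\<close>.\<close>

definition deboor :: "nat \<Rightarrow> (int \<Rightarrow> real) \<Rightarrow> int \<Rightarrow> real" where
  "deboor k c j = (real k + of_int j) * c (j - 1) - of_int j * c j"

text \<open>\<open>spl k c\<close> is the combination of the cardinal B-splines of degree \<open>k\<close> with coefficients \<open>c\<close>,
  where the B-spline with index \<open>j\<close> has support \<open>[j, j + k + 1]\<close>. The recursion is de Boor's
  algorithm with the dependence on \<open>s\<close> separated from the coefficients; \<open>spoly k c\<close> is the
  polynomial piece on \<open>[0, 1)\<close>.\<close>

primrec spl :: "nat \<Rightarrow> (int \<Rightarrow> real) \<Rightarrow> real \<Rightarrow> real" where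
  "spl 0 c s = c \<lfloor>s\<rfloor>"
| "spl (Suc k) c s = (s * spl k (nabla c) s + spl k (deboor (Suc k) c) s) / real (Suc k)"

primrec spoly :: "nat \<Rightarrow> (int \<Rightarrow> real) \<Rightarrow> real poly" where
  "spoly 0 c = [:c 0:]"
| "spoly (Suc k) c = smult (1 / real (Suc k)) ([:0, 1:] * spoly k (nabla c) + spoly k (deboor (Suc k) c))"

declare spl.simps(2) [simp del] spoly.simps(2) [simp del]

text \<open>This commutation carries the derivative rule: differencing the part without
  \<open>s\<close> returns the same expression one degree lower, so the recursion for
  \<open>c\<close> turns into the recursion for \<open>nabla c\<close>.\<close>

lemma nabla_deboor: "nabla (deboor (Suc k) c) = deboor k (nabla c)"
  by (rule ext) (simp add: nabla_def deboor_def algebra_simps)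

lemma nabla_linear: "nabla (\<lambda>j. a * c j + b * d j) = (\<lambda>j. a * nabla c j + b * nabla d j)"
  by (rule ext) (simp add: nabla_def algebra_simps)

lemma deboor_linear: "deboor k (\<lambda>j. a * c j + b * d j) = (\<lambda>j. a * deboor k c j + b * deboor k d j)"
  by (rule ext) (simp add: deboor_def algebra_simps)

lemma nabla_shift: "nabla (\<lambda>j. c (j + i)) = (\<lambda>j. nabla c (j + i))"
  by (rule ext) (simp add: nabla_def algebra_simps)

lemma spl_linear: "spl k (\<lambda>j. a * c j + b * d j) s = a * spl k c s + b * spl k d s"
proof (induction k arbitrary: c d)
  case (Suc k)
  show ?case
    unfolding spl.simps nabla_linear deboor_linear Suc.IH
    by (simp add: add_divide_distrib distrib_left mult.left_commute)
qed simp

lemma spl_add: "spl k (\<lambda>j. c j + d j) s = spl k c s + spl k d s"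
  using spl_linear[of k 1 c 1 d s] by simp

lemma spl_diff: "spl k (\<lambda>j. c j - d j) s = spl k c s - spl k d s"
  using spl_linear[of k 1 c "-1" d s] by simp

lemma spl_cmult: "spl k (\<lambda>j. a * c j) s = a * spl k c s"
  using spl_linear[of k a c 0 c s] by simp

lemma spl_zero: "spl k (\<lambda>j. 0) s = 0"
  using spl_cmult[of k 0 "\<lambda>j. 0" s] by simp

lemma spl_sum: "spl k (\<lambda>j. \<Sum>i\<in>A. f i j) s = (\<Sum>i\<in>A. spl k (f i) s)"
  by (induction A rule: infinite_finite_induct) (simp_all add: spl_zero spl_add)

lemma spl_shift: "spl k (\<lambda>j. c (j + i)) s = spl k c (s + of_int i)"
proof (induction k arbitrary: c)
  case (Suc k)
  \<comment> \<open>\<open>deboor\<close> contains the index explicitly, so it commutes with the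
    shift only up to \<open>i * nabla c\<close>; this extra term is what turns the factor
    \<open>s\<close> into \<open>s + i\<close>.\<close>
  have "deboor (Suc k) (\<lambda>j. c (j + i)) = (\<lambda>j. deboor (Suc k) c (j + i) + of_int i * nabla c (j + i))"
    by (rule ext) (simp add: deboor_def nabla_def algebra_simps)
  then show ?case
    unfolding spl.simps nabla_shift
    by (simp add: spl_add spl_cmult Suc.IH[of "nabla c"] Suc.IH[of "deboor (Suc k) c"] algebra_simps)
qed (simp add: add.commute)

lemma spl_const: "spl k (\<lambda>j. a) s = a"
proof (induction k)
  case (Suc k)
  have "nabla (\<lambda>j. a) = (\<lambda>j. 0)" "deboor (Suc k) (\<lambda>j. a) = (\<lambda>j. real (Suc k) * a)"
    by (auto simp: nabla_def deboor_def fun_eq_iff algebra_simps)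
  then show ?case
    by (simp add: spl.simps(2) spl_zero spl_cmult Suc.IH del: of_nat_Suc)
qed simp

lemma spl_cell: "0 \<le> s \<Longrightarrow> s < 1 \<Longrightarrow> spl k c s = poly (spoly k c) s"
proof (induction k arbitrary: c)
  case 0
  then have "\<lfloor>s\<rfloor> = 0" by linarith
  then show ?case by simp
qed (simp add: spl.simps(2) spoly.simps(2))

lemma spl_poly_cell:
  assumes "of_int j \<le> s" "s < of_int j + 1"
  shows "spl k c s = poly (spoly k (\<lambda>i. c (i + j))) (s - of_int j)"
  using spl_cell[of "s - of_int j" k "\<lambda>i. c (i + j)"] spl_shift[of k c j "s - of_int j"] assms
  by simp

lemma degree_spoly: "degree (spoly k c) \<le> k"
proof (induction k arbitrary: c)
  case (Suc k)
  have "degree ([:0, 1:] * spoly k (nabla c)) \<le> Suc k"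
    using degree_mult_le[of "[:0, 1::real:]" "spoly k (nabla c)"] Suc.IH[of "nabla c"] by simp
  moreover have "degree (spoly k (deboor (Suc k) c)) \<le> Suc k"
    using Suc.IH[of "deboor (Suc k) c"] by simp
  ultimately have "degree ([:0, 1:] * spoly k (nabla c) + spoly k (deboor (Suc k) c)) \<le> Suc k"
    by (rule degree_add_le)
  then show ?case
    unfolding spoly.simps(2) using degree_smult_le le_trans by blast
qed simp

text \<open>The product rule yields one copy of the piece for \<open>nabla c\<close>, and by
  \<open>nabla_deboor\<close> the other two terms are its own recursion without the normalisation.
  The number of copies adds up to the degree and cancels the division in
  \<open>spoly\<close>.\<close>

lemma pderiv_spoly: "pderiv (spoly (Suc k) c) = spoly k (nabla c)"
proof (induction k arbitrary: c)
  case 0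
  then show ?case
    by (simp add: spoly.simps(2) pderiv_smult pderiv_add pderiv_mult pderiv_pCons)
next
  case (Suc k)
  have "pderiv (spoly (Suc (Suc k)) c) =
    smult (1 / real (Suc (Suc k))) (spoly (Suc k) (nabla c) + ([:0,1:] * spoly k (nabla (nabla c))
       + spoly k (nabla (deboor (Suc (Suc k)) c))))"
    unfolding spoly.simps(2)[of "Suc k" c] pderiv_smult pderiv_add pderiv_mult Suc.IH
    by (simp add: pderiv_pCons algebra_simps)
  also have "[:0,1:] * spoly k (nabla (nabla c)) + spoly k (nabla (deboor (Suc (Suc k)) c))
      = smult (real (Suc k)) (spoly (Suc k) (nabla c))"
    unfolding spoly.simps(2)[of k "nabla c"] nabla_deboor by simp
  also have "spoly (Suc k) (nabla c) + smult (real (Suc k)) (spoly (Suc k) (nabla c))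
      = smult (real (Suc (Suc k))) (spoly (Suc k) (nabla c))"
    by (metis (no_types, lifting) of_nat_Suc smult_1_left smult_add_left)
  finally show ?case by (simp del: of_nat_Suc)
qed

text \<open>Continuity at a knot, reduced to the same matching one degree lower: the left piece is
  taken at local coordinate 1 and the right one at 0, and the missing term
  \<open>1 * nabla c\<close> reappears through the index inside \<open>deboor\<close>.\<close>

lemma spoly_join: "poly (spoly (Suc k) c) 1 = poly (spoly (Suc k) (\<lambda>j. c (j + 1))) 0"
proof (induction k arbitrary: c)
  case 0
  show ?case by (simp add: spoly.simps(2) nabla_def deboor_def)
next
  case (Suc k)
  have 1: "poly (spoly (Suc k) d) 0 = spl (Suc k) d 0" for d
    using spl_cell[of 0 "Suc k" d] by simp
  have "deboor (Suc (Suc k)) (\<lambda>j. c (j + 1))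
      = (\<lambda>j. deboor (Suc (Suc k)) c (j + 1) + nabla c (j + 1))"
    by (rule ext) (simp add: deboor_def nabla_def algebra_simps)
  then have "spl (Suc k) (deboor (Suc (Suc k)) (\<lambda>j. c (j + 1))) 0 =
     spl (Suc k) (\<lambda>j. deboor (Suc (Suc k)) c (j + 1)) 0 + spl (Suc k) (\<lambda>j. nabla c (j + 1)) 0"
    by (simp only: spl_add)
  then show ?case
    unfolding spoly.simps(2)[of "Suc k"]
    by (simp add: Suc.IH 1)
qed

lemma spl_poly_closed_cell:
  assumes "of_int j \<le> s" "s \<le> of_int j + 1"
  shows "spl (Suc k) c s = poly (spoly (Suc k) (\<lambda>i. c (i + j))) (s - of_int j)"
proof (cases "s = of_int j + 1")
  case True
  have "spl (Suc k) c s = poly (spoly (Suc k) (\<lambda>i. c (i + (j + 1)))) 0"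
    using spl_poly_cell[of "j + 1" s "Suc k" c] True by simp
  then show ?thesis
    using spoly_join[of k "\<lambda>i. c (i + j)"] True by (simp add: algebra_simps)
qed (use spl_poly_cell assms in auto)

lemma isCont_spl: "isCont (spl (Suc k) c) s"
proof -
  have cell: "continuous_on {of_int j..of_int j + 1} (spl (Suc k) c)" for j :: int
    by (rule continuous_on_eq[where f = "\<lambda>s. poly (spoly (Suc k) (\<lambda>i. c (i + j))) (s - of_int j)"])
      (auto intro!: continuous_intros simp: spl_poly_closed_cell)
  have "continuous (at_right s) (spl (Suc k) c)"
  proof -
    define j where "j = \<lfloor>s\<rfloor>"
    have j: "of_int j \<le> s" "s < of_int j + 1" unfolding j_def by linarith+
    have "continuous (at s within {of_int j..of_int j + 1}) (spl (Suc k) c)"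
      using cell[of j] j by (simp add: continuous_on_eq_continuous_within)
    then have "continuous (at s within {s..of_int j + 1}) (spl (Suc k) c)"
      by (rule continuous_within_subset) (use j in auto)
    then show ?thesis
      using j by (simp add: continuous_within at_within_Icc_at_right)
  qed
  moreover have "continuous (at_left s) (spl (Suc k) c)"
  proof -
    \<comment> \<open>The cell to the left of \<open>s\<close>; at an integer it differs from the
      cell of the floor.\<close>
    define j where "j = \<lceil>s\<rceil> - 1"
    have j: "of_int j < s" "s \<le> of_int j + 1" unfolding j_def by linarith+
    have "continuous (at s within {of_int j..of_int j + 1}) (spl (Suc k) c)"
      using cell[of j] j by (simp add: continuous_on_eq_continuous_within)
    then have "continuous (at s within {of_int j..s}) (spl (Suc k) c)"
      by (rule continuous_within_subset) (use j in auto)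
    then show ?thesis
      using j by (simp add: continuous_within at_within_Icc_at_left)
  qed
  ultimately show ?thesis by (simp add: continuous_at_split)
qed

lemma spl_poly_deriv_cell:
  assumes "of_int j \<le> s" "s < of_int j + 1" 
  shows "((\<lambda>s. poly (spoly (Suc k) (\<lambda>i. c (i + j))) (s - of_int j)) has_real_derivative spl k (nabla c) s) (at s within A)"
proof -
  have "((\<lambda>s. poly (spoly (Suc k) (\<lambda>i. c (i + j))) (s - of_int j)) has_real_derivative
     poly (pderiv (spoly (Suc k) (\<lambda>i. c (i + j)))) (s - of_int j) * 1) (at s within A)"
    by (rule DERIV_chain2[OF poly_DERIV]) (auto intro!: derivative_eq_intros)
  then show ?thesis
    unfolding pderiv_spoly using spl_poly_cell[OF assms, of k "nabla c"]
    by (simp add: nabla_shift)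
qed

lemma spl_has_derivative_off_int:
  assumes "s \<notin> \<int>"
  shows "(spl (Suc k) c has_real_derivative spl k (nabla c) s) (at s)"
proof -
  define j where "j = \<lfloor>s\<rfloor>"
  have "of_int j \<noteq> s" using assms by (metis Ints_of_int)
  then have j: "of_int j < s" "s < of_int j + 1" unfolding j_def by linarith+
  show ?thesis
    by (rule has_field_derivative_transform_within_open[OF spl_poly_deriv_cell[of j],
          of _ "{of_int j<..<of_int j + 1}"]) (use j in \<open>auto simp: spl_poly_cell[of j]\<close>)
qed

text \<open>At a knot the one-sided derivatives come from different pieces. They agree because the
  spline of degree \<open>k + 1\<close> with coefficients \<open>nabla c\<close> is continuous
  there, which is why the degree starts at 2.\<close>

lemma spl_has_derivative:
  "(spl (Suc (Suc k)) c has_real_derivative spl (Suc k) (nabla c) s) (at s)"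
proof (cases "s \<in> \<int>")
  case True
  then obtain i where i: "s = of_int i" by (auto elim: Ints_cases)
  define f where "f = spl (Suc (Suc k)) c"
  define D where "D = spl (Suc k) (nabla c) s"
  have R: "(f has_real_derivative D) (at_right s)"
  proof -
    have "((\<lambda>s. poly (spoly (Suc (Suc k)) (\<lambda>j. c (j + i))) (s - of_int i)) has_real_derivative D)
        (at s within {s..})"
      unfolding D_def by (rule spl_poly_deriv_cell) (auto simp: i)
    then have "(f has_real_derivative D) (at s within {s..})"
      by (rule has_field_derivative_transform_within[where d = 1])
        (auto simp: f_def i spl_poly_closed_cell[of i] dist_real_def)
    then show ?thesis by (rule DERIV_subset) auto
  qed
  have L: "(f has_real_derivative D) (at_left s)"
  proof -
    let ?p = "spoly (Suc (Suc k)) (\<lambda>j. c (j + (i - 1)))"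
    have "((\<lambda>s. poly ?p (s - of_int (i - 1))) has_real_derivative
       poly (pderiv ?p) (s - of_int (i - 1)) * 1) (at s within {..s})"
      by (rule DERIV_chain2[OF poly_DERIV]) (auto intro!: derivative_eq_intros)
    also have "poly (pderiv ?p) (s - of_int (i - 1)) = D"
      unfolding pderiv_spoly D_def using spl_poly_closed_cell[of "i - 1" s k "nabla c"]
      by (simp add: i nabla_shift[of c "i - 1"])
    finally have "((\<lambda>s. poly ?p (s - of_int (i - 1))) has_real_derivative D) (at s within {..s})" by simp
    then have "(f has_real_derivative D) (at s within {..s})"
      by (rule has_field_derivative_transform_within[where d = 1])
        (auto simp: f_def i spl_poly_closed_cell[of "i - 1"] dist_real_def)
    then show ?thesis by (rule DERIV_subset) auto
  qed
  have "(f has_real_derivative D) (at s)"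
    using L R unfolding has_field_derivative_iff by (rule filterlim_split_at)
  then show ?thesis by (simp add: f_def D_def)
qed (rule spl_has_derivative_off_int)

text \<open>Boundedness and locality in one estimate: coefficients that vanish at
  \<open>0, ..., -k\<close> give the zero function on \<open>[0, 1)\<close>.\<close>

lemma spl_local_bound:
  "\<exists>C\<ge>0. \<forall>c s. 0 \<le> s \<longrightarrow> s < 1 \<longrightarrow> \<bar>spl k c s\<bar> \<le> C * (\<Sum>i\<le>k. \<bar>c (- int i)\<bar>)"
proof (induction k)
  case 0
  have "\<lfloor>s\<rfloor> = 0" if "0 \<le> s" "s < 1" for s :: real using that by linarith
  then show ?case by (intro exI[of _ 1]) auto
next
  case (Suc k)
  then obtain C where C: "C \<ge> 0" "\<And>c s. 0 \<le> s \<Longrightarrow> s < 1 \<Longrightarrow> \<bar>spl k c s\<bar> \<le> C * (\<Sum>i\<le>k. \<bar>c (- int i)\<bar>)"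
    by auto
  show ?case
  proof (intro exI[of _ "C * (2 + 2 * real (Suc k))"] conjI allI impI)
    fix c :: "int \<Rightarrow> real" and s :: real
    assume s: "0 \<le> s" "s < 1"
    define \<Sigma> where "\<Sigma> = (\<Sum>i\<le>Suc k. \<bar>c (- int i)\<bar>)"
    have a: "(\<Sum>i\<le>k. \<bar>c (- int i)\<bar>) \<le> \<Sigma>"
      unfolding \<Sigma>_def by simp
    have b: "(\<Sum>i\<le>k. \<bar>c (- int i - 1)\<bar>) \<le> \<Sigma>"
    proof -
      have "\<Sigma> = \<bar>c 0\<bar> + (\<Sum>i\<le>k. \<bar>c (- int (Suc i))\<bar>)"
        unfolding \<Sigma>_def by (subst sum.atMost_Suc_shift) simp
      moreover have "- int i - 1 = - int (Suc i)" for i by simp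
      ultimately show ?thesis by (simp only:)
    qed
    have "(\<Sum>i\<le>k. \<bar>nabla c (- int i)\<bar>) \<le> (\<Sum>i\<le>k. \<bar>c (- int i)\<bar> + \<bar>c (- int i - 1)\<bar>)"
      by (intro sum_mono) (auto simp: nabla_def)
    also have "\<dots> \<le> 2 * \<Sigma>" using a b by (simp add: sum.distrib)
    finally have n: "\<bar>spl k (nabla c) s\<bar> \<le> C * (2 * \<Sigma>)"
      using C(2)[OF s, of "nabla c"] mult_left_mono[OF _ C(1)] by (meson order_trans)
    have "(\<Sum>i\<le>k. \<bar>deboor (Suc k) c (- int i)\<bar>)
        \<le> (\<Sum>i\<le>k. real (Suc k) * (\<bar>c (- int i)\<bar> + \<bar>c (- int i - 1)\<bar>))"
    proof (intro sum_mono)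
      fix i assume "i \<in> {..k}"
      then have i: "real i \<le> real (Suc k)" by simp
      have "\<bar>deboor (Suc k) c (- int i)\<bar> \<le> \<bar>real (Suc k) - real i\<bar> * \<bar>c (- int i - 1)\<bar> + real i * \<bar>c (- int i)\<bar>"
        using abs_triangle_ineq[of "(real (Suc k) - real i) * c (- int i - 1)" "real i * c (- int i)"]
        unfolding deboor_def by (simp add: abs_mult)
      also have "\<dots> \<le> real (Suc k) * \<bar>c (- int i - 1)\<bar> + real (Suc k) * \<bar>c (- int i)\<bar>"
        using i by (intro add_mono mult_right_mono) auto
      finally show "\<bar>deboor (Suc k) c (- int i)\<bar> \<le> real (Suc k) * (\<bar>c (- int i)\<bar> + \<bar>c (- int i - 1)\<bar>)"
        by (simp add: algebra_simps)
    qed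
    also have "\<dots> \<le> real (Suc k) * (2 * \<Sigma>)"
      unfolding sum_distrib_left[symmetric] using a b by (intro mult_left_mono) (auto simp: sum.distrib)
    finally have d: "\<bar>spl k (deboor (Suc k) c) s\<bar> \<le> C * (real (Suc k) * (2 * \<Sigma>))"
      using C(2)[OF s, of "deboor (Suc k) c"] mult_left_mono[OF _ C(1)] by (meson order_trans)
    have "\<bar>spl (Suc k) c s\<bar> \<le> \<bar>s * spl k (nabla c) s + spl k (deboor (Suc k) c) s\<bar>"
        unfolding spl.simps(2) by (simp add: abs_divide divide_le_eq mult_le_cancel_left1 algebra_simps)
    also have "\<dots> \<le> \<bar>s\<bar> * \<bar>spl k (nabla c) s\<bar> + \<bar>spl k (deboor (Suc k) c) s\<bar>"
      by (metis abs_mult abs_triangle_ineq)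
    also have "\<dots> \<le> 1 * (C * (2 * \<Sigma>)) + C * (real (Suc k) * (2 * \<Sigma>))"
      using s n d by (intro add_mono mult_mono) auto
    finally show "\<bar>spl (Suc k) c s\<bar> \<le> C * (2 + 2 * real (Suc k)) * \<Sigma>"
      by (simp add: algebra_simps)
  qed (use C in auto)
qed

lemma spl_bound:
  "\<exists>C\<ge>0. \<forall>c s. \<bar>spl k c s\<bar> \<le> C * (\<Sum>i\<le>k. \<bar>c (\<lfloor>s\<rfloor> - int i)\<bar>)"
proof -
  obtain C where C: "C \<ge> 0" "\<And>c s. 0 \<le> s \<Longrightarrow> s < 1 \<Longrightarrow> \<bar>spl k c s\<bar> \<le> C * (\<Sum>i\<le>k. \<bar>c (- int i)\<bar>)"
    using spl_local_bound[of k] by auto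
  have "\<bar>spl k c s\<bar> \<le> C * (\<Sum>i\<le>k. \<bar>c (\<lfloor>s\<rfloor> - int i)\<bar>)" for c s
  proof -
    have "0 \<le> s - of_int \<lfloor>s\<rfloor>" "s - of_int \<lfloor>s\<rfloor> < 1" by linarith+
    then show ?thesis
      using C(2)[of "s - of_int \<lfloor>s\<rfloor>" "\<lambda>j. c (j + \<lfloor>s\<rfloor>)"] spl_shift[of k c "\<lfloor>s\<rfloor>" "s - of_int \<lfloor>s\<rfloor>"]
      by simp
  qed
  then show ?thesis using C(1) by blast
qed

section \<open>Inner products and integration by parts on the circle\<close>

text \<open>A class closed under sums, products and affine substitutions, on which every integral
  over a bounded interval exists. Smooth periodic functions, splines and spline derivatives with
  jumps all belong to it.\<close>

definition bounded_borel :: "(real \<Rightarrow> real) \<Rightarrow> bool" where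
  "bounded_borel f \<longleftrightarrow> f \<in> borel_measurable borel \<and> (\<exists>B. \<forall>x. \<bar>f x\<bar> \<le> B)"

lemma bounded_borelI: "f \<in> borel_measurable borel \<Longrightarrow> (\<And>x. \<bar>f x\<bar> \<le> B) \<Longrightarrow> bounded_borel f"
  by (auto simp: bounded_borel_def)

lemma bounded_borelE:
  assumes "bounded_borel f" obtains B where "B \<ge> 0" "\<And>x. \<bar>f x\<bar> \<le> B"
  using assms unfolding bounded_borel_def by (meson abs_ge_zero order_trans)

lemma bounded_borel_measurable: "bounded_borel f \<Longrightarrow> f \<in> borel_measurable borel"
  by (simp add: bounded_borel_def)

lemma bounded_borel_const: "bounded_borel (\<lambda>x. a)"
  by (rule bounded_borelI[of _ "\<bar>a\<bar>"]) auto

lemma bounded_borel_add: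
  assumes "bounded_borel f" "bounded_borel g" shows "bounded_borel (\<lambda>x. f x + g x)"
proof -
  obtain B C where B: "\<And>x. \<bar>f x\<bar> \<le> B" and C: "\<And>x. \<bar>g x\<bar> \<le> C"
    using bounded_borelE[OF assms(1)] bounded_borelE[OF assms(2)] by metis
  show ?thesis
  proof (rule bounded_borelI)
    show "(\<lambda>x. f x + g x) \<in> borel_measurable borel"
      using assms unfolding bounded_borel_def by (intro borel_measurable_add) auto
    show "\<bar>f x + g x\<bar> \<le> B + C" for x
      by (rule order_trans[OF abs_triangle_ineq add_mono[OF B C]])
  qed
qed

lemma bounded_borel_mult: 
  assumes "bounded_borel f" "bounded_borel g" shows "bounded_borel (\<lambda>x. f x * g x)"
proof -
  obtain B C where B: "B \<ge> 0" "\<And>x. \<bar>f x\<bar> \<le> B" and C: "C \<ge> 0" "\<And>x. \<bar>g x\<bar> \<le> C"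
    using bounded_borelE[OF assms(1)] bounded_borelE[OF assms(2)] by metis
  show ?thesis
  proof (rule bounded_borelI)
    show "(\<lambda>x. f x * g x) \<in> borel_measurable borel"
      using assms unfolding bounded_borel_def by (intro borel_measurable_times) auto
    show "\<bar>f x * g x\<bar> \<le> B * C" for x
      unfolding abs_mult by (intro mult_mono) (use B C in auto)
  qed
qed

lemma bounded_borel_cmult: "bounded_borel f \<Longrightarrow> bounded_borel (\<lambda>x. a * f x)"
  by (intro bounded_borel_mult bounded_borel_const)

lemma bounded_borel_uminus: "bounded_borel f \<Longrightarrow> bounded_borel (\<lambda>x. - f x)"
  using bounded_borel_cmult[of f "-1"] by simp

lemma bounded_borel_diff: "bounded_borel f \<Longrightarrow> bounded_borel g \<Longrightarrow> bounded_borel (\<lambda>x. f x - g x)"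
  using bounded_borel_add[of f "\<lambda>x. - g x"] bounded_borel_uminus by simp

lemma bounded_borel_sum: "(\<And>i. i \<in> A \<Longrightarrow> bounded_borel (f i)) \<Longrightarrow> bounded_borel (\<lambda>x. \<Sum>i\<in>A. f i x)"
  by (induction A rule: infinite_finite_induct) (auto intro: bounded_borel_add bounded_borel_const)

lemma bounded_borel_affine: 
  assumes "bounded_borel f" shows "bounded_borel (\<lambda>x. f (a * x + b))"
proof -
  have "f \<in> borel_measurable borel" using assms by (rule bounded_borel_measurable)
  then have "(\<lambda>x. f (a * x + b)) \<in> borel_measurable borel" by measurable
  then show ?thesis using assms by (auto simp: bounded_borel_def)
qed

lemma bounded_borel_shift: "bounded_borel f \<Longrightarrow> bounded_borel (\<lambda>x. f (x + b))"
  using bounded_borel_affine[of f 1 b] by simp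

lemmas bounded_borel_intros = bounded_borel_const bounded_borel_add bounded_borel_mult
  bounded_borel_uminus bounded_borel_diff bounded_borel_sum bounded_borel_shift

lemma bounded_borel_set_integrable:
  assumes "bounded_borel f" "A \<in> sets borel" "emeasure lborel A < \<infinity>"
  shows "set_integrable lborel A f"
proof -
  obtain B where B: "\<And>x. \<bar>f x\<bar> \<le> B" using bounded_borelE[OF assms(1)] by metis
  show ?thesis
    unfolding set_integrable_def
  proof (rule integrableI_bounded_set_indicator[where B = B])
    show "AE x in lborel. x \<in> A \<longrightarrow> norm (f x) \<le> B" using B by simp
  qed (use assms bounded_borel_measurable in auto)
qed

lemma bounded_borel_integrable_Icc: "bounded_borel f \<Longrightarrow> set_integrable lborel {a..b::real} f"
  by (rule bounded_borel_set_integrable) (auto simp: emeasure_lborel_Icc_eq)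

lemma bounded_borel_integrable_Ico: "bounded_borel f \<Longrightarrow> set_integrable lborel {a..<b::real} f"
  by (rule bounded_borel_set_integrable) (cases "a \<le> b"; simp)+

section \<open>Algebra of the L2 inner product, Cauchy-Schwarz and product bounds\<close>

lemma L2_inner_commute: "L2_inner f g = L2_inner g f"
  by (simp add: L2_inner_def mult.commute)

lemma L2_inner_add_left:
  "bounded_borel f \<Longrightarrow> bounded_borel g \<Longrightarrow> bounded_borel k \<Longrightarrow>
   L2_inner (\<lambda>x. f x + g x) k = L2_inner f k + L2_inner g k"
  unfolding L2_inner_def distrib_right
  by (intro set_integral_add bounded_borel_integrable_Icc bounded_borel_mult)

lemma L2_inner_cmult_left: "L2_inner (\<lambda>x. a * f x) k = a * L2_inner f k"
  unfolding L2_inner_def mult.assoc by (rule set_integral_mult_right)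

lemma L2_inner_cmult_right: "L2_inner k (\<lambda>x. a * f x) = a * L2_inner k f"
  using L2_inner_cmult_left[of a f k] by (simp add: L2_inner_commute)

lemma L2_inner_uminus_left: "L2_inner (\<lambda>x. - f x) k = - L2_inner f k"
  using L2_inner_cmult_left[of "-1" f k] by simp

lemma L2_inner_diff_left:
  "bounded_borel f \<Longrightarrow> bounded_borel g \<Longrightarrow> bounded_borel k \<Longrightarrow>
   L2_inner (\<lambda>x. f x - g x) k = L2_inner f k - L2_inner g k"
  using L2_inner_add_left[of f "\<lambda>x. - g x" k] 
  by (simp add: bounded_borel_uminus L2_inner_uminus_left)

lemma L2_inner_add_right:
  "bounded_borel f \<Longrightarrow> bounded_borel g \<Longrightarrow> bounded_borel k \<Longrightarrow>
   L2_inner k (\<lambda>x. f x + g x) = L2_inner k f + L2_inner k g"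
  using L2_inner_add_left[of f g k] by (simp add: L2_inner_commute)

lemma L2_inner_diff_right:
  "bounded_borel f \<Longrightarrow> bounded_borel g \<Longrightarrow> bounded_borel k \<Longrightarrow>
   L2_inner k (\<lambda>x. f x - g x) = L2_inner k f - L2_inner k g"
  using L2_inner_diff_left[of f g k] by (simp add: L2_inner_commute)

lemma L2_inner_zero_left: "L2_inner (\<lambda>x. 0) g = 0"
  by (simp add: L2_inner_def)

lemma L2_inner_sum_left:
  "finite A \<Longrightarrow> (\<And>i. i \<in> A \<Longrightarrow> bounded_borel (f i)) \<Longrightarrow> bounded_borel k \<Longrightarrow>
   L2_inner (\<lambda>x. \<Sum>i\<in>A. f i x) k = (\<Sum>i\<in>A. L2_inner (f i) k)"
  by (induction A rule: finite_induct)
    (auto simp: L2_inner_zero_left L2_inner_add_left bounded_borel_sum)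

lemma L2_inner_sum_right:
  "finite A \<Longrightarrow> (\<And>i. i \<in> A \<Longrightarrow> bounded_borel (f i)) \<Longrightarrow> bounded_borel k \<Longrightarrow>
   L2_inner k (\<lambda>x. \<Sum>i\<in>A. f i x) = (\<Sum>i\<in>A. L2_inner k (f i))"
  using L2_inner_sum_left[of A f k] by (simp add: L2_inner_commute)

lemma set_lborel_integral_nonneg: "(\<And>x. x \<in> A \<Longrightarrow> 0 \<le> f x) \<Longrightarrow> 0 \<le> (LBINT x:A. f x :: real)"
  unfolding set_lebesgue_integral_def
  by (intro Bochner_Integration.integral_nonneg) (auto simp: indicator_def)

lemma L2_inner_self_nonneg: "0 \<le> L2_inner f f"
  unfolding L2_inner_def by (rule set_lborel_integral_nonneg) simp

lemma L2_nrm_nonneg: "0 \<le> L2_nrm f"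
  by (simp add: L2_nrm_def L2_inner_self_nonneg)

lemma L2_nrm_square: "(L2_nrm f)\<^sup>2 = L2_inner f f"
  by (simp add: L2_nrm_def L2_inner_self_nonneg)

lemma L2_inner_Cauchy_Schwarz:
  assumes "bounded_borel f" "bounded_borel g"
  shows "\<bar>L2_inner f g\<bar> \<le> L2_nrm f * L2_nrm g"
proof -
  define a b c where "a = L2_inner f f" and "b = L2_inner f g" and "c = L2_inner g g"
  have q: "0 \<le> a + 2 * t * b + t\<^sup>2 * c" for t
  proof -
    have "0 \<le> L2_inner (\<lambda>x. f x + t * g x) (\<lambda>x. f x + t * g x)"
      by (rule L2_inner_self_nonneg)
    also have "\<dots> = a + 2 * t * b + t\<^sup>2 * c"
      using assms by (simp add: L2_inner_add_left L2_inner_add_right bounded_borel_intros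
          L2_inner_cmult_left L2_inner_cmult_right a_def b_def c_def L2_inner_commute[of g f]
          power2_eq_square algebra_simps)
    finally show ?thesis .
  qed
  have ac: "0 \<le> a" "0 \<le> c" by (simp_all add: a_def c_def L2_inner_self_nonneg)
  have "b\<^sup>2 \<le> a * c"
  proof (cases "c = 0")
    case True
    have "b = 0"
    proof (rule ccontr)
      assume "b \<noteq> 0"
      \<comment> \<open>For \<open>c = 0\<close> the quadratic is affine in \<open>t\<close>, and
        this choice of \<open>t\<close> gives it the value -1.\<close>
      then show False
        using q[of "- (a + 1) / (2 * b)"] True by (simp add: field_simps)
    qed
    then show ?thesis using ac by simp
  next
    case False
    then have "c > 0" using ac by simp
    then show ?thesis using q[of "- b / c"]
      by (simp add: field_simps power2_eq_square)
  qed
  then have "\<bar>b\<bar> \<le> sqrt (a * c)"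
    by (metis real_sqrt_abs real_sqrt_le_mono)
  then show ?thesis
    by (simp add: L2_nrm_def a_def b_def c_def real_sqrt_mult)
qed

lemma L2_nrm_triangle:
  assumes "bounded_borel f" "bounded_borel g"
  shows "L2_nrm (\<lambda>x. f x + g x) \<le> L2_nrm f + L2_nrm g"
proof (rule power2_le_imp_le)
  have "(L2_nrm (\<lambda>x. f x + g x))\<^sup>2 = (L2_nrm f)\<^sup>2 + 2 * L2_inner f g + (L2_nrm g)\<^sup>2"
    unfolding L2_nrm_square using assms
    by (simp add: L2_inner_add_left L2_inner_add_right bounded_borel_intros L2_inner_commute[of g f])
  also have "\<dots> \<le> (L2_nrm f + L2_nrm g)\<^sup>2"
    using L2_inner_Cauchy_Schwarz[OF assms] by (simp add: power2_sum)
  finally show "(L2_nrm (\<lambda>x. f x + g x))\<^sup>2 \<le> (L2_nrm f + L2_nrm g)\<^sup>2" .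
qed (simp add: L2_nrm_nonneg)

lemma L2_nrm_uminus: "L2_nrm (\<lambda>x. - f x) = L2_nrm f"
  by (simp add: L2_nrm_def L2_inner_def)

lemma L2_nrm_diff_triangle:
  assumes "bounded_borel f" "bounded_borel g"
  shows "L2_nrm (\<lambda>x. f x - g x) \<le> L2_nrm f + L2_nrm g"
  using L2_nrm_triangle[OF assms(1) bounded_borel_uminus[OF assms(2)]] by (simp add: L2_nrm_uminus)

lemma L2_nrm_mult_le:
  assumes "bounded_borel f" "bounded_borel g" "\<And>x. x \<in> {0..1} \<Longrightarrow> \<bar>f x\<bar> \<le> B" 
  shows "L2_nrm (\<lambda>x. f x * g x) \<le> B * L2_nrm g"
proof (rule power2_le_imp_le)
  have B: "B \<ge> 0" using assms(3)[of 0] by simp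
  have "(L2_nrm (\<lambda>x. f x * g x))\<^sup>2 = (LBINT x:{0..1}. (f x * g x) * (f x * g x))"
    by (simp add: L2_nrm_square L2_inner_def)
  also have "\<dots> \<le> (LBINT x:{0..1}. B\<^sup>2 * (g x * g x))"
  proof (rule set_integral_mono)
    fix x :: real assume "x \<in> {0..1}"
    then have "\<bar>f x\<bar>\<^sup>2 \<le> B\<^sup>2" using assms(3) by (intro power_mono) auto
    then have "(f x)\<^sup>2 * (g x)\<^sup>2 \<le> B\<^sup>2 * (g x)\<^sup>2" by (intro mult_right_mono) auto
    then show "(f x * g x) * (f x * g x) \<le> B\<^sup>2 * (g x * g x)"
      by (simp add: power2_eq_square algebra_simps)
  qed (use assms in \<open>auto intro!: bounded_borel_integrable_Icc bounded_borel_intros\<close>)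
  also have "\<dots> = (B * L2_nrm g)\<^sup>2"
    by (simp add: power_mult_distrib L2_nrm_square L2_inner_def)
  finally show "(L2_nrm (\<lambda>x. f x * g x))\<^sup>2 \<le> (B * L2_nrm g)\<^sup>2" .
  show "0 \<le> B * L2_nrm g" using B L2_nrm_nonneg by simp
qed

lemma L2_nrm_const: "L2_nrm (\<lambda>x. 1) = 1"
  by (simp add: L2_nrm_def L2_inner_def set_lebesgue_integral_def)

lemma L2_nrm_le_sup:
  assumes "bounded_borel f" "\<And>x. x \<in> {0..1} \<Longrightarrow> \<bar>f x\<bar> \<le> B" 
  shows "L2_nrm f \<le> B"
  using L2_nrm_mult_le[OF assms(1) bounded_borel_const[of 1] assms(2)] L2_nrm_const by simp

lemma L2_nrm_cmult: "L2_nrm (\<lambda>x. a * f x) = \<bar>a\<bar> * L2_nrm f"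
  by (simp add: L2_nrm_def L2_inner_cmult_left L2_inner_cmult_right real_sqrt_mult
      flip: mult.assoc power2_eq_square)

lemma L2_inner_le_sup:
  assumes "bounded_borel f" "bounded_borel g" "\<And>x. x \<in> {0..1} \<Longrightarrow> \<bar>f x\<bar> \<le> B"
  shows "\<bar>L2_inner f g\<bar> \<le> B * L2_nrm g"
  using L2_inner_Cauchy_Schwarz[OF assms(1,2)] L2_nrm_le_sup[OF assms(1,3)] L2_nrm_nonneg[of g]
  by (meson mult_right_mono order_trans)

lemma L2_inner_le3:
  assumes "bounded_borel f" "bounded_borel g" "bounded_borel k" "\<And>x. x \<in> {0..1} \<Longrightarrow> \<bar>f x\<bar> \<le> B"
  shows "\<bar>L2_inner (\<lambda>x. f x * g x) k\<bar> \<le> B * L2_nrm g * L2_nrm k"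
  using L2_inner_Cauchy_Schwarz[OF bounded_borel_mult[OF assms(1,2)] assms(3)]
    L2_nrm_mult_le[OF assms(1,2,4)] L2_nrm_nonneg[of k]
  by (meson mult_right_mono order_trans)

section \<open>Change of variables and decomposition of integrals into mesh cells\<close>

lemma set_lborel_integral_cong_off_finite:
  fixes f g :: "real \<Rightarrow> real"
  assumes "finite S" "\<And>x. x \<in> A - S \<Longrightarrow> f x = g x"
  shows "(LBINT x:A. f x) = (LBINT x:A. g x)"
  unfolding set_lebesgue_integral_def
  by (rule integral_discrete_difference[of S])
    (use assms in \<open>auto simp: countable_finite indicator_def\<close>)

lemma L2_inner_cong_off_finite:
  assumes "finite S" "\<And>x. x \<in> {0..1} - S \<Longrightarrow> f x = f' x" "\<And>x. x \<in> {0..1} - S \<Longrightarrow> g x = g' x"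
  shows "L2_inner f g = L2_inner f' g'"
  unfolding L2_inner_def
  by (rule set_lborel_integral_cong_off_finite[OF assms(1)]) (use assms in auto)

lemma set_lborel_integral_affine:
  fixes f :: "real \<Rightarrow> real"
  assumes "h > 0"
  shows "(LBINT x:{a..b}. f x) = h * (LBINT s:{(a - t) / h..(b - t) / h}. f (t + h * s))"
    and "(LBINT x:{a..<b}. f x) = h * (LBINT s:{(a - t) / h..<(b - t) / h}. f (t + h * s))"
proof -
  have "indicator {a..b} (t + h * s) = (indicator {(a - t) / h..(b - t) / h} s :: real)"
       "indicator {a..<b} (t + h * s) = (indicator {(a - t) / h..<(b - t) / h} s :: real)" for s
    using assms by (auto simp: indicator_def field_simps)
  then show "(LBINT x:{a..b}. f x) = h * (LBINT s:{(a - t) / h..(b - t) / h}. f (t + h * s))"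
    and "(LBINT x:{a..<b}. f x) = h * (LBINT s:{(a - t) / h..<(b - t) / h}. f (t + h * s))"
    unfolding set_lebesgue_integral_def
    using lborel_integral_real_affine[of h "\<lambda>x. indicator {a..b} x *\<^sub>R f x" t]
      lborel_integral_real_affine[of h "\<lambda>x. indicator {a..<b} x *\<^sub>R f x" t] assms by simp_all
qed

lemma set_lborel_integral_Ico:
  fixes f :: "real \<Rightarrow> real"
  shows "(LBINT x:{a..<b}. f x) = (LBINT x:{a..b}. f x)"
  unfolding set_lebesgue_integral_def
  by (rule integral_discrete_difference[of "{b}"]) (auto simp: indicator_def)

lemma bounded_borel_integral_combine:
  assumes "bounded_borel f" "a \<le> b" "b \<le> c"
  shows "(LBINT x:{a..c}. f x) = (LBINT x:{a..b}. f x) + (LBINT x:{b..c}. f x)"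
proof -
  have "{a..<c} = {a..<b} \<union> {b..<c}" using assms by auto
  then show ?thesis
    unfolding set_lborel_integral_Ico[symmetric]
    by (simp add: set_integral_Un bounded_borel_integrable_Ico assms)
qed

text \<open>Rescaling each cell to the unit interval lets local estimates be proved once on
  \<open>[0, 1]\<close>, with constants that do not see \<open>N\<close>.\<close>

lemma bounded_borel_integral_cells:
  assumes "bounded_borel f" "N \<ge> 1"
  shows "(LBINT x:{0..1}. f x) = (\<Sum>l<N. (LBINT s:{0..1}. f ((real l + s) / real N)) / real N)"
proof -
  have cells: "(LBINT x:{0..real n / real N}. f x)
     = (\<Sum>l<n. (LBINT s:{0..1}. f ((real l + s) / real N)) / real N)" for n
  proof (induction n)
    case 0
    have "(LBINT x:{0..0}. f x) = 0"
      using set_lborel_integral_Ico[of 0 0 f] by (simp add: set_lebesgue_integral_def)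
    then show ?case by simp
  next
    case (Suc n)
    have "(LBINT x:{0..real (Suc n) / real N}. f x) =
       (LBINT x:{0..real n / real N}. f x) + (LBINT x:{real n / real N..real (Suc n) / real N}. f x)"
      using assms by (intro bounded_borel_integral_combine) (auto simp: divide_right_mono)
    also have "(LBINT x:{real n / real N..real (Suc n) / real N}. f x)
       = (LBINT s:{0..1}. f ((real n + s) / real N)) / real N"
      using set_lborel_integral_affine(1)[of "1 / real N" "real n / real N" "real (Suc n) / real N" f "real n / real N"]
        assms(2) by (simp add: field_simps)
    finally show ?case using Suc.IH by simp
  qed
  show ?thesis using cells[of N] assms(2) by simp
qed

lemma periodic_integral_shift:
  assumes f: "bounded_borel f" "periodic1 f" and "0 \<le> a" "a \<le> 1"
  shows "(LBINT x:{0..1}. f (x + a)) = (LBINT x:{0..1}. f x)"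
proof -
  have "(LBINT x:{a..1 + a}. f x) = (LBINT x:{0..1}. f (x + a))"
    using set_lborel_integral_affine(1)[of 1 a "1 + a" f a] by (simp add: add.commute)
  moreover have "(LBINT x:{a..1 + a}. f x) = (LBINT x:{a..1}. f x) + (LBINT x:{1..1 + a}. f x)"
    using assms by (intro bounded_borel_integral_combine) auto
  moreover have "(LBINT x:{1..1 + a}. f x) = (LBINT x:{0..a}. f x)"
    using set_lborel_integral_affine(1)[of 1 1 "1 + a" f 1] f(2) by (simp add: periodic1_def add.commute)
  moreover have "(LBINT x:{0..1}. f x) = (LBINT x:{0..a}. f x) + (LBINT x:{a..1}. f x)"
    using assms by (intro bounded_borel_integral_combine) auto
  ultimately show ?thesis by simp
qed

section \<open>Periodic functions, piecewise derivatives and integration by parts\<close>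

lemma periodic1_int: "periodic1 f \<Longrightarrow> f (x + of_int n) = f x"
proof (induction n rule: int_induct[of _ 0])
  case (step1 i)
  then show ?case unfolding periodic1_def by (metis add.assoc of_int_1 of_int_add)
next
  case (step2 i)
  then show ?case unfolding periodic1_def
    by (metis add.assoc diff_add_cancel of_int_1 of_int_add)
qed simp

lemma periodic1_frac: "periodic1 f \<Longrightarrow> f (frac x) = f x"
  using periodic1_int[of f "frac x" "\<lfloor>x\<rfloor>"] by (simp add: frac_def)

lemma periodic1_bound:
  assumes "periodic1 f" "\<And>x. x \<in> {0..1} \<Longrightarrow> \<bar>f x\<bar> \<le> B" shows "\<bar>f x\<bar> \<le> B"
  using assms(2)[of "frac x"] periodic1_frac[OF assms(1), of x]
    frac_lt_1[of x] frac_ge_0[of x] by simp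

lemma bounded_borel_periodic_continuous:
  assumes "periodic1 f" "continuous_on UNIV f" shows "bounded_borel f"
proof -
  have "compact (f ` {0..1})"
    by (intro compact_continuous_image) (use assms in \<open>auto intro: continuous_on_subset\<close>)
  then obtain B where "\<And>x. x \<in> {0..1} \<Longrightarrow> \<bar>f x\<bar> \<le> B"
    by (metis bounded_real compact_imp_bounded imageI)
  then show ?thesis
    using periodic1_bound[OF assms(1)] assms(2)
    by (intro bounded_borelI[of f B]) (auto intro: borel_measurable_continuous_onI)
qed

text \<open>Wide enough for smooth functions and for splines of order 2, whose derivative is missing
  at the nodes: \<open>f'\<close> may be any bounded Borel representative off finitely many points.
  Continuity of \<open>f\<close> keeps the fundamental theorem valid, and periodicity removes the
  boundary terms.\<close>

definition pw_deriv :: "(real \<Rightarrow> real) \<Rightarrow> (real \<Rightarrow> real) \<Rightarrow> bool" where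
  "pw_deriv f f' \<longleftrightarrow> periodic1 f \<and> continuous_on UNIV f \<and> bounded_borel f' \<and>
     (\<exists>S. finite S \<and> (\<forall>x\<in>{0..1} - S. (f has_real_derivative f' x) (at x)))"

lemma pw_deriv_bounded_borel: "pw_deriv f f' \<Longrightarrow> bounded_borel f"
  unfolding pw_deriv_def by (auto intro: bounded_borel_periodic_continuous)

lemma pw_deriv_bounded_borel': "pw_deriv f f' \<Longrightarrow> bounded_borel f'"
  by (auto simp: pw_deriv_def)

lemma pw_deriv_add:
  assumes "pw_deriv f f'" "pw_deriv g g'" shows "pw_deriv (\<lambda>x. f x + g x) (\<lambda>x. f' x + g' x)"
proof -
  obtain S T where S: "finite S" "\<forall>x\<in>{0..1} - S. (f has_real_derivative f' x) (at x)"
    and T: "finite T" "\<forall>x\<in>{0..1} - T. (g has_real_derivative g' x) (at x)"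
    using assms unfolding pw_deriv_def by blast
  have "finite (S \<union> T) \<and> (\<forall>x\<in>{0..1} - (S \<union> T). ((\<lambda>x. f x + g x) has_real_derivative f' x + g' x) (at x))"
    using S T by (auto intro!: DERIV_add)
  then show ?thesis
    using assms unfolding pw_deriv_def
    by (auto intro: continuous_on_add bounded_borel_add simp: periodic1_def simp del: finite_Un)
qed

lemma pw_deriv_mult:
  assumes "pw_deriv f f'" "pw_deriv g g'"
  shows "pw_deriv (\<lambda>x. f x * g x) (\<lambda>x. f' x * g x + f x * g' x)"
proof -
  obtain S T where S: "finite S" "\<forall>x\<in>{0..1} - S. (f has_real_derivative f' x) (at x)"
    and T: "finite T" "\<forall>x\<in>{0..1} - T. (g has_real_derivative g' x) (at x)"
    using assms unfolding pw_deriv_def by blast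
  have "finite (S \<union> T) \<and> (\<forall>x\<in>{0..1} - (S \<union> T).
      ((\<lambda>x. f x * g x) has_real_derivative f' x * g x + f x * g' x) (at x))"
    using S T by (auto intro!: derivative_eq_intros)
  moreover have "bounded_borel (\<lambda>x. f' x * g x + f x * g' x)"
    by (intro bounded_borel_add bounded_borel_mult)
      (use assms in \<open>auto intro: pw_deriv_bounded_borel pw_deriv_bounded_borel'\<close>)
  ultimately show ?thesis
    using assms unfolding pw_deriv_def
    by (auto intro: continuous_on_mult simp: periodic1_def simp del: finite_Un)
qed

lemma pw_deriv_const: "pw_deriv (\<lambda>x. a) (\<lambda>x. 0)"
  unfolding pw_deriv_def by (auto simp: periodic1_def intro: bounded_borel_const)

lemma pw_deriv_cmult: "pw_deriv f f' \<Longrightarrow> pw_deriv (\<lambda>x. a * f x) (\<lambda>x. a * f' x)"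
  using pw_deriv_mult[OF pw_deriv_const[of a], of f f'] by simp

lemma pw_deriv_diff:
  "pw_deriv f f' \<Longrightarrow> pw_deriv g g' \<Longrightarrow> pw_deriv (\<lambda>x. f x - g x) (\<lambda>x. f' x - g' x)"
  using pw_deriv_add[of f f' "\<lambda>x. -1 * g x" "\<lambda>x. -1 * g' x"] pw_deriv_cmult[of g g' "-1"] by simp

lemma pw_deriv_integral_zero:
  assumes "pw_deriv f f'" shows "(LBINT x:{0..1}. f' x) = 0"
proof -
  obtain S where S: "finite S" "\<forall>x\<in>{0..1} - S. (f has_real_derivative f' x) (at x)"
    using assms unfolding pw_deriv_def by blast
  have "(f' has_integral (f 1 - f 0)) {0..1}"
  proof (rule fundamental_theorem_of_calculus_interior_strong[OF S(1)])
    fix x :: real assume "x \<in> {0<..<1} - S"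
    then show "(f has_vector_derivative f' x) (at x)"
      using S(2) by (auto simp: has_real_derivative_iff_has_vector_derivative[symmetric])
  next
    show "continuous_on {0..1} f" using assms unfolding pw_deriv_def
      by (auto intro: continuous_on_subset)
  qed simp
  moreover have "f 1 = f 0" using assms unfolding pw_deriv_def periodic1_def
    by (metis add_0)
  ultimately have "integral {0..1} f' = 0" by (simp add: integral_unique)
  then show ?thesis
    using set_borel_integral_eq_integral(2)[OF bounded_borel_integrable_Icc[OF pw_deriv_bounded_borel'[OF assms]], of 0 1]
    by simp
qed

lemma L2_inner_by_parts:
  assumes "pw_deriv f f'" "pw_deriv g g'"
  shows "L2_inner f' g = - L2_inner f g'"
proof -
  note bb = assms[THEN pw_deriv_bounded_borel] assms[THEN pw_deriv_bounded_borel']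
  have "(LBINT x:{0..1}. f' x * g x + f x * g' x) = 0"
    using pw_deriv_integral_zero[OF pw_deriv_mult[OF assms]] .
  also have "(LBINT x:{0..1}. f' x * g x + f x * g' x) = L2_inner f' g + L2_inner f g'"
    unfolding L2_inner_def
    by (intro set_integral_add bounded_borel_integrable_Icc bounded_borel_mult bb)
  finally show ?thesis by simp
qed

section \<open>Dual functionals and stability of the spline basis\<close>

lemma continuous_on_Icc_bounded:
  fixes f :: "real \<Rightarrow> real"
  assumes "continuous_on {a..b} f" obtains B where "\<And>x. x \<in> {a..b} \<Longrightarrow> \<bar>f x\<bar> \<le> B"
proof -
  have "bounded (f ` {a..b})"
    by (intro compact_imp_bounded compact_continuous_image assms) auto
  then show ?thesis using that unfolding bounded_real by blast
qed

definition lagrange_basis :: "nat \<Rightarrow> (nat \<Rightarrow> real) \<Rightarrow> nat \<Rightarrow> real poly" where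
  "lagrange_basis n y l = (\<Prod>k\<in>{..n} - {l}. smult (1 / (y l - y k)) [:- y k, 1:])"

lemma lagrange_interpolation:
  assumes inj: "inj_on y {..n}" and p: "degree p \<le> n"
  shows "p = (\<Sum>l\<le>n. smult (poly p (y l)) (lagrange_basis n y l))"
proof (rule poly_eqI_degree)
  have val: "poly (lagrange_basis n y l) (y m) = (if l = m then 1 else 0)" if "l \<le> n" "m \<le> n" for l m
  proof (cases "l = m")
    case True
    have "\<forall>k\<in>{..n} - {l}. y l \<noteq> y k" using inj that by (auto simp: inj_on_def)
    then have "y l / (y l - y k) - y k / (y l - y k) = 1" if "k \<in> {..n} - {l}" for k
      using that by (simp flip: diff_divide_distrib)
    then have "poly (lagrange_basis n y l) (y l) = (\<Prod>k\<in>{..n} - {l}. 1)"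
      unfolding lagrange_basis_def poly_prod by (intro prod.cong refl) simp
    then show ?thesis using True by simp
  next
    case False
    then show ?thesis using that by (auto simp: lagrange_basis_def poly_prod intro!: prod_zero)
  qed
  show "poly p x = poly (\<Sum>l\<le>n. smult (poly p (y l)) (lagrange_basis n y l)) x" if "x \<in> y ` {..n}" for x
    using that by (auto simp: poly_sum val if_distrib cong: if_cong)
  have deg: "degree (lagrange_basis n y l) \<le> n" if "l \<le> n" for l
  proof -
    have "degree (lagrange_basis n y l) \<le> (\<Sum>k\<in>{..n} - {l}. degree (smult (1 / (y l - y k)) [:- y k, 1:]))"
      unfolding lagrange_basis_def by (rule order_trans[OF degree_prod_sum_le]) auto
    also have "\<dots> \<le> (\<Sum>k\<in>{..n} - {l}. 1)" by (intro sum_mono) (auto intro: order_trans[OF degree_smult_le])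
    also have "\<dots> \<le> n" using that by simp
    finally show ?thesis .
  qed
  have "card (y ` {..n}) = Suc n" using inj by (simp add: card_image)
  moreover have "degree (\<Sum>l\<le>n. smult (poly p (y l)) (lagrange_basis n y l)) \<le> n"
    by (rule degree_sum_le) (auto intro: order_trans[OF degree_smult_le] deg)
  ultimately show "degree p < card (y ` {..n})"
    "degree (\<Sum>l\<le>n. smult (poly p (y l)) (lagrange_basis n y l)) < card (y ` {..n})"
    using p by auto
qed

text \<open>The sequence \<open>d\<close> agrees with \<open>c\<close> on the window
  \<open>0, ..., -k\<close>, so \<open>spl_local_bound\<close> for \<open>c - d\<close> forces both
  splines to coincide on the cell.\<close>

lemma spl_window:
  assumes "0 \<le> s" "s < 1"
  shows "spl k c s = (\<Sum>i\<le>k. c (- int i) * spl k (\<lambda>j. if j = - int i then 1 else 0) s)"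
proof -
  obtain C where C: "\<And>c. \<bar>spl k c s\<bar> \<le> C * (\<Sum>i\<le>k. \<bar>c (- int i)\<bar>)"
    using spl_local_bound[of k] assms by blast
  define d where "d = (\<lambda>j. \<Sum>i\<le>k. c (- int i) * (if j = - int i then 1 else 0))"
  have "d (- int i) = c (- int i)" if "i \<le> k" for i
  proof -
    have "d (- int i) = (\<Sum>m\<le>k. if m = i then c (- int m) else 0)"
      unfolding d_def by (intro sum.cong) auto
    then show ?thesis using that by simp
  qed
  then have "\<bar>spl k (\<lambda>j. c j - d j) s\<bar> \<le> C * 0"
    using C[of "\<lambda>j. c j - d j"] by simp
  then have "spl k c s = spl k d s" by (simp add: spl_diff)
  then show ?thesis unfolding d_def by (simp add: spl_sum spl_cmult)
qed

text \<open>Functionals of the coefficients that factor through \<open>k + 1\<close> equispaced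
  samples of the spline in the first cell. The aim is to show that each single coefficient active on
  that cell is of this kind.\<close>

definition node_functional :: "nat \<Rightarrow> ((int \<Rightarrow> real) \<Rightarrow> real) \<Rightarrow> bool" where
  "node_functional k f \<longleftrightarrow> (\<exists>a. \<forall>c. f c = (\<Sum>l\<le>k. a l * spl k c (real l / real (Suc k))))"

lemma node_functional_zero: "node_functional k (\<lambda>c. 0)"
  unfolding node_functional_def by (rule exI[of _ "\<lambda>l. 0"]) simp

lemma node_functional_add:
  assumes "node_functional k f" "node_functional k g" shows "node_functional k (\<lambda>c. f c + g c)"
proof -
  obtain a b where "\<forall>c. f c = (\<Sum>l\<le>k. a l * spl k c (real l / real (Suc k)))"
    "\<forall>c. g c = (\<Sum>l\<le>k. b l * spl k c (real l / real (Suc k)))"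
    using assms unfolding node_functional_def by blast
  then show ?thesis
    unfolding node_functional_def by (intro exI[of _ "\<lambda>l. a l + b l"]) (simp add: sum.distrib distrib_right)
qed

lemma node_functional_cmult:
  assumes "node_functional k f" shows "node_functional k (\<lambda>c. b * f c)"
proof -
  obtain a where "\<forall>c. f c = (\<Sum>l\<le>k. a l * spl k c (real l / real (Suc k)))"
    using assms unfolding node_functional_def by blast
  then show ?thesis
    unfolding node_functional_def by (intro exI[of _ "\<lambda>l. b * a l"]) (simp add: sum_distrib_left mult.assoc)
qed

lemma node_functional_sum:
  "(\<And>i. i \<in> A \<Longrightarrow> node_functional k (f i)) \<Longrightarrow> node_functional k (\<lambda>c. \<Sum>i\<in>A. f i c)"
  by (induction A rule: infinite_finite_induct) (simp_all add: node_functional_zero node_functional_add)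

lemma node_functional_node:
  assumes "l \<le> k" shows "node_functional k (\<lambda>c. spl k c (real l / real (Suc k)))"
proof -
  have "spl k c (real l / real (Suc k)) = (\<Sum>m\<le>k. (if m = l then 1 else 0) * spl k c (real m / real (Suc k)))" for c
  proof -
    have "(\<Sum>m\<le>k. (if m = l then 1 else 0) * spl k c (real m / real (Suc k)))
      = (\<Sum>m\<le>k. if m = l then spl k c (real m / real (Suc k)) else 0)" by (intro sum.cong) auto
    then show ?thesis using assms by simp
  qed
  then show ?thesis
    unfolding node_functional_def by (intro exI[of _ "\<lambda>m. if m = l then 1 else 0"]) blast
qed

text \<open>Local linear independence of the B-splines, by induction on the degree. The samples
  determine the polynomial piece, hence its derivative, whose coefficients are
  \<open>nabla c\<close>; by induction all differences of \<open>c\<close> in the window are node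
  functionals. They fix \<open>c\<close> there up to a constant, and the value of the spline at 0
  fixes the constant because the B-splines sum to 1.\<close>

lemma node_functional_coefficient: "i \<le> k \<Longrightarrow> node_functional k (\<lambda>c. c (- int i))"
proof (induction k arbitrary: i)
  case 0
  show ?case using 0 node_functional_node[of 0 0] by simp
next
  case (Suc k)
  define y where "y = (\<lambda>l. real l / real (Suc (Suc k)))"
  have inj: "inj_on y {..Suc k}" unfolding y_def by (auto simp: inj_on_def field_simps)
  have y01: "0 \<le> y l" "y l < 1" if "l \<le> Suc k" for l
    using that by (auto simp: y_def)
  have ynode: "node_functional (Suc k) (\<lambda>c. spl (Suc k) c (y l))" if "l \<le> Suc k" for l
    using node_functional_node[OF that] by (simp add: y_def)
  have nab: "node_functional (Suc k) (\<lambda>c. nabla c (- int i))" if i: "i \<le> k" for i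
  proof -
    obtain a where a: "\<And>c. c (- int i) = (\<Sum>l\<le>k. a l * spl k c (real l / real (Suc k)))"
      using Suc.IH[OF i] unfolding node_functional_def by blast
    have val: "spl k (nabla c) z = (\<Sum>l\<le>Suc k. poly (pderiv (lagrange_basis (Suc k) y l)) z * spl (Suc k) c (y l))"
      if z: "0 \<le> z" "z < 1" for c z
    proof -
      have "spl k (nabla c) z = poly (pderiv (spoly (Suc k) c)) z"
        using z by (simp add: spl_cell pderiv_spoly)
      also have "\<dots> = poly (pderiv (\<Sum>l\<le>Suc k. smult (poly (spoly (Suc k) c) (y l)) (lagrange_basis (Suc k) y l))) z"
        using lagrange_interpolation[OF inj degree_spoly[of "Suc k" c]] by simp
      also have "\<dots> = (\<Sum>l\<le>Suc k. poly (spoly (Suc k) c) (y l) * poly (pderiv (lagrange_basis (Suc k) y l)) z)"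
        by (simp add: higher_pderiv_sum[where n = 1, simplified] pderiv_smult poly_sum del: sum.atMost_Suc)
      also have "\<dots> = (\<Sum>l\<le>Suc k. poly (pderiv (lagrange_basis (Suc k) y l)) z * spl (Suc k) c (y l))"
        by (intro sum.cong) (auto simp: spl_cell y01)
      finally show ?thesis .
    qed
    have "nabla c (- int i) = (\<Sum>m\<le>k. a m * (\<Sum>l\<le>Suc k. poly (pderiv (lagrange_basis (Suc k) y l))
          (real m / real (Suc k)) * spl (Suc k) c (y l)))" for c
      unfolding a[of "nabla c"] by (intro sum.cong refl arg_cong2[where f = "(*)"] val) auto
    moreover have "node_functional (Suc k) (\<lambda>c. \<Sum>m\<le>k. a m * (\<Sum>l\<le>Suc k. poly (pderiv (lagrange_basis (Suc k) y l))
          (real m / real (Suc k)) * spl (Suc k) c (y l)))"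
      by (intro node_functional_sum node_functional_cmult ynode) auto
    ultimately show ?thesis by simp
  qed
  have d0: "node_functional (Suc k) (\<lambda>c. c 0 - c (- int j))" if "j \<le> Suc k" for j
    using that
  proof (induction j)
    case 0
    then show ?case using node_functional_zero by simp
  next
    case (Suc j)
    have "node_functional (Suc k) (\<lambda>c. (c 0 - c (- int j)) + nabla c (- int j))"
      using Suc by (intro node_functional_add nab) auto
    moreover have "(c 0 - c (- int j)) + nabla c (- int j) = c 0 - c (- int (Suc j))" for c
    proof -
      have "- int j - 1 = - int (Suc j)" by simp
      then show ?thesis by (simp only: nabla_def)
    qed
    ultimately show ?case by simp
  qed
  have d: "node_functional (Suc k) (\<lambda>c. c (- int i) - c (- int j))" if "j \<le> Suc k" for j
    using node_functional_add[OF d0[OF that] node_functional_cmult[OF d0[OF Suc.prems], of "-1"]] by simp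
  define w where "w = (\<lambda>j. spl (Suc k) (\<lambda>m. if m = - int j then 1 else 0) 0)"
  have win: "spl (Suc k) c 0 = (\<Sum>j\<le>Suc k. c (- int j) * w j)" for c
    unfolding w_def by (rule spl_window) auto
  have w1: "(\<Sum>j\<le>Suc k. w j) = 1"
    using win[of "\<lambda>_. 1"] by (simp add: spl_const del: sum.atMost_Suc)
  have "c (- int i) = spl (Suc k) c (y 0) + (\<Sum>j\<le>Suc k. w j * (c (- int i) - c (- int j)))" for c
  proof -
    have "(\<Sum>j\<le>Suc k. w j * (c (- int i) - c (- int j)))
      = (\<Sum>j\<le>Suc k. w j) * c (- int i) - (\<Sum>j\<le>Suc k. c (- int j) * w j)"
      by (simp add: sum_subtractf sum_distrib_right sum_distrib_left right_diff_distrib mult.commute del: sum.atMost_Suc)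
    then show ?thesis by (simp add: w1 win y_def del: sum.atMost_Suc)
  qed
  moreover have "node_functional (Suc k) (\<lambda>c. spl (Suc k) c (y 0) + (\<Sum>j\<le>Suc k. w j * (c (- int i) - c (- int j))))"
    by (intro node_functional_add node_functional_sum node_functional_cmult d ynode) auto
  ultimately show ?case by simp
qed

text \<open>By translation the functional for index 0 serves every \<open>j\<close> with the same
  weights. This is the source of the lower bounds that are uniform in the mesh.\<close>

lemma spl_dual:
  "\<exists>a. \<forall>c j. c j = (\<Sum>l\<le>k. a l * spl k c (of_int j + real l / real (Suc k)))"
proof -
  obtain a where a: "\<And>c. c 0 = (\<Sum>l\<le>k. a l * spl k c (real l / real (Suc k)))"
    using node_functional_coefficient[of 0 k] unfolding node_functional_def by auto
  have "c j = (\<Sum>l\<le>k. a l * spl k c (of_int j + real l / real (Suc k)))" for c j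
    using a[of "\<lambda>i. c (i + j)"] by (simp add: spl_shift add.commute)
  then show ?thesis by blast
qed

text \<open>Equivalence of norms on polynomials of degree at most \<open>n\<close>, made explicit:
  the value at \<open>x\<close> is interpolated from the nodes \<open>(l + t) / N\<close>, and
  integrating over \<open>t\<close> in \<open>[0, 1]\<close> makes these nodes sweep out the unit
  interval, which turns the sum of squares into the integral.\<close>

lemma poly_sup_le_L2:
  "\<exists>C\<ge>0. \<forall>p x. degree p \<le> n \<longrightarrow> x \<in> {0..1::real} \<longrightarrow> (poly p x)\<^sup>2 \<le> C * (LBINT s:{0..1}. (poly p s)\<^sup>2)"
proof -
  define N where "N = Suc n"
  define y where "y = (\<lambda>l. real l / real N)"
  have inj: "inj_on y {..n}" by (auto simp: inj_on_def y_def N_def)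
  define L where "L = lagrange_basis n y"
  have "continuous_on {-1..1} (\<lambda>z. \<Sum>l\<le>n. (poly (L l) z)\<^sup>2)"
    by (intro continuous_intros)
  then obtain B where "\<And>z. z \<in> {-1..1} \<Longrightarrow> \<bar>\<Sum>l\<le>n. (poly (L l) z)\<^sup>2\<bar> \<le> B"
    by (rule continuous_on_Icc_bounded) blast
  then have B: "\<And>z. z \<in> {-1..1} \<Longrightarrow> (\<Sum>l\<le>n. (poly (L l) z)\<^sup>2) \<le> B"
    by force
  have B0: "B \<ge> 0" using order_trans[OF sum_nonneg B[of 0]] by auto
  show ?thesis
  proof (intro exI[of _ "B * real N"] conjI allI impI)
    fix p :: "real poly" and x :: real
    assume p: "degree p \<le> n" and x: "x \<in> {0..1}"
    have pt: "(poly p x)\<^sup>2 \<le> B * (\<Sum>l\<le>n. (poly p ((real l + t) / real N))\<^sup>2)" if t: "t \<in> {0..1}" for t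
    proof -
      \<comment> \<open>Translating the polynomial instead of the nodes keeps the Lagrange basis
        independent of \<open>t\<close>. Its argument becomes \<open>x - t / N\<close>, which stays
        in \<open>[-1, 1]\<close>, where \<open>B\<close> was chosen.\<close>
      let ?q = "pcompose p [:t / real N, 1:]"
      have "degree ?q \<le> n" using p by (simp add: degree_pcompose)
      then have q: "?q = (\<Sum>l\<le>n. smult (poly ?q (y l)) (L l))"
        unfolding L_def by (rule lagrange_interpolation[OF inj])
      have "poly ?q (x - t / real N) = (\<Sum>l\<le>n. poly ?q (y l) * poly (L l) (x - t / real N))"
        by (subst q) (simp add: poly_sum)
      then have "poly p x = (\<Sum>l\<le>n. poly p ((real l + t) / real N) * poly (L l) (x - t / real N))"
        by (simp add: poly_pcompose y_def add_divide_distrib add.commute)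
      then have "(poly p x)\<^sup>2 \<le> (\<Sum>l\<le>n. (poly p ((real l + t) / real N))\<^sup>2) * (\<Sum>l\<le>n. (poly (L l) (x - t / real N))\<^sup>2)"
        by (simp add: Cauchy_Schwarz_ineq_sum)
      also have "\<dots> \<le> (\<Sum>l\<le>n. (poly p ((real l + t) / real N))\<^sup>2) * B"
      proof (rule mult_left_mono[OF B])
        have "0 \<le> t / real N" "t / real N \<le> 1" using t by (auto simp: N_def divide_le_eq)
        then show "x - t / real N \<in> {- 1..1}" using x by auto
      qed (simp add: sum_nonneg)
      finally show ?thesis by (simp add: mult.commute)
    qed
    \<comment> \<open>The cutoff makes the integrand bounded on the whole line, as the decomposition
      into cells requires.\<close>
    define f where "f = (\<lambda>s. indicator {0..1} s * (poly p s)\<^sup>2 :: real)"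
    have fb: "bounded_borel f"
    proof -
      have "continuous_on {0..1} (\<lambda>s. (poly p s)\<^sup>2)" by (intro continuous_intros)
      then obtain K where K: "\<And>s. s \<in> {0..1} \<Longrightarrow> \<bar>(poly p s)\<^sup>2\<bar> \<le> K"
        by (rule continuous_on_Icc_bounded) blast
      have "(\<lambda>s. poly p s) \<in> borel_measurable borel"
        by (intro borel_measurable_continuous_onI continuous_intros)
      then have "f \<in> borel_measurable borel" unfolding f_def by measurable
      then show ?thesis
        by (rule bounded_borelI[of _ "max 0 K"])
          (use K in \<open>auto simp: f_def indicator_def le_max_iff_disj\<close>)
    qed
    have "(poly p x)\<^sup>2 = (LBINT t:{0..1::real}. (poly p x)\<^sup>2)"
      by (simp add: set_lebesgue_integral_def)
    also have "\<dots> \<le> (LBINT t:{0..1}. B * (\<Sum>l\<le>n. f ((real l + t) / real N)))"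
    proof (rule set_integral_mono)
      show "set_integrable lborel {0..1} (\<lambda>t. B * (\<Sum>l\<le>n. f ((real l + t) / real N)))"
      proof (intro bounded_borel_integrable_Icc bounded_borel_cmult bounded_borel_sum)
        fix l show "bounded_borel (\<lambda>t. f ((real l + t) / real N))"
          using bounded_borel_affine[OF fb, of "1 / real N" "real l / real N"]
          by (simp add: add_divide_distrib add.commute)
      qed
      show "(poly p x)\<^sup>2 \<le> B * (\<Sum>l\<le>n. f ((real l + t) / real N))" if t: "t \<in> {0..1}" for t
      proof -
        have "(real l + t) / real N \<in> {0..1}" if "l \<le> n" for l
          using that t by (auto simp: N_def)
        then have "(\<Sum>l\<le>n. f ((real l + t) / real N)) = (\<Sum>l\<le>n. (poly p ((real l + t) / real N))\<^sup>2)"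
          by (intro sum.cong) (auto simp: f_def)
        then show ?thesis using pt[OF t] by simp
      qed
    qed (intro bounded_borel_integrable_Icc bounded_borel_const)
    also have "\<dots> = B * (\<Sum>l\<le>n. LBINT t:{0..1}. f ((real l + t) / real N))"
    proof -
      have "bounded_borel (\<lambda>t. f ((real l + t) / real N))" for l
        using bounded_borel_affine[OF fb, of "1 / real N" "real l / real N"]
        by (simp add: add_divide_distrib add.commute)
      then have "L2_inner (\<lambda>t. \<Sum>l\<le>n. f ((real l + t) / real N)) (\<lambda>x. 1) = (\<Sum>l\<le>n. L2_inner (\<lambda>t. f ((real l + t) / real N)) (\<lambda>x. 1))"
        by (intro L2_inner_sum_left bounded_borel_const) auto
      then show ?thesis by (simp add: L2_inner_def)
    qed
    also have "(\<Sum>l\<le>n. LBINT t:{0..1}. f ((real l + t) / real N)) = real N * (LBINT s:{0..1}. f s)"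
    proof -
      have "{..<N} = {..n}" "N \<ge> 1" by (auto simp: N_def)
      then show ?thesis
        using bounded_borel_integral_cells[OF fb, of N] by (simp add: sum_divide_distrib[symmetric])
    qed
    also have "(LBINT s:{0..1}. f s) = (LBINT s:{0..1}. (poly p s)\<^sup>2)"
      by (rule set_lborel_integral_cong_off_finite[of "{}"]) (auto simp: f_def)
    finally show "(poly p x)\<^sup>2 \<le> B * real N * (LBINT s:{0..1}. (poly p s)\<^sup>2)" by simp
  qed (simp add: B0)
qed

section \<open>Periodic coefficients and their norm equivalence with periodic splines\<close>

definition periodic_seq :: "nat \<Rightarrow> (int \<Rightarrow> real) \<Rightarrow> bool" where
  "periodic_seq N c \<longleftrightarrow> (\<forall>j. c (j + int N) = c j)"

lemma periodic_seq_mult: 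
  assumes "periodic_seq N c" shows "c (j + i * int N) = c j"
proof (induction i rule: int_induct[of _ 0])
  case (step1 i)
  have "c (j + (i + 1) * int N) = c ((j + i * int N) + int N)" by (simp add: algebra_simps)
  then show ?case using step1 assms by (simp add: periodic_seq_def)
next
  case (step2 i)
  have "c (j + i * int N) = c ((j + (i - 1) * int N) + int N)" by (simp add: algebra_simps)
  then show ?case using step2 assms by (simp add: periodic_seq_def)
qed simp

lemma periodic_seq_mod: "periodic_seq N c \<Longrightarrow> c (j mod int N) = c j"
  using periodic_seq_mult[of N c "j mod int N" "j div int N"] by (simp add: mult.commute)

lemma periodic_seq_nabla: "periodic_seq N c \<Longrightarrow> periodic_seq N (nabla c)"
  by (simp add: periodic_seq_def nabla_def diff_add_eq[symmetric] del: add_diff_eq)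

lemma periodic_seq_shift: "periodic_seq N c \<Longrightarrow> periodic_seq N (\<lambda>j. c (j + i))"
  by (simp add: periodic_seq_def add.assoc add.commute[of "int N" i]) (simp flip: add.assoc)

lemma periodic_seq_sum_shift1:
  assumes "periodic_seq N c" shows "(\<Sum>l<N. c (int l - 1)) = (\<Sum>l<N. c (int l))"
proof (cases N)
  case (Suc M)
  have "(\<Sum>l<N. c (int l - 1)) = c (-1) + (\<Sum>l<M. c (int l))"
    unfolding Suc by (subst sum.lessThan_Suc_shift) simp
  also have "c (-1) = c (int M)"
  proof -
    have "c (-1 + int N) = c (-1)" using assms by (simp only: periodic_seq_def)
    moreover have "-1 + int N = int M" using Suc by simp
    ultimately show ?thesis by simp
  qed
  finally show ?thesis unfolding Suc by simp
qed simp

lemma periodic_seq_sum_shift: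
  assumes "periodic_seq N c" shows "(\<Sum>l<N. c (int l - int i)) = (\<Sum>l<N. c (int l))"
proof (induction i)
  case (Suc i)
  have "(\<Sum>l<N. c (int l - int (Suc i))) = (\<Sum>l<N. (\<lambda>j. c (j + (- int i))) (int l - 1))"
    by (simp add: algebra_simps)
  also have "\<dots> = (\<Sum>l<N. c (int l - int i))"
    using periodic_seq_sum_shift1[OF periodic_seq_shift[OF assms, of "- int i"]] by simp
  finally show ?case using Suc.IH by simp
qed simp

lemma spl_measurable: "spl k c \<in> borel_measurable borel"
proof (induction k arbitrary: c)
  case 0
  have "(\<lambda>s::real. c \<lfloor>s\<rfloor>) \<in> borel_measurable borel"
    by (rule measurable_compose[of floor _ "count_space UNIV"]) auto
  then show ?case by (simp cong: measurable_cong)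
next
  case (Suc k)
  have "(\<lambda>s. (s * spl k (nabla c) s + spl k (deboor (Suc k) c) s) / real (Suc k)) \<in> borel_measurable borel"
    using Suc.IH[of "nabla c"] Suc.IH[of "deboor (Suc k) c"] by measurable
  then show ?case by (simp add: spl.simps(2)[abs_def] flip: of_nat_Suc)
qed

lemma spl_sup_bound:
  "\<exists>C\<ge>1. \<forall>c (s::real) (B::real). (\<forall>j. \<bar>c j\<bar> \<le> B) \<longrightarrow> \<bar>spl k c s\<bar> \<le> C * B"
proof -
  obtain C where C: "C \<ge> 0" "\<And>c s. \<bar>spl k c s\<bar> \<le> C * (\<Sum>i\<le>k. \<bar>c (\<lfloor>s\<rfloor> - int i)\<bar>)"
    using spl_bound[of k] by auto
  show ?thesis
  proof (intro exI[of _ "C * real (Suc k) + 1"] conjI allI impI)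
    fix c :: "int \<Rightarrow> real" and s B :: real assume B: "\<forall>j. \<bar>c j\<bar> \<le> B"
    have "(\<Sum>i\<le>k. \<bar>c (\<lfloor>s\<rfloor> - int i)\<bar>) \<le> real (Suc k) * B"
      using sum_bounded_above[of "{..k}" "\<lambda>i. \<bar>c (\<lfloor>s\<rfloor> - int i)\<bar>" B] B by simp
    then have "\<bar>spl k c s\<bar> \<le> C * (real (Suc k) * B)"
      using C mult_left_mono order_trans by meson
    moreover have "0 \<le> B" using B abs_ge_zero order_trans by blast
    ultimately show "\<bar>spl k c s\<bar> \<le> (C * real (Suc k) + 1) * B"
      by (simp add: algebra_simps)
  qed (use C in simp)
qed

lemma periodic_seq_bounded:
  assumes "periodic_seq N c" "N \<ge> 1" shows "(c j)\<^sup>2 \<le> (\<Sum>l<N. (c (int l))\<^sup>2)"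
proof -
  define m where "m = nat (j mod int N)"
  have m: "m < N" "int m = j mod int N" using assms(2) by (auto simp: m_def nat_less_iff)
  then have "(c j)\<^sup>2 = (c (int m))\<^sup>2" using periodic_seq_mod[OF assms(1), of j] by simp
  also have "\<dots> \<le> (\<Sum>l<N. (c (int l))\<^sup>2)" using m by (intro member_le_sum) auto
  finally show ?thesis .
qed

text \<open>Only the rescaling from unit cells to cells of width \<open>1 / N\<close>; periodicity
  in \<open>x\<close> is a property of \<open>c\<close> and is carried separately.\<close>

definition pspline :: "nat \<Rightarrow> nat \<Rightarrow> (int \<Rightarrow> real) \<Rightarrow> real \<Rightarrow> real" where
  "pspline k N c x = spl k c (real N * x)"

lemma pspline_bounded_borel:
  assumes "periodic_seq N c" "N \<ge> 1" shows "bounded_borel (pspline k N c)"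
proof -
  obtain C where C: "\<And>c (s::real) B. (\<forall>j. \<bar>c j\<bar> \<le> B) \<Longrightarrow> \<bar>spl k c s\<bar> \<le> C * B"
    using spl_sup_bound[of k] by blast
  have "\<bar>c j\<bar> \<le> sqrt (\<Sum>l<N. (c (int l))\<^sup>2)" for j
    using periodic_seq_bounded[OF assms, of j] by (metis real_sqrt_abs real_sqrt_le_mono)
  then have "\<bar>pspline k N c x\<bar> \<le> C * sqrt (\<Sum>l<N. (c (int l))\<^sup>2)" for x
    unfolding pspline_def by (intro C) auto
  moreover have "pspline k N c \<in> borel_measurable borel"
    unfolding pspline_def using spl_measurable[of k c] by measurable
  ultimately show ?thesis by (intro bounded_borelI)
qed

lemma pspline_periodic:
  assumes "periodic_seq N c" shows "periodic1 (pspline k N c)"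
proof -
  have "(\<lambda>j. c (j + int N)) = c" using assms by (auto simp: periodic_seq_def)
  then have "spl k c (s + real N) = spl k c s" for s
    using spl_shift[of k c "int N" s] by simp
  then show ?thesis by (simp add: periodic1_def pspline_def distrib_left)
qed

text \<open>The weight \<open>1 / N\<close> is the length of a cell, so this mean square is
  comparable with the squared L2 norm uniformly in \<open>N\<close>.\<close>

definition coeff_sq :: "nat \<Rightarrow> (int \<Rightarrow> real) \<Rightarrow> real" where
  "coeff_sq N c = (\<Sum>l<N. (c (int l))\<^sup>2) / real N"

text \<open>Lower Riesz bound of the B-spline basis: a coefficient is recovered from samples in one
  cell, the samples are controlled by the L2 norm on that cell, and the cells add up.\<close>

lemma pspline_stability:
  "\<exists>C\<ge>0. \<forall>N\<ge>1. \<forall>c. periodic_seq N c \<longrightarrow> coeff_sq N c \<le> C * (L2_nrm (pspline k N c))\<^sup>2"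
proof -
  obtain a where a: "\<forall>c j. c j = (\<Sum>l\<le>k. a l * spl k c (of_int j + real l / real (Suc k)))"
    using spl_dual[of k] by (rule exE)
  obtain C where C: "C \<ge> 0" "\<And>p x. degree p \<le> k \<Longrightarrow> x \<in> {0..1::real} \<Longrightarrow>
      (poly p x)\<^sup>2 \<le> C * (LBINT s:{0..1}. (poly p s)\<^sup>2)"
    using poly_sup_le_L2[of k] by blast
  define A where "A = (\<Sum>l\<le>k. (a l)\<^sup>2)"
  have A: "A \<ge> 0" unfolding A_def by (simp add: sum_nonneg)
  have cell: "(c (int m))\<^sup>2 \<le> A * (real (Suc k) * C) * (LBINT s:{0..1}. (spl k c (real m + s))\<^sup>2)" for c m
  proof -
    define p where "p = spoly k (\<lambda>i. c (i + int m))"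
    have ps: "spl k c (real m + s) = poly p s" if "0 \<le> s" "s < 1" for s
      unfolding p_def using spl_poly_cell[of "int m" "real m + s" k c] that by simp
    have p: "degree p \<le> k" unfolding p_def by (rule degree_spoly)
    have "(c (int m))\<^sup>2 = (\<Sum>l\<le>k. a l * spl k c (real m + real l / real (Suc k)))\<^sup>2"
      using a[rule_format, of c "int m"] by simp
    also have "\<dots> \<le> A * (\<Sum>l\<le>k. (spl k c (real m + real l / real (Suc k)))\<^sup>2)"
      unfolding A_def by (rule Cauchy_Schwarz_ineq_sum)
    also have "(\<Sum>l\<le>k. (spl k c (real m + real l / real (Suc k)))\<^sup>2) = (\<Sum>l\<le>k. (poly p (real l / real (Suc k)))\<^sup>2)"
      by (intro sum.cong) (auto simp: ps)
    also have "A * \<dots> \<le> A * (\<Sum>l\<le>k. C * (LBINT s:{0..1}. (poly p s)\<^sup>2))"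
      by (intro mult_left_mono sum_mono C(2) p A) auto
    also have "(LBINT s:{0..1}. (poly p s)\<^sup>2) = (LBINT s:{0..1}. (spl k c (real m + s))\<^sup>2)"
      by (rule set_lborel_integral_cong_off_finite[of "{1}"]) (auto simp: ps)
    finally show ?thesis by simp
  qed
  show ?thesis
  proof (intro exI[of _ "A * (real (Suc k) * C)"] conjI allI impI)
    fix N :: nat and c assume N: "N \<ge> 1" and c: "periodic_seq N c"
    have "(L2_nrm (pspline k N c))\<^sup>2 = (LBINT x:{0..1}. (pspline k N c x)\<^sup>2)"
      unfolding L2_nrm_square by (simp add: L2_inner_def power2_eq_square)
    also have "\<dots> = (\<Sum>l<N. (LBINT s:{0..1}. (pspline k N c ((real l + s) / real N))\<^sup>2) / real N)"
      unfolding power2_eq_square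
      by (intro bounded_borel_integral_cells bounded_borel_mult pspline_bounded_borel N c)
    also have "\<dots> = (\<Sum>l<N. (LBINT s:{0..1}. (spl k c (real l + s))\<^sup>2) / real N)"
      using N by (simp add: pspline_def)
    finally have *: "(L2_nrm (pspline k N c))\<^sup>2 = \<dots>" .
    show "coeff_sq N c \<le> A * (real (Suc k) * C) * (L2_nrm (pspline k N c))\<^sup>2"
      unfolding * coeff_sq_def sum_distrib_left sum_divide_distrib
      by (intro sum_mono) (use cell N in \<open>auto intro: divide_right_mono\<close>)
  qed (use A C in simp)
qed

text \<open>Upper Riesz bound: at any point only \<open>k + 1\<close> coefficients act, and summing
  over the cells counts each coefficient \<open>k + 1\<close> times.\<close>

lemma pspline_upper:
  "\<exists>C\<ge>0. \<forall>N\<ge>1. \<forall>c. periodic_seq N c \<longrightarrow> (L2_nrm (pspline k N c))\<^sup>2 \<le> C * coeff_sq N c"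
proof -
  obtain C where C: "C \<ge> 0" "\<And>c s. \<bar>spl k c s\<bar> \<le> C * (\<Sum>i\<le>k. \<bar>c (\<lfloor>s\<rfloor> - int i)\<bar>)"
    using spl_bound[of k] by auto
  have pt: "(spl k c s)\<^sup>2 \<le> C\<^sup>2 * (real (Suc k) * (\<Sum>i\<le>k. (c (\<lfloor>s\<rfloor> - int i))\<^sup>2))" for c s
  proof -
    have "\<bar>spl k c s\<bar>\<^sup>2 \<le> (C * (\<Sum>i\<le>k. \<bar>c (\<lfloor>s\<rfloor> - int i)\<bar>))\<^sup>2"
      by (intro power_mono C(2)) auto
    also have "\<dots> = C\<^sup>2 * (\<Sum>i\<le>k. 1 * \<bar>c (\<lfloor>s\<rfloor> - int i)\<bar>)\<^sup>2" by (simp add: power_mult_distrib)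
    also have "\<dots> \<le> C\<^sup>2 * ((\<Sum>i\<le>k. 1\<^sup>2) * (\<Sum>i\<le>k. \<bar>c (\<lfloor>s\<rfloor> - int i)\<bar>\<^sup>2))"
      by (intro mult_left_mono Cauchy_Schwarz_ineq_sum) auto
    finally show ?thesis by simp
  qed
  show ?thesis
  proof (intro exI[of _ "C\<^sup>2 * (real (Suc k) * real (Suc k))"] conjI allI impI)
    fix N :: nat and c assume N: "N \<ge> 1" and c: "periodic_seq N c"
    have bb: "bounded_borel (\<lambda>x. (pspline k N c x)\<^sup>2)"
      unfolding power2_eq_square by (intro bounded_borel_mult pspline_bounded_borel N c)
    have "(L2_nrm (pspline k N c))\<^sup>2 = (LBINT x:{0..1}. (pspline k N c x)\<^sup>2)"
      unfolding L2_nrm_square by (simp add: L2_inner_def power2_eq_square)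
    also have "\<dots> = (\<Sum>l<N. (LBINT s:{0..1}. (pspline k N c ((real l + s) / real N))\<^sup>2) / real N)"
      by (intro bounded_borel_integral_cells bb N)
    also have "\<dots> \<le> (\<Sum>l<N. (C\<^sup>2 * (real (Suc k) * (\<Sum>i\<le>k. (c (int l - int i))\<^sup>2))) / real N)"
    proof (intro sum_mono divide_right_mono)
      fix l
      let ?M = "C\<^sup>2 * (real (Suc k) * (\<Sum>i\<le>k. (c (int l - int i))\<^sup>2))"
      have "(LBINT s:{0..1}. (pspline k N c ((real l + s) / real N))\<^sup>2)
        = (LBINT s:{0..<1}. (pspline k N c ((real l + s) / real N))\<^sup>2)"
        by (simp add: set_lborel_integral_Ico)
      also have "\<dots> \<le> (LBINT s:{0..<1::real}. ?M)"
      proof (rule set_integral_mono)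
        show "set_integrable lborel {0..<1} (\<lambda>s. (pspline k N c ((real l + s) / real N))\<^sup>2)"
          using bounded_borel_integrable_Ico[OF bounded_borel_affine[OF bb, of "1 / real N" "real l / real N"]]
          by (simp add: add_divide_distrib add.commute)
        fix s :: real assume s: "s \<in> {0..<1}"
        then have "\<lfloor>real l + s\<rfloor> = int l" by (simp add: floor_eq_iff)
        then show "(pspline k N c ((real l + s) / real N))\<^sup>2 \<le> ?M"
          using pt[of c "real l + s"] N by (simp add: pspline_def)
      qed (intro bounded_borel_integrable_Ico bounded_borel_const)
      also have "\<dots> = ?M" by (simp add: set_lebesgue_integral_def)
      finally show "(LBINT s:{0..1}. (pspline k N c ((real l + s) / real N))\<^sup>2) \<le> ?M" .
    qed simp
    also have "\<dots> = C\<^sup>2 * (real (Suc k) * (\<Sum>i\<le>k. \<Sum>l<N. (c (int l - int i))\<^sup>2)) / real N"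
      by (subst sum.swap) (simp add: sum_distrib_left sum_divide_distrib)
    also have "(\<Sum>i\<le>k. \<Sum>l<N. (c (int l - int i))\<^sup>2) = (\<Sum>i\<le>k. \<Sum>l<N. (c (int l))\<^sup>2)"
    proof -
      have "periodic_seq N (\<lambda>j. (c j)\<^sup>2)" using c by (simp add: periodic_seq_def)
      from periodic_seq_sum_shift[OF this] show ?thesis by simp
    qed
    finally show "(L2_nrm (pspline k N c))\<^sup>2 \<le> C\<^sup>2 * (real (Suc k) * real (Suc k)) * coeff_sq N c"
      by (simp add: coeff_sq_def mult.assoc)
  qed simp
qed

section \<open>Quasi-interpolation\<close>

lemma funpow_nabla_linear:
  "(nabla ^^ n) (\<lambda>j. a * c j + b * d j) = (\<lambda>j. a * (nabla ^^ n) c j + b * (nabla ^^ n) d j)"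
  by (induction n) (simp_all add: nabla_linear)

lemma funpow_nabla_shift: "(nabla ^^ n) (\<lambda>j. c (j + i)) = (\<lambda>j. (nabla ^^ n) c (j + i))"
  by (induction n) (simp_all add: nabla_shift)

text \<open>These are the values at the integers of polynomials of degree less than
  \<open>n\<close>; vanishing differences say so without naming the polynomial and survive every
  operation that commutes with translation.\<close>

definition poly_seq :: "nat \<Rightarrow> (int \<Rightarrow> real) \<Rightarrow> bool" where
  "poly_seq n c \<longleftrightarrow> (\<forall>j. (nabla ^^ n) c j = 0)"

lemma poly_seq_linear: "poly_seq n c \<Longrightarrow> poly_seq n d \<Longrightarrow> poly_seq n (\<lambda>j. a * c j + b * d j)"
  by (simp add: poly_seq_def funpow_nabla_linear)

lemma poly_seq_add: "poly_seq n c \<Longrightarrow> poly_seq n d \<Longrightarrow> poly_seq n (\<lambda>j. c j + d j)"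
  using poly_seq_linear[of n c d 1 1] by simp

lemma poly_seq_diff: "poly_seq n c \<Longrightarrow> poly_seq n d \<Longrightarrow> poly_seq n (\<lambda>j. c j - d j)"
  using poly_seq_linear[of n c d 1 "-1"] by simp

lemma poly_seq_cmult: "poly_seq n c \<Longrightarrow> poly_seq n (\<lambda>j. a * c j)"
  using poly_seq_linear[of n c c a 0] by simp

lemma poly_seq_zero: "poly_seq n (\<lambda>j. 0)"
proof -
  have "(nabla ^^ n) (\<lambda>j. 0) = (\<lambda>j. 0)"
    using funpow_nabla_linear[of n 0 "\<lambda>j. 0" 0 "\<lambda>j. 0"] by simp
  then show ?thesis by (simp add: poly_seq_def)
qed

lemma poly_seq_sum: "(\<And>i. i \<in> A \<Longrightarrow> poly_seq n (f i)) \<Longrightarrow> poly_seq n (\<lambda>j. \<Sum>i\<in>A. f i j)"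
  by (induction A rule: infinite_finite_induct) (simp_all add: poly_seq_zero poly_seq_add)

lemma poly_seq_shift: "poly_seq n c \<Longrightarrow> poly_seq n (\<lambda>j. c (j + i))"
  by (simp add: poly_seq_def funpow_nabla_shift)

lemma poly_seq_nabla: "poly_seq (Suc n) c \<longleftrightarrow> poly_seq n (nabla c)"
  by (simp add: poly_seq_def funpow_Suc_right del: funpow.simps)

lemma funpow_nabla_deboor: "(nabla ^^ n) (deboor (n + m) c) = deboor m ((nabla ^^ n) c)"
proof (induction n arbitrary: c)
  case (Suc n)
  have "(nabla ^^ Suc n) (deboor (Suc n + m) c) = (nabla ^^ n) (nabla (deboor (Suc (n + m)) c))"
    by (simp add: funpow_Suc_right del: funpow.simps)
  also have "\<dots> = deboor m ((nabla ^^ Suc n) c)"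
    by (simp add: nabla_deboor Suc.IH funpow_Suc_right del: funpow.simps)
  finally show ?case .
qed simp

lemma nabla_zero_const: assumes "\<And>j. nabla c j = 0" shows "c j = c 0"
proof (induction j rule: int_induct[of _ 0])
  case (step1 i) then show ?case using assms[of "i + 1"] by (simp add: nabla_def)
next
  case (step2 i) then show ?case using assms[of i] by (simp add: nabla_def)
qed simp

text \<open>In the step, \<open>k + 1\<close> differences of \<open>deboor (Suc k) c\<close>
  collapse to a multiple of the difference of order \<open>k + 2\<close> of \<open>c\<close>, which
  vanishes. So both parts of the recursion fall under the induction hypothesis.\<close>

lemma spl_poly_seq:
  "poly_seq (Suc k) c \<Longrightarrow> \<exists>p. degree p \<le> k \<and> (\<forall>s. spl k c s = poly p s)"
proof (induction k arbitrary: c)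
  case 0
  then have "c j = c 0" for j by (intro nabla_zero_const) (simp add: poly_seq_def)
  then show ?case by (intro exI[of _ "[:c 0:]"]) simp
next
  case (Suc k)
  have "(nabla ^^ Suc k) (deboor (Suc k) c) j = 0" for j
  proof -
    have "(nabla ^^ Suc k) (deboor (Suc k) c) j = deboor 0 ((nabla ^^ Suc k) c) j"
      using funpow_nabla_deboor[of "Suc k" 0 c] by simp
    also have "\<dots> = - of_int j * (nabla ^^ Suc (Suc k)) c j"
      by (simp add: deboor_def nabla_def[of "nabla ((nabla ^^ k) c)"] algebra_simps)
    finally show ?thesis using Suc.prems by (simp add: poly_seq_def)
  qed
  then have "poly_seq (Suc k) (deboor (Suc k) c)" by (simp only: poly_seq_def) simp
  with Suc obtain p q where p: "degree p \<le> k" "\<And>s. spl k (nabla c) s = poly p s"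
    and q: "degree q \<le> k" "\<And>s. spl k (deboor (Suc k) c) s = poly q s"
    by (metis poly_seq_nabla)
  have "degree ([:0, 1:] * p + q) \<le> Suc k"
    by (rule degree_add_le) (use degree_mult_le[of "[:0, 1:]" p] p q in auto)
  then have "degree (smult (1 / real (Suc k)) ([:0, 1:] * p + q)) \<le> Suc k"
    using degree_smult_le order_trans by blast
  then show ?case
    by (intro exI[of _ "smult (1 / real (Suc k)) ([:0, 1:] * p + q)"] conjI)
      (simp_all add: spl.simps(2) p q)
qed

lemma poly_seq_poly: "p = 0 \<or> degree p < n \<Longrightarrow> poly_seq n (\<lambda>j. poly p (of_int j))"
proof (induction n arbitrary: p)
  case 0
  then show ?case by (simp add: poly_seq_def)
next
  case (Suc n)
  define p' where "p' = p - pcompose p [:-1, 1:]"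
  have "p' = 0 \<or> degree p' < n"
  proof (cases "degree p = 0")
    case True
    then obtain a where "p = [:a:]" by (auto elim: degree_eq_zeroE)
    then show ?thesis by (simp add: p'_def)
  next
    case False
    have "degree p' \<le> degree p" unfolding p'_def by (rule degree_diff_le) (simp_all add: degree_pcompose)
    moreover have "coeff p' (degree p) = 0"
      using lead_coeff_comp[of "[:-1, 1:]" p] by (simp add: p'_def degree_pcompose)
    ultimately have "p' = 0 \<or> degree p' < degree p"
      by (metis le_neq_implies_less leading_coeff_0_iff)
    then show ?thesis using Suc.prems False by auto
  qed
  then have "poly_seq n (\<lambda>j. poly p' (of_int j))" by (rule Suc.IH)
  moreover have "(\<lambda>j. poly p' (of_int j)) = nabla (\<lambda>j. poly p (of_int j))"
    by (rule ext) (simp add: p'_def nabla_def poly_pcompose)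
  ultimately show ?case by (simp add: poly_seq_nabla)
qed

text \<open>A partial sum of the Neumann series for the inverse of the sampling operator
  \<open>\<sigma> c = (spl k c at the integers)\<close>. Since \<open>1 - \<sigma>\<close> lowers the degree of a polynomial sequence,
  \<open>k + 1\<close> terms invert \<open>\<sigma>\<close> on sequences of degree at most \<open>k\<close>.\<close>

primrec quasi_coeff :: "nat \<Rightarrow> nat \<Rightarrow> (int \<Rightarrow> real) \<Rightarrow> int \<Rightarrow> real" where
  "quasi_coeff k 0 c = (\<lambda>j. 0)"
| "quasi_coeff k (Suc n) c =
     (\<lambda>j. c j + (quasi_coeff k n c j - spl k (quasi_coeff k n c) (of_int j)))"

lemma spl_at_int:
  "\<exists>w. (\<Sum>i\<le>k. w i) = 1 \<and> (\<forall>c j. spl k c (of_int j) = (\<Sum>i\<le>k. w i * c (j + (- int i))))"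
proof -
  define w where "w = (\<lambda>i. spl k (\<lambda>m. if m = - int i then 1 else 0) 0)"
  have w: "spl k c 0 = (\<Sum>i\<le>k. c (- int i) * w i)" for c
    unfolding w_def by (rule spl_window) auto
  have "spl k c (of_int j) = (\<Sum>i\<le>k. w i * c (j + (- int i)))" for c j
    using w[of "\<lambda>i. c (i + j)"] spl_shift[of k c j 0] by (simp add: mult.commute add.commute)
  moreover have "(\<Sum>i\<le>k. w i) = 1" using w[of "\<lambda>_. 1"] by (simp add: spl_const)
  ultimately show ?thesis by blast
qed

lemma poly_seq_spl: "poly_seq n c \<Longrightarrow> poly_seq n (\<lambda>j. spl k c (of_int j))"
proof -
  assume "poly_seq n c"
  moreover obtain w where "\<And>c j. spl k c (of_int j) = (\<Sum>i\<le>k. w i * c (j + (- int i)))"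
    using spl_at_int[of k] by blast
  ultimately show ?thesis by (simp only:) (intro poly_seq_sum poly_seq_cmult poly_seq_shift)
qed

lemma poly_seq_quasi_coeff: "poly_seq n c \<Longrightarrow> poly_seq n (quasi_coeff k m c)"
  by (induction m) (simp_all add: poly_seq_zero poly_seq_add poly_seq_diff poly_seq_spl)

text \<open>Sampling a spline at the integers averages the coefficients with weights of sum 1, so
  the defect of the averaging factors through a backward difference.\<close>

lemma poly_seq_spl_defect:
  assumes "poly_seq (Suc n) c" shows "poly_seq n (\<lambda>j. c j - spl k c (of_int j))"
proof -
  obtain w where w: "(\<Sum>i\<le>k. w i) = 1" "\<And>c j. spl k c (of_int j) = (\<Sum>i\<le>k. w i * c (j + (- int i)))"
    using spl_at_int[of k] by blast
  have 1: "poly_seq n (\<lambda>j. c j - c (j + (- int i)))" for i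
  proof (induction i)
    case (Suc i)
    have "poly_seq n (\<lambda>j. (c j - c (j + (- int i))) + nabla c (j + (- int i)))"
      using assms by (intro poly_seq_add Suc poly_seq_shift) (simp add: poly_seq_nabla)
    moreover have "(c j - c (j + (- int i))) + nabla c (j + (- int i)) = c j - c (j + (- int (Suc i)))" for j
    proof -
      have "j + (- int i) - 1 = j + (- int (Suc i))" by simp
      then show ?thesis by (simp only: nabla_def)
    qed
    ultimately show ?case by (simp only:)
  qed (simp add: poly_seq_zero)
  have "c j - spl k c (of_int j) = (\<Sum>i\<le>k. w i * (c j - c (j + (- int i))))" for j
    unfolding w(2) right_diff_distrib sum_subtractf sum_distrib_right[symmetric] w(1) by simp
  moreover have "poly_seq n (\<lambda>j. \<Sum>i\<le>k. w i * (c j - c (j + (- int i))))"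
    by (intro poly_seq_sum poly_seq_cmult 1)
  ultimately show ?thesis by simp
qed

text \<open>One more Neumann term replaces the defect \<open>d\<close> by \<open>d\<close> minus its
  sampled spline, and by \<open>poly_seq_spl_defect\<close> this lowers the degree by one.\<close>

lemma quasi_coeff_defect:
  assumes "poly_seq (n + m) c" shows "poly_seq m (\<lambda>j. c j - spl k (quasi_coeff k n c) (of_int j))"
  using assms
proof (induction n arbitrary: m)
  case 0
  then show ?case by (simp add: spl_zero)
next
  case (Suc n)
  define d where "d = (\<lambda>j. c j - spl k (quasi_coeff k n c) (of_int j))"
  have "poly_seq (Suc m) d" unfolding d_def by (rule Suc.IH) (use Suc.prems in simp)
  then have "poly_seq m (\<lambda>j. d j - spl k d (of_int j))" by (rule poly_seq_spl_defect)
  moreover have "d j - spl k d (of_int j) = c j - spl k (quasi_coeff k (Suc n) c) (of_int j)" for j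
    by (simp add: d_def spl_diff spl_add)
  ultimately show ?case by simp
qed

text \<open>Both sides are polynomials in \<open>s\<close> of degree at most \<open>k\<close>, and
  they agree at all integers because \<open>k + 1\<close> Neumann steps reduce the defect to
  zero.\<close>

lemma spl_quasi_coeff_poly:
  assumes "degree p \<le> k"
  shows "spl k (quasi_coeff k (Suc k) (\<lambda>j. poly p (of_int j))) s = poly p s"
proof -
  define c where "c = (\<lambda>j. poly p (of_int j))"
  have c: "poly_seq (Suc k) c" unfolding c_def by (rule poly_seq_poly) (use assms in auto)
  obtain q where q: "degree q \<le> k" "\<And>s. spl k (quasi_coeff k (Suc k) c) s = poly q s"
    using spl_poly_seq[OF poly_seq_quasi_coeff[OF c]] by blast
  have "c j - spl k (quasi_coeff k (Suc k) c) (of_int j) = 0" for j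
    using quasi_coeff_defect[of "Suc k" 0 c k] c by (simp add: poly_seq_def del: quasi_coeff.simps)
  then have *: "poly p (of_int j) = poly q (of_int j)" for j unfolding q(2) by (simp add: c_def)
  have "inj_on (real_of_int \<circ> int) {..k}" by (auto simp: inj_on_def)
  then have "card ((real_of_int \<circ> int) ` {..k}) = Suc k" by (simp add: card_image)
  moreover have "poly p x = poly q x" if "x \<in> (real_of_int \<circ> int) ` {..k}" for x
    using that by (elim imageE) (simp only: * o_apply)
  ultimately have "p = q"
    using poly_eqI_degree[of "(real_of_int \<circ> int) ` {..k}" p q] assms q(1) by simp
  then show ?thesis using q(2) by (simp add: c_def)
qed

lemma quasi_coeff_linear:
  "quasi_coeff k n (\<lambda>j. a * c j + b * d j) = (\<lambda>j. a * quasi_coeff k n c j + b * quasi_coeff k n d j)"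
  by (induction n) (auto simp: spl_linear algebra_simps)

lemma quasi_coeff_diff:
  "quasi_coeff k n (\<lambda>j. c j - d j) = (\<lambda>j. quasi_coeff k n c j - quasi_coeff k n d j)"
  using quasi_coeff_linear[of k n 1 c "-1" d] by simp

lemma quasi_coeff_shift: "quasi_coeff k n (\<lambda>j. c (j + i)) = (\<lambda>j. quasi_coeff k n c (j + i))"
  by (induction n) (auto simp: spl_shift)

lemma quasi_coeff_nabla: "quasi_coeff k n (nabla c) = nabla (quasi_coeff k n c)"
  using quasi_coeff_diff[of k n c "\<lambda>j. c (j + (-1))"] quasi_coeff_shift[of k n c "-1"]
  by (simp add: nabla_def[abs_def])

lemma quasi_coeff_periodic: "periodic_seq N c \<Longrightarrow> periodic_seq N (quasi_coeff k n c)"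
  using quasi_coeff_shift[of k n c "int N"] by (simp add: periodic_seq_def fun_eq_iff)

text \<open>Locality with an unspecified reach: each Neumann step looks back at most
  \<open>k\<close> further indices. \<open>B\<close> bounds the data only inside the window, so the
  estimate can be applied to a Taylor remainder that grows away from its centre.\<close>

lemma quasi_coeff_bound:
  "\<exists>K\<ge>0. \<exists>R. \<forall>c j (B::real). (\<forall>i. j - int R \<le> i \<and> i \<le> j \<longrightarrow> \<bar>c i\<bar> \<le> B) \<longrightarrow> \<bar>quasi_coeff k n c j\<bar> \<le> K * B"
proof (induction n)
  case 0
  then show ?case by (intro exI[of _ 0]) simp
next
  case (Suc n)
  then obtain K R where K: "K \<ge> 0"
    "\<forall>c j (B::real). (\<forall>i. j - int R \<le> i \<and> i \<le> j \<longrightarrow> \<bar>c i\<bar> \<le> B) \<longrightarrow> \<bar>quasi_coeff k n c j\<bar> \<le> K * B"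
    by blast
  obtain C where C: "C \<ge> 0" "\<And>c s. \<bar>spl k c s\<bar> \<le> C * (\<Sum>i\<le>k. \<bar>c (\<lfloor>s\<rfloor> - int i)\<bar>)"
    using spl_bound[of k] by auto
  show ?case
  proof (intro exI[of _ "1 + (K + C * (real (Suc k) * K))"] exI[of _ "R + k"] conjI allI impI)
    fix c :: "int \<Rightarrow> real" and j B assume B: "\<forall>i. j - int (R + k) \<le> i \<and> i \<le> j \<longrightarrow> \<bar>c i\<bar> \<le> B"
    have q: "\<bar>quasi_coeff k n c (j - int i)\<bar> \<le> K * B" if "i \<le> k" for i
      by (rule K(2)[rule_format]) (use B that in auto)
    have "(\<Sum>i\<le>k. \<bar>quasi_coeff k n c (j - int i)\<bar>) \<le> real (Suc k) * (K * B)"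
      using sum_bounded_above[of "{..k}" "\<lambda>i. \<bar>quasi_coeff k n c (j - int i)\<bar>" "K * B"] q by simp
    then have "C * (\<Sum>i\<le>k. \<bar>quasi_coeff k n c (j - int i)\<bar>) \<le> C * (real (Suc k) * (K * B))"
      by (rule mult_left_mono[OF _ C(1)])
    then have "\<bar>spl k (quasi_coeff k n c) (of_int j)\<bar> \<le> C * (real (Suc k) * (K * B))"
      using order_trans[OF C(2)[of "quasi_coeff k n c" "of_int j"]] by (simp only: floor_of_int)
    moreover have "\<bar>c j\<bar> \<le> B" using B by simp
    moreover have "\<bar>quasi_coeff k n c j\<bar> \<le> K * B" using q[of 0] by simp
    ultimately have "\<bar>quasi_coeff k (Suc n) c j\<bar> \<le> B + (K * B + C * (real (Suc k) * (K * B)))"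
      unfolding quasi_coeff.simps by linarith
    then show "\<bar>quasi_coeff k (Suc n) c j\<bar> \<le> (1 + (K + C * (real (Suc k) * K))) * B"
      by (simp only: distrib_right mult_1 mult.assoc)
  qed (use K(1) C(1) in simp)
qed

lemma spl_quasi_coeff_bound:
  "\<exists>K\<ge>0. \<exists>R. \<forall>c s (B::real). (\<forall>i. \<lfloor>s\<rfloor> - int R \<le> i \<and> i \<le> \<lfloor>s\<rfloor> \<longrightarrow> \<bar>c i\<bar> \<le> B) \<longrightarrow>
     \<bar>spl k (quasi_coeff m n c) s\<bar> \<le> K * B"
proof -
  obtain K R where K: "K \<ge> 0"
    "\<forall>c j (B::real). (\<forall>i. j - int R \<le> i \<and> i \<le> j \<longrightarrow> \<bar>c i\<bar> \<le> B) \<longrightarrow> \<bar>quasi_coeff m n c j\<bar> \<le> K * B"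
    using quasi_coeff_bound[of m n] that by (elim exE conjE) (assumption | rule that)+
  obtain C where C: "C \<ge> 0" "\<And>c s. \<bar>spl k c s\<bar> \<le> C * (\<Sum>i\<le>k. \<bar>c (\<lfloor>s\<rfloor> - int i)\<bar>)"
    using spl_bound[of k] by auto
  show ?thesis
  proof (intro exI[of _ "C * (real (Suc k) * K)"] exI[of _ "R + k"] conjI allI impI)
    fix c :: "int \<Rightarrow> real" and s B :: real assume B: "\<forall>i. \<lfloor>s\<rfloor> - int (R + k) \<le> i \<and> i \<le> \<lfloor>s\<rfloor> \<longrightarrow> \<bar>c i\<bar> \<le> B"
    have q: "\<bar>quasi_coeff m n c (\<lfloor>s\<rfloor> - int i)\<bar> \<le> K * B" if "i \<le> k" for i
      by (rule K(2)[rule_format]) (use B that in auto)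
    have "(\<Sum>i\<le>k. \<bar>quasi_coeff m n c (\<lfloor>s\<rfloor> - int i)\<bar>) \<le> real (Suc k) * (K * B)"
      using sum_bounded_above[of "{..k}" "\<lambda>i. \<bar>quasi_coeff m n c (\<lfloor>s\<rfloor> - int i)\<bar>" "K * B"] q by simp
    from order_trans[OF C(2) mult_left_mono[OF this C(1)]]
    show "\<bar>spl k (quasi_coeff m n c) s\<bar> \<le> C * (real (Suc k) * K) * B"
      by (simp only: mult.assoc)
  qed (use K(1) C(1) in simp)
qed

section \<open>Differentiation of splines and quasi-interpolants in a parameter\<close>

lemma spl_has_derivative_param:
  "(\<And>j. ((\<lambda>t. c t j) has_real_derivative c' j) (at t within A)) \<Longrightarrow>
   ((\<lambda>t. spl k (c t) s) has_real_derivative spl k c' s) (at t within A)"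
proof (induction k arbitrary: c c')
  case (Suc k)
  have "((\<lambda>t. spl k (nabla (c t)) s) has_real_derivative spl k (nabla c') s) (at t within A)"
    by (rule Suc.IH) (auto simp: nabla_def intro!: DERIV_diff Suc.prems)
  moreover have "((\<lambda>t. spl k (deboor (Suc k) (c t)) s) has_real_derivative spl k (deboor (Suc k) c') s) (at t within A)"
    by (rule Suc.IH) (auto simp: deboor_def intro!: DERIV_diff DERIV_cmult Suc.prems)
  ultimately show ?case
    unfolding spl.simps(2) by (intro DERIV_cdivide DERIV_add DERIV_cmult)
qed simp

text \<open>For data depending on time this makes quasi-interpolation commute with the time
  derivative: the derivative of the interpolant of \<open>m\<close> is the interpolant of its time
  derivative.\<close>

lemma quasi_coeff_has_derivative:
  "(\<And>j. ((\<lambda>t. c t j) has_real_derivative c' j) (at t within A)) \<Longrightarrow>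
   ((\<lambda>t. quasi_coeff k n (c t) j) has_real_derivative quasi_coeff k n c' j) (at t within A)"
proof (induction n arbitrary: j)
  case (Suc n)
  show ?case
    unfolding quasi_coeff.simps
    by (intro DERIV_add DERIV_diff Suc spl_has_derivative_param)
qed simp

text \<open>The data are samples at the mesh points; \<open>Suc k\<close> Neumann terms are just
  enough for exactness on polynomials of degree at most \<open>k\<close>.\<close>

definition quasi_interp :: "nat \<Rightarrow> nat \<Rightarrow> (real \<Rightarrow> real) \<Rightarrow> int \<Rightarrow> real" where
  "quasi_interp k N g = quasi_coeff k (Suc k) (\<lambda>j. g (of_int j / real N))"

lemma quasi_interp_periodic:
  assumes "periodic1 g" "N \<ge> 1" shows "periodic_seq N (quasi_interp k N g)"
  unfolding quasi_interp_def
  by (rule quasi_coeff_periodic) (use assms in \<open>simp add: periodic_seq_def periodic1_def add_divide_distrib\<close>)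

text \<open>The Taylor polynomial at \<open>x\<close> is reproduced and agrees with
  \<open>D 0\<close> at \<open>x\<close>. The error at \<open>x\<close> is therefore a
  quasi-interpolant of the Taylor remainder, which samples only points at distance at most
  \<open>(R + 1) / N\<close>.\<close>

lemma quasi_interp_error:
  "\<exists>K\<ge>0. \<forall>N\<ge>1. \<forall>D B x. (\<forall>m\<le>k. \<forall>y. (D m has_real_derivative D (Suc m) y) (at y)) \<longrightarrow>
      (\<forall>y. \<bar>D (Suc k) y\<bar> \<le> B) \<longrightarrow>
      \<bar>D 0 x - pspline k N (quasi_interp k N (D 0)) x\<bar> \<le> K * B * (1 / real N) ^ Suc k"
proof -
  obtain K R where K: "K \<ge> 0"
     "\<forall>c s (B::real). (\<forall>i. \<lfloor>s\<rfloor> - int R \<le> i \<and> i \<le> \<lfloor>s\<rfloor> \<longrightarrow> \<bar>c i\<bar> \<le> B) \<longrightarrow>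
     \<bar>spl k (quasi_coeff k (Suc k) c) s\<bar> \<le> K * B"
    using spl_quasi_coeff_bound[of k k "Suc k"] that by (elim exE conjE) (assumption | rule that)+
  show ?thesis
  proof (intro exI[of _ "K * (real R + 1) ^ Suc k"] conjI allI impI)
    fix N :: nat and D :: "nat \<Rightarrow> real \<Rightarrow> real" and B x :: real
    assume N: "N \<ge> 1" and D: "\<forall>m\<le>k. \<forall>y. (D m has_real_derivative D (Suc m) y) (at y)"
      and B: "\<forall>y. \<bar>D (Suc k) y\<bar> \<le> B"
    have B0: "B \<ge> 0" using B abs_ge_zero order_trans by blast
    \<comment> \<open>The Taylor polynomial in the variable \<open>N * y\<close>, so that its values
      at integers are its samples at mesh points.\<close>
    define p where "p = (\<Sum>m\<le>k. smult (D m x / fact m) ([:- x, 1 / real N:] ^ m))"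
    have pdeg: "degree p \<le> k" unfolding p_def
    proof (rule degree_sum_le)
      fix m assume "m \<in> {..k}"
      have "degree ([:- x, 1 / real N:] ^ m) \<le> 1 * m"
        by (rule order_trans[OF degree_power_le]) (simp add: mult_right_mono)
      then show "degree (smult (D m x / fact m) ([:- x, 1 / real N:] ^ m)) \<le> k"
        using \<open>m \<in> {..k}\<close> by (intro order_trans[OF degree_smult_le]) auto
    qed simp
    have pval: "poly p z = (\<Sum>m<Suc k. D m x / fact m * (z / real N - x) ^ m)" for z
      unfolding p_def by (simp add: poly_sum lessThan_Suc_atMost)
    have taylor: "\<bar>D 0 y - poly p (real N * y)\<bar> \<le> B * \<bar>y - x\<bar> ^ Suc k" for y
    proof (cases "y = x")
      case True
      have "poly p (real N * x) = (\<Sum>m<Suc k. D m x / fact m * 0 ^ m)" using N by (simp add: pval)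
      also have "\<dots> = D 0 x" by (subst sum.lessThan_Suc_shift) simp
      finally show ?thesis using True by simp
    next
      case False
      have "\<exists>t. (if y < x then y < t \<and> t < x else x < t \<and> t < y) \<and>
        D 0 y = (\<Sum>m<Suc k. (D m x / fact m) * (y - x) ^ m) + (D (Suc k) t / fact (Suc k)) * (y - x) ^ Suc k"
        by (rule Taylor[of _ D _ "min x y" "max x y"]) (use D False in auto)
      then obtain t where t: "D 0 y = (\<Sum>m<Suc k. (D m x / fact m) * (y - x) ^ m) + (D (Suc k) t / fact (Suc k)) * (y - x) ^ Suc k"
        by blast
      have "\<bar>D 0 y - poly p (real N * y)\<bar> = \<bar>D (Suc k) t\<bar> / fact (Suc k) * \<bar>y - x\<bar> ^ Suc k"
        unfolding t pval using N by (simp add: abs_mult power_abs del: fact_Suc power_Suc)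
      also have "\<dots> \<le> B * \<bar>y - x\<bar> ^ Suc k"
      proof (rule mult_right_mono)
        have "\<bar>D (Suc k) t\<bar> / fact (Suc k) \<le> \<bar>D (Suc k) t\<bar> / 1"
          by (intro divide_left_mono) (auto simp del: fact_Suc simp: fact_ge_1)
        then show "\<bar>D (Suc k) t\<bar> / fact (Suc k) \<le> B" using B[rule_format, of t] by linarith
      qed simp
      finally show ?thesis .
    qed
    define s where "s = real N * x"
    define E where "E = B * ((real R + 1) / real N) ^ Suc k"
    have "\<bar>poly p (of_int i) - D 0 (of_int i / real N)\<bar> \<le> E"
      if i: "\<lfloor>s\<rfloor> - int R \<le> i" "i \<le> \<lfloor>s\<rfloor>" for i
    proof -
      have "real_of_int i \<le> s" "s - real R - 1 \<le> real_of_int i" using i by linarith+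
      then have "\<bar>of_int i - s\<bar> \<le> real R + 1" by simp
      moreover have "of_int i / real N - x = (of_int i - s) / real N"
        using N by (simp add: s_def field_simps)
      ultimately have "\<bar>of_int i / real N - x\<bar> \<le> (real R + 1) / real N"
        using N by (simp add: divide_right_mono)
      then have "B * \<bar>of_int i / real N - x\<bar> ^ Suc k \<le> E"
        unfolding E_def by (intro mult_left_mono power_mono B0) auto
      then show ?thesis using taylor[of "of_int i / real N"] N by (simp add: abs_minus_commute)
    qed
    then have *: "\<bar>spl k (quasi_coeff k (Suc k) (\<lambda>i. poly p (of_int i) - D 0 (of_int i / real N))) s\<bar> \<le> K * E"
      by (intro K(2)[rule_format]) auto
    have "D 0 x = poly p s" using taylor[of x] by (simp add: s_def)
    then have "D 0 x - pspline k N (quasi_interp k N (D 0)) x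
       = spl k (quasi_coeff k (Suc k) (\<lambda>i. poly p (of_int i) - D 0 (of_int i / real N))) s"
      unfolding quasi_coeff_diff spl_diff spl_quasi_coeff_poly[OF pdeg]
      by (simp add: pspline_def quasi_interp_def s_def)
    with * show "\<bar>D 0 x - pspline k N (quasi_interp k N (D 0)) x\<bar> \<le> K * (real R + 1) ^ Suc k * B * (1 / real N) ^ Suc k"
      by (simp add: E_def power_divide mult_ac del: power_Suc)
  qed (use K(1) in simp)
qed

lemma pspline_shift: "N \<ge> 1 \<Longrightarrow> pspline k N c (x + 1 / real N) = pspline k N (\<lambda>j. c (j + 1)) x"
  by (simp add: pspline_def spl_shift distrib_left)

text \<open>The quasi-interpolant commutes with translation by a mesh width, so the increment of the
  error over one cell is the error for the increment, which is smaller by one power of \<open>h\<close>.\<close>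

lemma quasi_interp_error_shift:
  "\<exists>K\<ge>0. \<forall>N\<ge>1. \<forall>D B x. (\<forall>m\<le>Suc k. \<forall>y. (D m has_real_derivative D (Suc m) y) (at y)) \<longrightarrow>
      (\<forall>y. \<bar>D (Suc (Suc k)) y\<bar> \<le> B) \<longrightarrow>
      \<bar>(D 0 (x + 1 / real N) - pspline k N (quasi_interp k N (D 0)) (x + 1 / real N)) -
       (D 0 x - pspline k N (quasi_interp k N (D 0)) x)\<bar> \<le> K * B * (1 / real N) ^ Suc (Suc k)"
proof -
  obtain K where K: "K \<ge> 0" "\<forall>N\<ge>1. \<forall>D B x. (\<forall>m\<le>k. \<forall>y. (D m has_real_derivative D (Suc m) y) (at y)) \<longrightarrow>
      (\<forall>y. \<bar>D (Suc k) y\<bar> \<le> B) \<longrightarrow>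
      \<bar>D 0 x - pspline k N (quasi_interp k N (D 0)) x\<bar> \<le> K * B * (1 / real N) ^ Suc k"
    using quasi_interp_error[of k] that by (elim exE conjE) (assumption | rule that)+
  show ?thesis
  proof (intro exI[of _ K] conjI allI impI)
    fix N :: nat and D :: "nat \<Rightarrow> real \<Rightarrow> real" and B x :: real
    assume N: "N \<ge> 1" and D: "\<forall>m\<le>Suc k. \<forall>y. (D m has_real_derivative D (Suc m) y) (at y)"
      and B: "\<forall>y. \<bar>D (Suc (Suc k)) y\<bar> \<le> B"
    define h where "h = 1 / real N"
    have h: "h > 0" using N by (simp add: h_def)
    define D' where "D' = (\<lambda>m y. D m (y + h) - D m y)"
    have "\<bar>D' 0 x - pspline k N (quasi_interp k N (D' 0)) x\<bar> \<le> K * (B * h) * (1 / real N) ^ Suc k"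
    proof (rule K(2)[rule_format, OF N])
      show "(D' m has_real_derivative D' (Suc m) y) (at y)" if "m \<le> k" for m y
        unfolding D'_def using D that
        by (auto intro!: derivative_eq_intros DERIV_chain'[of "\<lambda>y. y + h" 1 y _ "D m", simplified])
      \<comment> \<open>The mean value theorem on one cell gives the additional factor
        \<open>h\<close>, at the price of one more derivative of \<open>D 0\<close>.\<close>
      show "\<bar>D' (Suc k) y\<bar> \<le> B * h" for y
      proof -
        have "\<exists>z>y. z < y + h \<and> D (Suc k) (y + h) - D (Suc k) y = (y + h - y) * D (Suc (Suc k)) z"
          by (rule MVT2) (use D h in auto)
        then obtain z where "D' (Suc k) y = h * D (Suc (Suc k)) z" by (auto simp: D'_def)
        then show ?thesis using h B by (simp add: abs_mult mult.commute)
      qed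
    qed
    moreover have "quasi_interp k N (D' 0) = (\<lambda>j. quasi_interp k N (D 0) (j + 1) - quasi_interp k N (D 0) j)"
    proof -
      have "(\<lambda>j. D' 0 (of_int j / real N)) = (\<lambda>j. (\<lambda>i. D 0 (of_int i / real N)) (j + 1) - D 0 (of_int j / real N))"
        by (rule ext) (simp add: D'_def h_def add_divide_distrib)
      then show ?thesis
        unfolding quasi_interp_def
        by (simp only: quasi_coeff_diff quasi_coeff_shift[of k "Suc k" "\<lambda>i. D 0 (of_int i / real N)" 1])
    qed
    ultimately show "\<bar>(D 0 (x + 1 / real N) - pspline k N (quasi_interp k N (D 0)) (x + 1 / real N)) -
       (D 0 x - pspline k N (quasi_interp k N (D 0)) x)\<bar> \<le> K * B * (1 / real N) ^ Suc (Suc k)"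
      unfolding pspline_shift[OF N]
      by (simp add: D'_def h_def pspline_def spl_diff algebra_simps)
  qed (use K(1) in simp)
qed

text \<open>Differencing the coefficients is the same as differencing the samples, and these
  differences are at most \<open>B / N\<close>. The factor \<open>N\<close> is thus compensated, and
  the derivative of a quasi-interpolant stays bounded as the mesh is refined.\<close>

lemma quasi_interp_nabla_bound:
  "\<exists>K\<ge>0. \<forall>N\<ge>1. \<forall>g g' B x. (\<forall>y. (g has_real_derivative g' y) (at y)) \<longrightarrow> (\<forall>y. \<bar>g' y\<bar> \<le> B) \<longrightarrow>
      \<bar>real N * pspline l N (nabla (quasi_interp k N g)) x\<bar> \<le> K * B"
proof -
  obtain K R where K: "K \<ge> 0"
     "\<forall>c s (B::real). (\<forall>i. \<lfloor>s\<rfloor> - int R \<le> i \<and> i \<le> \<lfloor>s\<rfloor> \<longrightarrow> \<bar>c i\<bar> \<le> B) \<longrightarrow>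
     \<bar>spl l (quasi_coeff k (Suc k) c) s\<bar> \<le> K * B"
    using spl_quasi_coeff_bound[of l k "Suc k"] that by (elim exE conjE) (assumption | rule that)+
  show ?thesis
  proof (intro exI[of _ K] conjI allI impI)
    fix N :: nat and g g' :: "real \<Rightarrow> real" and B x :: real
    assume N: "N \<ge> 1" and g: "\<forall>y. (g has_real_derivative g' y) (at y)" and B: "\<forall>y. \<bar>g' y\<bar> \<le> B"
    have "\<bar>nabla (\<lambda>j. g (of_int j / real N)) i\<bar> \<le> B / real N" for i
    proof -
      let ?a = "of_int (i - 1) / real N" and ?b = "of_int i / real N"
      have ab: "?a < ?b" using N by (simp add: divide_strict_right_mono)
      have "\<exists>z>?a. z < ?b \<and> g ?b - g ?a = (?b - ?a) * g' z"
        by (rule MVT2) (use g ab in auto)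
      then obtain z where "g ?b - g ?a = (?b - ?a) * g' z" by blast
      then have "nabla (\<lambda>j. g (of_int j / real N)) i = g' z / real N"
        by (simp add: nabla_def diff_divide_distrib)
      then show ?thesis using B N by (simp add: divide_right_mono)
    qed
    then have "\<bar>pspline l N (nabla (quasi_interp k N g)) x\<bar> \<le> K * (B / real N)"
      unfolding quasi_interp_def quasi_coeff_nabla[symmetric] pspline_def by (intro K(2)[rule_format]) auto
    then have "real N * \<bar>pspline l N (nabla (quasi_interp k N g)) x\<bar> \<le> real N * (K * (B / real N))"
      by (intro mult_left_mono) auto
    then show "\<bar>real N * pspline l N (nabla (quasi_interp k N g)) x\<bar> \<le> K * B"
      using N by (simp add: abs_mult)
  qed (use K(1) in simp)
qed

section \<open>Periodic splines on a uniform mesh\<close>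

lemma pspline_add: "pspline k N (\<lambda>j. c j + d j) = (\<lambda>x. pspline k N c x + pspline k N d x)"
  by (rule ext) (simp add: pspline_def spl_add)

lemma pspline_diff: "pspline k N (\<lambda>j. c j - d j) = (\<lambda>x. pspline k N c x - pspline k N d x)"
  by (rule ext) (simp add: pspline_def spl_diff)

lemma pspline_cmult: "pspline k N (\<lambda>j. a * c j) = (\<lambda>x. a * pspline k N c x)"
  by (rule ext) (simp add: pspline_def spl_cmult)

lemma pspline_sum: "pspline k N (\<lambda>j. \<Sum>i\<in>A. f i j) = (\<lambda>x. \<Sum>i\<in>A. pspline k N (f i) x)"
  by (rule ext) (simp add: pspline_def spl_sum)

lemma pspline_const: "pspline k N (\<lambda>j. a) = (\<lambda>x. a)"
  by (rule ext) (simp add: pspline_def spl_const)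

lemma pspline_has_derivative:
  "(pspline (Suc (Suc k)) N c has_real_derivative real N * pspline (Suc k) N (nabla c) x) (at x)"
proof -
  have "((\<lambda>x. real N * x) has_real_derivative real N) (at x)"
    by (auto intro!: derivative_eq_intros)
  from DERIV_chain2[where g = "\<lambda>x. real N * x", OF spl_has_derivative[of k c] this]
  show ?thesis unfolding pspline_def by (simp add: mult.commute)
qed

lemma pspline_has_derivative_off_nodes:
  assumes "real N * x \<notin> \<int>"
  shows "(pspline (Suc k) N c has_real_derivative real N * pspline k N (nabla c) x) (at x)"
proof -
  have "((\<lambda>x. real N * x) has_real_derivative real N) (at x)"
    by (auto intro!: derivative_eq_intros)
  from DERIV_chain2[where g = "\<lambda>x. real N * x", OF spl_has_derivative_off_int[OF assms, of k c] this]
  show ?thesis unfolding pspline_def by (simp add: mult.commute)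
qed

lemma pspline_continuous: "continuous_on A (pspline (Suc k) N c)"
proof -
  have "isCont (\<lambda>x. spl (Suc k) c (real N * x)) x" for x
    by (rule isCont_o2[of x "\<lambda>x. real N * x" "spl (Suc k) c"]) (auto intro: isCont_spl)
  then show ?thesis unfolding pspline_def[abs_def] by (simp add: continuous_at_imp_continuous_on)
qed

text \<open>The cells behind \<open>spl\<close> are closed on the left, so at a node the spline of
  degree \<open>k\<close> takes the value of the cell to the right. This is why the formula holds at
  every point, also for \<open>k = 0\<close>.\<close>

lemma pspline_right_derivative:
  assumes "N \<ge> 1"
  shows "(pspline (Suc k) N c has_real_derivative real N * pspline k N (nabla c) x) (at_right x)"
proof -
  define j where "j = \<lfloor>real N * x\<rfloor>"
  define q where "q = (\<lambda>s. poly (spoly (Suc k) (\<lambda>i. c (i + j))) (s - of_int j))"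
  have j: "of_int j \<le> real N * x" "real N * x < of_int j + 1" unfolding j_def by linarith+
  have "(q has_real_derivative spl k (nabla c) (real N * x)) (at (real N * x) within UNIV)"
    unfolding q_def by (rule spl_poly_deriv_cell) (use j in auto)
  moreover have "((\<lambda>x. real N * x) has_real_derivative real N) (at x within {x..})"
    by (auto intro!: derivative_eq_intros)
  ultimately have D: "((\<lambda>x. q (real N * x)) has_real_derivative spl k (nabla c) (real N * x) * real N) (at x within {x..})"
    by (rule DERIV_chain2[where g = "\<lambda>x. real N * x"])
  define d where "d = (of_int j + 1) / real N - x"
  have d: "d > 0" using j assms by (simp add: d_def field_simps)
  have "(pspline (Suc k) N c has_real_derivative spl k (nabla c) (real N * x) * real N) (at x within {x..})"
  proof (rule has_field_derivative_transform_within[OF D d])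
    fix y assume "y \<in> {x..}" "dist y x < d"
    then have "x \<le> y" "y < (of_int j + 1) / real N" by (auto simp: d_def dist_real_def)
    then have y: "real N * x \<le> real N * y" "real N * y < of_int j + 1"
      using assms by (auto simp: field_simps mult_left_mono)
    then show "q (real N * y) = pspline (Suc k) N c y"
      unfolding q_def pspline_def using spl_poly_cell[of j "real N * y"] j by simp
  qed simp
  then have "(pspline (Suc k) N c has_real_derivative spl k (nabla c) (real N * x) * real N) (at_right x)"
    by (rule DERIV_subset) auto
  then show ?thesis by (simp add: pspline_def mult.commute)
qed

text \<open>For \<open>r = 2\<close> the right derivative supplies a value at the mesh points, where \<open>deriv\<close> is
  unspecified.\<close>

definition right_deriv :: "(real \<Rightarrow> real) \<Rightarrow> real \<Rightarrow> real" where
  "right_deriv f x = (THE d. (f has_real_derivative d) (at_right x))"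

lemma right_deriv_eq: "(f has_real_derivative d) (at_right x) \<Longrightarrow> right_deriv f x = d"
  unfolding right_deriv_def
proof (rule the_equality)
  fix e assume "(f has_real_derivative d) (at_right x)" "(f has_real_derivative e) (at_right x)"
  then show "e = d"
    unfolding has_field_derivative_iff by (metis tendsto_unique trivial_limit_at_right_real)
qed

lemma right_deriv_pspline:
  "N \<ge> 1 \<Longrightarrow> right_deriv (pspline (Suc k) N c) = (\<lambda>x. real N * pspline k N (nabla c) x)"
  by (rule ext) (intro right_deriv_eq pspline_right_derivative)

lemma nodes_finite: 
  assumes "N \<ge> 1" shows "finite {x \<in> {0..1}. real N * x \<in> \<int>}"
proof (rule finite_subset)
  show "{x \<in> {0..1}. real N * x \<in> \<int>} \<subseteq> (\<lambda>j. of_int j / real N) ` {0..int N}"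
  proof
    fix x assume x: "x \<in> {x \<in> {0..1}. real N * x \<in> \<int>}"
    then obtain j where j: "real N * x = of_int j" by (auto elim: Ints_cases)
    moreover have "0 \<le> real N * x" "real N * x \<le> real N" using x by (auto simp: mult_left_le)
    ultimately have "j \<in> {0..int N}" by auto
    moreover have "x = of_int j / real N" using j assms by (simp add: field_simps)
    ultimately show "x \<in> (\<lambda>j. of_int j / real N) ` {0..int N}" by blast
  qed
qed simp

lemma pw_deriv_pspline:
  assumes "N \<ge> 1" "periodic_seq N c"
  shows "pw_deriv (pspline (Suc k) N c) (right_deriv (pspline (Suc k) N c))"
  unfolding pw_deriv_def right_deriv_pspline[OF assms(1)]
proof (intro conjI)
  show "\<exists>S. finite S \<and> (\<forall>x\<in>{0..1} - S. (pspline (Suc k) N c has_real_derivative real N * pspline k N (nabla c) x) (at x))"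
    by (rule exI[of _ "{x \<in> {0..1}. real N * x \<in> \<int>}"])
      (use nodes_finite[OF assms(1)] in \<open>auto intro!: pspline_has_derivative_off_nodes\<close>)
  show "bounded_borel (\<lambda>x. real N * pspline k N (nabla c) x)"
    by (intro bounded_borel_cmult pspline_bounded_borel periodic_seq_nabla assms)
qed (simp_all add: pspline_periodic pspline_continuous assms)

section \<open>Identification of \<open>spline_space\<close> with periodic B-spline
  combinations\<close>

definition pw_poly :: "nat \<Rightarrow> nat \<Rightarrow> (real \<Rightarrow> real) \<Rightarrow> bool" where
  "pw_poly d N f \<longleftrightarrow> (\<forall>j::int. \<exists>p. degree p \<le> d \<and>
     (\<forall>x\<in>{of_int j / real N..(of_int j + 1) / real N}. f x = poly p x))"

text \<open>Cells indexed by all integers free the later induction from the ends of the period; a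
  general cell is carried into \<open>[0, 1]\<close> by \<open>m\<close> whole periods.\<close>

lemma pw_poly_periodic:
  assumes N: "N \<ge> 1" and f: "periodic1 f"
    and p: "\<forall>i\<in>{1..N}. \<exists>p. degree p \<le> d \<and> (\<forall>x\<in>{(real i - 1) / real N..real i / real N}. f x = poly p x)"
  shows "pw_poly d N f"
  unfolding pw_poly_def
proof
  fix j :: int
  define m where "m = j div int N"
  \<comment> \<open>The cells in \<open>spline_space\<close> are numbered from 1, hence the added
    1.\<close>
  define i where "i = nat (j mod int N) + 1"
  have i: "i \<in> {1..N}" using N by (auto simp: i_def nat_less_iff Suc_le_eq)
  have "int i = j mod int N + 1" using N by (simp add: i_def)
  then have "j = m * int N + int i - 1" by (simp add: m_def)
  then have ji: "real_of_int j = of_int m * real N + real i - 1"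
    by (metis of_int_1 of_int_add of_int_diff of_int_mult of_int_of_nat_eq)
  obtain p where p: "degree p \<le> d" "\<And>x. x \<in> {(real i - 1) / real N..real i / real N} \<Longrightarrow> f x = poly p x"
    using assms(3) i by blast
  show "\<exists>p. degree p \<le> d \<and> (\<forall>x\<in>{of_int j / real N..(of_int j + 1) / real N}. f x = poly p x)"
  proof (intro exI[of _ "pcompose p [:- of_int m, 1:]"] conjI ballI)
    show "degree (pcompose p [:- of_int m, 1:]) \<le> d" using p(1) by (simp add: degree_pcompose)
    fix x assume x: "x \<in> {of_int j / real N..(of_int j + 1) / real N}"
    then have "x - of_int m \<in> {(real i - 1) / real N..real i / real N}"
      using N by (simp add: ji field_simps)
    then have "f (x - of_int m) = poly p (x - of_int m)" by (rule p(2))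
    moreover have "f (x - of_int m) = f x"
      using periodic1_int[OF f, of "x - of_int m" m] by simp
    ultimately show "f x = poly (pcompose p [:- of_int m, 1:]) x" by (simp add: poly_pcompose)
  qed
qed

text \<open>Summation from 0 in both directions. Even for periodic \<open>d\<close> the result need
  not be periodic, so periodicity of spline coefficients is restored only afterwards, by
  \<open>pspline_periodic_imp\<close>.\<close>

lemma antidifference: "\<exists>c. nabla c = d"
proof -
  define c where "c = (\<lambda>j::int. if j \<ge> 0 then \<Sum>i\<in>{1..j}. d i else - (\<Sum>i\<in>{j + 1..0}. d i))"
  have "nabla c j = d j" for j
  proof (cases "j \<ge> 1")
    case True
    then have "{1..j} = insert j {1..j - 1}" by auto
    then show ?thesis using True by (simp add: nabla_def c_def)
  next
    case False
    then have "{j..0} = insert j {j + 1..0}" by auto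
    then have "c (j - 1) = - (d j + (\<Sum>i\<in>{j + 1..0}. d i))" using False by (simp add: c_def)
    moreover have "c j = - (\<Sum>i\<in>{j + 1..0}. d i)" using False by (cases "j = 0") (auto simp: c_def)
    ultimately show ?thesis by (simp add: nabla_def)
  qed
  then show ?thesis by blast
qed

text \<open>Induction on the smoothness. For \<open>k = 0\<close> the function is the linear
  interpolant of its nodal values. Otherwise its derivative is a spline by induction, an
  antidifference integrates the coefficients, and the remaining constant is the spline with constant
  coefficients.\<close>

lemma pw_poly_imp_pspline:
  assumes N: "N \<ge> 1"
  shows "f \<in> C_per k \<Longrightarrow> pw_poly (Suc k) N f \<Longrightarrow> \<exists>c. f = pspline (Suc k) N c"
proof (induction k arbitrary: f)
  case 0
  show ?case
  \<comment> \<open>The hat function with index \<open>j\<close> lives on \<open>[j, j + 2]\<close>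
    and peaks at \<open>j + 1\<close>, whence the shifted nodal value.\<close>
  proof (intro exI[of _ "\<lambda>j. f ((of_int j + 1) / real N)"] ext)
    fix x
    define j where "j = \<lfloor>real N * x\<rfloor>"
    have j: "of_int j \<le> real N * x" "real N * x < of_int j + 1" unfolding j_def by linarith+
    define a where "a = real_of_int j / real N"
    define b where "b = (real_of_int j + 1) / real N"
    obtain p where p: "degree p \<le> Suc 0" "\<And>x. x \<in> {a..b} \<Longrightarrow> f x = poly p x"
      using 0(2) unfolding pw_poly_def a_def b_def by blast
    have x: "x \<in> {a..b}" "a \<in> {a..b}" "b \<in> {a..b}" using j N by (auto simp: a_def b_def field_simps)
    define p0 p1 where "p0 = coeff p 0" and "p1 = coeff p 1"
    have "p = [:p0, p1:]"
    proof (rule poly_eqI)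
      fix n show "coeff p n = coeff [:p0, p1:] n"
        using p(1) by (cases n; cases "n - 1") (auto simp: p0_def p1_def coeff_eq_0)
    qed
    then have pv: "poly p z = p0 + z * p1" for z by simp
    have "pspline (Suc 0) N (\<lambda>j. f ((of_int j + 1) / real N)) x
       = f a + (real N * x - of_int j) * (f b - f a)"
      unfolding pspline_def spl.simps(2) spl.simps(1) nabla_def deboor_def j_def[symmetric]
      by (simp add: a_def b_def algebra_simps)
    also have "\<dots> = f x"
      using N x by (simp add: p(2) pv) (simp add: a_def b_def field_simps)
    finally show "f x = pspline (Suc 0) N (\<lambda>j. f ((of_int j + 1) / real N)) x" by simp
  qed
next
  case (Suc k)
  have f': "(f has_real_derivative deriv f x) (at x)" for x
    using Suc.prems(1) DERIV_deriv_iff_field_differentiable unfolding C_per_def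
    by (metis (mono_tags, lifting) funpow_0 mem_Collect_eq zero_less_Suc)
  have "deriv f \<in> C_per k"
  proof -
    have "deriv f (x + 1) = deriv f x" for x
    proof -
      have "((\<lambda>y. f (y + 1)) has_real_derivative deriv f (x + 1)) (at x)"
        using DERIV_shift[of f "deriv f (x + 1)" x 1] f' by blast
      moreover have "(\<lambda>y. f (y + 1)) = f" using Suc.prems(1) by (auto simp: C_per_def periodic1_def)
      ultimately show ?thesis using f'[of x] DERIV_unique by metis
    qed
    moreover have "(deriv ^^ j) (deriv f) = (deriv ^^ Suc j) f" for j
      by (simp add: funpow_Suc_right del: funpow.simps)
    ultimately show ?thesis using Suc.prems(1)
      unfolding C_per_def periodic1_def by (auto simp del: funpow.simps)
  qed
  moreover have "pw_poly (Suc k) N (deriv f)"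
    unfolding pw_poly_def
  proof
    fix j :: int
    define a where "a = real_of_int j / real N"
    define b where "b = (real_of_int j + 1) / real N"
    have ab: "a < b" using N by (simp add: a_def b_def divide_strict_right_mono)
    obtain p where p: "degree p \<le> Suc (Suc k)" "\<And>x. x \<in> {a..b} \<Longrightarrow> f x = poly p x"
      using Suc.prems(2) unfolding pw_poly_def a_def b_def by blast
    \<comment> \<open>At an end point of the cell \<open>p\<close> determines only a one-sided
      derivative; since \<open>f\<close> is differentiable there, the two have to agree.\<close>
    have "deriv f x = poly (pderiv p) x" if x: "x \<in> {a..b}" for x
    proof (rule vector_derivative_unique_within_closed_interval[of a b x f])
      show "(f has_vector_derivative deriv f x) (at x within cbox a b)"
        using f'[of x] has_real_derivative_iff_has_vector_derivative has_vector_derivative_at_within by blast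
      have "(f has_real_derivative poly (pderiv p) x) (at x within {a..b})"
        by (rule has_field_derivative_transform_within[OF DERIV_subset[OF poly_DERIV] zero_less_one x])
          (auto simp: p(2))
      then show "(f has_vector_derivative poly (pderiv p) x) (at x within cbox a b)"
        by (simp add: has_real_derivative_iff_has_vector_derivative)
    qed (use ab x in auto)
    moreover have "degree (pderiv p) \<le> Suc k" using p(1) by (simp add: degree_pderiv)
    ultimately show "\<exists>p. degree p \<le> Suc k \<and>
        (\<forall>x\<in>{real_of_int j / real N..(real_of_int j + 1) / real N}. deriv f x = poly p x)"
      unfolding a_def b_def by blast
  qed
  ultimately obtain d where d: "deriv f = pspline (Suc k) N d" using Suc.IH by blast
  obtain c where c: "nabla c = (\<lambda>j. d j / real N)" using antidifference by blast
  have "real N * pspline (Suc k) N (nabla c) x = deriv f x" for x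
    using N pspline_cmult[of "Suc k" N "1 / real N" d] unfolding c d by simp
  then have "(pspline (Suc (Suc k)) N c has_real_derivative deriv f x) (at x)" for x
    using pspline_has_derivative[of k N c x] by simp
  then have "((\<lambda>x. f x - pspline (Suc (Suc k)) N c x) has_real_derivative deriv f x - deriv f x) (at x)" for x
    by (intro DERIV_diff f') auto
  then have "f x - pspline (Suc (Suc k)) N c x = f 0 - pspline (Suc (Suc k)) N c 0" for x
    using DERIV_isconst_all[of "\<lambda>x. f x - pspline (Suc (Suc k)) N c x" x 0] by simp
  then have "f x = pspline (Suc (Suc k)) N c x + (f 0 - pspline (Suc (Suc k)) N c 0)" for x
    by (metis diff_add_cancel add.commute)
  then have "f = pspline (Suc (Suc k)) N (\<lambda>j. c j + (f 0 - pspline (Suc (Suc k)) N c 0))"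
    unfolding pspline_add pspline_const by blast
  then show ?case by blast
qed

text \<open>Coefficients are fixed combinations of point values, so pointwise information such as
  equality or differentiability in time passes from the spline to its coefficients.\<close>

lemma pspline_dual:
  assumes "N \<ge> 1"
  shows "\<exists>a z. \<forall>c j. c j = (\<Sum>l\<le>k. a l * pspline k N c (of_int j / real N + z l))"
proof -
  obtain a where a: "\<And>c j. c j = (\<Sum>l\<le>k. a l * spl k c (of_int j + real l / real (Suc k)))"
    using spl_dual[of k] by blast
  have "c j = (\<Sum>l\<le>k. a l * pspline k N c (of_int j / real N + real l / real (Suc k) / real N))" for c j
    by (subst a) (use assms in \<open>simp add: pspline_def distrib_left del: of_nat_Suc\<close>)
  then show ?thesis
    by (intro exI[of _ a] exI[of _ "\<lambda>l. real l / real (Suc k) / real N"]) blast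
qed

lemma pspline_inj:
  assumes "N \<ge> 1" "pspline k N c = pspline k N d" shows "c = d"
proof
  fix j
  obtain a z where a: "\<And>c j. c j = (\<Sum>l\<le>k. a l * pspline k N c (of_int j / real N + z l))"
    using pspline_dual[OF assms(1)] by blast
  show "c j = d j" using a[of c j] a[of d j] assms(2) by simp
qed

lemma pspline_periodic_imp:
  assumes "N \<ge> 1" "periodic1 (pspline k N c)" shows "periodic_seq N c"
proof -
  have "pspline k N (\<lambda>j. c (j + int N)) = pspline k N c"
  proof
    fix x
    have "pspline k N (\<lambda>j. c (j + int N)) x = pspline k N c (x + 1)"
      by (simp add: pspline_def spl_shift distrib_left)
    then show "pspline k N (\<lambda>j. c (j + int N)) x = pspline k N c x"
      using assms(2) by (simp add: periodic1_def)
  qed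
  from pspline_inj[OF assms(1) this] show ?thesis by (simp add: periodic_seq_def fun_eq_iff)
qed

lemma funpow_deriv_pspline:
  "(deriv ^^ j) (pspline (Suc (j + k)) N c) = (\<lambda>x. real N ^ j * pspline (Suc k) N ((nabla ^^ j) c) x)"
proof (induction j arbitrary: c)
  case (Suc j)
  have "deriv (pspline (Suc (Suc j + k)) N c) = pspline (Suc (j + k)) N (\<lambda>i. real N * nabla c i)"
    by (rule ext) (simp add: DERIV_imp_deriv[OF pspline_has_derivative] pspline_cmult)
  then have "(deriv ^^ Suc j) (pspline (Suc (Suc j + k)) N c)
     = (\<lambda>x. real N ^ j * pspline (Suc k) N ((nabla ^^ j) (\<lambda>i. real N * nabla c i)) x)"
    by (simp add: funpow_Suc_right Suc.IH del: funpow.simps)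
  moreover have "(nabla ^^ j) (\<lambda>i. real N * nabla c i) = (\<lambda>i. real N * (nabla ^^ Suc j) c i)"
    using funpow_nabla_linear[of j "real N" "nabla c" 0 c] by (simp add: funpow_Suc_right del: funpow.simps)
  ultimately show ?case by (simp add: pspline_cmult mult.assoc mult.left_commute)
qed simp

text \<open>The bridge to coefficients, through which the spline space is used from here on. Order
  \<open>k + 2\<close> means degree \<open>k + 1\<close>; for \<open>k = 0\<close> these are the
  continuous piecewise linear functions.\<close>

lemma spline_space_iff:
  assumes N: "N \<ge> 1"
  shows "\<phi> \<in> spline_space (Suc (Suc k)) N \<longleftrightarrow> (\<exists>c. periodic_seq N c \<and> \<phi> = pspline (Suc k) N c)"
proof
  assume \<phi>: "\<phi> \<in> spline_space (Suc (Suc k)) N"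
  then have C: "\<phi> \<in> C_per k" by (simp add: spline_space_def)
  then have P: "periodic1 \<phi>" by (simp add: C_per_def)
  have "pw_poly (Suc k) N \<phi>"
    by (rule pw_poly_periodic[OF N P]) (use \<phi> in \<open>simp add: spline_space_def\<close>)
  then obtain c where "\<phi> = pspline (Suc k) N c" using pw_poly_imp_pspline[OF N C] by blast
  then show "\<exists>c. periodic_seq N c \<and> \<phi> = pspline (Suc k) N c"
    using pspline_periodic_imp[OF N] P by blast
next
  assume "\<exists>c. periodic_seq N c \<and> \<phi> = pspline (Suc k) N c"
  then obtain c where c: "periodic_seq N c" "\<phi> = pspline (Suc k) N c" by blast
  have D: "(deriv ^^ j) \<phi> = (\<lambda>x. real N ^ j * pspline (Suc (k - j)) N ((nabla ^^ j) c) x)" if "j \<le> k" for j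
    using funpow_deriv_pspline[of j "k - j" N c] that c by simp
  have "\<phi> \<in> C_per k"
    unfolding C_per_def
  proof (intro CollectI conjI allI impI)
    show "periodic1 \<phi>" using c pspline_periodic by simp
    fix j x assume j: "j < k"
    then have "Suc (k - j) = Suc (Suc (k - Suc j))" by simp
    then show "(deriv ^^ j) \<phi> field_differentiable at x"
      using D[of j] j pspline_has_derivative[of "k - Suc j" N "(nabla ^^ j) c" x]
      by (auto simp: field_differentiable_def intro!: exI DERIV_cmult)
  next
    show "continuous_on UNIV ((deriv ^^ k) \<phi>)"
      unfolding D[OF order_refl] by (intro continuous_intros pspline_continuous)
  qed
  moreover have "\<exists>p. degree p \<le> Suc k \<and> (\<forall>x\<in>{(real i - 1) / real N..real i / real N}. \<phi> x = poly p x)" for i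
  proof (intro exI conjI ballI)
    define j where "j = int i - 1"
    let ?p = "pcompose (spoly (Suc k) (\<lambda>i. c (i + j))) [:- of_int j, real N:]"
    show "degree ?p \<le> Suc k" using degree_spoly[of "Suc k" "\<lambda>i. c (i + j)"] N by (simp add: degree_pcompose)
    fix x assume "x \<in> {(real i - 1) / real N..real i / real N}"
    then have "of_int j \<le> real N * x" "real N * x \<le> of_int j + 1" using N by (auto simp: j_def field_simps)
    then show "\<phi> x = poly ?p x"
      unfolding c(2) pspline_def using spl_poly_closed_cell[of j "real N * x" k c]
      by (simp add: poly_pcompose mult.commute)
  qed
  ultimately show "\<phi> \<in> spline_space (Suc (Suc k)) N" by (simp add: spline_space_def)
qed

section \<open>Coordinates, and splines depending on time\<close>

definition delta_seq :: "nat \<Rightarrow> nat \<Rightarrow> int \<Rightarrow> real" where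
  "delta_seq N i j = (if j mod int N = int i then 1 else 0)"

lemma periodic_delta_seq: "periodic_seq N (delta_seq N i)"
  by (simp add: periodic_seq_def delta_seq_def)

lemma periodic_seq_expand:
  assumes "N \<ge> 1" "periodic_seq N c" shows "c = (\<lambda>j. \<Sum>i<N. c (int i) * delta_seq N i j)"
proof
  fix j
  define m where "m = nat (j mod int N)"
  have m: "m < N" "int m = j mod int N" using assms(1) by (auto simp: m_def nat_less_iff)
  have "(\<Sum>i<N. c (int i) * delta_seq N i j) = (\<Sum>i<N. if i = m then c (int i) else 0)"
    by (intro sum.cong) (auto simp: delta_seq_def m(2)[symmetric])
  also have "\<dots> = c (int m)" using m by simp
  also have "\<dots> = c j" using m periodic_seq_mod[OF assms(2), of j] by simp
  finally show "c j = (\<Sum>i<N. c (int i) * delta_seq N i j)" by simp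
qed

lemma pspline_expand:
  assumes "N \<ge> 1" "periodic_seq N c"
  shows "pspline k N c = (\<lambda>x. \<Sum>i<N. c (int i) * pspline k N (delta_seq N i) x)"
  by (subst periodic_seq_expand[OF assms]) (simp add: pspline_sum pspline_cmult)

text \<open>In coordinates the squared norm is a quadratic form with Gram matrix \<open>G\<close>,
  so only finitely many scalar functions of time are differentiated and never an integral. Symmetry
  of \<open>G\<close> gives the factor 2.\<close>

lemma L2_inner_pspline_has_derivative:
  assumes N: "N \<ge> 1" and T: "T > 0" and t: "t \<in> {0..T}"
    and c: "\<And>s. s \<in> {0..T} \<Longrightarrow> periodic_seq N (c s)" and c': "periodic_seq N c'"
    and d: "\<And>j. ((\<lambda>s. c s j) has_real_derivative c' j) (at t within {0..T})"
  shows "((\<lambda>s. L2_inner (pspline k N (c s)) (pspline k N (c s))) has_real_derivative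
    2 * L2_inner (pspline k N c') (pspline k N (c t))) (at t within {0..T})"
proof -
  define G where "G = (\<lambda>i j. L2_inner (pspline k N (delta_seq N i)) (pspline k N (delta_seq N j)))"
  have bb: "bounded_borel (pspline k N (delta_seq N i))" for i
    by (intro pspline_bounded_borel periodic_delta_seq N)
  have ip: "L2_inner (pspline k N a) (pspline k N b) = (\<Sum>i<N. \<Sum>j<N. a (int i) * b (int j) * G i j)"
    if ab: "periodic_seq N a" "periodic_seq N b" for a b
  proof -
    have "L2_inner (pspline k N a) (pspline k N b)
      = (\<Sum>i<N. L2_inner (\<lambda>x. a (int i) * pspline k N (delta_seq N i) x) (pspline k N b))"
      by (subst pspline_expand[OF N ab(1)], rule L2_inner_sum_left)
        (auto intro!: bounded_borel_cmult bb pspline_bounded_borel ab N)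
    also have "\<dots> = (\<Sum>i<N. \<Sum>j<N. L2_inner (\<lambda>x. a (int i) * pspline k N (delta_seq N i) x)
        (\<lambda>x. b (int j) * pspline k N (delta_seq N j) x))"
      by (subst pspline_expand[OF N ab(2)], intro sum.cong refl L2_inner_sum_right)
        (auto intro!: bounded_borel_cmult bb)
    finally show ?thesis by (simp add: L2_inner_cmult_left L2_inner_cmult_right G_def mult_ac)
  qed
  have G: "G i j = G j i" for i j unfolding G_def by (rule L2_inner_commute)
  have "((\<lambda>s. \<Sum>i<N. \<Sum>j<N. c s (int i) * c s (int j) * G i j) has_real_derivative
     (\<Sum>i<N. \<Sum>j<N. (c' (int i) * c t (int j) + c t (int i) * c' (int j)) * G i j)) (at t within {0..T})"
    by (intro DERIV_sum) (auto intro!: derivative_eq_intros d simp: algebra_simps)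
  also have "(\<Sum>i<N. \<Sum>j<N. (c' (int i) * c t (int j) + c t (int i) * c' (int j)) * G i j)
    = (\<Sum>i<N. \<Sum>j<N. c' (int i) * c t (int j) * G i j) + (\<Sum>i<N. \<Sum>j<N. c' (int j) * c t (int i) * G j i)"
  proof -
    have "(c' (int i) * c t (int j) + c t (int i) * c' (int j)) * G i j
      = c' (int i) * c t (int j) * G i j + c' (int j) * c t (int i) * G j i" for i j
      using G[of i j] by (simp add: algebra_simps)
    then show ?thesis by (simp only: sum.distrib)
  qed
  also have "(\<Sum>i<N. \<Sum>j<N. c' (int j) * c t (int i) * G j i) = (\<Sum>i<N. \<Sum>j<N. c' (int i) * c t (int j) * G i j)"
    by (rule sum.swap)
  also have "\<dots> + \<dots> = 2 * L2_inner (pspline k N c') (pspline k N (c t))"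
    using ip[OF c' c[OF t]] by simp
  finally show ?thesis
    by (rule has_field_derivative_transform_within[OF _ zero_less_one t]) (simp add: ip c)
qed

text \<open>Solutions are differentiable in time only pointwise in \<open>x\<close>. The dual
  functionals turn this into differentiability of the coefficients, and the time derivative is then
  again a periodic spline.\<close>

lemma pspline_time_derivative:
  assumes N: "N \<ge> 1" and T: "T > 0" and v: "\<And>s. s \<in> {0..T} \<Longrightarrow> periodic_seq N (c s)"
    and eq: "\<And>s. s \<in> {0..T} \<Longrightarrow> v s = pspline k N (c s)"
    and d: "\<And>x. (\<lambda>s. v s x) differentiable (at t within {0..T})" and t: "t \<in> {0..T}"
  shows "\<exists>c'. periodic_seq N c' \<and> (\<forall>j. ((\<lambda>s. c s j) has_real_derivative c' j) (at t within {0..T})) \<and>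
    time_deriv T v t = pspline k N c'"
proof -
  \<comment> \<open>Because \<open>T > 0\<close>, every time in the interval is a limit point of it,
    so derivatives within the interval are unique.\<close>
  have nt: "at t within {0..T} \<noteq> bot" using T t by (simp add: trivial_limit_within islimpt_Icc)
  obtain a z where a: "\<And>c j. c j = (\<Sum>l\<le>k. a l * pspline k N c (of_int j / real N + z l))"
    using pspline_dual[OF N] by blast
  define c' where "c' = (\<lambda>j. \<Sum>l\<le>k. a l * time_deriv T v t (of_int j / real N + z l))"
  have vd: "((\<lambda>s. v s x) has_real_derivative time_deriv T v t x) (at t within {0..T})" for x
    using d[of x] unfolding time_deriv_def has_real_derivative_iff_has_vector_derivative
    by (simp add: vector_derivative_works)
  have cd: "((\<lambda>s. c s j) has_real_derivative c' j) (at t within {0..T})" for j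
  proof -
    have "((\<lambda>s. \<Sum>l\<le>k. a l * v s (of_int j / real N + z l)) has_real_derivative c' j) (at t within {0..T})"
      unfolding c'_def by (intro DERIV_sum DERIV_cmult vd)
    then show ?thesis
      by (rule has_field_derivative_transform_within[OF _ zero_less_one t]) (metis a eq)
  qed
  have un: "D = E" if "(f has_real_derivative D) (at t within {0..T})" "(f has_real_derivative E) (at t within {0..T})" for f D E
    using that unfolding has_field_derivative_iff by (rule tendsto_unique[OF nt])
  have "c' (j + int N) = c' j" for j
  proof (rule un)
    show "((\<lambda>s. c s (j + int N)) has_real_derivative c' (j + int N)) (at t within {0..T})" by (rule cd)
    show "((\<lambda>s. c s (j + int N)) has_real_derivative c' j) (at t within {0..T})"
      by (rule has_field_derivative_transform_within[OF cd[of j] zero_less_one t])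
        (use v in \<open>simp add: periodic_seq_def\<close>)
  qed
  moreover have "time_deriv T v t x = pspline k N c' x" for x
  proof (rule un)
    show "((\<lambda>s. v s x) has_real_derivative time_deriv T v t x) (at t within {0..T})" by (rule vd)
    have "((\<lambda>s. pspline k N (c s) x) has_real_derivative pspline k N c' x) (at t within {0..T})"
      unfolding pspline_def by (intro spl_has_derivative_param cd)
    then show "((\<lambda>s. v s x) has_real_derivative pspline k N c' x) (at t within {0..T})"
      by (rule has_field_derivative_transform_within[OF _ zero_less_one t]) (simp add: eq)
  qed
  ultimately show ?thesis using cd by (auto simp: periodic_seq_def)
qed

section \<open>Inverse inequalities and superconvergence\<close>

lemma spline_spaceE:
  assumes "\<phi> \<in> spline_space (Suc (Suc k)) N" "N \<ge> 1"
  obtains c where "periodic_seq N c" "\<phi> = pspline (Suc k) N c"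
  using assms spline_space_iff by blast

lemma pspline_in_spline_space:
  "N \<ge> 1 \<Longrightarrow> periodic_seq N c \<Longrightarrow> pspline (Suc k) N c \<in> spline_space (Suc (Suc k)) N"
  using spline_space_iff by blast

lemma pw_deriv_spline:
  assumes "\<phi> \<in> spline_space (Suc (Suc k)) N" "N \<ge> 1" shows "pw_deriv \<phi> (right_deriv \<phi>)"
  using spline_spaceE[OF assms] pw_deriv_pspline[OF assms(2)] by metis

lemma spline_bounded_borel:
  "\<phi> \<in> spline_space (Suc (Suc k)) N \<Longrightarrow> N \<ge> 1 \<Longrightarrow> bounded_borel \<phi>"
  "\<phi> \<in> spline_space (Suc (Suc k)) N \<Longrightarrow> N \<ge> 1 \<Longrightarrow> bounded_borel (right_deriv \<phi>)"
  using pw_deriv_spline pw_deriv_bounded_borel pw_deriv_bounded_borel' by blast+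

lemma spline_linear:
  assumes N: "N \<ge> 1" and f: "f \<in> spline_space (Suc (Suc k)) N" and g: "g \<in> spline_space (Suc (Suc k)) N"
  shows "(\<lambda>x. a * f x + b * g x) \<in> spline_space (Suc (Suc k)) N"
    and "right_deriv (\<lambda>x. a * f x + b * g x) = (\<lambda>x. a * right_deriv f x + b * right_deriv g x)"
proof -
  obtain c where c: "periodic_seq N c" "f = pspline (Suc k) N c" by (rule spline_spaceE[OF f N])
  obtain d where d: "periodic_seq N d" "g = pspline (Suc k) N d" by (rule spline_spaceE[OF g N])
  have eq: "(\<lambda>x. a * f x + b * g x) = pspline (Suc k) N (\<lambda>j. a * c j + b * d j)"
    by (rule ext) (simp add: c d pspline_def spl_linear)
  have "periodic_seq N (\<lambda>j. a * c j + b * d j)" using c d by (simp add: periodic_seq_def)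
  then show "(\<lambda>x. a * f x + b * g x) \<in> spline_space (Suc (Suc k)) N"
    unfolding eq by (rule pspline_in_spline_space[OF N])
  show "right_deriv (\<lambda>x. a * f x + b * g x) = (\<lambda>x. a * right_deriv f x + b * right_deriv g x)"
    unfolding eq unfolding c d right_deriv_pspline[OF N] nabla_linear
    by (rule ext) (simp add: pspline_def spl_linear algebra_simps)
qed

lemma spline_add:
  assumes "N \<ge> 1" "f \<in> spline_space (Suc (Suc k)) N" "g \<in> spline_space (Suc (Suc k)) N"
  shows "(\<lambda>x. f x + g x) \<in> spline_space (Suc (Suc k)) N"
    and "right_deriv (\<lambda>x. f x + g x) = (\<lambda>x. right_deriv f x + right_deriv g x)"
  using spline_linear[OF assms, of 1 1] by simp_all

lemma spline_diff:
  assumes "N \<ge> 1" "f \<in> spline_space (Suc (Suc k)) N" "g \<in> spline_space (Suc (Suc k)) N"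
  shows "(\<lambda>x. f x - g x) \<in> spline_space (Suc (Suc k)) N"
    and "right_deriv (\<lambda>x. f x - g x) = (\<lambda>x. right_deriv f x - right_deriv g x)"
  using spline_linear[OF assms, of 1 "-1"] by simp_all

lemma spline_zero:
  assumes "N \<ge> 1"
  shows "(\<lambda>x. 0) \<in> spline_space (Suc (Suc k)) N" and "right_deriv (\<lambda>x. 0) = (\<lambda>x. 0)"
proof -
  have "pspline (Suc k) N (\<lambda>j. 0) \<in> spline_space (Suc (Suc k)) N"
    by (rule pspline_in_spline_space[OF assms]) (simp add: periodic_seq_def)
  then show "(\<lambda>x. 0) \<in> spline_space (Suc (Suc k)) N" by (simp add: pspline_const)
  show "right_deriv (\<lambda>x. 0) = (\<lambda>x. 0)" by (rule ext) (rule right_deriv_eq, simp)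
qed

lemma spline_sum:
  assumes "N \<ge> 1" "\<And>i. i \<in> A \<Longrightarrow> f i \<in> spline_space (Suc (Suc k)) N"
  shows "(\<lambda>x. \<Sum>i\<in>A. a i * f i x) \<in> spline_space (Suc (Suc k)) N"
    and "right_deriv (\<lambda>x. \<Sum>i\<in>A. a i * f i x) = (\<lambda>x. \<Sum>i\<in>A. a i * right_deriv (f i) x)"
proof -
  have "(\<lambda>x. \<Sum>i\<in>A. a i * f i x) \<in> spline_space (Suc (Suc k)) N \<and>
     right_deriv (\<lambda>x. \<Sum>i\<in>A. a i * f i x) = (\<lambda>x. \<Sum>i\<in>A. a i * right_deriv (f i) x)"
    using assms(2)
  proof (induction A rule: infinite_finite_induct)
    case (insert i A)
    then show ?case
      using spline_linear[OF assms(1), of "f i" k "\<lambda>x. \<Sum>i\<in>A. a i * f i x" "a i" 1] by simp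
  qed (simp_all add: spline_zero[OF assms(1)])
  then show "(\<lambda>x. \<Sum>i\<in>A. a i * f i x) \<in> spline_space (Suc (Suc k)) N"
    "right_deriv (\<lambda>x. \<Sum>i\<in>A. a i * f i x) = (\<lambda>x. \<Sum>i\<in>A. a i * right_deriv (f i) x)" by auto
qed

section \<open>Inverse inequalities\<close>

lemma coeff_sq_shift: "periodic_seq N c \<Longrightarrow> coeff_sq N (\<lambda>j. c (j + (- int i))) = coeff_sq N c"
  using periodic_seq_sum_shift[of N "\<lambda>j. (c j)\<^sup>2" i] by (simp add: coeff_sq_def periodic_seq_def)

text \<open>One square is at most the sum of all, which is \<open>N\<close> times their mean. This
  is the factor lost in passing from the L2 norm to the maximum.\<close>

lemma coeff_bound:
  "\<exists>C\<ge>0. \<forall>N\<ge>1. \<forall>c. periodic_seq N c \<longrightarrow>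
     (\<forall>j. \<bar>c j\<bar> \<le> C * sqrt (real N) * L2_nrm (pspline k N c))"
proof -
  obtain C where C: "C \<ge> 0" "\<And>N c. N \<ge> 1 \<Longrightarrow> periodic_seq N c \<Longrightarrow> coeff_sq N c \<le> C * (L2_nrm (pspline k N c))\<^sup>2"
    using pspline_stability[of k] by blast
  have "\<bar>c j\<bar> \<le> sqrt C * sqrt (real N) * L2_nrm (pspline k N c)" if N: "N \<ge> 1" and c: "periodic_seq N c" for N c j
  proof -
    have "(c j)\<^sup>2 \<le> (\<Sum>l<N. (c (int l))\<^sup>2)" by (rule periodic_seq_bounded[OF c N])
    also have "\<dots> = real N * coeff_sq N c" using N by (simp add: coeff_sq_def)
    also have "\<dots> \<le> real N * (C * (L2_nrm (pspline k N c))\<^sup>2)"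
      using C(2)[OF N c] by (intro mult_left_mono) auto
    finally have "sqrt ((c j)\<^sup>2) \<le> sqrt (real N * (C * (L2_nrm (pspline k N c))\<^sup>2))"
      by (rule real_sqrt_le_mono)
    then show ?thesis
      using C(1) L2_nrm_nonneg[of "pspline k N c"] by (simp add: real_sqrt_mult mult_ac)
  qed
  then show ?thesis using C(1) by (intro exI[of _ "sqrt C"]) auto
qed

text \<open>Both norms are equivalent to the mean square of the common coefficients
  \<open>c\<close>, whatever the two degrees.\<close>

lemma lower_order_bound:
  "\<exists>C\<ge>0. \<forall>N\<ge>1. \<forall>c. periodic_seq N c \<longrightarrow> L2_nrm (pspline l N c) \<le> C * L2_nrm (pspline k N c)"
proof -
  obtain C where C: "C \<ge> 0" "\<And>N c. N \<ge> 1 \<Longrightarrow> periodic_seq N c \<Longrightarrow> coeff_sq N c \<le> C * (L2_nrm (pspline k N c))\<^sup>2"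
    using pspline_stability[of k] by blast
  obtain K where K: "K \<ge> 0" "\<And>N c. N \<ge> 1 \<Longrightarrow> periodic_seq N c \<Longrightarrow> (L2_nrm (pspline l N c))\<^sup>2 \<le> K * coeff_sq N c"
    using pspline_upper[of l] by blast
  have "L2_nrm (pspline l N c) \<le> sqrt (K * C) * L2_nrm (pspline k N c)" if N: "N \<ge> 1" and c: "periodic_seq N c" for N c
  proof -
    have "(L2_nrm (pspline l N c))\<^sup>2 \<le> K * (C * (L2_nrm (pspline k N c))\<^sup>2)"
      using K(2)[OF N c] mult_left_mono[OF C(2)[OF N c] K(1)] by linarith
    also have "\<dots> = (sqrt (K * C) * L2_nrm (pspline k N c))\<^sup>2"
      using K(1) C(1) by (simp add: power_mult_distrib)
    finally show ?thesis
      by (rule power2_le_imp_le) (use K(1) C(1) L2_nrm_nonneg in simp)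
  qed
  then show ?thesis using K(1) C(1) by (intro exI[of _ "sqrt (K * C)"]) auto
qed

text \<open>A derivative costs a factor \<open>N\<close>, since its coefficients are
  \<open>N\<close> times differences of bounded size, and passing from L2 to the maximum costs
  \<open>sqrt N\<close>. Their product is the reciprocal of the smallness threshold in
  \<open>galerkin_error\<close>.\<close>

lemma inverse_inequalities:
  "\<exists>C\<ge>1. \<forall>N\<ge>1. \<forall>\<phi>\<in>spline_space (Suc (Suc k)) N.
     (\<forall>x. \<bar>\<phi> x\<bar> \<le> C * sqrt (real N) * L2_nrm \<phi>) \<and>
     (\<forall>x. \<bar>right_deriv \<phi> x\<bar> \<le> C * real N * sqrt (real N) * L2_nrm \<phi>) \<and>
     L2_nrm (right_deriv \<phi>) \<le> C * real N * L2_nrm \<phi>"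
proof -
  obtain A where A: "A \<ge> 0" "\<And>N c j. N \<ge> 1 \<Longrightarrow> periodic_seq N c \<Longrightarrow>
      \<bar>c j\<bar> \<le> A * sqrt (real N) * L2_nrm (pspline (Suc k) N c)"
    using coeff_bound[of "Suc k"] by blast
  obtain P where P: "P \<ge> 1" "\<And>c s B. (\<And>j. \<bar>c j\<bar> \<le> B) \<Longrightarrow> \<bar>spl (Suc k) c s\<bar> \<le> P * B"
    using spl_sup_bound[of "Suc k"] by blast
  obtain Q where Q: "Q \<ge> 1" "\<And>c s B. (\<And>j. \<bar>c j\<bar> \<le> B) \<Longrightarrow> \<bar>spl k c s\<bar> \<le> Q * B"
    using spl_sup_bound[of k] by blast
  obtain U where U: "U \<ge> 0" "\<And>N c. N \<ge> 1 \<Longrightarrow> periodic_seq N c \<Longrightarrow> (L2_nrm (pspline k N c))\<^sup>2 \<le> U * coeff_sq N c"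
    using pspline_upper[of k] by blast
  obtain V where V: "V \<ge> 0" "\<And>N c. N \<ge> 1 \<Longrightarrow> periodic_seq N c \<Longrightarrow> coeff_sq N c \<le> V * (L2_nrm (pspline (Suc k) N c))\<^sup>2"
    using pspline_stability[of "Suc k"] by blast
  define C where "C = 1 + P * A + 2 * Q * A + 2 * sqrt (U * V)"
  have C1: "C \<ge> 1" unfolding C_def using P(1) Q(1) A(1) U(1) V(1) by simp
  have C2: "P * A \<le> C" "2 * Q * A \<le> C" "2 * sqrt (U * V) \<le> C"
    unfolding C_def using P(1) Q(1) A(1) U(1) V(1) by simp_all
  show ?thesis
  proof (intro exI[of _ C] conjI allI impI ballI C1)
    fix N :: nat and \<phi> x assume N: "N \<ge> 1" and \<phi>: "\<phi> \<in> spline_space (Suc (Suc k)) N"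
    obtain c where c: "periodic_seq N c" "\<phi> = pspline (Suc k) N c" by (rule spline_spaceE[OF \<phi> N])
    define M where "M = sqrt (real N) * L2_nrm \<phi>"
    have M: "M \<ge> 0" by (simp add: M_def L2_nrm_nonneg)
    have cb: "\<bar>c j\<bar> \<le> A * M" for j using A(2)[OF N c(1), of j] c(2) by (simp add: M_def mult.assoc)
    then have "\<bar>\<phi> x\<bar> \<le> P * (A * M)" unfolding c(2) pspline_def by (rule P(2))
    also have "\<dots> \<le> C * M" using mult_right_mono[OF C2(1) M] by (simp add: mult.assoc)
    finally show "\<bar>\<phi> x\<bar> \<le> C * sqrt (real N) * L2_nrm \<phi>" by (simp add: M_def mult.assoc)
    have "\<bar>nabla c j\<bar> \<le> 2 * (A * M)" for j
      using cb[of j] cb[of "j - 1"] by (simp add: nabla_def)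
    then have "\<bar>pspline k N (nabla c) x\<bar> \<le> Q * (2 * (A * M))" unfolding pspline_def by (rule Q(2))
    also have "\<dots> \<le> C * M" using mult_right_mono[OF C2(2) M] by (simp add: mult_ac)
    finally have "real N * \<bar>pspline k N (nabla c) x\<bar> \<le> real N * (C * M)" by (intro mult_left_mono) auto
    then show "\<bar>right_deriv \<phi> x\<bar> \<le> C * real N * sqrt (real N) * L2_nrm \<phi>"
      unfolding c(2) right_deriv_pspline[OF N] by (simp add: abs_mult M_def c(2) mult_ac)
    have b: "L2_nrm (pspline k N d) \<le> sqrt (U * V) * L2_nrm \<phi>"
      if "periodic_seq N d" "coeff_sq N d = coeff_sq N c" for d
    proof (rule power2_le_imp_le)
      have "(L2_nrm (pspline k N d))\<^sup>2 \<le> U * coeff_sq N c" using U(2)[OF N that(1)] that(2) by simp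
      also have "\<dots> \<le> U * (V * (L2_nrm \<phi>)\<^sup>2)" using V(2)[OF N c(1)] U(1) c(2) by (intro mult_left_mono) auto
      also have "\<dots> = (sqrt (U * V) * L2_nrm \<phi>)\<^sup>2" using U(1) V(1) by (simp add: power_mult_distrib)
      finally show "(L2_nrm (pspline k N d))\<^sup>2 \<le> (sqrt (U * V) * L2_nrm \<phi>)\<^sup>2" .
    qed (use U(1) V(1) L2_nrm_nonneg in simp)
    have sh: "periodic_seq N (\<lambda>j. c (j + (- int 1)))" using periodic_seq_shift[OF c(1)] by blast
    have "pspline k N (nabla c) = (\<lambda>x. pspline k N c x - pspline k N (\<lambda>j. c (j + (- int 1))) x)"
      unfolding pspline_diff[symmetric] by (simp add: nabla_def[abs_def])
    then have "L2_nrm (pspline k N (nabla c)) \<le> L2_nrm (pspline k N c) + L2_nrm (pspline k N (\<lambda>j. c (j + (- int 1))))"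
      using L2_nrm_diff_triangle pspline_bounded_borel[OF _ N] c(1) sh by metis
    also have "\<dots> \<le> sqrt (U * V) * L2_nrm \<phi> + sqrt (U * V) * L2_nrm \<phi>"
      by (intro add_mono b sh c(1) coeff_sq_shift) simp
    also have "\<dots> \<le> C * L2_nrm \<phi>"
      using mult_right_mono[OF C2(3) L2_nrm_nonneg[of \<phi>]] by (simp add: mult_ac)
    finally have "real N * L2_nrm (pspline k N (nabla c)) \<le> real N * (C * L2_nrm \<phi>)"
      by (intro mult_left_mono) auto
    then show "L2_nrm (right_deriv \<phi>) \<le> C * real N * L2_nrm \<phi>"
      unfolding c(2) right_deriv_pspline[OF N] L2_nrm_cmult by (simp add: c(2) mult_ac)
  qed
qed

text \<open>The derivative of a spline is a difference quotient of a spline of lower order; summation by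
  parts moves the difference onto the other factor.\<close>

lemma inner_spline_deriv_le:
  "\<exists>C\<ge>0. \<forall>N\<ge>1. \<forall>\<phi>\<in>spline_space (Suc (Suc k)) N. \<forall>F \<delta>. bounded_borel F \<longrightarrow> periodic1 F \<longrightarrow>
     (\<forall>x. \<bar>F (x + 1 / real N) - F x\<bar> \<le> \<delta>) \<longrightarrow>
     \<bar>L2_inner F (right_deriv \<phi>)\<bar> \<le> C * real N * \<delta> * L2_nrm \<phi>"
proof -
  obtain L where L: "L \<ge> 0" "\<And>N c. N \<ge> 1 \<Longrightarrow> periodic_seq N c \<Longrightarrow> L2_nrm (pspline k N c) \<le> L * L2_nrm (pspline (Suc k) N c)"
    using lower_order_bound[of k "Suc k"] by blast
  show ?thesis
  proof (intro exI[of _ L] conjI allI impI ballI L(1))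
    fix N :: nat and \<phi> F \<delta> assume N: "N \<ge> 1" and \<phi>: "\<phi> \<in> spline_space (Suc (Suc k)) N"
      and F: "bounded_borel F" "periodic1 F" and \<delta>: "\<forall>x. \<bar>F (x + 1 / real N) - F x\<bar> \<le> \<delta>"
    obtain c where c: "periodic_seq N c" "\<phi> = pspline (Suc k) N c" by (rule spline_spaceE[OF \<phi> N])
    define \<psi> where "\<psi> = pspline k N c"
    define \<psi>' where "\<psi>' = pspline k N (\<lambda>j. c (j + (-1)))"
    have per: "periodic_seq N (\<lambda>j. c (j + (-1)))" by (rule periodic_seq_shift[OF c(1)])
    have bb: "bounded_borel \<psi>" "bounded_borel \<psi>'"
      unfolding \<psi>_def \<psi>'_def by (intro pspline_bounded_borel N c(1) per)+
    have sh: "\<psi>' (x + 1 / real N) = \<psi> x" for x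
      unfolding \<psi>_def \<psi>'_def pspline_shift[OF N] by simp
    have "pspline k N (nabla c) = (\<lambda>x. \<psi> x - \<psi>' x)"
      unfolding \<psi>_def \<psi>'_def pspline_diff[symmetric] by (simp add: nabla_def[abs_def])
    then have "L2_inner F (right_deriv \<phi>) = real N * (L2_inner F \<psi> - L2_inner F \<psi>')"
      unfolding c(2) right_deriv_pspline[OF N]
      by (simp add: L2_inner_cmult_right L2_inner_diff_right F(1) bb)
    \<comment> \<open>Translating the periodic product \<open>F * \<psi>'\<close> by one mesh width
      turns \<psi>' into \<psi> and puts the shift on \<open>F\<close>.\<close>
    also have "L2_inner F \<psi>' = L2_inner (\<lambda>x. F (x + 1 / real N)) \<psi>"
    proof -
      have "periodic1 (\<lambda>x. F x * \<psi>' x)"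
        using F(2) pspline_periodic[OF per, of k] by (simp add: periodic1_def \<psi>'_def)
      then have "(LBINT x:{0..1}. F (x + 1 / real N) * \<psi>' (x + 1 / real N)) = (LBINT x:{0..1}. F x * \<psi>' x)"
        using periodic_integral_shift[of "\<lambda>x. F x * \<psi>' x" "1 / real N"] F(1) bb N
        by (simp add: bounded_borel_mult)
      then show ?thesis by (simp add: L2_inner_def sh)
    qed
    also have "L2_inner F \<psi> - L2_inner (\<lambda>x. F (x + 1 / real N)) \<psi> = L2_inner (\<lambda>x. F x - F (x + 1 / real N)) \<psi>"
      by (intro L2_inner_diff_left[symmetric] F(1) bb bounded_borel_shift)
    finally have "\<bar>L2_inner F (right_deriv \<phi>)\<bar> = real N * \<bar>L2_inner (\<lambda>x. F x - F (x + 1 / real N)) \<psi>\<bar>"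
      by (simp add: abs_mult)
    also have "\<dots> \<le> real N * (\<delta> * L2_nrm \<psi>)"
      by (intro mult_left_mono L2_inner_le_sup bounded_borel_diff F(1) bounded_borel_shift bb)
        (use \<delta> in \<open>auto simp: abs_minus_commute\<close>)
    also have "\<dots> \<le> real N * (\<delta> * (L * L2_nrm \<phi>))"
      using L(2)[OF N c(1)] order_trans[OF abs_ge_zero \<delta>[rule_format, of 0]]
      unfolding \<psi>_def c(2) by (intro mult_left_mono) auto
    finally show "\<bar>L2_inner F (right_deriv \<phi>)\<bar> \<le> L * real N * \<delta> * L2_nrm \<phi>" by (simp add: mult_ac)
  qed
qed

section \<open>Superconvergence for derivatives tested with spline derivatives\<close>

lemma pw_deriv_integral:
  assumes f: "pw_deriv f f'" and ab: "0 \<le> a" "a \<le> b" "b \<le> 1"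
  shows "(LBINT x:{a..b}. f' x) = f b - f a"
proof -
  obtain S where S: "finite S" "\<forall>x\<in>{0..1} - S. (f has_real_derivative f' x) (at x)"
    using f unfolding pw_deriv_def by blast
  have "(f' has_integral (f b - f a)) {a..b}"
  proof (rule fundamental_theorem_of_calculus_interior_strong[OF S(1) ab(2)])
    fix x :: real assume "x \<in> {a<..<b} - S"
    then show "(f has_vector_derivative f' x) (at x)"
      using S(2) ab by (auto simp: has_real_derivative_iff_has_vector_derivative[symmetric])
  next
    show "continuous_on {a..b} f" using f unfolding pw_deriv_def
      by (auto intro: continuous_on_subset)
  qed
  then show ?thesis
    using set_borel_integral_eq_integral(2)[OF bounded_borel_integrable_Icc[OF pw_deriv_bounded_borel'[OF f]], of a b]
    by (simp add: integral_unique)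
qed

text \<open>A step function is constant on each cell, where \<open>e'\<close> integrates to the
  increment of \<open>e\<close>. This covers order 2, in which spline derivatives are discontinuous
  and cannot be integrated by parts again.\<close>

lemma inner_deriv_step_le:
  "\<exists>C\<ge>0. \<forall>N\<ge>1. \<forall>d e e' \<delta>. periodic_seq N d \<longrightarrow> pw_deriv e e' \<longrightarrow>
     (\<forall>x. \<bar>e (x + 1 / real N) - e x\<bar> \<le> \<delta>) \<longrightarrow>
     \<bar>L2_inner e' (pspline 0 N d)\<bar> \<le> C * real N * \<delta> * L2_nrm (pspline 0 N d)"
proof -
  obtain V where V: "V \<ge> 0" "\<And>N c. N \<ge> 1 \<Longrightarrow> periodic_seq N c \<Longrightarrow> coeff_sq N c \<le> V * (L2_nrm (pspline 0 N c))\<^sup>2"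
    using pspline_stability[of 0] by blast
  show ?thesis
  proof (intro exI[of _ "sqrt V"] conjI allI impI)
    fix N :: nat and d e e' \<delta> assume N: "N \<ge> 1" and d: "periodic_seq N d" and e: "pw_deriv e e'"
      and \<delta>: "\<forall>x. \<bar>e (x + 1 / real N) - e x\<bar> \<le> \<delta>"
    have \<delta>0: "\<delta> \<ge> 0" using order_trans[OF abs_ge_zero \<delta>[rule_format, of 0]] .
    have cell: "(LBINT s:{0..1}. e' ((real l + s) / real N) * pspline 0 N d ((real l + s) / real N)) / real N
       = d (int l) * (e (real l / real N + 1 / real N) - e (real l / real N))" if l: "l < N" for l
    proof -
      have "(LBINT s:{0..1}. e' ((real l + s) / real N) * pspline 0 N d ((real l + s) / real N))
         = (LBINT s:{0..<1}. e' ((real l + s) / real N) * pspline 0 N d ((real l + s) / real N))"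
        by (simp add: set_lborel_integral_Ico)
      also have "\<dots> = (LBINT s:{0..<1}. e' ((real l + s) / real N) * d (int l))"
      proof (rule set_lborel_integral_cong_off_finite[of "{}"])
        fix s :: real assume "s \<in> {0..<1} - {}"
        then have "\<lfloor>real l + s\<rfloor> = int l" by (simp add: floor_eq_iff)
        then show "e' ((real l + s) / real N) * pspline 0 N d ((real l + s) / real N) = e' ((real l + s) / real N) * d (int l)"
          using N by (simp add: pspline_def)
      qed simp
      also have "\<dots> = (LBINT s:{0..1}. e' ((real l + s) / real N)) * d (int l)"
        by (simp add: set_lborel_integral_Ico)
      finally have I: "(LBINT s:{0..1}. e' ((real l + s) / real N) * pspline 0 N d ((real l + s) / real N))
        = (LBINT s:{0..1}. e' ((real l + s) / real N)) * d (int l)" .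
      have "(LBINT s:{0..1}. e' ((real l + s) / real N)) / real N = (LBINT x:{real l / real N..real (Suc l) / real N}. e' x)"
        using set_lborel_integral_affine(1)[of "1 / real N" "real l / real N" "real (Suc l) / real N" e' "real l / real N"]
          N by (simp add: field_simps)
      also have "\<dots> = e (real (Suc l) / real N) - e (real l / real N)"
        by (rule pw_deriv_integral[OF e]) (use l in \<open>auto simp: divide_right_mono\<close>)
      finally have "(LBINT s:{0..1}. e' ((real l + s) / real N)) / real N = e (real l / real N + 1 / real N) - e (real l / real N)"
        by (simp add: add_divide_distrib add.commute)
      then show ?thesis unfolding I times_divide_eq_left[symmetric] by (simp add: mult.commute)
    qed
    have "L2_inner e' (pspline 0 N d) = (\<Sum>l<N. (LBINT s:{0..1}. e' ((real l + s) / real N) * pspline 0 N d ((real l + s) / real N)) / real N)"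
      unfolding L2_inner_def
      by (intro bounded_borel_integral_cells[of "\<lambda>x. e' x * pspline 0 N d x"] bounded_borel_mult
          pw_deriv_bounded_borel'[OF e] pspline_bounded_borel d N)
    also have "\<dots> = (\<Sum>l<N. d (int l) * (e (real l / real N + 1 / real N) - e (real l / real N)))"
      by (intro sum.cong refl cell) simp
    finally have "\<bar>L2_inner e' (pspline 0 N d)\<bar> \<le> (\<Sum>l<N. \<bar>d (int l) * (e (real l / real N + 1 / real N) - e (real l / real N))\<bar>)"
      by (simp only: sum_abs)
    also have "\<dots> \<le> (\<Sum>l<N. \<bar>d (int l)\<bar> * \<delta>)"
      unfolding abs_mult by (intro sum_mono mult_left_mono) (use \<delta> in auto)
    also have "\<dots> = (\<Sum>l<N. \<bar>d (int l)\<bar>) * \<delta>" by (simp add: sum_distrib_right)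
    also have "\<dots> \<le> (sqrt V * real N * L2_nrm (pspline 0 N d)) * \<delta>"
    proof (rule mult_right_mono[OF power2_le_imp_le \<delta>0])
      have "(\<Sum>l<N. \<bar>d (int l)\<bar>)\<^sup>2 = (\<Sum>l<N. 1 * \<bar>d (int l)\<bar>)\<^sup>2" by simp
      also have "\<dots> \<le> (\<Sum>l<N. 1\<^sup>2) * (\<Sum>l<N. \<bar>d (int l)\<bar>\<^sup>2)" by (rule Cauchy_Schwarz_ineq_sum)
      also have "\<dots> = (real N)\<^sup>2 * coeff_sq N d" using N by (simp add: coeff_sq_def power2_eq_square)
      also have "\<dots> \<le> (real N)\<^sup>2 * (V * (L2_nrm (pspline 0 N d))\<^sup>2)" by (intro mult_left_mono V(2) N d) simp
      also have "\<dots> = (sqrt V * real N * L2_nrm (pspline 0 N d))\<^sup>2" using V(1) by (simp add: power_mult_distrib)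
      finally show "(\<Sum>l<N. \<bar>d (int l)\<bar>)\<^sup>2 \<le> (sqrt V * real N * L2_nrm (pspline 0 N d))\<^sup>2" .
    qed (simp add: V(1) L2_nrm_nonneg)
    finally show "\<bar>L2_inner e' (pspline 0 N d)\<bar> \<le> sqrt V * real N * \<delta> * L2_nrm (pspline 0 N d)"
      by (simp add: mult_ac)
  qed (simp add: V(1))
qed

text \<open>From order 3 on \<open>right_deriv \<phi>\<close> is itself a continuous spline, so
  integration by parts followed by \<open>inner_spline_deriv_le\<close> one degree lower applies;
  order 2 is \<open>inner_deriv_step_le\<close>. For an interpolation error \<open>e\<close> this
  gains a full power of \<open>h\<close> over Cauchy-Schwarz with \<open>e'\<close>.\<close>

lemma inner_deriv_spline_deriv_le:
  "\<exists>C\<ge>0. \<forall>N\<ge>1. \<forall>\<phi>\<in>spline_space (Suc (Suc k)) N. \<forall>e e' \<delta>. pw_deriv e e' \<longrightarrow>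
     (\<forall>x. \<bar>e (x + 1 / real N) - e x\<bar> \<le> \<delta>) \<longrightarrow>
     \<bar>L2_inner e' (right_deriv \<phi>)\<bar> \<le> C * real N * \<delta> * L2_nrm (right_deriv \<phi>)"
proof -
  have rd: "\<exists>d. periodic_seq N d \<and> right_deriv \<phi> = pspline k N d"
    if N: "N \<ge> 1" and \<phi>: "\<phi> \<in> spline_space (Suc (Suc k)) N" for N \<phi>
  proof -
    obtain c where c: "periodic_seq N c" "\<phi> = pspline (Suc k) N c" by (rule spline_spaceE[OF \<phi> N])
    have "right_deriv \<phi> = pspline k N (\<lambda>j. real N * nabla c j)"
      unfolding c(2) right_deriv_pspline[OF N] by (simp add: pspline_cmult)
    moreover have "periodic_seq N (\<lambda>j. real N * nabla c j)"
      using periodic_seq_nabla[OF c(1)] by (simp add: periodic_seq_def)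
    ultimately show ?thesis by blast
  qed
  show ?thesis
  proof (cases k)
    case 0
    obtain C where C: "C \<ge> 0" "\<And>N d e e' \<delta>. N \<ge> 1 \<Longrightarrow> periodic_seq N d \<Longrightarrow> pw_deriv e e' \<Longrightarrow>
     (\<And>x. \<bar>e (x + 1 / real N) - e x\<bar> \<le> \<delta>) \<Longrightarrow>
     \<bar>L2_inner e' (pspline 0 N d)\<bar> \<le> C * real N * \<delta> * L2_nrm (pspline 0 N d)"
      using inner_deriv_step_le by blast
    show ?thesis
    proof (intro exI[of _ C] conjI allI impI ballI C(1))
      fix N :: nat and \<phi> e e' \<delta> assume N: "N \<ge> 1" and \<phi>: "\<phi> \<in> spline_space (Suc (Suc k)) N"
        and e: "pw_deriv e e'" and \<delta>: "\<forall>x. \<bar>e (x + 1 / real N) - e x\<bar> \<le> \<delta>"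
      obtain d where d: "periodic_seq N d" "right_deriv \<phi> = pspline 0 N d" using rd[OF N \<phi>] 0 by blast
      show "\<bar>L2_inner e' (right_deriv \<phi>)\<bar> \<le> C * real N * \<delta> * L2_nrm (right_deriv \<phi>)"
        unfolding d(2) by (rule C(2)[OF N d(1) e]) (use \<delta> in blast)
    qed
  next
    case (Suc k')
    obtain C where C: "C \<ge> 0" "\<And>N \<phi> F \<delta>. N \<ge> 1 \<Longrightarrow> \<phi>\<in>spline_space (Suc (Suc k')) N \<Longrightarrow>
      bounded_borel F \<Longrightarrow> periodic1 F \<Longrightarrow> (\<And>x. \<bar>F (x + 1 / real N) - F x\<bar> \<le> \<delta>) \<Longrightarrow>
      \<bar>L2_inner F (right_deriv \<phi>)\<bar> \<le> C * real N * \<delta> * L2_nrm \<phi>"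
      using inner_spline_deriv_le[of k'] by blast
    show ?thesis
    proof (intro exI[of _ C] conjI allI impI ballI C(1))
      fix N :: nat and \<phi> e e' \<delta> assume N: "N \<ge> 1" and \<phi>: "\<phi> \<in> spline_space (Suc (Suc k)) N"
        and e: "pw_deriv e e'" and \<delta>: "\<forall>x. \<bar>e (x + 1 / real N) - e x\<bar> \<le> \<delta>"
      obtain d where d: "periodic_seq N d" "right_deriv \<phi> = pspline (Suc k') N d" using rd[OF N \<phi>] Suc by blast
      have S: "right_deriv \<phi> \<in> spline_space (Suc (Suc k')) N"
        unfolding d(2) by (rule pspline_in_spline_space[OF N d(1)])
      have "\<bar>L2_inner e' (right_deriv \<phi>)\<bar> = \<bar>L2_inner e (right_deriv (right_deriv \<phi>))\<bar>"
        using L2_inner_by_parts[OF e pw_deriv_spline[OF S N]] by simp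
      also have "\<dots> \<le> C * real N * \<delta> * L2_nrm (right_deriv \<phi>)"
        by (rule C(2)[OF N S pw_deriv_bounded_borel[OF e]]) (use e \<delta> in \<open>auto simp: pw_deriv_def\<close>)
      finally show "\<bar>L2_inner e' (right_deriv \<phi>)\<bar> \<le> C * real N * \<delta> * L2_nrm (right_deriv \<phi>)" .
    qed
  qed
qed

section \<open>The discrete elliptic problem and the convection form\<close>

text \<open>Gram-Schmidt for an abstract form, since it is used for the L2 and the H1 inner product.
  The generators may be dependent: a vanishing remainder contributes no new vector, so the resulting
  \<open>m\<close> is determined by the construction.\<close>

lemma orthonormal_basis_exists:
  fixes V :: "(real \<Rightarrow> real) set" and ip :: "(real \<Rightarrow> real) \<Rightarrow> (real \<Rightarrow> real) \<Rightarrow> real"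
    and n :: nat
  assumes lin: "\<And>f g a b. f \<in> V \<Longrightarrow> g \<in> V \<Longrightarrow> (\<lambda>x. a * f x + b * g x) \<in> V"
    and zero: "(\<lambda>x. 0) \<in> V"
    and sym: "\<And>f g. f \<in> V \<Longrightarrow> g \<in> V \<Longrightarrow> ip f g = ip g f"
    and ipl: "\<And>f g h a b. f \<in> V \<Longrightarrow> g \<in> V \<Longrightarrow> h \<in> V \<Longrightarrow> ip (\<lambda>x. a * f x + b * g x) h = a * ip f h + b * ip g h"
    and pos: "\<And>f. f \<in> V \<Longrightarrow> f \<noteq> (\<lambda>x. 0) \<Longrightarrow> ip f f > 0"
    and gen: "\<And>i. i < n \<Longrightarrow> b i \<in> V" and span: "\<And>f. f \<in> V \<Longrightarrow> \<exists>c. f = (\<lambda>x. \<Sum>i<n. c i * b i x)"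
  shows "\<exists>(m::nat) e. (\<forall>i<m. e i \<in> V) \<and> (\<forall>i<m. \<forall>j<m. ip (e i) (e j) = (if i = j then 1 else 0)) \<and>
    (\<forall>f\<in>V. f = (\<lambda>x. \<Sum>i<m. ip f (e i) * e i x))"
proof -
  have sumV: "(\<lambda>x. \<Sum>i<m. c i * f i x) \<in> V" if "\<And>i. i < m \<Longrightarrow> f i \<in> V" for m :: nat and c f
    using that
  proof (induction m)
    case (Suc m)
    have "(\<lambda>x. \<Sum>i<Suc m. c i * f i x) = (\<lambda>x. 1 * (\<Sum>i<m. c i * f i x) + c m * f m x)" by simp
    then show ?case using Suc by (simp only:) (intro lin; simp)
  qed (simp add: zero)
  have ip0: "ip (\<lambda>x. 0) h = 0" if "h \<in> V" for h using ipl[OF zero zero that, of 0 0] by simp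
  have ipsum: "ip (\<lambda>x. \<Sum>i<m. c i * f i x) h = (\<Sum>i<m. c i * ip (f i) h)"
    if "\<And>i. i < m \<Longrightarrow> f i \<in> V" "h \<in> V" for m :: nat and c f h
    using that(1)
  proof (induction m)
    case (Suc m)
    have "(\<lambda>x. \<Sum>i<Suc m. c i * f i x) = (\<lambda>x. 1 * (\<Sum>i<m. c i * f i x) + c m * f m x)" by simp
    then have "ip (\<lambda>x. \<Sum>i<Suc m. c i * f i x) h = 1 * ip (\<lambda>x. \<Sum>i<m. c i * f i x) h + c m * ip (f m) h"
      by (simp only:) (rule ipl; use Suc.prems that(2) sumV[of m f c] in auto)
    then show ?case using Suc by simp
  qed (simp add: ip0 that(2))
  have "\<exists>(m::nat) e. (\<forall>i<m. e i \<in> V) \<and> (\<forall>i<m. \<forall>j<m. ip (e i) (e j) = (if i = j then 1 else 0)) \<and>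
     (\<forall>i<l. b i = (\<lambda>x. \<Sum>j<m. ip (b i) (e j) * e j x))" if "l \<le> n" for l
    using that
  proof (induction l)
    case 0
    show ?case by (rule exI[of _ 0]) auto
  next
    case (Suc l)
    obtain m :: nat and e where e: "\<And>i. i < m \<Longrightarrow> e i \<in> V"
      and on: "\<And>i j. i < m \<Longrightarrow> j < m \<Longrightarrow> ip (e i) (e j) = (if i = j then 1 else 0)"
      and ex: "\<And>i. i < l \<Longrightarrow> b i = (\<lambda>x. \<Sum>j<m. ip (b i) (e j) * e j x)"
      using Suc.IH[OF Suc_leD[OF Suc.prems]] by blast
    define g where "g = b l"
    have g: "g \<in> V" using gen Suc.prems by (simp add: g_def)
    define p where "p = (\<lambda>x. \<Sum>j<m. ip g (e j) * e j x)"
    have p: "p \<in> V" unfolding p_def by (intro sumV e)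
    define r where "r = (\<lambda>x. 1 * g x + (-1) * p x)"
    have r: "r \<in> V" unfolding r_def by (intro lin g p)
    have re: "ip r (e j) = 0" if j: "j < m" for j
    proof -
      have "ip p (e j) = (\<Sum>i<m. ip g (e i) * ip (e i) (e j))" unfolding p_def by (intro ipsum e j)
      also have "\<dots> = (\<Sum>i<m. if i = j then ip g (e i) else 0)" by (intro sum.cong) (auto simp: on j)
      also have "\<dots> = ip g (e j)" using j by simp
      finally have "ip p (e j) = ip g (e j)" .
      moreover have "ip r (e j) = 1 * ip g (e j) + (-1) * ip p (e j)" unfolding r_def by (intro ipl g p e j)
      ultimately show ?thesis by simp
    qed
    show ?case
    proof (cases "r = (\<lambda>x. 0)")
      case True
      then have "g = p" by (auto simp: r_def fun_eq_iff)
      then have "\<forall>i<Suc l. b i = (\<lambda>x. \<Sum>j<m. ip (b i) (e j) * e j x)"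
        using ex by (auto simp: less_Suc_eq g_def p_def)
      then show ?thesis using e on by blast
    next
      case False
      define \<rho> where "\<rho> = sqrt (ip r r)"
      have \<rho>: "\<rho> > 0" "\<rho> * \<rho> = ip r r" using pos[OF r False] by (simp_all add: \<rho>_def)
      define w where "w = (\<lambda>x. (1 / \<rho>) * r x + 0 * r x)"
      have w: "w \<in> V" unfolding w_def by (intro lin r)
      have wip: "ip w h = ip r h / \<rho>" if "h \<in> V" for h
        unfolding w_def using ipl[OF r r that, of "1 / \<rho>" 0] by simp
      have we: "ip w (e j) = 0" "ip (e j) w = 0" if "j < m" for j
        using wip[OF e[OF that]] re[OF that] sym[OF w e[OF that]] by simp_all
      have rw: "ip r w = \<rho>"
        using sym[OF r w] wip[OF r] \<rho>(1) unfolding \<rho>(2)[symmetric] by simp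
      have ww: "ip w w = 1" using wip[OF w] rw \<rho> by simp
      define e' where "e' = e(m := w)"
      have 1: "e' i \<in> V" if "i < Suc m" for i using that e w by (auto simp: e'_def less_Suc_eq)
      have 2: "ip (e' i) (e' j) = (if i = j then 1 else 0)" if "i < Suc m" "j < Suc m" for i j
        using that on we ww by (auto simp: e'_def less_Suc_eq)
      have 3: "b i = (\<lambda>x. \<Sum>j<Suc m. ip (b i) (e' j) * e' j x)" if i: "i < Suc l" for i
      proof (cases "i = l")
        case True
        have "ip p w = (\<Sum>j<m. ip g (e j) * ip (e j) w)" unfolding p_def by (intro ipsum e w)
        also have "\<dots> = 0" by (simp add: we)
        finally have pw: "ip p w = 0" .
        have "ip r w = 1 * ip g w + (-1) * ip p w" unfolding r_def by (intro ipl g p w)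
        then have "ip g w = \<rho>" using rw pw by simp
        then have "(\<Sum>j<Suc m. ip g (e' j) * e' j x) = p x + r x" for x
          using \<rho> by (simp add: e'_def p_def w_def)
        then show ?thesis using True by (simp add: g_def r_def del: sum.lessThan_Suc)
      next
        case False
        then have i: "i < l" using i by simp
        have "ip (\<lambda>x. \<Sum>j<m. ip (b i) (e j) * e j x) w = (\<Sum>j<m. ip (b i) (e j) * ip (e j) w)"
          by (intro ipsum e w)
        then have "ip (b i) w = 0" using ex[OF i] by (simp add: we)
        then show ?thesis using ex[OF i] by (simp add: e'_def)
      qed
      show ?thesis using 1 2 3 by (intro exI[of _ "Suc m"] exI[of _ e']) blast
    qed
  qed
  from this[OF order_refl] obtain m :: nat and e where e: "\<And>i. i < m \<Longrightarrow> e i \<in> V"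
    and on: "\<And>i j. i < m \<Longrightarrow> j < m \<Longrightarrow> ip (e i) (e j) = (if i = j then 1 else 0)"
    and ex: "\<And>i. i < n \<Longrightarrow> b i = (\<lambda>x. \<Sum>j<m. ip (b i) (e j) * e j x)" by blast
  have "f = (\<lambda>x. \<Sum>i<m. ip f (e i) * e i x)" if f: "f \<in> V" for f
  proof
    fix x
    obtain c where c: "f = (\<lambda>x. \<Sum>i<n. c i * b i x)" using span[OF f] by blast
    have fe: "ip f (e j) = (\<Sum>i<n. c i * ip (b i) (e j))" if "j < m" for j
      unfolding c by (intro ipsum gen e that)
    have "f x = (\<Sum>i<n. c i * b i x)" by (simp add: c)
    also have "\<dots> = (\<Sum>i<n. c i * (\<Sum>j<m. ip (b i) (e j) * e j x))"
      by (intro sum.cong refl arg_cong2[where f = "(*)"]) (metis ex lessThan_iff)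
    also have "\<dots> = (\<Sum>j<m. \<Sum>i<n. c i * ip (b i) (e j) * e j x)"
      unfolding sum_distrib_left by (subst sum.swap) (simp add: mult.assoc)
    also have "\<dots> = (\<Sum>j<m. ip f (e j) * e j x)"
      by (intro sum.cong refl) (simp add: fe sum_distrib_right)
    finally show "f x = (\<Sum>i<m. ip f (e i) * e i x)" .
  qed
  then show ?thesis using e on by blast
qed

text \<open>\<open>right_deriv\<close> is linear on splines at every point, nodes included, which
  \<open>deriv\<close> is not known to be when the order is 2; under the integral both give the same
  value.\<close>

definition h1_inner :: "(real \<Rightarrow> real) \<Rightarrow> (real \<Rightarrow> real) \<Rightarrow> real" where
  "h1_inner f g = L2_inner f g + L2_inner (right_deriv f) (right_deriv g)"

text \<open>The inverse inequality bounds point values by the L2 norm, so definiteness holds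
  everywhere and not just almost everywhere.\<close>

lemma spline_eq_zero:
  assumes N: "N \<ge> 1" and f: "f \<in> spline_space (Suc (Suc k)) N" and 0: "L2_nrm f = 0"
  shows "f = (\<lambda>x. 0)"
proof
  fix x
  obtain C where C: "\<And>N f x. N \<ge> 1 \<Longrightarrow> f \<in> spline_space (Suc (Suc k)) N \<Longrightarrow> \<bar>f x\<bar> \<le> C * sqrt (real N) * L2_nrm f"
    using inverse_inequalities[of k] by blast
  show "f x = 0" using C[OF N f, of x] 0 by simp
qed

lemma spline_L2_pos:
  assumes "N \<ge> 1" "f \<in> spline_space (Suc (Suc k)) N" "f \<noteq> (\<lambda>x. 0)" shows "L2_inner f f > 0"
  using spline_eq_zero[OF assms(1,2)] assms(3) L2_inner_self_nonneg[of f]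
  by (auto simp: L2_nrm_def less_le)

lemma spline_generators:
  assumes N: "N \<ge> 1"
  shows "pspline (Suc k) N (delta_seq N i) \<in> spline_space (Suc (Suc k)) N"
    and "f \<in> spline_space (Suc (Suc k)) N \<Longrightarrow> \<exists>c. f = (\<lambda>x. \<Sum>i<N. c i * pspline (Suc k) N (delta_seq N i) x)"
proof -
  show "pspline (Suc k) N (delta_seq N i) \<in> spline_space (Suc (Suc k)) N"
    by (intro pspline_in_spline_space N periodic_delta_seq)
  assume f: "f \<in> spline_space (Suc (Suc k)) N"
  obtain c where c: "periodic_seq N c" "f = pspline (Suc k) N c" by (rule spline_spaceE[OF f N])
  have "f = (\<lambda>x. \<Sum>i<N. (\<lambda>i. c (int i)) i * pspline (Suc k) N (delta_seq N i) x)"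
    unfolding c(2) by (rule pspline_expand[OF N c(1)])
  then show "\<exists>c. f = (\<lambda>x. \<Sum>i<N. c i * pspline (Suc k) N (delta_seq N i) x)"
    by (rule exI[of _ "\<lambda>i. c (int i)"])
qed

lemma L2_inner_spline_linear_left:
  assumes "N \<ge> 1" "f \<in> spline_space (Suc (Suc k)) N" "g \<in> spline_space (Suc (Suc k)) N" "bounded_borel h"
  shows "L2_inner (\<lambda>x. a * f x + b * g x) h = a * L2_inner f h + b * L2_inner g h"
  using assms
  by (simp add: L2_inner_add_left L2_inner_cmult_left bounded_borel_cmult spline_bounded_borel)

lemma h1_inner_linear_left:
  assumes "N \<ge> 1" "f \<in> spline_space (Suc (Suc k)) N" "g \<in> spline_space (Suc (Suc k)) N"
    "h \<in> spline_space (Suc (Suc k)) N"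
  shows "h1_inner (\<lambda>x. a * f x + b * g x) h = a * h1_inner f h + b * h1_inner g h"
proof -
  note bb = spline_bounded_borel[OF assms(2,1)] spline_bounded_borel[OF assms(3,1)] spline_bounded_borel[OF assms(4,1)]
  show ?thesis
    unfolding h1_inner_def spline_linear(2)[OF assms(1-3)]
    by (simp add: L2_inner_add_left L2_inner_cmult_left bounded_borel_cmult bb algebra_simps)
qed

lemma spline_L2_orthonormal_basis:
  assumes N: "N \<ge> 1"
  shows "\<exists>(m::nat) e. (\<forall>i<m. e i \<in> spline_space (Suc (Suc k)) N) \<and>
    (\<forall>i<m. \<forall>j<m. L2_inner (e i) (e j) = (if i = j then 1 else 0)) \<and>
    (\<forall>f\<in>spline_space (Suc (Suc k)) N. f = (\<lambda>x. \<Sum>i<m. L2_inner f (e i) * e i x))"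
  by (rule orthonormal_basis_exists[where n = N and b = "\<lambda>i. pspline (Suc k) N (delta_seq N i)"])
    (auto intro: spline_linear spline_zero spline_generators L2_inner_commute spline_L2_pos
      L2_inner_spline_linear_left spline_bounded_borel N)

lemma spline_h1_orthonormal_basis:
  assumes N: "N \<ge> 1"
  shows "\<exists>(m::nat) e. (\<forall>i<m. e i \<in> spline_space (Suc (Suc k)) N) \<and>
    (\<forall>i<m. \<forall>j<m. h1_inner (e i) (e j) = (if i = j then 1 else 0)) \<and>
    (\<forall>f\<in>spline_space (Suc (Suc k)) N. f = (\<lambda>x. \<Sum>i<m. h1_inner f (e i) * e i x))"
proof (rule orthonormal_basis_exists[where n = N and b = "\<lambda>i. pspline (Suc k) N (delta_seq N i)"])
  show "h1_inner f g = h1_inner g f" for f g by (simp add: h1_inner_def L2_inner_commute)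
  show "h1_inner f f > 0" if "f \<in> spline_space (Suc (Suc k)) N" "f \<noteq> (\<lambda>x. 0)" for f
    using spline_L2_pos[OF N that] L2_inner_self_nonneg[of "right_deriv f"] by (simp add: h1_inner_def)
qed (auto intro: spline_linear spline_zero spline_generators h1_inner_linear_left N)

text \<open>The discrete solution operator of \<open>w - w'' = v\<close>, that is, the Riesz
  representative of \<open>v\<close> for \<open>h1_inner\<close> on splines. It is defined for data
  outside the spline space as well.\<close>

definition elliptic :: "nat \<Rightarrow> nat \<Rightarrow> (real \<Rightarrow> real) \<Rightarrow> real \<Rightarrow> real" where
  "elliptic k N v = (SOME w. w \<in> spline_space (Suc (Suc k)) N \<and>
     (\<forall>\<phi>\<in>spline_space (Suc (Suc k)) N. h1_inner w \<phi> = L2_inner v \<phi>))"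

lemma elliptic:
  assumes N: "N \<ge> 1" and v: "bounded_borel v"
  shows "elliptic k N v \<in> spline_space (Suc (Suc k)) N"
    and "\<phi> \<in> spline_space (Suc (Suc k)) N \<Longrightarrow> h1_inner (elliptic k N v) \<phi> = L2_inner v \<phi>"
proof -
  let ?S = "spline_space (Suc (Suc k)) N"
  obtain m :: nat and e where e: "\<And>i. i < m \<Longrightarrow> e i \<in> ?S"
    and on: "\<And>i j. i < m \<Longrightarrow> j < m \<Longrightarrow> h1_inner (e i) (e j) = (if i = j then 1 else 0)"
    and ex: "\<And>f. f \<in> ?S \<Longrightarrow> f = (\<lambda>x. \<Sum>i<m. h1_inner f (e i) * e i x)"
    using spline_h1_orthonormal_basis[OF N, of k] by blast
  \<comment> \<open>Riesz representation in coordinates: the H1 Fourier coefficients of the solution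
    have to be the pairings of \<open>v\<close> with the basis.\<close>
  define w where "w = (\<lambda>x. \<Sum>i<m. L2_inner v (e i) * e i x)"
  have w: "w \<in> ?S" unfolding w_def by (rule spline_sum(1)[OF N]) (use e in auto)
  have "h1_inner w \<phi> = L2_inner v \<phi>" if \<phi>: "\<phi> \<in> ?S" for \<phi>
  proof -
    have bb: "bounded_borel (\<lambda>x. L2_inner v (e i) * e i x)" "bounded_borel (\<lambda>x. L2_inner v (e i) * right_deriv (e i) x)"
      "bounded_borel (\<lambda>x. h1_inner \<phi> (e i) * e i x)" if "i < m" for i
      using spline_bounded_borel[OF e[OF that] N] by (auto intro: bounded_borel_cmult)
    have "h1_inner w \<phi> = (\<Sum>i<m. L2_inner v (e i) * L2_inner (e i) \<phi>) + (\<Sum>i<m. L2_inner v (e i) * L2_inner (right_deriv (e i)) (right_deriv \<phi>))"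
    proof -
      have "L2_inner w \<phi> = (\<Sum>i<m. L2_inner (\<lambda>x. L2_inner v (e i) * e i x) \<phi>)"
        unfolding w_def using bb spline_bounded_borel[OF \<phi> N] by (intro L2_inner_sum_left) auto
      moreover have "right_deriv w = (\<lambda>x. \<Sum>i<m. L2_inner v (e i) * right_deriv (e i) x)"
        unfolding w_def by (rule spline_sum(2)[OF N]) (use e in auto)
      moreover have "L2_inner (\<lambda>x. \<Sum>i<m. L2_inner v (e i) * right_deriv (e i) x) (right_deriv \<phi>)
         = (\<Sum>i<m. L2_inner (\<lambda>x. L2_inner v (e i) * right_deriv (e i) x) (right_deriv \<phi>))"
        using bb spline_bounded_borel[OF \<phi> N] by (intro L2_inner_sum_left) auto
      ultimately show ?thesis by (simp add: h1_inner_def L2_inner_cmult_left)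
    qed
    also have "\<dots> = (\<Sum>i<m. L2_inner v (e i) * h1_inner \<phi> (e i))"
      by (simp add: h1_inner_def sum.distrib[symmetric] distrib_left L2_inner_commute[of \<phi>] L2_inner_commute[of "right_deriv \<phi>"])
    also have "\<dots> = L2_inner v (\<lambda>x. \<Sum>i<m. h1_inner \<phi> (e i) * e i x)"
    proof -
      have "L2_inner v (\<lambda>x. \<Sum>i<m. h1_inner \<phi> (e i) * e i x) = (\<Sum>i<m. L2_inner v (\<lambda>x. h1_inner \<phi> (e i) * e i x))"
        using bb v by (intro L2_inner_sum_right) auto
      then show ?thesis unfolding L2_inner_cmult_right by (simp only: mult.commute[of "L2_inner v _"])
    qed
    also have "\<dots> = L2_inner v \<phi>" using ex[OF \<phi>] by simp
    finally show ?thesis .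
  qed
  with w have "\<exists>w. w \<in> ?S \<and> (\<forall>\<phi>\<in>?S. h1_inner w \<phi> = L2_inner v \<phi>)" by blast
  from someI_ex[OF this] show "elliptic k N v \<in> ?S"
    and "\<phi> \<in> ?S \<Longrightarrow> h1_inner (elliptic k N v) \<phi> = L2_inner v \<phi>"
    unfolding elliptic_def by blast+
qed

lemma elliptic_unique:
  assumes N: "N \<ge> 1" and v: "bounded_borel v" and w: "w \<in> spline_space (Suc (Suc k)) N"
    and eq: "\<And>\<phi>. \<phi> \<in> spline_space (Suc (Suc k)) N \<Longrightarrow> h1_inner w \<phi> = L2_inner v \<phi>"
  shows "w = elliptic k N v"
proof -
  let ?z = "elliptic k N v"
  let ?d = "\<lambda>x. 1 * w x + (-1) * ?z x"
  have d: "?d \<in> spline_space (Suc (Suc k)) N" by (intro spline_linear(1) N w elliptic(1) v)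
  have "h1_inner ?d ?d = 1 * h1_inner w ?d + (-1) * h1_inner ?z ?d"
    by (rule h1_inner_linear_left[OF N w elliptic(1)[OF N v] d])
  also have "\<dots> = 0" using eq[OF d] elliptic(2)[OF N v d] by simp
  finally have "L2_inner ?d ?d \<le> 0"
    using L2_inner_self_nonneg[of "right_deriv ?d"] unfolding h1_inner_def by simp
  then have "?d = (\<lambda>x. 0)" using spline_L2_pos[OF N d] by fastforce
  then show ?thesis by (auto simp: fun_eq_iff)
qed

lemma elliptic_linear:
  assumes N: "N \<ge> 1" and v: "bounded_borel v" "bounded_borel w"
  shows "elliptic k N (\<lambda>x. a * v x + b * w x) = (\<lambda>x. a * elliptic k N v x + b * elliptic k N w x)"
proof (rule elliptic_unique[symmetric, OF N])
  show "bounded_borel (\<lambda>x. a * v x + b * w x)" by (intro bounded_borel_add bounded_borel_cmult v)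
  show "(\<lambda>x. a * elliptic k N v x + b * elliptic k N w x) \<in> spline_space (Suc (Suc k)) N"
    by (intro spline_linear(1) N elliptic(1) v)
  fix \<phi> assume \<phi>: "\<phi> \<in> spline_space (Suc (Suc k)) N"
  show "h1_inner (\<lambda>x. a * elliptic k N v x + b * elliptic k N w x) \<phi> = L2_inner (\<lambda>x. a * v x + b * w x) \<phi>"
    using h1_inner_linear_left[OF N elliptic(1)[OF N v(1)] elliptic(1)[OF N v(2)] \<phi>, of a b]
      elliptic(2)[OF N v(1) \<phi>] elliptic(2)[OF N v(2) \<phi>] v spline_bounded_borel(1)[OF \<phi> N]
    by (simp add: L2_inner_add_left L2_inner_cmult_left bounded_borel_cmult)
qed

lemma elliptic_sum:
  assumes N: "N \<ge> 1" and v: "\<And>i. i < m \<Longrightarrow> bounded_borel (v i)"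
  shows "elliptic k N (\<lambda>x. \<Sum>i<m. a i * v i x) = (\<lambda>x. \<Sum>i<(m::nat). a i * elliptic k N (v i) x)"
  using v
proof (induction m)
  case 0
  then show ?case using elliptic_linear[OF N bounded_borel_const bounded_borel_const, of k 0 0 0 0] by simp
next
  case (Suc m)
  have "bounded_borel (\<lambda>x. \<Sum>i<m. a i * v i x)"
    using Suc.prems by (intro bounded_borel_sum bounded_borel_cmult) auto
  then have "elliptic k N (\<lambda>x. 1 * (\<Sum>i<m. a i * v i x) + a m * v m x)
     = (\<lambda>x. 1 * elliptic k N (\<lambda>x. \<Sum>i<m. a i * v i x) x + a m * elliptic k N (v m) x)"
    using Suc.prems by (intro elliptic_linear N) auto
  then show ?case using Suc by simp
qed

text \<open>Division by the H1 norm: the absorption step shared by the stability and the error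
  estimate of \<open>elliptic\<close>.\<close>

lemma h1_self_bound:
  assumes "h1_inner w w \<le> A * sqrt (h1_inner w w)" "A \<ge> 0"
  shows "L2_nrm w \<le> A" "L2_nrm (right_deriv w) \<le> A"
proof -
  define z where "z = sqrt (h1_inner w w)"
  have nn: "L2_inner w w \<ge> 0" "L2_inner (right_deriv w) (right_deriv w) \<ge> 0"
    by (rule L2_inner_self_nonneg)+
  then have z: "z \<ge> 0" "z * z = h1_inner w w" by (simp_all add: z_def h1_inner_def)
  then have "z * z \<le> A * z" using assms(1) by (simp add: z_def)
  then have "z \<le> A" using z(1) assms(2) by (cases "z = 0") (auto simp: less_le)
  moreover have "L2_nrm w \<le> z" "L2_nrm (right_deriv w) \<le> z"
    unfolding L2_nrm_def z_def h1_inner_def using nn by simp_all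
  ultimately show "L2_nrm w \<le> A" "L2_nrm (right_deriv w) \<le> A" by simp_all
qed

lemma L2_nrm_le_h1: "L2_nrm w \<le> sqrt (h1_inner w w)" "L2_nrm (right_deriv w) \<le> sqrt (h1_inner w w)"
  unfolding L2_nrm_def h1_inner_def
  using L2_inner_self_nonneg[of w] L2_inner_self_nonneg[of "right_deriv w"] by simp_all

lemma elliptic_bound:
  assumes N: "N \<ge> 1" and v: "bounded_borel v"
  shows "L2_nrm (elliptic k N v) \<le> L2_nrm v" "L2_nrm (right_deriv (elliptic k N v)) \<le> L2_nrm v"
proof -
  let ?w = "elliptic k N v"
  have w: "?w \<in> spline_space (Suc (Suc k)) N" by (rule elliptic(1)[OF N v])
  have "h1_inner ?w ?w = L2_inner v ?w" by (rule elliptic(2)[OF N v w])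
  also have "\<dots> \<le> L2_nrm v * L2_nrm ?w"
    using L2_inner_Cauchy_Schwarz[OF v spline_bounded_borel(1)[OF w N]] by simp
  also have "\<dots> \<le> L2_nrm v * sqrt (h1_inner ?w ?w)"
    by (intro mult_left_mono L2_nrm_le_h1 L2_nrm_nonneg)
  finally show "L2_nrm ?w \<le> L2_nrm v" "L2_nrm (right_deriv ?w) \<le> L2_nrm v"
    using h1_self_bound[OF _ L2_nrm_nonneg] by blast+
qed

section \<open>The convection form and the scheme with \<open>uh\<close> eliminated\<close>

definition conv_form :: "(real \<Rightarrow> real) \<Rightarrow> (real \<Rightarrow> real) \<Rightarrow> (real \<Rightarrow> real) \<Rightarrow> real" where
  "conv_form m u \<phi> = L2_inner (\<lambda>x. m x * u x) (right_deriv \<phi>) - L2_inner (\<lambda>x. m x * right_deriv u x) \<phi>"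

lemma pw_deriv_right_deriv: 
  assumes "pw_deriv f f'" shows "\<exists>S. finite S \<and> (\<forall>x\<in>{0..1} - S. deriv f x = f' x)"
proof -
  obtain S where "finite S" "\<forall>x\<in>{0..1} - S. (f has_real_derivative f' x) (at x)"
    using assms unfolding pw_deriv_def by blast
  then show ?thesis using DERIV_imp_deriv by blast
qed

lemma L2_inner_deriv_eq:
  assumes "pw_deriv f f'" shows "L2_inner (deriv f) g = L2_inner f' g"
proof -
  obtain S where "finite S" "\<forall>x\<in>{0..1} - S. deriv f x = f' x"
    using pw_deriv_right_deriv[OF assms] by blast
  then show ?thesis by (intro L2_inner_cong_off_finite[of S]) auto
qed

lemma L2_inner_deriv_deriv_eq:
  assumes "pw_deriv f f'" "pw_deriv g g'" shows "L2_inner (deriv f) (deriv g) = L2_inner f' g'"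
  using L2_inner_deriv_eq[OF assms(1), of "deriv g"] L2_inner_deriv_eq[OF assms(2), of f']
  by (simp add: L2_inner_commute)

text \<open>Integration by parts moves the derivative of the product onto \<phi>, so the scheme
  reads \<open>(m_t, \<phi>) = conv_form m u \<phi>\<close>; the node values of \<open>deriv\<close>
  disappear under the integral.\<close>

lemma conv_form_eq:
  assumes N: "N \<ge> 1" and m: "m \<in> spline_space (Suc (Suc k)) N" and u: "u \<in> spline_space (Suc (Suc k)) N"
    and \<phi>: "\<phi> \<in> spline_space (Suc (Suc k)) N"
  shows "L2_inner (deriv (\<lambda>x. m x * u x)) \<phi> + L2_inner (\<lambda>x. m x * deriv u x) \<phi> = - conv_form m u \<phi>"
proof -
  note p = pw_deriv_spline[OF m N] pw_deriv_spline[OF u N] pw_deriv_spline[OF \<phi> N]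
  have "L2_inner (deriv (\<lambda>x. m x * u x)) \<phi> = - L2_inner (\<lambda>x. m x * u x) (right_deriv \<phi>)"
    using L2_inner_deriv_eq[OF pw_deriv_mult[OF p(1,2)]] L2_inner_by_parts[OF pw_deriv_mult[OF p(1,2)] p(3)]
    by simp
  moreover have "L2_inner (\<lambda>x. m x * deriv u x) \<phi> = L2_inner (\<lambda>x. m x * right_deriv u x) \<phi>"
  proof -
    obtain S where "finite S" "\<forall>x\<in>{0..1} - S. deriv u x = right_deriv u x"
      using pw_deriv_right_deriv[OF p(2)] by blast
    then show ?thesis by (intro L2_inner_cong_off_finite[of S]) auto
  qed
  ultimately show ?thesis by (simp add: conv_form_def)
qed

text \<open>Since \<open>uh\<close> is \<open>elliptic\<close> of \<open>mh\<close>, the scheme is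
  an evolution equation for \<open>mh\<close> alone. Existence and uniqueness are both derived from
  this form.\<close>

lemma semidiscrete_solution_alt:
  assumes N: "N \<ge> 1"
  shows "semidiscrete_solution (Suc (Suc k)) N T u0 mh uh \<longleftrightarrow>
    (\<forall>t\<in>{0..T}. mh t \<in> spline_space (Suc (Suc k)) N \<and> uh t = elliptic k N (mh t) \<and>
       (\<forall>x. (\<lambda>s. mh s x) differentiable (at t within {0..T})) \<and>
       (\<forall>\<phi>\<in>spline_space (Suc (Suc k)) N. L2_inner (time_deriv T mh t) \<phi> = conv_form (mh t) (uh t) \<phi>)) \<and>
    (\<forall>\<phi>\<in>spline_space (Suc (Suc k)) N. L2_inner (mh 0) \<phi> = L2_inner u0 \<phi> + L2_inner (deriv u0) (deriv \<phi>))"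
    (is "_ \<longleftrightarrow> ?R")
proof -
  let ?S = "spline_space (Suc (Suc k)) N"
  have ell: "(\<forall>\<phi>\<in>?S. L2_inner m \<phi> = L2_inner u \<phi> + L2_inner (deriv u) (deriv \<phi>)) \<longleftrightarrow> u = elliptic k N m"
    if m: "m \<in> ?S" and u: "u \<in> ?S" for m u
  proof -
    have "h1_inner u \<phi> = L2_inner u \<phi> + L2_inner (deriv u) (deriv \<phi>)" if "\<phi> \<in> ?S" for \<phi>
      unfolding h1_inner_def
      using L2_inner_deriv_deriv_eq[OF pw_deriv_spline[OF u N] pw_deriv_spline[OF that N]] by simp
    then show ?thesis
      using elliptic_unique[OF N spline_bounded_borel(1)[OF m N] u]
        elliptic(2)[OF N spline_bounded_borel(1)[OF m N], of _ k] by metis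
  qed
  have eS: "elliptic k N m \<in> ?S" if "m \<in> ?S" for m
    using elliptic(1)[OF N spline_bounded_borel(1)[OF that N]] .
  have cf: "L2_inner w \<phi> + L2_inner (deriv (\<lambda>x. m x * u x)) \<phi> + L2_inner (\<lambda>x. m x * deriv u x) \<phi> = 0
     \<longleftrightarrow> L2_inner w \<phi> = conv_form m u \<phi>" if "m \<in> ?S" "u \<in> ?S" "\<phi> \<in> ?S" for w m u \<phi>
    using conv_form_eq[OF N that] by auto
  show ?thesis
  proof
    assume "semidiscrete_solution (Suc (Suc k)) N T u0 mh uh"
    then show ?R unfolding semidiscrete_solution_def using ell cf by blast
  next
    assume R: ?R
    have "uh t \<in> ?S" if "t \<in> {0..T}" for t using R eS that by metis
    then show "semidiscrete_solution (Suc (Suc k)) N T u0 mh uh"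
      using R ell cf unfolding semidiscrete_solution_def by (intro conjI ballI) blast+
  qed
qed

section \<open>Ordinary differential equations\<close>

text \<open>One contraction on all of \<open>[0, T]\<close>: the unknown \<open>z\<close> is the
  solution damped by \<open>exp (- K * t)\<close>, and \<open>c\<close> clamps time to the interval
  so that the Picard image is bounded and continuous on the whole line.\<close>

lemma lipschitz_ode_exists:
  fixes F :: "'a::banach \<Rightarrow> 'a"
  assumes F: "\<And>x y. norm (F x - F y) \<le> L * norm (x - y)" and L: "L \<ge> 0" and T: "T > 0"
  shows "\<exists>y. y 0 = y0 \<and> (\<forall>t\<in>{0..T}. (y has_vector_derivative F (y t)) (at t within {0..T}))"
proof -
  \<comment> \<open>Twice \<open>L\<close> yields the contraction factor 1/2; the added 1 keeps
    \<open>K\<close> positive when \<open>L = 0\<close>.\<close>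
  define K where "K = 2 * L + 1"
  have K: "K > 0" "L / K \<le> 1 / 2" using L by (simp_all add: K_def field_simps)
  define c where "c = (\<lambda>t. max 0 (min t T))"
  have c: "c t \<in> {0..T}" for t using T by (simp add: c_def)
  have ci: "c t = t" if "t \<in> {0..T}" for t using that by (simp add: c_def)
  have cc: "continuous_on A c" for A unfolding c_def by (intro continuous_intros)
  have Fc: "continuous_on UNIV F"
  proof (rule continuous_onI)
    fix x e assume e: "(e::real) > 0"
    show "\<exists>d>0. \<forall>x'\<in>UNIV. dist x' x < d \<longrightarrow> dist (F x') (F x) \<le> e"
    proof (intro exI[of _ "e / (L + 1)"] conjI ballI impI)
      fix x' assume "dist x' x < e / (L + 1)"
      then have "L * norm (x' - x) \<le> (L + 1) * (e / (L + 1))"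
        using L by (intro mult_mono) (auto simp: dist_norm)
      then show "dist (F x') (F x) \<le> e" using F[of x' x] L by (simp add: dist_norm)
    qed (use e L in simp)
  qed
  define I where "I = (\<lambda>z::real \<Rightarrow>\<^sub>C 'a. \<lambda>s. F (exp (K * s) *\<^sub>R z s))"
  have Ic: "continuous_on A (I z)" for A z
    unfolding I_def by (intro continuous_on_compose2[OF Fc] continuous_intros) auto
  \<comment> \<open>The exponential weight makes the Picard map a contraction on all of \<open>[0, T]\<close> at once.\<close>
  define \<Psi> where "\<Psi> = (\<lambda>z::real \<Rightarrow>\<^sub>C 'a. \<lambda>t. exp (- (K * c t)) *\<^sub>R (y0 + integral {0..c t} (I z)))"
  have \<Psi>b: "\<Psi> z \<in> bcontfun" for z
  proof -
    define G where "G = (\<lambda>t. exp (- (K * t)) *\<^sub>R (y0 + integral {0..t} (I z)))"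
    have G: "continuous_on {0..T} G"
      unfolding G_def by (intro continuous_intros indefinite_integral_continuous_1 integrable_continuous_real Ic)
    have "\<Psi> z = G \<circ> c" by (auto simp: \<Psi>_def G_def)
    moreover have "continuous_on UNIV (G \<circ> c)"
      by (intro continuous_on_compose cc continuous_on_subset[OF G]) (use c in auto)
    moreover have "bounded (range (G \<circ> c))"
      by (rule bounded_subset[OF compact_imp_bounded[OF compact_continuous_image[OF G compact_Icc]]]) (use c in auto)
    ultimately show ?thesis by (simp add: bcontfun_def)
  qed
  have "\<exists>!z. Bcontfun (\<Psi> z) = z"
  proof (rule banach_fix_type)
    show "\<forall>x y. dist (Bcontfun (\<Psi> x)) (Bcontfun (\<Psi> y)) \<le> 1 / 2 * dist x y"
    proof (intro allI dist_bound)
      fix x y :: "real \<Rightarrow>\<^sub>C 'a" and t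
      define s where "s = c t"
      have s: "s \<in> {0..T}" unfolding s_def by (rule c)
      have le: "norm (I x r - I y r) \<le> L * dist x y * exp (K * r)" for r
      proof -
        have "norm (I x r - I y r) \<le> L * norm (exp (K * r) *\<^sub>R (x r - y r))"
          unfolding I_def scaleR_diff_right by (rule F)
        also have "\<dots> = L * (exp (K * r) * norm (x r - y r))" by simp
        also have "\<dots> \<le> L * (exp (K * r) * dist x y)"
          using dist_bounded[of x r y] L by (intro mult_left_mono) (auto simp: dist_norm)
        finally show ?thesis by (simp add: mult_ac)
      qed
      have "\<Psi> x t - \<Psi> y t = exp (- (K * s)) *\<^sub>R (integral {0..s} (I x) - integral {0..s} (I y))"
        unfolding \<Psi>_def s_def[symmetric] scaleR_diff_right[symmetric] by simp
      also have "integral {0..s} (I x) - integral {0..s} (I y) = integral {0..s} (\<lambda>r. I x r - I y r)"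
        by (intro Henstock_Kurzweil_Integration.integral_diff[symmetric] integrable_continuous_real Ic)
      finally have "norm (\<Psi> x t - \<Psi> y t) = exp (- (K * s)) * norm (integral {0..s} (\<lambda>r. I x r - I y r))" by simp
      also have "norm (integral {0..s} (\<lambda>r. I x r - I y r)) \<le> integral {0..s} (\<lambda>r. L * dist x y * exp (K * r))"
        by (rule integral_norm_bound_integral)
          (auto intro!: integrable_continuous_real continuous_intros Ic le)
      also have "integral {0..s} (\<lambda>r. L * dist x y * exp (K * r)) = L * dist x y * exp (K * s) / K - L * dist x y * exp (K * 0) / K"
      proof (rule integral_unique[OF fundamental_theorem_of_calculus])
        fix r assume "r \<in> {0..s}"
        show "((\<lambda>r. L * dist x y * exp (K * r) / K) has_vector_derivative L * dist x y * exp (K * r)) (at r within {0..s})"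
          using K by (auto intro!: derivative_eq_intros simp: has_real_derivative_iff_has_vector_derivative[symmetric])
      qed (use s in simp)
      also have "\<dots> \<le> L * dist x y * exp (K * s) / K" using L K by simp
      also have "exp (- (K * s)) * (L * dist x y * exp (K * s) / K) = L / K * dist x y"
        by (simp add: exp_minus field_simps)
      also have "\<dots> \<le> 1 / 2 * dist x y" by (intro mult_right_mono K) simp
      finally show "dist (Bcontfun (\<Psi> x) t) (Bcontfun (\<Psi> y) t) \<le> 1 / 2 * dist x y"
        by (simp add: Bcontfun_inverse \<Psi>b dist_norm)
    qed
  qed auto
  then obtain z where "Bcontfun (\<Psi> z) = z" by auto
  then have z: "z t = \<Psi> z t" for t by (metis Bcontfun_inverse \<Psi>b)
  define y where "y = (\<lambda>t. exp (K * t) *\<^sub>R z t)"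
  have y: "y t = y0 + integral {0..t} (I z)" if t: "t \<in> {0..T}" for t
    unfolding y_def by (subst z) (simp add: \<Psi>_def ci[OF t] flip: exp_add)
  have "(y has_vector_derivative F (y t)) (at t within {0..T})" if t: "t \<in> {0..T}" for t
  proof -
    have "((\<lambda>t. y0 + integral {0..t} (I z)) has_vector_derivative I z t) (at t within {0..T})"
      using has_vector_derivative_add[OF has_vector_derivative_const[of y0] integral_has_vector_derivative[OF Ic t, of z]]
      by simp
    then have "(y has_vector_derivative I z t) (at t within {0..T})"
      by (rule has_vector_derivative_transform[OF t, rotated]) (simp add: y)
    then show ?thesis by (simp add: I_def y_def)
  qed
  moreover have "y 0 = y0" using y[of 0] T by simp
  ultimately show ?thesis by blast
qed

text \<open>Bounded continuous functions are the state space to which the preceding existence result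
  is applied next.\<close>

instance bcontfun :: (metric_space, banach) banach ..

lemma lipschitz_system_exists:
  fixes G :: "nat \<Rightarrow> (nat \<Rightarrow> real) \<Rightarrow> real"
  assumes G: "\<And>i y z D. i < m \<Longrightarrow> (\<And>j. j < m \<Longrightarrow> \<bar>y j - z j\<bar> \<le> D) \<Longrightarrow> \<bar>G i y - G i z\<bar> \<le> L * D"
    and L: "L \<ge> 0" and T: "T > 0"
  shows "\<exists>y. \<forall>i<m. y i 0 = y0 i \<and>
    (\<forall>t\<in>{0..T}. (y i has_real_derivative G i (\<lambda>j. y j t)) (at t within {0..T}))"
proof -
  \<comment> \<open>There is no Banach type of dimension \<open>m\<close> for a variable \<open>m\<close>; vectors are embedded into the
    bounded continuous functions as piecewise linear interpolants.\<close>
  define hat where "hat = (\<lambda>i x. max 0 (1 - \<bar>x - real i\<bar>))"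
  have hat: "hat i (real j) = (if i = j then 1 else 0)" "0 \<le> hat i x" "hat i x \<le> 1" for i j x
    by (auto simp: hat_def)
  define emb where "emb = (\<lambda>f::nat \<Rightarrow> real. Bcontfun (\<lambda>x. \<Sum>i<m. f i * hat i x))"
  have emb: "apply_bcontfun (emb f) x = (\<Sum>i<m. f i * hat i x)" for f x
  proof -
    have "(\<lambda>x. \<Sum>i<m. f i * hat i x) \<in> bcontfun"
    proof (rule bcontfun_normI)
      show "norm (\<Sum>i<m. f i * hat i x) \<le> (\<Sum>i<m. \<bar>f i\<bar>)" for x
        by (rule order_trans[OF norm_sum]) (auto intro!: sum_mono simp: abs_mult hat mult_left_le)
      show "continuous_on UNIV (\<lambda>x. \<Sum>i<m. f i * hat i x)"
        unfolding hat_def by (intro continuous_intros)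
    qed
    then show ?thesis by (simp add: emb_def Bcontfun_inverse)
  qed
  have emb_node: "apply_bcontfun (emb f) (real i) = f i" if "i < m" for f i
  proof -
    have "(\<Sum>j<m. f j * hat j (real i)) = (\<Sum>j<m. if j = i then f j else 0)" by (intro sum.cong) (auto simp: hat)
    then show ?thesis using that by (simp add: emb)
  qed
  define F where "F = (\<lambda>v::real \<Rightarrow>\<^sub>C real. emb (\<lambda>i. G i (\<lambda>j. v (real j))))"
  have F: "norm (F x - F y) \<le> (real m * L) * norm (x - y)" for x y
  proof (rule norm_bound)
    fix s
    have "\<bar>x r - y r\<bar> \<le> norm (x - y)" for r using norm_bounded[of "x - y" r] by simp
    then have *: "\<bar>G i (\<lambda>j. x (real j)) - G i (\<lambda>j. y (real j))\<bar> \<le> L * norm (x - y)" if "i < m" for i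
      by (intro G that)
    have "norm ((F x - F y) s) = \<bar>\<Sum>i<m. (G i (\<lambda>j. x (real j)) - G i (\<lambda>j. y (real j))) * hat i s\<bar>"
      by (simp add: F_def emb sum_subtractf left_diff_distrib)
    also have "\<dots> \<le> (\<Sum>i<m. L * norm (x - y))"
    proof (rule order_trans[OF sum_abs sum_mono])
      fix i assume "i \<in> {..<m}"
      then have "\<bar>G i (\<lambda>j. x (real j)) - G i (\<lambda>j. y (real j))\<bar> * hat i s \<le> (L * norm (x - y)) * 1"
        using * L by (intro mult_mono hat) auto
      then show "\<bar>(G i (\<lambda>j. x (real j)) - G i (\<lambda>j. y (real j))) * hat i s\<bar> \<le> L * norm (x - y)"
        by (simp add: abs_mult hat)
    qed
    finally show "norm ((F x - F y) s) \<le> (real m * L) * norm (x - y)" by simp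
  qed
  have "0 \<le> real m * L" using L by simp
  from lipschitz_ode_exists[of F "real m * L" T "emb y0", OF F this T]
  obtain v where v: "v 0 = emb y0" "\<And>t. t \<in> {0..T} \<Longrightarrow> (v has_vector_derivative F (v t)) (at t within {0..T})"
    by auto
  have bl: "bounded_linear (\<lambda>v::real \<Rightarrow>\<^sub>C real. v x)" for x
  proof (rule bounded_linear_intro[of _ 1])
    show "norm (v x) \<le> norm v * 1" for v :: "real \<Rightarrow>\<^sub>C real" using norm_bounded[of v x] by simp
  qed simp_all
  show ?thesis
  proof (intro exI[of _ "\<lambda>i t. v t (real i)"] allI impI conjI ballI)
    fix i assume i: "i < m"
    show "v 0 (real i) = y0 i" using i by (simp add: v emb_node)
    fix t assume t: "t \<in> {0..T}"
    have "((\<lambda>t. v t (real i)) has_vector_derivative F (v t) (real i)) (at t within {0..T})"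
      by (rule bounded_linear.has_vector_derivative[OF bl v(2)[OF t]])
    then show "((\<lambda>t. v t (real i)) has_real_derivative G i (\<lambda>j. v t (real j))) (at t within {0..T})"
      using i by (simp add: F_def emb_node has_real_derivative_iff_has_vector_derivative)
  qed
qed

text \<open>The integrating factor makes \<open>exp (- (a * s)) * y s - b * s\<close> nonincreasing.
  The differential inequality is assumed on \<open>[0, t]\<close> only, because in the continuity
  argument it is available just up to the time reached so far.\<close>

lemma gronwall_linear:
  assumes T: "t \<in> {0..T}" and d: "\<And>s. s \<in> {0..T} \<Longrightarrow> (y has_real_derivative y' s) (at s within {0..T})"
    and le: "\<And>s. s \<in> {0..t} \<Longrightarrow> y' s \<le> a * y s + b" and ab: "a \<ge> 0" "b \<ge> 0"
  shows "y t \<le> exp (a * t) * (y 0 + b * t)"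
proof -
  define z where "z = (\<lambda>s. exp (- (a * s)) * y s - b * s)"
  have dz: "(z has_real_derivative exp (- (a * s)) * (y' s - a * y s) - b) (at s within {0..T})"
    if s: "s \<in> {0..T}" for s
    unfolding z_def using d[OF s] by (auto intro!: derivative_eq_intros simp: algebra_simps)
  have "z t \<le> z 0"
  proof (rule DERIV_nonpos_imp_decreasing_open[of 0 t z])
    fix s assume s: "0 < s" "s < t"
    then have sT: "s \<in> {0..T}" and "at s within {0..T} = at s" using T by (auto simp: at_within_Icc_at)
    then have "(z has_real_derivative exp (- (a * s)) * (y' s - a * y s) - b) (at s)" using dz[OF sT] by simp
    moreover have "exp (- (a * s)) * (y' s - a * y s) - b \<le> 0"
    proof -
      have "exp (- (a * s)) * (y' s - a * y s) \<le> exp (- (a * s)) * b"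
        using le[of s] s by (intro mult_left_mono) auto
      also have "\<dots> \<le> 1 * b" using ab s by (intro mult_right_mono) auto
      finally show ?thesis by simp
    qed
    ultimately show "\<exists>D. DERIV z s :> D \<and> D \<le> 0" by blast
  next
    have "continuous_on {0..T} z" by (rule DERIV_continuous_on[OF dz])
    then show "continuous_on {0..t} z" by (rule continuous_on_subset) (use T in auto)
  qed (use T in simp)
  then have "exp (- (a * t)) * y t \<le> y 0 + b * t" by (simp add: z_def)
  then have "exp (a * t) * (exp (- (a * t)) * y t) \<le> exp (a * t) * (y 0 + b * t)"
    by (intro mult_left_mono) auto
  then show ?thesis by (simp add: mult.assoc[symmetric] flip: exp_add)
qed

text \<open>Continuity argument: a bound that improves itself up to time \<open>t\<close> cannot be lost.\<close>

lemma bootstrap: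
  fixes Y :: "real \<Rightarrow> real"
  assumes c: "continuous_on {0..T} Y" and lt: "\<eta> < \<delta>" and 0: "Y 0 < \<delta>"
    and imp: "\<And>t. t \<in> {0..T} \<Longrightarrow> (\<And>s. s \<in> {0..t} \<Longrightarrow> Y s \<le> \<delta>) \<Longrightarrow> Y t \<le> \<eta>"
    and t: "t \<in> {0..T}"
  shows "Y t \<le> \<eta>"
proof -
  have "Y s < \<delta>" if s: "s \<in> {0..T}" for s
  proof (rule ccontr)
    assume "\<not> Y s < \<delta>"
    \<comment> \<open>The least element \<open>r\<close> of this closed set is the first time at
      which \<delta> is reached. There \<open>Y r = \<delta>\<close> by continuity, while
      \<open>imp\<close> at \<open>r\<close> gives \<open>Y r \<le> \<eta>\<close>.\<close>
    define B where "B = {r \<in> {0..s}. Y r \<ge> \<delta>}"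
    have cs: "continuous_on {0..s} Y" using c s by (auto intro: continuous_on_subset)
    have "closed B" unfolding B_def
      using continuous_closed_preimage[OF cs closed_atLeastAtMost closed_atLeast, of \<delta>]
      by (simp add: vimage_def Int_def)
    moreover have "bounded B" by (rule bounded_subset[of "{0..s}"]) (auto simp: B_def)
    ultimately have "compact B" by (simp add: compact_eq_bounded_closed)
    moreover have "B \<noteq> {}" using \<open>\<not> Y s < \<delta>\<close> s by (auto simp: B_def)
    ultimately have "\<exists>r\<in>B. \<forall>q\<in>B. r \<le> q" by (intro compact_attains_inf)
    then obtain r where r: "r \<in> B" "\<And>q. q \<in> B \<Longrightarrow> r \<le> q" by blast
    have rT: "r \<in> {0..T}" using r s by (auto simp: B_def)
    have "Y r = \<delta>"
    proof (rule ccontr)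
      assume "Y r \<noteq> \<delta>"
      then have "Y r > \<delta>" using r by (auto simp: B_def)
      moreover have "continuous_on {0..r} Y" using c rT by (auto intro: continuous_on_subset)
      ultimately obtain q where q: "0 \<le> q" "q \<le> r" "Y q = \<delta>"
        using IVT'[of Y 0 \<delta> r] 0 rT by auto
      then have "q \<in> B" using r by (auto simp: B_def)
      then have "q = r" using r q by force
      then show False using q \<open>Y r \<noteq> \<delta>\<close> by simp
    qed
    moreover have "Y q \<le> \<delta>" if "q \<in> {0..r}" for q
    proof (cases "q \<in> B")
      case True
      then have "q = r" using r that by force
      then show ?thesis using \<open>Y r = \<delta>\<close> by simp
    next
      case False
      then show ?thesis using that r by (auto simp: B_def)
    qed
    then have "Y r \<le> \<eta>" by (rule imp[OF rT])
    ultimately show False using lt by simp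
  qed
  then have "Y s \<le> \<delta>" if "s \<in> {0..t}" for s using that t by (intro less_imp_le) auto
  then show ?thesis by (rule imp[OF t])
qed

section \<open>Consistency\<close>

text \<open>\<open>D j\<close> stands for the derivative of order \<open>j\<close> of
  \<open>D 0\<close>. A single \<open>B\<close> for all orders can be taken uniform in time, so the
  constants below depend on \<open>B\<close> and not on the time slice.\<close>

definition smooth_bound :: "nat \<Rightarrow> real \<Rightarrow> (nat \<Rightarrow> real \<Rightarrow> real) \<Rightarrow> bool" where
  "smooth_bound n B D \<longleftrightarrow> (\<forall>j\<le>n. periodic1 (D j) \<and> (\<forall>x. \<bar>D j x\<bar> \<le> B)) \<and>
     (\<forall>j<n. \<forall>x. (D j has_real_derivative D (Suc j) x) (at x))"

lemma smooth_bound_le: "smooth_bound n B D \<Longrightarrow> j \<le> n \<Longrightarrow> \<bar>D j x\<bar> \<le> B"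
  by (simp add: smooth_bound_def)

lemma smooth_bound_nonneg: "smooth_bound n B D \<Longrightarrow> 0 \<le> B"
  using smooth_bound_le[of n B D 0 0] abs_ge_zero[of "D 0 0"] by linarith

text \<open>The index condition is strict because \<open>D (Suc j)\<close> has to be continuous, and
  its continuity comes from the existence of the next derivative.\<close>

lemma smooth_bound_pw_deriv:
  assumes "smooth_bound n B D" "Suc j < n" shows "pw_deriv (D j) (D (Suc j))"
  unfolding pw_deriv_def
proof (intro conjI)
  have c: "continuous_on UNIV (D i)" if "i < n" for i
    using assms(1) that by (intro DERIV_continuous_on[of _ _ "D (Suc i)"]) (simp add: smooth_bound_def)
  show "periodic1 (D j)" "continuous_on UNIV (D j)" using assms c by (auto simp: smooth_bound_def)
  show "bounded_borel (D (Suc j))"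
    using assms c by (intro bounded_borel_periodic_continuous) (auto simp: smooth_bound_def)
  show "\<exists>S. finite S \<and> (\<forall>x\<in>{0..1} - S. (D j has_real_derivative D (Suc j) x) (at x))"
    using assms by (intro exI[of _ "{}"]) (auto simp: smooth_bound_def)
qed

lemma smooth_bound_right_deriv: "smooth_bound n B D \<Longrightarrow> j < n \<Longrightarrow> right_deriv (D j) = D (Suc j)"
  by (rule ext, rule right_deriv_eq) (auto simp: smooth_bound_def intro: has_field_derivative_at_within)

lemma smooth_bound_Lipschitz:
  assumes D: "smooth_bound n B D" "0 < n" and h: "h > 0" shows "\<bar>D 0 (x + h) - D 0 x\<bar> \<le> B * h"
proof -
  have "\<exists>z>x. z < x + h \<and> D 0 (x + h) - D 0 x = (x + h - x) * D (Suc 0) z"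
    by (rule MVT2) (use D h in \<open>auto simp: smooth_bound_def\<close>)
  then obtain z where "D 0 (x + h) - D 0 x = h * D (Suc 0) z" by auto
  then show ?thesis using smooth_bound_le[OF D(1), of 1 z] D(2) h by (simp add: abs_mult mult.commute)
qed

definition quasi_spline :: "nat \<Rightarrow> nat \<Rightarrow> (real \<Rightarrow> real) \<Rightarrow> real \<Rightarrow> real" where
  "quasi_spline k N g = pspline (Suc k) N (quasi_interp (Suc k) N g)"

lemma quasi_spline_in_space:
  "N \<ge> 1 \<Longrightarrow> periodic1 g \<Longrightarrow> quasi_spline k N g \<in> spline_space (Suc (Suc k)) N"
  unfolding quasi_spline_def by (intro pspline_in_spline_space quasi_interp_periodic)

text \<open>With r = k + 2 the error is of order r and its increment over a cell of order r + 1; the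
  latter is what calls for derivatives up to order \<open>k + 3\<close>. The last two bounds keep
  the comparison function bounded in \<open>N\<close>.\<close>

lemma quasi_spline_estimates:
  "\<exists>K\<ge>1. \<forall>N\<ge>1. \<forall>D B x. smooth_bound (Suc (Suc (Suc k))) B D \<longrightarrow>
     \<bar>D 0 x - quasi_spline k N (D 0) x\<bar> \<le> K * B * (1 / real N) ^ Suc (Suc k) \<and>
     \<bar>(D 0 (x + 1 / real N) - quasi_spline k N (D 0) (x + 1 / real N)) - (D 0 x - quasi_spline k N (D 0) x)\<bar>
        \<le> K * B * (1 / real N) ^ Suc (Suc (Suc k)) \<and>
     \<bar>quasi_spline k N (D 0) x\<bar> \<le> K * B \<and> \<bar>right_deriv (quasi_spline k N (D 0)) x\<bar> \<le> K * B"
proof -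
  let ?E = "\<lambda>N D x. \<bar>D (0::nat) x - pspline (Suc k) N (quasi_interp (Suc k) N (D 0)) x\<bar>"
  obtain K1 where K1: "K1 \<ge> 0" "\<And>N D B x. N \<ge> 1 \<Longrightarrow> (\<forall>m\<le>Suc k. \<forall>y. (D m has_real_derivative D (Suc m) y) (at y)) \<Longrightarrow>
      (\<forall>y. \<bar>D (Suc (Suc k)) y\<bar> \<le> B) \<Longrightarrow> ?E N D x \<le> K1 * B * (1 / real N) ^ Suc (Suc k)"
    using quasi_interp_error[of "Suc k"] by blast
  obtain K2 where K2: "K2 \<ge> 0" "\<And>N D B x. N \<ge> 1 \<Longrightarrow> (\<forall>m\<le>Suc (Suc k). \<forall>y. (D m has_real_derivative D (Suc m) y) (at y)) \<Longrightarrow>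
      (\<forall>y. \<bar>D (Suc (Suc (Suc k))) y\<bar> \<le> B) \<Longrightarrow>
      \<bar>(D 0 (x + 1 / real N) - pspline (Suc k) N (quasi_interp (Suc k) N (D 0)) (x + 1 / real N)) -
       (D 0 x - pspline (Suc k) N (quasi_interp (Suc k) N (D 0)) x)\<bar> \<le> K2 * B * (1 / real N) ^ Suc (Suc (Suc k))"
    using quasi_interp_error_shift[of "Suc k"] by blast
  obtain K3 where K3: "K3 \<ge> 0" "\<And>N g g' B x. N \<ge> 1 \<Longrightarrow> (\<forall>y. (g has_real_derivative g' y) (at y)) \<Longrightarrow> (\<forall>y. \<bar>g' y\<bar> \<le> B) \<Longrightarrow>
      \<bar>real N * pspline k N (nabla (quasi_interp (Suc k) N g)) x\<bar> \<le> K3 * B"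
    using quasi_interp_nabla_bound[of k "Suc k"] by blast
  define K where "K = 1 + K1 + K2 + K3"
  have KB: "K1 \<le> K" "K2 \<le> K" "K3 \<le> K" "1 + K1 \<le> K" "1 \<le> K" using K1(1) K2(1) K3(1) by (auto simp: K_def)
  show ?thesis
  proof (intro exI[of _ K] conjI allI impI KB)
    fix N :: nat and D B x assume N: "N \<ge> 1" and D: "smooth_bound (Suc (Suc (Suc k))) B D"
    have B: "B \<ge> 0" by (rule smooth_bound_nonneg[OF D])
    have der: "(D m has_real_derivative D (Suc m) y) (at y)" if "m \<le> Suc (Suc k)" for m y
      using D that by (simp add: smooth_bound_def)
    have bd: "\<bar>D m y\<bar> \<le> B" if "m \<le> Suc (Suc (Suc k))" for m y by (rule smooth_bound_le[OF D that])
    have e1: "\<bar>D 0 x - quasi_spline k N (D 0) x\<bar> \<le> K1 * B * (1 / real N) ^ Suc (Suc k)" for x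
      unfolding quasi_spline_def by (rule K1(2)[OF N]) (auto intro!: der bd)
    also have "K1 * B * (1 / real N) ^ Suc (Suc k) \<le> K * B * (1 / real N) ^ Suc (Suc k)"
      by (intro mult_right_mono KB B) simp
    finally show "\<bar>D 0 x - quasi_spline k N (D 0) x\<bar> \<le> K * B * (1 / real N) ^ Suc (Suc k)" .
    have "\<bar>(D 0 (x + 1 / real N) - quasi_spline k N (D 0) (x + 1 / real N)) - (D 0 x - quasi_spline k N (D 0) x)\<bar>
        \<le> K2 * B * (1 / real N) ^ Suc (Suc (Suc k))"
      unfolding quasi_spline_def by (rule K2(2)[OF N]) (auto intro!: der bd)
    also have "\<dots> \<le> K * B * (1 / real N) ^ Suc (Suc (Suc k))"
      by (intro mult_right_mono KB B) simp
    finally show "\<bar>(D 0 (x + 1 / real N) - quasi_spline k N (D 0) (x + 1 / real N)) - (D 0 x - quasi_spline k N (D 0) x)\<bar>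
        \<le> K * B * (1 / real N) ^ Suc (Suc (Suc k))" .
    have "(1 / real N) ^ Suc (Suc k) \<le> 1" using N by (intro power_le_one) auto
    then have "K1 * B * (1 / real N) ^ Suc (Suc k) \<le> K1 * B * 1" using K1(1) B by (intro mult_left_mono) auto
    then have "\<bar>quasi_spline k N (D 0) x\<bar> \<le> (1 + K1) * B"
      using e1[of x] bd[of 0 x] by (simp add: distrib_right)
    also have "\<dots> \<le> K * B" by (intro mult_right_mono KB B)
    finally show "\<bar>quasi_spline k N (D 0) x\<bar> \<le> K * B" .
    have "\<bar>right_deriv (quasi_spline k N (D 0)) x\<bar> \<le> K3 * B"
      unfolding quasi_spline_def right_deriv_pspline[OF N]
      by (rule K3(2)[OF N, of "D 0" "D 1"]) (use der[of 0] bd[of 1] in auto)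
    also have "\<dots> \<le> K * B" by (intro mult_right_mono KB B)
    finally show "\<bar>right_deriv (quasi_spline k N (D 0)) x\<bar> \<le> K * B" .
  qed
qed

text \<open>Moving the derivative off the test function leaves \<open>M' * d\<close> once and
  \<open>M * d'\<close> twice, which is the constant 3. No derivative of \<phi> survives, so no
  inverse inequality is spent.\<close>

lemma L2_inner_deriv_mult_le:
  assumes M: "pw_deriv M M'" and d: "pw_deriv d d'" and \<phi>: "pw_deriv \<phi> \<phi>'"
    and \<mu>: "\<And>x. \<bar>M x\<bar> \<le> \<mu>" "\<And>x. \<bar>M' x\<bar> \<le> \<mu>" and A: "L2_nrm d \<le> A" "L2_nrm d' \<le> A"
  shows "\<bar>L2_inner (\<lambda>x. M x * d x) \<phi>' - L2_inner (\<lambda>x. M x * d' x) \<phi>\<bar> \<le> 3 * \<mu> * A * L2_nrm \<phi>"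
proof -
  note bb = M[THEN pw_deriv_bounded_borel] d[THEN pw_deriv_bounded_borel] \<phi>[THEN pw_deriv_bounded_borel]
    M[THEN pw_deriv_bounded_borel'] d[THEN pw_deriv_bounded_borel'] \<phi>[THEN pw_deriv_bounded_borel']
  have \<mu>0: "\<mu> \<ge> 0" using order_trans[OF abs_ge_zero \<mu>(1)] .
  have "L2_inner (\<lambda>x. M x * d x) \<phi>' = - L2_inner (\<lambda>x. M' x * d x + M x * d' x) \<phi>"
    using L2_inner_by_parts[OF pw_deriv_mult[OF M d] \<phi>] by simp
  also have "\<dots> = - L2_inner (\<lambda>x. M' x * d x) \<phi> - L2_inner (\<lambda>x. M x * d' x) \<phi>"
    by (simp add: L2_inner_add_left bounded_borel_mult bb)
  finally have eq: "L2_inner (\<lambda>x. M x * d x) \<phi>' - L2_inner (\<lambda>x. M x * d' x) \<phi>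
     = - L2_inner (\<lambda>x. M' x * d x) \<phi> - 2 * L2_inner (\<lambda>x. M x * d' x) \<phi>" by simp
  have "\<bar>L2_inner (\<lambda>x. M' x * d x) \<phi>\<bar> \<le> \<mu> * L2_nrm d * L2_nrm \<phi>"
    by (rule L2_inner_le3) (use bb \<mu> in auto)
  also have "\<dots> \<le> \<mu> * A * L2_nrm \<phi>" by (intro mult_right_mono mult_left_mono A \<mu>0 L2_nrm_nonneg)
  finally have 1: "\<bar>L2_inner (\<lambda>x. M' x * d x) \<phi>\<bar> \<le> \<mu> * A * L2_nrm \<phi>" .
  have "\<bar>L2_inner (\<lambda>x. M x * d' x) \<phi>\<bar> \<le> \<mu> * L2_nrm d' * L2_nrm \<phi>"
    by (rule L2_inner_le3) (use bb \<mu> in auto)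
  also have "\<dots> \<le> \<mu> * A * L2_nrm \<phi>" by (intro mult_right_mono mult_left_mono A \<mu>0 L2_nrm_nonneg)
  finally have 2: "\<bar>L2_inner (\<lambda>x. M x * d' x) \<phi>\<bar> \<le> \<mu> * A * L2_nrm \<phi>" .
  show ?thesis using 1 2 unfolding eq by linarith
qed

text \<open>The difference splits into \<theta> transported by \<open>V = U + \<xi>\<close> and
  \<open>M\<close> combined with \<xi>. In the first part integration by parts gives
  \<open>(\<theta> V, \<theta>') = - 1/2 (V' \<theta>, \<theta>)\<close>, which with the second
  transport term makes the factor 3/2 and leaves no derivative on \<theta>. The second part is
  \<open>L2_inner_deriv_mult_le\<close>, since \<xi> is controlled in H1 by \<theta>.\<close>

lemma conv_form_energy:
  assumes N: "N \<ge> 1" and M: "M \<in> spline_space (Suc (Suc k)) N" and \<theta>: "\<theta> \<in> spline_space (Suc (Suc k)) N"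
    and U: "U \<in> spline_space (Suc (Suc k)) N" and \<xi>: "\<xi> \<in> spline_space (Suc (Suc k)) N"
    and \<beta>: "\<And>x. \<bar>right_deriv (\<lambda>x. U x + \<xi> x) x\<bar> \<le> \<beta>"
    and \<mu>: "\<And>x. \<bar>M x\<bar> \<le> \<mu>" "\<And>x. \<bar>right_deriv M x\<bar> \<le> \<mu>"
    and bd: "L2_nrm \<xi> \<le> L2_nrm \<theta>" "L2_nrm (right_deriv \<xi>) \<le> L2_nrm \<theta>"
  shows "conv_form (\<lambda>x. M x + \<theta> x) (\<lambda>x. U x + \<xi> x) \<theta> - conv_form M U \<theta> \<le> (3 / 2 * \<beta> + 3 * \<mu>) * (L2_nrm \<theta>)\<^sup>2"
proof -
  define V where "V = (\<lambda>x. U x + \<xi> x)"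
  have V: "V \<in> spline_space (Suc (Suc k)) N" unfolding V_def by (rule spline_add(1)[OF N U \<xi>])
  have DV: "right_deriv V = (\<lambda>x. right_deriv U x + right_deriv \<xi> x)" unfolding V_def by (rule spline_add(2)[OF N U \<xi>])
  note bb = spline_bounded_borel[OF M N] spline_bounded_borel[OF \<theta> N] spline_bounded_borel[OF U N]
    spline_bounded_borel[OF \<xi> N] spline_bounded_borel[OF V N]
  let ?t = "right_deriv \<theta>"
  have split: "conv_form (\<lambda>x. M x + \<theta> x) V \<theta> - conv_form M U \<theta>
     = (L2_inner (\<lambda>x. \<theta> x * V x) ?t - L2_inner (\<lambda>x. \<theta> x * right_deriv V x) \<theta>) +
       (L2_inner (\<lambda>x. M x * \<xi> x) ?t - L2_inner (\<lambda>x. M x * right_deriv \<xi> x) \<theta>)"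
  proof -
    have "(\<lambda>x. (M x + \<theta> x) * V x) = (\<lambda>x. M x * U x + (M x * \<xi> x + \<theta> x * V x))"
      by (rule ext) (simp add: V_def algebra_simps)
    then have 1: "L2_inner (\<lambda>x. (M x + \<theta> x) * V x) ?t
      = L2_inner (\<lambda>x. M x * U x) ?t + (L2_inner (\<lambda>x. M x * \<xi> x) ?t + L2_inner (\<lambda>x. \<theta> x * V x) ?t)"
      by (simp add: L2_inner_add_left bounded_borel_mult bounded_borel_add bb)
    have "(\<lambda>x. (M x + \<theta> x) * right_deriv V x)
      = (\<lambda>x. M x * right_deriv U x + (M x * right_deriv \<xi> x + \<theta> x * right_deriv V x))"
      by (rule ext) (simp add: DV algebra_simps)
    then have 2: "L2_inner (\<lambda>x. (M x + \<theta> x) * right_deriv V x) \<theta>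
      = L2_inner (\<lambda>x. M x * right_deriv U x) \<theta> + (L2_inner (\<lambda>x. M x * right_deriv \<xi> x) \<theta> + L2_inner (\<lambda>x. \<theta> x * right_deriv V x) \<theta>)"
      by (simp add: L2_inner_add_left bounded_borel_mult bounded_borel_add bb)
    show ?thesis unfolding conv_form_def 1 2 by simp
  qed
  have "L2_inner (\<lambda>x. right_deriv V x * \<theta> x + V x * ?t x) \<theta> = - L2_inner (\<lambda>x. V x * \<theta> x) ?t"
    by (rule L2_inner_by_parts[OF pw_deriv_mult[OF pw_deriv_spline[OF V N] pw_deriv_spline[OF \<theta> N]] pw_deriv_spline[OF \<theta> N]])
  moreover have "L2_inner (\<lambda>x. right_deriv V x * \<theta> x + V x * ?t x) \<theta>
    = L2_inner (\<lambda>x. right_deriv V x * \<theta> x) \<theta> + L2_inner (\<lambda>x. V x * ?t x) \<theta>"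
    by (intro L2_inner_add_left bounded_borel_mult bb)
  moreover have "L2_inner (\<lambda>x. V x * ?t x) \<theta> = L2_inner (\<lambda>x. V x * \<theta> x) ?t"
    by (simp add: L2_inner_def mult_ac)
  ultimately have "L2_inner (\<lambda>x. \<theta> x * V x) ?t = - (1 / 2) * L2_inner (\<lambda>x. right_deriv V x * \<theta> x) \<theta>"
    by (simp add: mult.commute)
  then have "L2_inner (\<lambda>x. \<theta> x * V x) ?t - L2_inner (\<lambda>x. \<theta> x * right_deriv V x) \<theta>
     = - (3 / 2) * L2_inner (\<lambda>x. right_deriv V x * \<theta> x) \<theta>" by (simp add: mult.commute)
  moreover have "\<bar>L2_inner (\<lambda>x. right_deriv V x * \<theta> x) \<theta>\<bar> \<le> \<beta> * L2_nrm \<theta> * L2_nrm \<theta>"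
    by (rule L2_inner_le3) (use bb \<beta> in \<open>auto simp: V_def\<close>)
  moreover have "\<bar>L2_inner (\<lambda>x. M x * \<xi> x) ?t - L2_inner (\<lambda>x. M x * right_deriv \<xi> x) \<theta>\<bar> \<le> 3 * \<mu> * L2_nrm \<theta> * L2_nrm \<theta>"
    by (rule L2_inner_deriv_mult_le) (use pw_deriv_spline[OF _ N] M \<xi> \<theta> \<mu> bd in auto)
  ultimately show ?thesis
    using split unfolding V_def by (simp add: power2_eq_square algebra_simps)
qed

lemma mesh_power:
  assumes "N \<ge> (1::nat)"
  shows "real N * (1 / real N) ^ Suc n = (1 / real N) ^ n" 
    and "real N * sqrt (real N) * (1 / real N) ^ Suc (Suc n) \<le> 1"
    and "(1 / real N) ^ n \<le> 1"
proof -
  show 1: "real N * (1 / real N) ^ Suc n = (1 / real N) ^ n" for n using assms by simp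
  show 2: "(1 / real N) ^ n \<le> 1" for n using assms by (intro power_le_one) auto
  have "sqrt (real N) \<le> real N" using assms by (intro real_le_lsqrt) (auto simp: power2_eq_square)
  then have "real N * sqrt (real N) * (1 / real N) ^ Suc (Suc n) \<le> real N * real N * (1 / real N) ^ Suc (Suc n)"
    by (intro mult_right_mono mult_left_mono) auto
  also have "\<dots> = (1 / real N) ^ n" unfolding mult.assoc 1 by (rule refl)
  also have "\<dots> \<le> 1" by (rule 2)
  finally show "real N * sqrt (real N) * (1 / real N) ^ Suc (Suc n) \<le> 1" .
qed

text \<open>A smooth factor does not spoil the small increments of the error: in the product rule
  for differences its own increment is O(h) and meets an error of order r. So the product still has
  increments of order r + 1, and the factor \<open>N\<close> leaves order r.\<close>

lemma L2_inner_smooth_mult_error_le: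
  "\<exists>C\<ge>0. \<forall>N\<ge>1. \<forall>D E K. \<forall>\<phi>\<in>spline_space (Suc (Suc k)) N.
     smooth_bound (Suc (Suc (Suc k))) B D \<longrightarrow> bounded_borel E \<longrightarrow> periodic1 E \<longrightarrow>
     (\<forall>x. \<bar>E x\<bar> \<le> K * (1 / real N) ^ Suc (Suc k)) \<longrightarrow>
     (\<forall>x. \<bar>E (x + 1 / real N) - E x\<bar> \<le> K * (1 / real N) ^ Suc (Suc (Suc k))) \<longrightarrow>
     \<bar>L2_inner (\<lambda>x. D 0 x * E x) (right_deriv \<phi>)\<bar> \<le> C * K * (1 / real N) ^ Suc (Suc k) * L2_nrm \<phi>"
proof -
  obtain C where C: "C \<ge> 0" "\<And>N \<phi> F \<delta>. N \<ge> 1 \<Longrightarrow> \<phi> \<in> spline_space (Suc (Suc k)) N \<Longrightarrow> bounded_borel F \<Longrightarrow> periodic1 F \<Longrightarrow>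
     (\<forall>x. \<bar>F (x + 1 / real N) - F x\<bar> \<le> \<delta>) \<Longrightarrow>
     \<bar>L2_inner F (right_deriv \<phi>)\<bar> \<le> C * real N * \<delta> * L2_nrm \<phi>"
    using inner_spline_deriv_le[of k] by blast
  show ?thesis
  \<comment> \<open>\<open>B\<close> is fixed before any function is given; the absolute value keeps
    the constant nonnegative, and \<open>smooth_bound\<close> later yields
    \<open>B \<ge> 0\<close>.\<close>
  proof (intro exI[of _ "C * (2 * \<bar>B\<bar>)"] conjI allI impI ballI)
    fix N :: nat and D E K \<phi>
    assume N: "N \<ge> 1" and \<phi>: "\<phi> \<in> spline_space (Suc (Suc k)) N"
      and D: "smooth_bound (Suc (Suc (Suc k))) B D" and E: "bounded_borel E" "periodic1 E"
      and e1: "\<forall>x. \<bar>E x\<bar> \<le> K * (1 / real N) ^ Suc (Suc k)"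
      and e2: "\<forall>x. \<bar>E (x + 1 / real N) - E x\<bar> \<le> K * (1 / real N) ^ Suc (Suc (Suc k))"
    define h where "h = 1 / real N"
    have h: "h > 0" using N by (simp add: h_def)
    have B: "B \<ge> 0" by (rule smooth_bound_nonneg[OF D])
    have bb: "bounded_borel (\<lambda>x. D 0 x * E x)"
      by (intro bounded_borel_mult E pw_deriv_bounded_borel[OF smooth_bound_pw_deriv[OF D]]) simp
    have per: "periodic1 (\<lambda>x. D 0 x * E x)" using D E(2) by (auto simp: periodic1_def smooth_bound_def)
    have inc: "\<bar>D 0 (x + h) * E (x + h) - D 0 x * E x\<bar> \<le> 2 * B * K * h ^ Suc (Suc (Suc k))" for x
    proof -
      have "\<bar>D 0 (x + h) * E (x + h) - D 0 x * E x\<bar> = \<bar>D 0 (x + h) * (E (x + h) - E x) + (D 0 (x + h) - D 0 x) * E x\<bar>"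
        by (simp add: algebra_simps)
      also have "\<dots> \<le> \<bar>D 0 (x + h)\<bar> * \<bar>E (x + h) - E x\<bar> + \<bar>D 0 (x + h) - D 0 x\<bar> * \<bar>E x\<bar>"
        by (metis abs_mult abs_triangle_ineq)
      also have "\<dots> \<le> B * (K * h ^ Suc (Suc (Suc k))) + (B * h) * (K * h ^ Suc (Suc k))"
        using smooth_bound_le[OF D, of 0] smooth_bound_Lipschitz[OF D _ h, of x] e1[rule_format, of x] e2[rule_format, of x] B h
        by (intro add_mono mult_mono) (auto simp: h_def)
      finally show ?thesis by (simp add: algebra_simps)
    qed
    have "\<bar>L2_inner (\<lambda>x. D 0 x * E x) (right_deriv \<phi>)\<bar> \<le> C * real N * (2 * B * K * h ^ Suc (Suc (Suc k))) * L2_nrm \<phi>"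
      by (rule C(2)[OF N \<phi> bb per]) (use inc in \<open>auto simp: h_def\<close>)
    also have "\<dots> = C * (2 * B * K) * (real N * h ^ Suc (Suc (Suc k))) * L2_nrm \<phi>" by (simp only: mult_ac)
    also have "real N * h ^ Suc (Suc (Suc k)) = h ^ Suc (Suc k)"
      unfolding h_def by (rule mesh_power(1)[OF N])
    finally show "\<bar>L2_inner (\<lambda>x. D 0 x * E x) (right_deriv \<phi>)\<bar> \<le> C * (2 * \<bar>B\<bar>) * K * (1 / real N) ^ Suc (Suc k) * L2_nrm \<phi>"
      using B by (simp add: h_def mult_ac)
  qed (use C(1) in simp)
qed

lemma smooth_h1_inner:
  assumes N: "N \<ge> 1" and Du: "smooth_bound (Suc (Suc (Suc k))) B Du"
    and m: "\<And>x. m x = Du 0 x - Du (Suc (Suc 0)) x" and \<phi>: "\<phi> \<in> spline_space (Suc (Suc k)) N"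
  shows "L2_inner m \<phi> = L2_inner (Du 0) \<phi> + L2_inner (Du (Suc 0)) (right_deriv \<phi>)"
proof -
  have p0: "pw_deriv (Du 0) (Du (Suc 0))" by (rule smooth_bound_pw_deriv[OF Du]) simp
  have p1: "pw_deriv (Du (Suc 0)) (Du (Suc (Suc 0)))" by (rule smooth_bound_pw_deriv[OF Du]) simp
  have "m = (\<lambda>x. Du 0 x - Du (Suc (Suc 0)) x)" by (rule ext) (rule m)
  then have "L2_inner m \<phi> = L2_inner (Du 0) \<phi> - L2_inner (Du (Suc (Suc 0))) \<phi>"
    using L2_inner_diff_left[OF pw_deriv_bounded_borel[OF p0] pw_deriv_bounded_borel'[OF p1]
        spline_bounded_borel(1)[OF \<phi> N]] by simp
  then show ?thesis using L2_inner_by_parts[OF p1 pw_deriv_spline[OF \<phi> N]] by simp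
qed

text \<open>The difference \<open>d\<close> of the two splines is tested with itself, leaving
  \<open>(eu, d) + (eu', d') - (em, d)\<close>. By Cauchy-Schwarz the middle term would be of order
  r - 1 only; \<open>inner_deriv_spline_deriv_le\<close> restores order r.\<close>

lemma elliptic_quasi_spline_error:
  "\<exists>C\<ge>0. \<forall>N\<ge>1. \<forall>Dm Du. smooth_bound (Suc (Suc (Suc k))) B Dm \<longrightarrow> smooth_bound (Suc (Suc (Suc k))) B Du \<longrightarrow>
     (\<forall>x. Dm 0 x = Du 0 x - Du (Suc (Suc 0)) x) \<longrightarrow>
     L2_nrm (\<lambda>x. elliptic k N (quasi_spline k N (Dm 0)) x - quasi_spline k N (Du 0) x) \<le> C * (1 / real N) ^ Suc (Suc k) \<and>
     L2_nrm (right_deriv (\<lambda>x. elliptic k N (quasi_spline k N (Dm 0)) x - quasi_spline k N (Du 0) x)) \<le> C * (1 / real N) ^ Suc (Suc k)"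
proof -
  let ?n = "Suc (Suc (Suc k))"
  obtain K where K: "K \<ge> 1" "\<And>N D B x. N \<ge> 1 \<Longrightarrow> smooth_bound ?n B D \<Longrightarrow>
     \<bar>D 0 x - quasi_spline k N (D 0) x\<bar> \<le> K * B * (1 / real N) ^ Suc (Suc k) \<and>
     \<bar>(D 0 (x + 1 / real N) - quasi_spline k N (D 0) (x + 1 / real N)) - (D 0 x - quasi_spline k N (D 0) x)\<bar>
        \<le> K * B * (1 / real N) ^ Suc (Suc (Suc k)) \<and>
     \<bar>quasi_spline k N (D 0) x\<bar> \<le> K * B \<and> \<bar>right_deriv (quasi_spline k N (D 0)) x\<bar> \<le> K * B"
    using quasi_spline_estimates[of k] by blast
  obtain C where C: "C \<ge> 0" "\<And>N \<phi> e e' \<delta>. N \<ge> 1 \<Longrightarrow> \<phi> \<in> spline_space (Suc (Suc k)) N \<Longrightarrow> pw_deriv e e' \<Longrightarrow>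
     (\<forall>x. \<bar>e (x + 1 / real N) - e x\<bar> \<le> \<delta>) \<Longrightarrow>
     \<bar>L2_inner e' (right_deriv \<phi>)\<bar> \<le> C * real N * \<delta> * L2_nrm (right_deriv \<phi>)"
    using inner_deriv_spline_deriv_le[of k] by blast
  show ?thesis
  proof (intro exI[of _ "(2 + C) * (K * \<bar>B\<bar>)"] conjI allI impI)
    show "0 \<le> (2 + C) * (K * \<bar>B\<bar>)" using K(1) C(1) by simp
    fix N :: nat and Dm Du assume N: "N \<ge> 1" and Dm: "smooth_bound ?n B Dm" and Du: "smooth_bound ?n B Du"
      and m: "\<forall>x. Dm 0 x = Du 0 x - Du (Suc (Suc 0)) x"
    define hr where "hr = (1 / real N) ^ Suc (Suc k)"
    have B: "B \<ge> 0" by (rule smooth_bound_nonneg[OF Dm])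
    define A where "A = (2 + C) * (K * \<bar>B\<bar>) * hr"
    have A0: "A \<ge> 0" using K(1) C(1) by (simp add: A_def hr_def)
    define M where "M = quasi_spline k N (Dm 0)"
    define Q where "Q = quasi_spline k N (Du 0)"
    define em where "em = (\<lambda>x. Dm 0 x - M x)"
    define eu where "eu = (\<lambda>x. Du 0 x - Q x)"
    define eu' where "eu' = (\<lambda>x. Du (Suc 0) x - right_deriv Q x)"
    have M: "M \<in> spline_space (Suc (Suc k)) N" unfolding M_def
      by (rule quasi_spline_in_space[OF N]) (use Dm in \<open>simp add: smooth_bound_def\<close>)
    have Q: "Q \<in> spline_space (Suc (Suc k)) N" unfolding Q_def
      by (rule quasi_spline_in_space[OF N]) (use Du in \<open>simp add: smooth_bound_def\<close>)
    note bbM = spline_bounded_borel(1)[OF M N]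
    have pm: "pw_deriv (Dm 0) (Dm (Suc 0))" by (rule smooth_bound_pw_deriv[OF Dm]) simp
    have pu: "pw_deriv (Du 0) (Du (Suc 0))" by (rule smooth_bound_pw_deriv[OF Du]) simp
    have peu: "pw_deriv eu eu'" unfolding eu_def eu'_def by (rule pw_deriv_diff[OF pu pw_deriv_spline[OF Q N]])
    have bbem: "bounded_borel em" unfolding em_def
      by (intro bounded_borel_diff bbM pw_deriv_bounded_borel[OF pm])
    have em: "\<bar>em x\<bar> \<le> K * B * hr" for x unfolding em_def M_def hr_def using K(2)[OF N Dm] by blast
    have eu: "\<bar>eu x\<bar> \<le> K * B * hr" for x unfolding eu_def Q_def hr_def using K(2)[OF N Du] by blast
    have eu2: "\<forall>x. \<bar>eu (x + 1 / real N) - eu x\<bar> \<le> K * B * (1 / real N) ^ Suc (Suc (Suc k))"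
      unfolding eu_def Q_def using K(2)[OF N Du] by blast
    define U where "U = elliptic k N M"
    have U: "U \<in> spline_space (Suc (Suc k)) N" unfolding U_def by (rule elliptic(1)[OF N bbM])
    define d where "d = (\<lambda>x. U x - Q x)"
    have d: "d \<in> spline_space (Suc (Suc k)) N" unfolding d_def by (rule spline_diff(1)[OF N U Q])
    note bbd = spline_bounded_borel[OF d N]
    have bQ: "bounded_borel Q" "bounded_borel (right_deriv Q)" by (intro spline_bounded_borel[OF Q N])+
    have bu: "bounded_borel (Du 0)" "bounded_borel (Du (Suc 0))" "bounded_borel (Dm 0)"
      using pu pm pw_deriv_bounded_borel pw_deriv_bounded_borel' by blast+
    have "h1_inner d d = h1_inner U d - h1_inner Q d"
      using h1_inner_linear_left[OF N U Q d, of 1 "-1"] by (simp add: d_def)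
    also have "h1_inner U d = L2_inner M d" unfolding U_def by (rule elliptic(2)[OF N bbM d])
    also have "L2_inner M d = L2_inner (Dm 0) d - L2_inner em d"
    proof -
      have "M = (\<lambda>x. Dm 0 x - em x)" by (simp add: em_def)
      then show ?thesis using L2_inner_diff_left[OF bu(3) bbem bbd(1)] by simp
    qed
    also have "L2_inner (Dm 0) d = L2_inner (Du 0) d + L2_inner (Du (Suc 0)) (right_deriv d)"
      by (rule smooth_h1_inner[OF N Du _ d]) (use m in blast)
    also have "\<dots> - L2_inner em d - h1_inner Q d = L2_inner eu d + L2_inner eu' (right_deriv d) - L2_inner em d"
      unfolding eu_def eu'_def h1_inner_def by (simp add: L2_inner_diff_left bu bQ bbd)
    also have "\<dots> \<le> (K * B * hr) * L2_nrm d + C * (K * B * hr) * L2_nrm (right_deriv d) + (K * B * hr) * L2_nrm d"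
    proof -
      have "\<bar>L2_inner eu d\<bar> \<le> (K * B * hr) * L2_nrm d"
        by (rule L2_inner_le_sup) (use eu bbd pw_deriv_bounded_borel[OF peu] in auto)
      moreover have "\<bar>L2_inner em d\<bar> \<le> (K * B * hr) * L2_nrm d"
        by (rule L2_inner_le_sup) (use em bbd bbem in auto)
      moreover have "\<bar>L2_inner eu' (right_deriv d)\<bar> \<le> C * (K * B * hr) * L2_nrm (right_deriv d)"
      proof -
        have "C * real N * (K * B * (1 / real N) ^ Suc (Suc (Suc k))) = C * (K * B) * (real N * (1 / real N) ^ Suc (Suc (Suc k)))"
          by (simp only: mult_ac)
        also have "\<dots> = C * (K * B * hr)" unfolding mesh_power(1)[OF N] hr_def by (simp only: mult_ac)
        finally show ?thesis using C(2)[OF N d peu eu2] by (simp only:)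
      qed
      ultimately show ?thesis by linarith
    qed
    also have "\<dots> \<le> A * sqrt (h1_inner d d)"
    proof -
      have KBh: "0 \<le> K * B * hr" using K(1) B by (simp add: hr_def)
      have "(K * B * hr) * L2_nrm d \<le> (K * B * hr) * sqrt (h1_inner d d)"
        by (intro mult_left_mono L2_nrm_le_h1 KBh)
      moreover have "C * (K * B * hr) * L2_nrm (right_deriv d) \<le> C * (K * B * hr) * sqrt (h1_inner d d)"
        by (intro mult_left_mono L2_nrm_le_h1) (use KBh C(1) in simp)
      ultimately show ?thesis using B by (simp add: A_def algebra_simps)
    qed
    finally have *: "h1_inner d d \<le> A * sqrt (h1_inner d d)" .
    show "L2_nrm (\<lambda>x. elliptic k N (quasi_spline k N (Dm 0)) x - quasi_spline k N (Du 0) x) \<le> (2 + C) * (K * \<bar>B\<bar>) * (1 / real N) ^ Suc (Suc k)"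
      using h1_self_bound(1)[OF * A0] unfolding d_def U_def M_def Q_def A_def hr_def .
    show "L2_nrm (right_deriv (\<lambda>x. elliptic k N (quasi_spline k N (Dm 0)) x - quasi_spline k N (Du 0) x)) \<le> (2 + C) * (K * \<bar>B\<bar>) * (1 / real N) ^ Suc (Suc k)"
      using h1_self_bound(2)[OF * A0] unfolding d_def U_def M_def Q_def A_def hr_def .
  qed
qed

text \<open>All that the evolution argument uses about one time slice, with one constant. The last
  clause is the residual of \<open>(M, U)\<close> in the scheme; for \<open>U\<close> only the
  derivative is bounded pointwise, as this is what the energy estimate asks of the velocity.\<close>

definition consistent :: "nat \<Rightarrow> nat \<Rightarrow> real \<Rightarrow> (real \<Rightarrow> real) \<Rightarrow> (real \<Rightarrow> real) \<Rightarrow> bool" where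
  "consistent k N C m u \<longleftrightarrow>
     (let h = 1 / real N; M = quasi_spline k N m; U = elliptic k N M in
      L2_nrm (\<lambda>x. m x - M x) \<le> C * h ^ Suc (Suc k) \<and>
      L2_nrm (\<lambda>x. u x - U x) \<le> C * h ^ Suc (Suc k) \<and>
      (\<forall>x. \<bar>M x\<bar> \<le> C \<and> \<bar>right_deriv M x\<bar> \<le> C \<and> \<bar>right_deriv U x\<bar> \<le> C) \<and>
      (\<forall>\<phi>\<in>spline_space (Suc (Suc k)) N.
         \<bar>conv_form M U \<phi> - conv_form m u \<phi>\<bar> \<le> C * h ^ Suc (Suc k) * L2_nrm \<phi>))"

text \<open>The products are expanded around the exact pair. Terms with the spline difference
  \<open>d\<close> are integrated by parts. Terms with one smooth factor and one interpolation error
  against \<phi>' use the small increments. In the product of two errors the second power of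
  \<open>h^r\<close> pays for an inverse inequality.\<close>

lemma consistency:
  "\<exists>C\<ge>1. \<forall>N\<ge>1. \<forall>Dm Du. smooth_bound (Suc (Suc (Suc k))) B Dm \<longrightarrow> smooth_bound (Suc (Suc (Suc k))) B Du \<longrightarrow>
     (\<forall>x. Dm 0 x = Du 0 x - Du (Suc (Suc 0)) x) \<longrightarrow> consistent k N C (Dm 0) (Du 0)"
proof -
  let ?n = "Suc (Suc (Suc k))"
  obtain K where K: "K \<ge> 1" "\<And>N D B x. N \<ge> 1 \<Longrightarrow> smooth_bound ?n B D \<Longrightarrow>
     \<bar>D 0 x - quasi_spline k N (D 0) x\<bar> \<le> K * B * (1 / real N) ^ Suc (Suc k) \<and>
     \<bar>(D 0 (x + 1 / real N) - quasi_spline k N (D 0) (x + 1 / real N)) - (D 0 x - quasi_spline k N (D 0) x)\<bar>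
        \<le> K * B * (1 / real N) ^ Suc (Suc (Suc k)) \<and>
     \<bar>quasi_spline k N (D 0) x\<bar> \<le> K * B \<and> \<bar>right_deriv (quasi_spline k N (D 0)) x\<bar> \<le> K * B"
    using quasi_spline_estimates[of k] by blast
  obtain E where E: "E \<ge> 0" "\<And>N Dm Du. N \<ge> 1 \<Longrightarrow> smooth_bound ?n B Dm \<Longrightarrow> smooth_bound ?n B Du \<Longrightarrow>
     (\<forall>x. Dm 0 x = Du 0 x - Du (Suc (Suc 0)) x) \<Longrightarrow>
     L2_nrm (\<lambda>x. elliptic k N (quasi_spline k N (Dm 0)) x - quasi_spline k N (Du 0) x) \<le> E * (1 / real N) ^ Suc (Suc k) \<and>
     L2_nrm (right_deriv (\<lambda>x. elliptic k N (quasi_spline k N (Dm 0)) x - quasi_spline k N (Du 0) x)) \<le> E * (1 / real N) ^ Suc (Suc k)"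
    using elliptic_quasi_spline_error[of k B] by blast
  obtain I where I: "I \<ge> 1" "\<And>N \<phi>. N \<ge> 1 \<Longrightarrow> \<phi> \<in> spline_space (Suc (Suc k)) N \<Longrightarrow>
     (\<forall>x. \<bar>\<phi> x\<bar> \<le> I * sqrt (real N) * L2_nrm \<phi>) \<and>
     (\<forall>x. \<bar>right_deriv \<phi> x\<bar> \<le> I * real N * sqrt (real N) * L2_nrm \<phi>) \<and>
     L2_nrm (right_deriv \<phi>) \<le> I * real N * L2_nrm \<phi>"
    using inverse_inequalities[of k] by blast
  obtain P where P: "P \<ge> 0" "\<And>N D F K \<phi>. N \<ge> 1 \<Longrightarrow> \<phi> \<in> spline_space (Suc (Suc k)) N \<Longrightarrow>
     smooth_bound ?n B D \<Longrightarrow> bounded_borel F \<Longrightarrow> periodic1 F \<Longrightarrow>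
     (\<forall>x. \<bar>F x\<bar> \<le> K * (1 / real N) ^ Suc (Suc k)) \<Longrightarrow>
     (\<forall>x. \<bar>F (x + 1 / real N) - F x\<bar> \<le> K * (1 / real N) ^ Suc (Suc (Suc k))) \<Longrightarrow>
     \<bar>L2_inner (\<lambda>x. D 0 x * F x) (right_deriv \<phi>)\<bar> \<le> P * K * (1 / real N) ^ Suc (Suc k) * L2_nrm \<phi>"
    using L2_inner_smooth_mult_error_le[of k B] by blast
  define b where "b = \<bar>B\<bar>"
  define L where "L = K * b"
  \<comment> \<open>The sum of the constants of \<open>t1\<close> to \<open>t7\<close> below;
    \<open>P * L\<close> occurs three times because the term with \<open>Dm 0 * eu\<close> enters
    twice.\<close>
  define Cc where "Cc = 3 * (P * L) + b * L + b * L + L * L * I + L * (b + L) + 3 * L * E"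
  define C where "C = 1 + L + E + I * E + Cc"
  have b0: "b \<ge> 0" "L \<ge> 0" using K(1) by (simp_all add: b_def L_def)
  have Cc0: "Cc \<ge> 0" using P(1) b0 I(1) E(1) by (simp add: Cc_def)
  have IE: "0 \<le> I * E" using I(1) E(1) by simp
  have CL: "1 \<le> C" "L \<le> C" "L + E \<le> C" "Cc \<le> C" "L + I * E \<le> C" using b0 Cc0 E(1) IE by (simp_all add: C_def)
  show ?thesis
  proof (intro exI[of _ C] conjI allI impI CL)
    fix N :: nat and Dm Du assume N: "N \<ge> 1" and Dm: "smooth_bound ?n B Dm" and Du: "smooth_bound ?n B Du"
      and m: "\<forall>x. Dm 0 x = Du 0 x - Du (Suc (Suc 0)) x"
    define hr where "hr = (1 / real N) ^ Suc (Suc k)"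
    have hr: "0 \<le> hr" "hr \<le> 1" unfolding hr_def by (simp, rule mesh_power(3)[OF N])
    have Bb: "B = b" using smooth_bound_nonneg[OF Dm] by (simp add: b_def)
    define M where "M = quasi_spline k N (Dm 0)"
    define Q where "Q = quasi_spline k N (Du 0)"
    define U where "U = elliptic k N M"
    define d where "d = (\<lambda>x. U x - Q x)"
    define em where "em = (\<lambda>x. Dm 0 x - M x)"
    define eu where "eu = (\<lambda>x. Du 0 x - Q x)"
    define eu' where "eu' = (\<lambda>x. Du (Suc 0) x - right_deriv Q x)"
    have M: "M \<in> spline_space (Suc (Suc k)) N" unfolding M_def
      by (rule quasi_spline_in_space[OF N]) (use Dm in \<open>simp add: smooth_bound_def\<close>)
    have Q: "Q \<in> spline_space (Suc (Suc k)) N" unfolding Q_def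
      by (rule quasi_spline_in_space[OF N]) (use Du in \<open>simp add: smooth_bound_def\<close>)
    have U: "U \<in> spline_space (Suc (Suc k)) N" unfolding U_def by (rule elliptic(1)[OF N spline_bounded_borel(1)[OF M N]])
    have d: "d \<in> spline_space (Suc (Suc k)) N" unfolding d_def by (rule spline_diff(1)[OF N U Q])
    have dd: "right_deriv d = (\<lambda>x. right_deriv U x - right_deriv Q x)" unfolding d_def by (rule spline_diff(2)[OF N U Q])
    have pm: "pw_deriv (Dm 0) (Dm (Suc 0))" by (rule smooth_bound_pw_deriv[OF Dm]) simp
    have pu: "pw_deriv (Du 0) (Du (Suc 0))" by (rule smooth_bound_pw_deriv[OF Du]) simp
    have peu: "pw_deriv eu eu'" unfolding eu_def eu'_def by (rule pw_deriv_diff[OF pu pw_deriv_spline[OF Q N]])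
    have pem: "pw_deriv em (\<lambda>x. Dm (Suc 0) x - right_deriv M x)" unfolding em_def by (rule pw_deriv_diff[OF pm pw_deriv_spline[OF M N]])
    note bb = pw_deriv_bounded_borel[OF pm] pw_deriv_bounded_borel[OF pu] pw_deriv_bounded_borel'[OF pu]
      pw_deriv_bounded_borel'[OF pm] pw_deriv_bounded_borel[OF peu] pw_deriv_bounded_borel'[OF peu]
      pw_deriv_bounded_borel[OF pem]
      spline_bounded_borel[OF M N] spline_bounded_borel[OF Q N] spline_bounded_borel[OF U N] spline_bounded_borel[OF d N]
    have per: "periodic1 em" "periodic1 eu" using pem peu by (simp_all add: pw_deriv_def)
    have em: "\<bar>em x\<bar> \<le> L * hr" for x unfolding em_def M_def hr_def L_def Bb[symmetric] using K(2)[OF N Dm] by blast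
    have eu: "\<bar>eu x\<bar> \<le> L * hr" for x unfolding eu_def Q_def hr_def L_def Bb[symmetric] using K(2)[OF N Du] by blast
    have em2: "\<forall>x. \<bar>em (x + 1 / real N) - em x\<bar> \<le> L * (1 / real N) ^ Suc (Suc (Suc k))"
      unfolding em_def M_def L_def Bb[symmetric] using K(2)[OF N Dm] by blast
    have eu2: "\<forall>x. \<bar>eu (x + 1 / real N) - eu x\<bar> \<le> L * (1 / real N) ^ Suc (Suc (Suc k))"
      unfolding eu_def Q_def L_def Bb[symmetric] using K(2)[OF N Du] by blast
    have Mb: "\<bar>M x\<bar> \<le> L" "\<bar>right_deriv M x\<bar> \<le> L" for x unfolding M_def L_def Bb[symmetric] using K(2)[OF N Dm] by blast+
    have Qb: "\<bar>right_deriv Q x\<bar> \<le> L" for x unfolding Q_def L_def Bb[symmetric] using K(2)[OF N Du] by blast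
    have db: "L2_nrm d \<le> E * hr" "L2_nrm (right_deriv d) \<le> E * hr"
      unfolding d_def U_def M_def Q_def hr_def using E(2)[OF N Dm Du m] by blast+
    have "L2_nrm em \<le> L * hr" by (rule L2_nrm_le_sup) (use em bb in auto)
    also have "\<dots> \<le> C * hr" by (intro mult_right_mono CL hr)
    finally have 1: "L2_nrm em \<le> C * hr" .
    have "(\<lambda>x. Du 0 x - U x) = (\<lambda>x. eu x - d x)" by (simp add: eu_def d_def)
    then have "L2_nrm (\<lambda>x. Du 0 x - U x) \<le> L2_nrm eu + L2_nrm d" using L2_nrm_diff_triangle bb by simp
    also have "L2_nrm eu \<le> L * hr" by (rule L2_nrm_le_sup) (use eu bb in auto)
    also have "L * hr + L2_nrm d \<le> (L + E) * hr" using db(1) by (simp add: distrib_right)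
    also have "\<dots> \<le> C * hr" by (intro mult_right_mono CL hr)
    finally have 2: "L2_nrm (\<lambda>x. Du 0 x - U x) \<le> C * hr" by simp
    \<comment> \<open>The inverse inequality for \<open>d\<close> costs \<open>N * sqrt N\<close>,
      which the factor \<open>hr\<close> absorbs because r >= 2.\<close>
    have 3: "\<bar>right_deriv U x\<bar> \<le> C" for x
    proof -
      have "\<bar>right_deriv d x\<bar> \<le> I * real N * sqrt (real N) * L2_nrm d" using I(2)[OF N d] by blast
      also have "\<dots> \<le> I * real N * sqrt (real N) * (E * hr)" by (intro mult_left_mono db) (use I(1) in simp)
      also have "\<dots> = I * E * (real N * sqrt (real N) * hr)" by (simp only: mult_ac)
      also have "\<dots> \<le> I * E * 1" unfolding hr_def by (intro mult_left_mono mesh_power(2) N IE)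
      finally have "\<bar>right_deriv d x\<bar> \<le> I * E" by simp
      moreover have "right_deriv U x = right_deriv Q x + right_deriv d x" by (simp add: dd)
      ultimately have "\<bar>right_deriv U x\<bar> \<le> L + I * E" using Qb[of x] by linarith
      then show ?thesis using CL(5) by linarith
    qed
    have 4: "\<bar>conv_form M U \<phi> - conv_form (Dm 0) (Du 0) \<phi>\<bar> \<le> C * hr * L2_nrm \<phi>"
      if \<phi>: "\<phi> \<in> spline_space (Suc (Suc k)) N" for \<phi>
    proof -
      note b\<phi> = spline_bounded_borel[OF \<phi> N]
      define n where "n = L2_nrm \<phi>"
      have n: "n \<ge> 0" by (simp add: n_def L2_nrm_nonneg)
      let ?p = "right_deriv \<phi>"
      have "(\<lambda>x. M x * U x) = (\<lambda>x. Dm 0 x * Du 0 x + (M x * d x - Du 0 x * em x - Dm 0 x * eu x + em x * eu x))"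
        by (rule ext) (simp add: em_def eu_def d_def algebra_simps)
      then have e1: "L2_inner (\<lambda>x. M x * U x) ?p = L2_inner (\<lambda>x. Dm 0 x * Du 0 x) ?p + (L2_inner (\<lambda>x. M x * d x) ?p
          - L2_inner (\<lambda>x. Du 0 x * em x) ?p - L2_inner (\<lambda>x. Dm 0 x * eu x) ?p + L2_inner (\<lambda>x. em x * eu x) ?p)"
        by (simp add: L2_inner_add_left L2_inner_diff_left bounded_borel_mult bounded_borel_add bounded_borel_diff bb b\<phi>)
      have "(\<lambda>x. M x * right_deriv U x) = (\<lambda>x. Dm 0 x * Du (Suc 0) x + (M x * right_deriv d x - Du (Suc 0) x * em x - Dm 0 x * eu' x + em x * eu' x))"
        by (rule ext) (simp add: em_def eu'_def dd algebra_simps)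
      then have e2: "L2_inner (\<lambda>x. M x * right_deriv U x) \<phi> = L2_inner (\<lambda>x. Dm 0 x * Du (Suc 0) x) \<phi> + (L2_inner (\<lambda>x. M x * right_deriv d x) \<phi>
          - L2_inner (\<lambda>x. Du (Suc 0) x * em x) \<phi> - L2_inner (\<lambda>x. Dm 0 x * eu' x) \<phi> + L2_inner (\<lambda>x. em x * eu' x) \<phi>)"
        by (simp add: L2_inner_add_left L2_inner_diff_left bounded_borel_mult bounded_borel_add bounded_borel_diff bb b\<phi>)
      \<comment> \<open>\<open>eu'\<close> alone is only of order r - 1. Moving the derivative onto
        \<phi> replaces it by \<open>eu\<close>, for which the superconvergent bound is
        available.\<close>
      have "L2_inner (\<lambda>x. Dm (Suc 0) x * eu x + Dm 0 x * eu' x) \<phi> = - L2_inner (\<lambda>x. Dm 0 x * eu x) ?p"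
        by (rule L2_inner_by_parts[OF pw_deriv_mult[OF pm peu] pw_deriv_spline[OF \<phi> N]])
      then have e3: "L2_inner (\<lambda>x. Dm 0 x * eu' x) \<phi> = - L2_inner (\<lambda>x. Dm 0 x * eu x) ?p - L2_inner (\<lambda>x. Dm (Suc 0) x * eu x) \<phi>"
        by (simp add: L2_inner_add_left bounded_borel_mult bb b\<phi>)
      have ru: "right_deriv (Du 0) = Du (Suc 0)" by (rule smooth_bound_right_deriv[OF Du]) simp
      have eq: "conv_form M U \<phi> - conv_form (Dm 0) (Du 0) \<phi> =
         (L2_inner (\<lambda>x. M x * d x) ?p - L2_inner (\<lambda>x. M x * right_deriv d x) \<phi>)
         - L2_inner (\<lambda>x. Du 0 x * em x) ?p - 2 * L2_inner (\<lambda>x. Dm 0 x * eu x) ?p + L2_inner (\<lambda>x. em x * eu x) ?p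
         + L2_inner (\<lambda>x. Du (Suc 0) x * em x) \<phi> - L2_inner (\<lambda>x. Dm (Suc 0) x * eu x) \<phi> - L2_inner (\<lambda>x. em x * eu' x) \<phi>"
        unfolding conv_form_def ru e1 e2 e3 by simp
      have Lh: "0 \<le> L * hr" using b0 hr by simp
      have t1: "\<bar>L2_inner (\<lambda>x. M x * d x) ?p - L2_inner (\<lambda>x. M x * right_deriv d x) \<phi>\<bar> \<le> 3 * L * (E * hr) * n"
        unfolding n_def by (rule L2_inner_deriv_mult_le[OF pw_deriv_spline[OF M N] pw_deriv_spline[OF d N] pw_deriv_spline[OF \<phi> N] Mb db])
      have t2: "\<bar>L2_inner (\<lambda>x. Du 0 x * em x) ?p\<bar> \<le> P * L * hr * n"
        unfolding n_def hr_def by (rule P(2)[OF N \<phi> Du]) (use bb per em em2 in \<open>auto simp: hr_def\<close>)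
      have t3: "\<bar>L2_inner (\<lambda>x. Dm 0 x * eu x) ?p\<bar> \<le> P * L * hr * n"
        unfolding n_def hr_def by (rule P(2)[OF N \<phi> Dm]) (use bb per eu eu2 in \<open>auto simp: hr_def\<close>)
      have t4: "\<bar>L2_inner (\<lambda>x. em x * eu x) ?p\<bar> \<le> L * L * I * hr * n"
      proof -
        have "\<bar>L2_inner (\<lambda>x. em x * eu x) ?p\<bar> \<le> (L * hr) * L2_nrm eu * L2_nrm ?p"
          by (rule L2_inner_le3) (use em bb b\<phi> in auto)
        also have "\<dots> \<le> (L * hr) * (L * hr) * (I * real N * n)"
        proof (intro mult_mono mult_left_mono Lh)
          show "L2_nrm eu \<le> L * hr" by (rule L2_nrm_le_sup) (use eu bb in auto)
          show "L2_nrm ?p \<le> I * real N * n" unfolding n_def using I(2)[OF N \<phi>] by blast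
        qed (use b0 hr L2_nrm_nonneg in auto)
        also have "\<dots> = L * L * I * hr * n * (real N * hr)" by (simp only: mult_ac)
        also have "real N * hr = (1 / real N) ^ Suc k" unfolding hr_def by (rule mesh_power(1)[OF N])
        also have "L * L * I * hr * n * (1 / real N) ^ Suc k \<le> L * L * I * hr * n * 1"
          by (intro mult_left_mono mesh_power(3)[OF N]) (use b0 I(1) hr n in simp)
        finally show ?thesis by simp
      qed
      have t5: "\<bar>L2_inner (\<lambda>x. Du (Suc 0) x * em x) \<phi>\<bar> \<le> b * (L * hr) * n"
      proof -
        have "\<bar>L2_inner (\<lambda>x. Du (Suc 0) x * em x) \<phi>\<bar> \<le> b * L2_nrm em * L2_nrm \<phi>"
          by (rule L2_inner_le3) (use bb b\<phi> smooth_bound_le[OF Du] Bb in auto)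
        also have "\<dots> \<le> b * (L * hr) * n" unfolding n_def
          by (intro mult_right_mono mult_left_mono b0 L2_nrm_nonneg L2_nrm_le_sup) (use em bb in auto)
        finally show ?thesis .
      qed
      have t6: "\<bar>L2_inner (\<lambda>x. Dm (Suc 0) x * eu x) \<phi>\<bar> \<le> b * (L * hr) * n"
      proof -
        have "\<bar>L2_inner (\<lambda>x. Dm (Suc 0) x * eu x) \<phi>\<bar> \<le> b * L2_nrm eu * L2_nrm \<phi>"
          by (rule L2_inner_le3) (use bb b\<phi> smooth_bound_le[OF Dm] Bb in auto)
        also have "\<dots> \<le> b * (L * hr) * n" unfolding n_def
          by (intro mult_right_mono mult_left_mono b0 L2_nrm_nonneg L2_nrm_le_sup) (use eu bb in auto)
        finally show ?thesis .
      qed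
      have t7: "\<bar>L2_inner (\<lambda>x. em x * eu' x) \<phi>\<bar> \<le> L * hr * (b + L) * n"
      proof -
        have "\<bar>L2_inner (\<lambda>x. em x * eu' x) \<phi>\<bar> \<le> (L * hr) * L2_nrm eu' * L2_nrm \<phi>"
          by (rule L2_inner_le3) (use em bb b\<phi> in auto)
        also have "\<dots> \<le> (L * hr) * (b + L) * n" unfolding n_def
        proof (intro mult_right_mono mult_left_mono Lh L2_nrm_nonneg L2_nrm_le_sup)
          fix x show "\<bar>eu' x\<bar> \<le> b + L" unfolding eu'_def
            using smooth_bound_le[OF Du, of "Suc 0" x] Qb[of x] Bb by simp
        qed (use bb in auto)
        finally show ?thesis .
      qed
      have "\<bar>conv_form M U \<phi> - conv_form (Dm 0) (Du 0) \<phi>\<bar> \<le> 3 * L * (E * hr) * n + P * L * hr * n + 2 * (P * L * hr * n)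
          + L * L * I * hr * n + b * (L * hr) * n + b * (L * hr) * n + L * hr * (b + L) * n"
        unfolding eq using t1 t2 t3 t4 t5 t6 t7 by linarith
      also have "\<dots> = Cc * hr * n" by (simp add: Cc_def algebra_simps)
      also have "\<dots> \<le> C * hr * n" by (intro mult_right_mono CL hr n)
      finally show ?thesis by (simp add: n_def)
    qed
    have 5: "\<bar>M x\<bar> \<le> C" "\<bar>right_deriv M x\<bar> \<le> C" for x using Mb[of x] CL(2) by linarith+
    show "consistent k N C (Dm 0) (Du 0)"
      unfolding consistent_def Let_def M_def[symmetric] U_def[symmetric] hr_def[symmetric]
      using 1 2 3 4 5 unfolding em_def by blast
  qed
qed

section \<open>Smooth solutions\<close>

text \<open>\<open>smooth_upto\<close> branches into time and space derivatives at each level;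
  following the space branch throughout produces the chain \<open>D\<close>.\<close>

lemma smooth_upto_space_derivs:
  "smooth_upto T n v \<Longrightarrow> \<exists>D. D 0 = v \<and> (\<forall>j\<le>n. continuous_on ({0..T} \<times> UNIV) (\<lambda>(t, x). D j t x)) \<and>
     (\<forall>j<n. \<forall>t\<in>{0..T}. \<forall>x. (D j t has_real_derivative D (Suc j) t x) (at x))"
proof (induction n arbitrary: v)
  case 0
  then show ?case by (intro exI[of _ "\<lambda>j. v"]) simp
next
  case (Suc n)
  have c: "continuous_on ({0..T} \<times> UNIV) (\<lambda>(t, x). v t x)" using Suc.prems by simp
  obtain vx where vx: "\<forall>t\<in>{0..T}. \<forall>x. (v t has_real_derivative vx t x) (at x)" "smooth_upto T n vx"
    using Suc.prems unfolding smooth_upto.simps by blast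
  obtain D where D: "D 0 = vx" "\<forall>j\<le>n. continuous_on ({0..T} \<times> UNIV) (\<lambda>(t, x). D j t x)"
     "\<forall>j<n. \<forall>t\<in>{0..T}. \<forall>x. (D j t has_real_derivative D (Suc j) t x) (at x)"
    using Suc.IH[OF vx(2)] by blast
  define D' where "D' = (\<lambda>j. case j of 0 \<Rightarrow> v | Suc i \<Rightarrow> D i)"
  have "\<forall>j\<le>Suc n. continuous_on ({0..T} \<times> UNIV) (\<lambda>(t, x). D' j t x)"
    using c D(2) by (auto simp: D'_def split: nat.split)
  moreover have "\<forall>j<Suc n. \<forall>t\<in>{0..T}. \<forall>x. (D' j t has_real_derivative D' (Suc j) t x) (at x)"
    using vx(1) D(1,3) by (auto simp: D'_def split: nat.split)
  moreover have "D' 0 = v" by (simp add: D'_def)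
  ultimately show ?case by blast
qed

lemma periodic1_derivative:
  assumes "periodic1 f" "\<And>x. (f has_real_derivative f' x) (at x)" shows "periodic1 f'"
  unfolding periodic1_def
proof
  fix x
  have "((\<lambda>y. f (y + 1)) has_real_derivative f' (x + 1)) (at x)"
    using DERIV_shift[of f "f' (x + 1)" x 1] assms(2) by blast
  moreover have "(\<lambda>y. f (y + 1)) = f" using assms(1) by (auto simp: periodic1_def)
  ultimately show "f' (x + 1) = f' x" using assms(2)[of x] DERIV_unique by metis
qed

lemma periodic_continuous_bounded:
  assumes c: "continuous_on ({0..T::real} \<times> UNIV) (\<lambda>(t, x). w t x)" and p: "\<And>t. t \<in> {0..T} \<Longrightarrow> periodic1 (w t)"
  shows "\<exists>B\<ge>0. \<forall>t\<in>{0..T}. \<forall>x::real. \<bar>w t x :: real\<bar> \<le> B"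
proof -
  have "compact ((\<lambda>(t, x). w t x) ` ({0..T} \<times> {0..1}))"
    by (intro compact_continuous_image continuous_on_subset[OF c] compact_Times compact_Icc) auto
  then obtain B where B: "\<forall>y\<in>(\<lambda>(t, x). w t x) ` ({0..T} \<times> {0..1}). \<bar>y\<bar> \<le> B"
    using compact_imp_bounded bounded_real by metis
  have "\<bar>w t x\<bar> \<le> max 0 B" if t: "t \<in> {0..T}" for t x
  proof (rule periodic1_bound[OF p[OF t]])
    fix x :: real assume "x \<in> {0..1}"
    then have "\<bar>w t x\<bar> \<le> B" using B t by force
    then show "\<bar>w t x\<bar> \<le> max 0 B" by simp
  qed
  then show ?thesis by (intro exI[of _ "max 0 B"]) auto
qed

lemma smooth_upto_smooth_bound:
  assumes v: "smooth_upto T n v" and p: "\<And>t. t \<in> {0..T} \<Longrightarrow> periodic1 (v t)"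
  shows "\<exists>D B. D 0 = v \<and> (\<forall>t\<in>{0..T}. smooth_bound n B (\<lambda>j. D j t))"
proof -
  obtain D where D0: "D 0 = v \<and> (\<forall>j\<le>n. continuous_on ({0..T} \<times> UNIV) (\<lambda>(t, x). D j t x)) \<and>
     (\<forall>j<n. \<forall>t\<in>{0..T}. \<forall>x. (D j t has_real_derivative D (Suc j) t x) (at x))"
    using smooth_upto_space_derivs[OF v] by (rule exE)
  have D: "D 0 = v" "continuous_on ({0..T} \<times> UNIV) (\<lambda>(t, x). D j t x)" if "j \<le> n" for j
    using D0 that by auto
  have D3: "(D j t has_real_derivative D (Suc j) t x) (at x)" if "j < n" "t \<in> {0..T}" for j t x
    using D0 that by auto
  have per: "periodic1 (D j t)" if "j \<le> n" "t \<in> {0..T}" for j t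
    using that
  proof (induction j)
    case 0
    then show ?case using D0 p by simp
  next
    case (Suc j)
    then show ?case using periodic1_derivative[of "D j t" "D (Suc j) t"] D3 by simp
  qed
  have "\<forall>j. \<exists>b. j \<le> n \<longrightarrow> b \<ge> 0 \<and> (\<forall>t\<in>{0..T}. \<forall>x. \<bar>D j t x\<bar> \<le> b)"
    using periodic_continuous_bounded[OF D(2) per] by blast
  then obtain B where B0: "\<forall>j. j \<le> n \<longrightarrow> B j \<ge> 0 \<and> (\<forall>t\<in>{0..T}. \<forall>x. \<bar>D j t x\<bar> \<le> B j)"
    by (rule choice[THEN exE])
  then have B: "j \<le> n \<Longrightarrow> B j \<ge> 0" "j \<le> n \<Longrightarrow> t \<in> {0..T} \<Longrightarrow> \<bar>D j t x\<bar> \<le> B j" for j t x by auto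
  have "\<bar>D j t x\<bar> \<le> (\<Sum>j\<le>n. B j)" if "j \<le> n" "t \<in> {0..T}" for j t x
  proof -
    have "B j \<le> (\<Sum>j\<le>n. B j)" using that B(1) by (intro member_le_sum) auto
    then show ?thesis using B(2)[OF that, of x] by linarith
  qed
  then show ?thesis
    using D0 per unfolding smooth_bound_def by (intro exI[of _ D] exI[of _ "\<Sum>j\<le>n. B j"]) auto
qed

lemma smooth_bound_mono: "smooth_bound n B D \<Longrightarrow> B \<le> B' \<Longrightarrow> smooth_bound n B' D"
  unfolding smooth_bound_def by (meson order_trans)

text \<open>Of \<open>n + 1\<close> orders of smoothness one is spent on the time derivative, so
  \<open>Dt\<close> still has \<open>n\<close> derivatives in space. One constant serves all three
  functions and all times by compactness and periodicity.\<close>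

lemma periodic_ivp_smooth_data:
  assumes T: "T > 0" and sol: "periodic_ivp_solution T u0 m u"
    and sm: "smooth_upto T (Suc n) m" and su: "smooth_upto T (Suc n) u" and n: "n \<ge> 2"
  shows "\<exists>B Dm Du Dt. Dm 0 = m \<and> Du 0 = u \<and> u0 = u 0 \<and>
     (\<forall>t\<in>{0..T}. smooth_bound n B (\<lambda>j. Dm j t) \<and> smooth_bound n B (\<lambda>j. Du j t) \<and> smooth_bound n B (\<lambda>j. Dt j t) \<and>
       (\<forall>x. ((\<lambda>s. m s x) has_real_derivative Dt 0 t x) (at t within {0..T}) \<and>
         m t x = Du 0 t x - Du (Suc (Suc 0)) t x) \<and>
       (\<forall>x\<in>{0..1}. Dt 0 t x + (Dm (Suc 0) t x * u t x + m t x * Du (Suc 0) t x) + m t x * Du (Suc 0) t x = 0))"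
proof -
  have pm: "periodic1 (m t)" "periodic1 (u t)" if "t \<in> {0..T}" for t
    using sol that unfolding periodic_ivp_solution_def by blast+
  obtain mt mx where mt: "\<And>t x. t \<in> {0..T} \<Longrightarrow> ((\<lambda>s. m s x) has_real_derivative mt t x) (at t within {0..T})" "smooth_upto T n mt"
    using sm unfolding smooth_upto.simps by blast
  have nt: "at t within {0..T} \<noteq> bot" if "t \<in> {0..T}" for t
    using T that by (simp add: trivial_limit_within islimpt_Icc)
  have un: "a = b" if "t \<in> {0..T}" "(f has_real_derivative a) (at t within {0..T})" "(f has_real_derivative b) (at t within {0..T})" for f a b t
    using that(2,3) unfolding has_field_derivative_iff by (rule tendsto_unique[OF nt[OF that(1)]])
  have td: "time_deriv T m t x = mt t x" if t: "t \<in> {0..T}" for t x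
  proof (rule un[OF t _ mt(1)[OF t]])
    show "((\<lambda>s. m s x) has_real_derivative time_deriv T m t x) (at t within {0..T})"
      unfolding time_deriv_def has_real_derivative_iff_has_vector_derivative vector_derivative_works[symmetric]
      using mt(1)[OF t] has_real_derivative_iff_has_vector_derivative differentiableI_vector by blast
  qed
  have pt: "periodic1 (mt t)" if t: "t \<in> {0..T}" for t
    unfolding periodic1_def
  proof
    fix x
    show "mt t (x + 1) = mt t x"
    proof (rule un[OF t mt(1)[OF t]])
      show "((\<lambda>s. m s (x + 1)) has_real_derivative mt t x) (at t within {0..T})"
        by (rule has_field_derivative_transform_within[OF mt(1)[OF t, of x] zero_less_one t])
          (use pm(1) in \<open>simp add: periodic1_def\<close>)
    qed
  qed
  have sd: "smooth_upto T n v" if "smooth_upto T (Suc n) v" for n v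
    using that
  proof (induction n arbitrary: v)
    case (Suc n)
    then show ?case
      unfolding smooth_upto.simps(2)[of T "Suc n" v] smooth_upto.simps(2)[of T n v] by blast
  qed simp
  obtain Dm B1 where Dm: "Dm 0 = m" "\<And>t. t \<in> {0..T} \<Longrightarrow> smooth_bound n B1 (\<lambda>j. Dm j t)"
    using smooth_upto_smooth_bound[OF sd[OF sm] pm(1)] by blast
  obtain Du B2 where Du: "Du 0 = u" "\<And>t. t \<in> {0..T} \<Longrightarrow> smooth_bound n B2 (\<lambda>j. Du j t)"
    using smooth_upto_smooth_bound[OF sd[OF su] pm(2)] by blast
  obtain Dt B3 where Dt: "Dt 0 = mt" "\<And>t. t \<in> {0..T} \<Longrightarrow> smooth_bound n B3 (\<lambda>j. Dt j t)"
    using smooth_upto_smooth_bound[OF mt(2) pt] by blast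
  define B where "B = max B1 (max B2 B3)"
  have sb: "smooth_bound n B (\<lambda>j. Dm j t)" "smooth_bound n B (\<lambda>j. Du j t)" "smooth_bound n B (\<lambda>j. Dt j t)"
    if t: "t \<in> {0..T}" for t
    using smooth_bound_mono[OF Dm(2)[OF t], of B] smooth_bound_mono[OF Du(2)[OF t], of B]
      smooth_bound_mono[OF Dt(2)[OF t], of B] by (simp_all add: B_def)
  have dm: "(m t has_real_derivative Dm (Suc 0) t x) (at x)" if "t \<in> {0..T}" for t x
    using sb(1)[OF that] n Dm(1) unfolding smooth_bound_def by fastforce
  have du: "(u t has_real_derivative Du (Suc 0) t x) (at x)" if "t \<in> {0..T}" for t x
    using sb(2)[OF that] n Du(1) unfolding smooth_bound_def by fastforce
  have ddu: "(Du (Suc 0) t has_real_derivative Du (Suc (Suc 0)) t x) (at x)" if "t \<in> {0..T}" for t x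
    using sb(2)[OF that] n unfolding smooth_bound_def by force
  have dU: "deriv (u t) = Du (Suc 0) t" if "t \<in> {0..T}" for t
    by (rule ext, rule DERIV_imp_deriv, rule du[OF that])
  \<comment> \<open>The relation is given on \<open>[0, 1]\<close> and extended to the line by
    periodicity through the fractional part; the evolution equation can stay on
    \<open>[0, 1]\<close>, as it enters only under integrals.\<close>
  have ell: "m t x = Du 0 t x - Du (Suc (Suc 0)) t x" if t: "t \<in> {0..T}" for t x
  proof -
    have f: "frac x \<in> {0..1}" using frac_lt_1[of x] frac_ge_0[of x] by simp
    have "m t (frac x) = u t (frac x) - deriv (deriv (u t)) (frac x)"
      using sol t f unfolding periodic_ivp_solution_def by blast
    also have "deriv (deriv (u t)) (frac x) = Du (Suc (Suc 0)) t (frac x)"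
      unfolding dU[OF t] by (rule DERIV_imp_deriv, rule ddu[OF t])
    finally show ?thesis
      using periodic1_frac[OF pm(1)[OF t]] periodic1_frac[OF pm(2)[OF t]] periodic1_frac[of "Du (Suc (Suc 0)) t"]
        sb(2)[OF t] n Du(1) by (simp add: smooth_bound_def)
  qed
  have pde: "Dt 0 t x + (Dm (Suc 0) t x * u t x + m t x * Du (Suc 0) t x) + m t x * Du (Suc 0) t x = 0"
    if t: "t \<in> {0..T}" and x: "x \<in> {0..1}" for t x
  proof -
    have "time_deriv T m t x + deriv (\<lambda>y. m t y * u t y) x + m t x * deriv (u t) x = 0"
      using sol t x unfolding periodic_ivp_solution_def by blast
    moreover have "deriv (\<lambda>y. m t y * u t y) x = Dm (Suc 0) t x * u t x + m t x * Du (Suc 0) t x"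
      by (rule DERIV_imp_deriv) (auto intro!: derivative_eq_intros dm du t)
    ultimately show ?thesis using td[OF t] dU[OF t] Dt(1) by simp
  qed
  have "u0 = u 0"
  proof
    fix x :: real
    have f: "frac x \<in> {0..1}" using frac_lt_1[of x] frac_ge_0[of x] by simp
    have "u 0 (frac x) = u0 (frac x)" and p0: "periodic1 u0" using sol f unfolding periodic_ivp_solution_def by blast+
    then show "u0 x = u 0 x" using periodic1_frac[OF p0, of x] periodic1_frac[OF pm(2)[of 0], of x] T by simp
  qed
  then show ?thesis
    using Dm(1) Du(1) Dt(1) sb ell pde mt(1)
    by (intro exI[of _ B] exI[of _ Dm] exI[of _ Du] exI[of _ Dt]) auto
qed

lemma pde_weak_form:
  assumes N: "N \<ge> 1" and Dm: "smooth_bound (Suc (Suc (Suc k))) B Dm" and Du: "smooth_bound (Suc (Suc (Suc k))) B Du"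
    and pde: "\<forall>x\<in>{0..1}. mt x + (Dm (Suc 0) x * Du 0 x + Dm 0 x * Du (Suc 0) x) + Dm 0 x * Du (Suc 0) x = 0"
    and \<phi>: "\<phi> \<in> spline_space (Suc (Suc k)) N"
  shows "L2_inner mt \<phi> = conv_form (Dm 0) (Du 0) \<phi>"
proof -
  have pm: "pw_deriv (Dm 0) (Dm (Suc 0))" by (rule smooth_bound_pw_deriv[OF Dm]) simp
  have pu: "pw_deriv (Du 0) (Du (Suc 0))" by (rule smooth_bound_pw_deriv[OF Du]) simp
  note p = pw_deriv_mult[OF pm pu]
  have b: "bounded_borel (\<lambda>x. Dm 0 x * Du (Suc 0) x)"
    by (intro bounded_borel_mult pw_deriv_bounded_borel[OF pm] pw_deriv_bounded_borel'[OF pu])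
  have "L2_inner mt \<phi> = L2_inner (\<lambda>x. - (Dm (Suc 0) x * Du 0 x + Dm 0 x * Du (Suc 0) x) - Dm 0 x * Du (Suc 0) x) \<phi>"
  proof (rule L2_inner_cong_off_finite[of "{}"])
    fix x :: real assume "x \<in> {0..1} - {}"
    then show "mt x = - (Dm (Suc 0) x * Du 0 x + Dm 0 x * Du (Suc 0) x) - Dm 0 x * Du (Suc 0) x"
      using pde by fastforce
  qed auto
  also have "\<dots> = - L2_inner (\<lambda>x. Dm (Suc 0) x * Du 0 x + Dm 0 x * Du (Suc 0) x) \<phi> - L2_inner (\<lambda>x. Dm 0 x * Du (Suc 0) x) \<phi>"
    using L2_inner_diff_left[OF bounded_borel_uminus[OF pw_deriv_bounded_borel'[OF p]] b spline_bounded_borel(1)[OF \<phi> N]]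
    unfolding L2_inner_uminus_left .
  also have "L2_inner (\<lambda>x. Dm (Suc 0) x * Du 0 x + Dm 0 x * Du (Suc 0) x) \<phi> = - L2_inner (\<lambda>x. Dm 0 x * Du 0 x) (right_deriv \<phi>)"
    by (rule L2_inner_by_parts[OF p pw_deriv_spline[OF \<phi> N]])
  finally show ?thesis
    by (simp add: conv_form_def smooth_bound_right_deriv[OF Du])
qed

section \<open>The Galerkin system\<close>

lemma conv_form_sum_left:
  fixes n :: nat
  assumes N: "N \<ge> 1" and e: "\<And>j. j < n \<Longrightarrow> e j \<in> spline_space (Suc (Suc k)) N"
    and u: "u \<in> spline_space (Suc (Suc k)) N" and \<phi>: "\<phi> \<in> spline_space (Suc (Suc k)) N"
  shows "conv_form (\<lambda>x. \<Sum>j<n. a j * e j x) u \<phi> = (\<Sum>j<n. a j * conv_form (e j) u \<phi>)"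
proof -
  note b = spline_bounded_borel[OF e N] spline_bounded_borel[OF u N] spline_bounded_borel[OF \<phi> N]
  have "L2_inner (\<lambda>x. (\<Sum>j<n. a j * e j x) * u x) (right_deriv \<phi>) = (\<Sum>j<n. L2_inner (\<lambda>x. a j * (e j x * u x)) (right_deriv \<phi>))"
    unfolding sum_distrib_right mult.assoc
    by (rule L2_inner_sum_left) (auto intro!: bounded_borel_cmult bounded_borel_mult b)
  moreover have "L2_inner (\<lambda>x. (\<Sum>j<n. a j * e j x) * right_deriv u x) \<phi> = (\<Sum>j<n. L2_inner (\<lambda>x. a j * (e j x * right_deriv u x)) \<phi>)"
    unfolding sum_distrib_right mult.assoc
    by (rule L2_inner_sum_left) (auto intro!: bounded_borel_cmult bounded_borel_mult b)
  ultimately show ?thesis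
    by (simp add: conv_form_def L2_inner_cmult_left sum_subtractf right_diff_distrib)
qed

lemma conv_form_sum_mid:
  fixes n :: nat
  assumes N: "N \<ge> 1" and e: "\<And>j. j < n \<Longrightarrow> e j \<in> spline_space (Suc (Suc k)) N"
    and m: "m \<in> spline_space (Suc (Suc k)) N" and \<phi>: "\<phi> \<in> spline_space (Suc (Suc k)) N"
  shows "conv_form m (\<lambda>x. \<Sum>j<n. a j * e j x) \<phi> = (\<Sum>j<n. a j * conv_form m (e j) \<phi>)"
proof -
  note b = spline_bounded_borel[OF e N] spline_bounded_borel[OF m N] spline_bounded_borel[OF \<phi> N]
  have "right_deriv (\<lambda>x. \<Sum>j<n. a j * e j x) = (\<lambda>x. \<Sum>j<n. a j * right_deriv (e j) x)"
    by (rule spline_sum(2)[OF N]) (use e in auto)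
  moreover have "L2_inner (\<lambda>x. m x * (\<Sum>j<n. a j * e j x)) (right_deriv \<phi>) = (\<Sum>j<n. L2_inner (\<lambda>x. a j * (m x * e j x)) (right_deriv \<phi>))"
    unfolding sum_distrib_left mult.left_commute[of "m _"]
    by (rule L2_inner_sum_left) (auto intro!: bounded_borel_cmult bounded_borel_mult b)
  moreover have "L2_inner (\<lambda>x. m x * (\<Sum>j<n. a j * right_deriv (e j) x)) \<phi> = (\<Sum>j<n. L2_inner (\<lambda>x. a j * (m x * right_deriv (e j) x)) \<phi>)"
    unfolding sum_distrib_left mult.left_commute[of "m _"]
    by (rule L2_inner_sum_left) (auto intro!: bounded_borel_cmult bounded_borel_mult b)
  ultimately show ?thesis
    by (simp add: conv_form_def L2_inner_cmult_left sum_subtractf right_diff_distrib)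
qed

lemma conv_form_sum_right:
  fixes n :: nat
  assumes N: "N \<ge> 1" and e: "\<And>j. j < n \<Longrightarrow> e j \<in> spline_space (Suc (Suc k)) N"
    and m: "m \<in> spline_space (Suc (Suc k)) N" and u: "u \<in> spline_space (Suc (Suc k)) N"
  shows "conv_form m u (\<lambda>x. \<Sum>j<n. a j * e j x) = (\<Sum>j<n. a j * conv_form m u (e j))"
proof -
  note b = spline_bounded_borel[OF e N] spline_bounded_borel[OF m N] spline_bounded_borel[OF u N]
  have "right_deriv (\<lambda>x. \<Sum>j<n. a j * e j x) = (\<lambda>x. \<Sum>j<n. a j * right_deriv (e j) x)"
    by (rule spline_sum(2)[OF N]) (use e in auto)
  moreover have "L2_inner (\<lambda>x. m x * u x) (\<lambda>x. \<Sum>j<n. a j * right_deriv (e j) x) = (\<Sum>j<n. L2_inner (\<lambda>x. m x * u x) (\<lambda>x. a j * right_deriv (e j) x))"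
    by (rule L2_inner_sum_right) (auto intro!: bounded_borel_cmult bounded_borel_mult b)
  moreover have "L2_inner (\<lambda>x. m x * right_deriv u x) (\<lambda>x. \<Sum>j<n. a j * e j x) = (\<Sum>j<n. L2_inner (\<lambda>x. m x * right_deriv u x) (\<lambda>x. a j * e j x))"
    by (rule L2_inner_sum_right) (auto intro!: bounded_borel_cmult bounded_borel_mult b)
  ultimately show ?thesis
    by (simp add: conv_form_def L2_inner_cmult_right sum_subtractf right_diff_distrib)
qed

text \<open>In an L2-orthonormal basis the mass matrix is the identity and each coordinate is
  bounded by the L2 norm. Hence clipping the coordinates at \<open>R\<close> does not alter the
  equation while the norm is at most \<open>R\<close>, and the clipped system has a solution on the
  whole interval.\<close>

lemma galerkin_trajectory:
  assumes N: "N \<ge> 1" and T: "T > 0" and R: "R \<ge> 0" and g: "bounded_borel g"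
  shows "\<exists>c c'. (\<forall>t\<in>{0..T}. periodic_seq N (c t) \<and> periodic_seq N (c' t) \<and>
       (\<forall>j. ((\<lambda>s. c s j) has_real_derivative c' t j) (at t within {0..T})) \<and>
       (L2_nrm (pspline (Suc k) N (c t)) \<le> R \<longrightarrow> (\<forall>\<phi>\<in>spline_space (Suc (Suc k)) N.
          L2_inner (pspline (Suc k) N (c' t)) \<phi> = conv_form (pspline (Suc k) N (c t)) (elliptic k N (pspline (Suc k) N (c t))) \<phi>))) \<and>
     (\<forall>\<phi>\<in>spline_space (Suc (Suc k)) N. L2_inner (pspline (Suc k) N (c 0)) \<phi> = L2_inner g \<phi>)"
proof -
  let ?S = "spline_space (Suc (Suc k)) N"
  obtain n :: nat and e where e: "\<And>i. i < n \<Longrightarrow> e i \<in> ?S"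
    and on: "\<And>i j. i < n \<Longrightarrow> j < n \<Longrightarrow> L2_inner (e i) (e j) = (if i = j then 1 else 0)"
    and ex: "\<And>f. f \<in> ?S \<Longrightarrow> f = (\<lambda>x. \<Sum>i<n. L2_inner f (e i) * e i x)"
    using spline_L2_orthonormal_basis[OF N, of k] by blast
  have "\<forall>i. \<exists>c. i < n \<longrightarrow> periodic_seq N c \<and> e i = pspline (Suc k) N c"
    using spline_space_iff[OF N, of _ k] e by blast
  then obtain E where "\<forall>i. i < n \<longrightarrow> periodic_seq N (E i) \<and> e i = pspline (Suc k) N (E i)"
    by (rule choice[THEN exE])
  then have E: "periodic_seq N (E i)" "e i = pspline (Suc k) N (E i)" if "i < n" for i using that by auto
  note be = spline_bounded_borel(1)[OF e N]
  define w where "w = (\<lambda>i. elliptic k N (e i))"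
  have w: "w i \<in> ?S" if "i < n" for i unfolding w_def by (rule elliptic(1)[OF N be[OF that]])
  \<comment> \<open>As \<open>elliptic\<close> is linear, the vector field is quadratic in the
    coordinates with these coefficients.\<close>
  define \<beta> where "\<beta> = (\<lambda>i j l. conv_form (e j) (w l) (e i))"
  \<comment> \<open>Truncation makes the quadratic vector field globally Lipschitz and is inactive while the
    \<open>L\<^sup>2\<close> norm is at most \<open>R\<close>.\<close>
  define clip where "clip = (\<lambda>y. max (- R) (min R y))"
  have clip: "\<bar>clip y\<bar> \<le> R" "\<bar>clip y - clip z\<bar> \<le> \<bar>y - z\<bar>" "\<bar>y\<bar> \<le> R \<Longrightarrow> clip y = y" for y z
    using R by (auto simp: clip_def)
  define G where "G = (\<lambda>i (y::nat \<Rightarrow> real). \<Sum>j<n. \<Sum>l<n. \<beta> i j l * (clip (y j) * clip (y l)))"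
  define L where "L = (\<Sum>i<n. \<Sum>j<n. \<Sum>l<n. \<bar>\<beta> i j l\<bar> * (2 * R))"
  have L: "L \<ge> 0" unfolding L_def using R by (intro sum_nonneg) auto
  have GL: "\<bar>G i y - G i z\<bar> \<le> L * D" if i: "i < n" and D: "\<And>j. j < n \<Longrightarrow> \<bar>y j - z j\<bar> \<le> D" for i y z D
  proof -
    have D0: "D \<ge> 0" using D[OF i] by linarith
    have prod: "\<bar>clip (y j) * clip (y l) - clip (z j) * clip (z l)\<bar> \<le> 2 * R * D" if "j < n" "l < n" for j l
    proof -
      have "clip (y j) * clip (y l) - clip (z j) * clip (z l)
         = clip (y j) * (clip (y l) - clip (z l)) + (clip (y j) - clip (z j)) * clip (z l)" by (simp add: algebra_simps)
      also have "\<bar>\<dots>\<bar> \<le> \<bar>clip (y j)\<bar> * \<bar>clip (y l) - clip (z l)\<bar> + \<bar>clip (y j) - clip (z j)\<bar> * \<bar>clip (z l)\<bar>"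
        by (metis abs_mult abs_triangle_ineq)
      also have "\<dots> \<le> R * D + D * R"
        using clip(2)[of "y l" "z l"] clip(2)[of "y j" "z j"] D[OF that(1)] D[OF that(2)] R D0
        by (intro add_mono mult_mono clip(1)) auto
      finally show ?thesis by (simp add: mult.commute)
    qed
    have "\<bar>G i y - G i z\<bar> = \<bar>\<Sum>j<n. \<Sum>l<n. \<beta> i j l * (clip (y j) * clip (y l) - clip (z j) * clip (z l))\<bar>"
      unfolding G_def by (simp add: sum_subtractf right_diff_distrib)
    also have "\<dots> \<le> (\<Sum>j<n. \<bar>\<Sum>l<n. \<beta> i j l * (clip (y j) * clip (y l) - clip (z j) * clip (z l))\<bar>)" by (rule sum_abs)
    also have "\<dots> \<le> (\<Sum>j<n. \<Sum>l<n. \<bar>\<beta> i j l * (clip (y j) * clip (y l) - clip (z j) * clip (z l))\<bar>)"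
      by (intro sum_mono sum_abs)
    also have "\<dots> \<le> (\<Sum>j<n. \<Sum>l<n. \<bar>\<beta> i j l\<bar> * (2 * R * D))"
      unfolding abs_mult[of "\<beta> _ _ _"] by (intro sum_mono mult_left_mono prod) auto
    also have "\<dots> = (\<Sum>j<n. \<Sum>l<n. \<bar>\<beta> i j l\<bar> * (2 * R)) * D" by (simp add: sum_distrib_right mult.assoc)
    also have "\<dots> \<le> L * D" unfolding L_def
      by (intro mult_right_mono D0 member_le_sum[of i _ "\<lambda>i. \<Sum>j<n. \<Sum>l<n. \<bar>\<beta> i j l\<bar> * (2 * R)"]) (use i R in \<open>auto intro!: sum_nonneg\<close>)
    finally show ?thesis .
  qed
  obtain y where y0: "\<And>i. i < n \<Longrightarrow> y i 0 = L2_inner g (e i)"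
    and y: "\<And>i t. i < n \<Longrightarrow> t \<in> {0..T} \<Longrightarrow> (y i has_real_derivative G i (\<lambda>j. y j t)) (at t within {0..T})"
    using lipschitz_system_exists[of n G L T "\<lambda>i. L2_inner g (e i)", OF GL L T] by blast
  define c where "c = (\<lambda>t j. \<Sum>i<n. y i t * E i j)"
  define c' where "c' = (\<lambda>t j. \<Sum>i<n. G i (\<lambda>j. y j t) * E i j)"
  have comb: "pspline (Suc k) N (\<lambda>j. \<Sum>i<n. a i * E i j) = (\<lambda>x. \<Sum>i<n. a i * e i x)" for a
    unfolding pspline_sum pspline_cmult by (rule ext, intro sum.cong refl) (use E(2) in auto)
  have per: "periodic_seq N (\<lambda>j. \<Sum>i<n. a i * E i j)" for a
    using E(1) by (simp add: periodic_seq_def)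
  have ipe: "L2_inner (\<lambda>x. \<Sum>i<n. a i * e i x) \<phi> = (\<Sum>i<n. a i * L2_inner (e i) \<phi>)" if \<phi>: "\<phi> \<in> ?S" for a \<phi>
  proof -
    have "L2_inner (\<lambda>x. \<Sum>i<n. a i * e i x) \<phi> = (\<Sum>i<n. L2_inner (\<lambda>x. a i * e i x) \<phi>)"
      by (rule L2_inner_sum_left) (auto intro!: bounded_borel_cmult be spline_bounded_borel(1)[OF \<phi> N])
    then show ?thesis by (simp add: L2_inner_cmult_left)
  qed
  have init: "L2_inner (pspline (Suc k) N (c 0)) \<phi> = L2_inner g \<phi>" if \<phi>: "\<phi> \<in> ?S" for \<phi>
  proof -
    have "L2_inner (pspline (Suc k) N (c 0)) \<phi> = (\<Sum>i<n. L2_inner g (e i) * L2_inner \<phi> (e i))"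
      unfolding c_def comb ipe[OF \<phi>] by (intro sum.cong refl) (auto simp: y0 L2_inner_commute)
    also have "\<dots> = (\<Sum>i<n. L2_inner g (\<lambda>x. L2_inner \<phi> (e i) * e i x))"
      unfolding L2_inner_cmult_right by (intro sum.cong refl mult.commute)
    also have "\<dots> = L2_inner g (\<lambda>x. \<Sum>i<n. L2_inner \<phi> (e i) * e i x)"
      by (rule L2_inner_sum_right[symmetric]) (auto intro!: bounded_borel_cmult be g)
    also have "\<dots> = L2_inner g \<phi>" using ex[OF \<phi>] by simp
    finally show ?thesis .
  qed
  have scheme: "L2_inner (pspline (Suc k) N (c' t)) \<phi> = conv_form (pspline (Suc k) N (c t)) (elliptic k N (pspline (Suc k) N (c t))) \<phi>"
    if t: "t \<in> {0..T}" and b: "L2_nrm (pspline (Suc k) N (c t)) \<le> R" and \<phi>: "\<phi> \<in> ?S" for t \<phi>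
  proof -
    define mh where "mh = (\<lambda>x. \<Sum>i<n. y i t * e i x)"
    have mh: "pspline (Suc k) N (c t) = mh" unfolding c_def comb mh_def ..
    have mhS: "mh \<in> ?S" unfolding mh_def by (rule spline_sum(1)[OF N]) (use e in auto)
    have yb: "\<bar>y i t\<bar> \<le> R" if i: "i < n" for i
    proof -
      have "L2_inner mh (e i) = (\<Sum>j<n. y j t * L2_inner (e j) (e i))" unfolding mh_def by (rule ipe[OF e[OF i]])
      also have "\<dots> = (\<Sum>j<n. if j = i then y j t else 0)" by (intro sum.cong) (auto simp: on i)
      also have "\<dots> = y i t" using i by simp
      finally have "\<bar>y i t\<bar> \<le> L2_nrm mh * L2_nrm (e i)"
        using L2_inner_Cauchy_Schwarz[OF spline_bounded_borel(1)[OF mhS N] be[OF i]] by simp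
      moreover have "L2_nrm (e i) = 1" by (simp add: L2_nrm_def on i)
      ultimately show ?thesis using b mh by simp
    qed
    have ell: "elliptic k N mh = (\<lambda>x. \<Sum>l<n. y l t * w l x)"
      unfolding mh_def w_def by (rule elliptic_sum[OF N be])
    have ellS: "elliptic k N mh \<in> ?S" by (rule elliptic(1)[OF N spline_bounded_borel(1)[OF mhS N]])
    have cf: "conv_form mh (elliptic k N mh) (e i) = G i (\<lambda>j. y j t)" if i: "i < n" for i
    proof -
      have "conv_form mh (elliptic k N mh) (e i) = (\<Sum>j<n. y j t * conv_form (e j) (elliptic k N mh) (e i))"
        by (subst (1) mh_def) (rule conv_form_sum_left[OF N e ellS e[OF i]])
      also have "\<dots> = (\<Sum>j<n. y j t * (\<Sum>l<n. y l t * \<beta> i j l))"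
        unfolding ell \<beta>_def by (intro sum.cong refl arg_cong2[where f = "(*)"] conv_form_sum_mid[OF N w _ e[OF i]] e) auto
      also have "\<dots> = G i (\<lambda>j. y j t)"
        unfolding G_def sum_distrib_left by (intro sum.cong refl) (auto simp: clip(3) yb)
      finally show ?thesis .
    qed
    have "L2_inner (pspline (Suc k) N (c' t)) \<phi> = (\<Sum>i<n. L2_inner \<phi> (e i) * conv_form mh (elliptic k N mh) (e i))"
      unfolding c'_def comb ipe[OF \<phi>] by (intro sum.cong refl) (auto simp: cf L2_inner_commute mult.commute)
    also have "\<dots> = conv_form mh (elliptic k N mh) (\<lambda>x. \<Sum>i<n. L2_inner \<phi> (e i) * e i x)"
      by (rule conv_form_sum_right[OF N e mhS ellS, symmetric])
    also have "\<dots> = conv_form mh (elliptic k N mh) \<phi>" using ex[OF \<phi>] by simp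
    finally show ?thesis unfolding mh .
  qed
  have der: "((\<lambda>s. c s j) has_real_derivative c' t j) (at t within {0..T})" if t: "t \<in> {0..T}" for t j
    unfolding c_def c'_def by (intro DERIV_sum DERIV_cmult_right y t) auto
  show ?thesis
    using init scheme der per unfolding c_def[symmetric] c'_def[symmetric]
    by (intro exI[of _ c] exI[of _ c']) (auto simp: c_def c'_def)
qed

text \<open>The trajectory is required to satisfy the scheme only at times when \<theta> is below
  the threshold. This weak form lets the estimate be applied to the truncated system before that
  system is known to solve the scheme.\<close>

lemma galerkin_error:
  assumes N: "N \<ge> 1" and T: "T > 0" and C: "C \<ge> 1" and I: "I \<ge> 1"
    and inv: "\<And>\<phi> x. \<phi> \<in> spline_space (Suc (Suc k)) N \<Longrightarrow> \<bar>right_deriv \<phi> x\<bar> \<le> I * real N * sqrt (real N) * L2_nrm \<phi>"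
    and m: "\<And>t. t \<in> {0..T} \<Longrightarrow> periodic1 (m t)" and mt: "\<And>t. t \<in> {0..T} \<Longrightarrow> periodic1 (mt t)"
    and bm: "\<And>t. t \<in> {0..T} \<Longrightarrow> bounded_borel (m t)" "\<And>t. t \<in> {0..T} \<Longrightarrow> bounded_borel (mt t)"
    and cons: "\<And>t. t \<in> {0..T} \<Longrightarrow> consistent k N C (m t) (u t)"
    and qt: "\<And>t. t \<in> {0..T} \<Longrightarrow> L2_nrm (\<lambda>x. mt t x - quasi_spline k N (mt t) x) \<le> C * (1 / real N) ^ Suc (Suc k)"
    and dm: "\<And>t x. t \<in> {0..T} \<Longrightarrow> ((\<lambda>s. m s x) has_real_derivative mt t x) (at t within {0..T})"
    and weak: "\<And>t \<phi>. t \<in> {0..T} \<Longrightarrow> \<phi> \<in> spline_space (Suc (Suc k)) N \<Longrightarrow> L2_inner (mt t) \<phi> = conv_form (m t) (u t) \<phi>"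
    and c: "\<And>t. t \<in> {0..T} \<Longrightarrow> periodic_seq N (c t)" and c': "\<And>t. t \<in> {0..T} \<Longrightarrow> periodic_seq N (c' t)"
    and dc: "\<And>t j. t \<in> {0..T} \<Longrightarrow> ((\<lambda>s. c s j) has_real_derivative c' t j) (at t within {0..T})"
    and scheme: "\<And>t \<phi>. t \<in> {0..T} \<Longrightarrow> \<phi> \<in> spline_space (Suc (Suc k)) N \<Longrightarrow>
       L2_nrm (\<lambda>x. pspline (Suc k) N (c t) x - quasi_spline k N (m t) x) \<le> 1 / (real N * sqrt (real N)) \<Longrightarrow>
       L2_inner (pspline (Suc k) N (c' t)) \<phi> = conv_form (pspline (Suc k) N (c t)) (elliptic k N (pspline (Suc k) N (c t))) \<phi>"
    and init: "L2_nrm (\<lambda>x. pspline (Suc k) N (c 0) x - quasi_spline k N (m 0) x) \<le> C * (1 / real N) ^ Suc (Suc k)"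
    and E: "E = sqrt (exp ((3 * (C + I) + 6 * C + 1) * T) * (C\<^sup>2 + 4 * C\<^sup>2 * T))"
    and small: "E * (1 / real N) ^ Suc (Suc k) < 1 / (real N * sqrt (real N))"
    and t: "t \<in> {0..T}"
  shows "L2_nrm (\<lambda>x. pspline (Suc k) N (c t) x - quasi_spline k N (m t) x) \<le> E * (1 / real N) ^ Suc (Suc k)"
proof -
  let ?S = "spline_space (Suc (Suc k)) N"
  define hr where "hr = (1 / real N) ^ Suc (Suc k)"
  have hr: "hr \<ge> 0" by (simp add: hr_def)
  define \<delta> where "\<delta> = 1 / (real N * sqrt (real N))"
  define q where "q = (\<lambda>t j. c t j - quasi_interp (Suc k) N (m t) j)"
  define q' where "q' = (\<lambda>t j. c' t j - quasi_interp (Suc k) N (mt t) j)"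
  define \<theta> where "\<theta> = (\<lambda>t. pspline (Suc k) N (q t))"
  define Y where "Y = (\<lambda>t. L2_nrm (\<theta> t))"
  have \<theta>: "\<theta> t = (\<lambda>x. pspline (Suc k) N (c t) x - quasi_spline k N (m t) x)" for t
    unfolding \<theta>_def q_def quasi_spline_def pspline_diff ..
  have qp: "periodic_seq N (q t)" "periodic_seq N (q' t)" if t: "t \<in> {0..T}" for t
    using c[OF t] c'[OF t] quasi_interp_periodic[OF m[OF t] N, of "Suc k"] quasi_interp_periodic[OF mt[OF t] N, of "Suc k"]
    by (simp_all add: q_def q'_def periodic_seq_def)
  have qd: "((\<lambda>s. q s j) has_real_derivative q' t j) (at t within {0..T})" if t: "t \<in> {0..T}" for t j
    unfolding q_def q'_def quasi_interp_def by (intro DERIV_diff dc quasi_coeff_has_derivative dm t)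
  have Yd: "((\<lambda>s. (Y s)\<^sup>2) has_real_derivative 2 * L2_inner (pspline (Suc k) N (q' t)) (\<theta> t)) (at t within {0..T})"
    if t: "t \<in> {0..T}" for t
    unfolding Y_def L2_nrm_square \<theta>_def
    by (rule L2_inner_pspline_has_derivative[OF N T t qp(1) qp(2)[OF t] qd[OF t]])
  have Yc: "continuous_on {0..T} Y"
  proof -
    have "continuous_on {0..T} (\<lambda>s. sqrt ((Y s)\<^sup>2))"
      by (intro continuous_on_real_sqrt DERIV_continuous_on[OF Yd])
    then show ?thesis by (simp add: Y_def L2_nrm_nonneg)
  qed
  \<comment> \<open>Twice the constant of \<open>conv_form_energy\<close> with \<beta> = C + I and
    \<mu> = C, plus 1 from splitting the residual term \<open>4 * (C * hr * Y t)\<close> by Young's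
    inequality; the other half of that splitting is \<open>b\<close>.\<close>
  define a where "a = 3 * (C + I) + 6 * C + 1"
  have a: "a \<ge> 0" using C I by (simp add: a_def)
  define b where "b = 4 * C\<^sup>2 * hr\<^sup>2"
  have b: "b \<ge> 0" by (simp add: b_def)
  \<comment> \<open>The scheme minus the exact weak form, tested with \<theta>: \<open>e1\<close> is
    the stability of the convection form, \<open>e2\<close> the residual of the comparison pair,
    \<open>e3\<close> the interpolation error of the time derivative.\<close>
  have energy: "2 * L2_inner (pspline (Suc k) N (q' t)) (\<theta> t) \<le> a * (Y t)\<^sup>2 + b"
    if t: "t \<in> {0..T}" and Yt: "Y t \<le> \<delta>" for t
  proof -
    define M where "M = quasi_spline k N (m t)"
    define Mt where "Mt = quasi_spline k N (mt t)"
    define U where "U = elliptic k N M"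
    define mh where "mh = pspline (Suc k) N (c t)"
    define \<xi> where "\<xi> = elliptic k N (\<theta> t)"
    have S: "M \<in> ?S" "Mt \<in> ?S" "\<theta> t \<in> ?S" "mh \<in> ?S" "pspline (Suc k) N (c' t) \<in> ?S"
      unfolding M_def Mt_def \<theta>_def mh_def
      by (intro quasi_spline_in_space pspline_in_spline_space N m mt t qp c c')+
    note bb = S[THEN spline_bounded_borel(1), OF N]
    have US: "U \<in> ?S" "\<xi> \<in> ?S" unfolding U_def \<xi>_def by (intro elliptic(1)[OF N] bb)+
    have mh: "mh = (\<lambda>x. M x + \<theta> t x)" unfolding \<theta> mh_def M_def by simp
    have "elliptic k N (\<lambda>x. 1 * M x + 1 * \<theta> t x) = (\<lambda>x. 1 * elliptic k N M x + 1 * elliptic k N (\<theta> t) x)"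
      by (rule elliptic_linear[OF N bb(1) bb(3)])
    then have uh: "elliptic k N mh = (\<lambda>x. U x + \<xi> x)" unfolding mh U_def \<xi>_def by simp
    have \<xi>b: "L2_nrm \<xi> \<le> Y t" "L2_nrm (right_deriv \<xi>) \<le> Y t"
      unfolding \<xi>_def Y_def by (rule elliptic_bound[OF N bb(3)])+
    note cn = cons[OF t, unfolded consistent_def Let_def, folded M_def, folded U_def, folded hr_def]
    have \<beta>: "\<bar>right_deriv (\<lambda>x. U x + \<xi> x) x\<bar> \<le> C + I" for x
    proof -
      have "\<bar>right_deriv \<xi> x\<bar> \<le> I * real N * sqrt (real N) * L2_nrm \<xi>" by (rule inv[OF US(2)])
      also have "\<dots> \<le> I * real N * sqrt (real N) * \<delta>"
        using \<xi>b(1) Yt I by (intro mult_left_mono) auto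
      also have "\<dots> = I" using N by (simp add: \<delta>_def)
      finally have "\<bar>right_deriv \<xi> x\<bar> \<le> I" .
      moreover have "\<bar>right_deriv U x\<bar> \<le> C" using cn by blast
      moreover have "right_deriv (\<lambda>x. U x + \<xi> x) x = right_deriv U x + right_deriv \<xi> x"
        unfolding spline_add(2)[OF N US] ..
      ultimately show ?thesis by linarith
    qed
    have e1: "conv_form mh (elliptic k N mh) (\<theta> t) - conv_form M U (\<theta> t) \<le> (3 / 2 * (C + I) + 3 * C) * (Y t)\<^sup>2"
      unfolding uh unfolding mh Y_def
      by (rule conv_form_energy[OF N S(1) S(3) US \<beta>]) (use cn \<xi>b in \<open>auto simp: Y_def\<close>)
    have e2: "conv_form M U (\<theta> t) - conv_form (m t) (u t) (\<theta> t) \<le> C * hr * Y t"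
    proof -
      have "\<bar>conv_form M U (\<theta> t) - conv_form (m t) (u t) (\<theta> t)\<bar> \<le> C * hr * L2_nrm (\<theta> t)" using cn S(3) by blast
      then show ?thesis unfolding Y_def by linarith
    qed
    have e3: "L2_inner (mt t) (\<theta> t) - L2_inner Mt (\<theta> t) \<le> C * hr * Y t"
    proof -
      have "L2_inner (mt t) (\<theta> t) - L2_inner Mt (\<theta> t) = L2_inner (\<lambda>x. mt t x - Mt x) (\<theta> t)"
        by (rule L2_inner_diff_left[symmetric]) (intro bm bb t)+
      also have "\<dots> \<le> L2_nrm (\<lambda>x. mt t x - Mt x) * L2_nrm (\<theta> t)"
        using L2_inner_Cauchy_Schwarz[OF bounded_borel_diff[OF bm(2)[OF t] bb(2)] bb(3)] by linarith
      also have "\<dots> \<le> C * hr * Y t" unfolding Y_def Mt_def hr_def by (intro mult_right_mono qt t L2_nrm_nonneg)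
      finally show ?thesis .
    qed
    have "pspline (Suc k) N (q' t) = (\<lambda>x. pspline (Suc k) N (c' t) x - Mt x)"
      unfolding q'_def Mt_def quasi_spline_def pspline_diff ..
    then have "L2_inner (pspline (Suc k) N (q' t)) (\<theta> t) = L2_inner (pspline (Suc k) N (c' t)) (\<theta> t) - L2_inner Mt (\<theta> t)"
      using L2_inner_diff_left[OF bb(5) bb(2) bb(3)] by simp
    also have "L2_inner (pspline (Suc k) N (c' t)) (\<theta> t) = conv_form mh (elliptic k N mh) (\<theta> t)"
      unfolding mh_def by (rule scheme[OF t S(3)]) (use Yt in \<open>simp add: \<theta> Y_def \<delta>_def\<close>)
    finally have "L2_inner (pspline (Suc k) N (q' t)) (\<theta> t) \<le> (3 / 2 * (C + I) + 3 * C) * (Y t)\<^sup>2 + 2 * (C * hr * Y t)"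
      using e1 e2 e3 weak[OF t S(3)] by linarith
    moreover have "4 * (C * hr * Y t) \<le> (Y t)\<^sup>2 + 4 * C\<^sup>2 * hr\<^sup>2"
      using zero_le_power2[of "Y t - 2 * (C * hr)"] by (simp add: power2_eq_square algebra_simps)
    moreover have "a * (Y t)\<^sup>2 = 2 * ((3 / 2 * (C + I) + 3 * C) * (Y t)\<^sup>2) + (Y t)\<^sup>2"
      unfolding a_def by (simp add: algebra_simps)
    ultimately show ?thesis unfolding b_def by linarith
  qed
  have "Y t \<le> E * hr"
  proof (rule bootstrap[OF Yc _ _ _ t])
    show "E * hr < \<delta>" using small by (simp add: hr_def \<delta>_def)
    have Y0: "Y 0 \<le> C * hr" unfolding Y_def \<theta> hr_def by (rule init)
    \<comment> \<open>This places the initial error below the threshold as well, so that the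
      continuity argument can start.\<close>
    have "C \<le> E"
    proof -
      have "C\<^sup>2 * 1 \<le> exp (a * T) * (C\<^sup>2 + 4 * C\<^sup>2 * T)"
        using T a by (subst mult.commute, intro mult_mono) auto
      then have "sqrt (C\<^sup>2) \<le> E" unfolding E a_def[symmetric] by (intro real_sqrt_le_mono) simp
      then show ?thesis using C by simp
    qed
    then have "C * hr \<le> E * hr" by (intro mult_right_mono hr)
    then show "Y 0 < \<delta>" using Y0 \<open>E * hr < \<delta>\<close> by linarith
    fix t assume t: "t \<in> {0..T}" and small: "\<And>s. s \<in> {0..t} \<Longrightarrow> Y s \<le> \<delta>"
    have "(Y t)\<^sup>2 \<le> exp (a * t) * ((Y 0)\<^sup>2 + b * t)"
      by (rule gronwall_linear[OF t Yd _ a b]) (use energy small t in auto)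
    also have "\<dots> \<le> exp (a * T) * ((C * hr)\<^sup>2 + b * T)"
    proof (rule mult_mono)
      have "a * t \<le> a * T" using t a by (intro mult_left_mono) auto
      then show "exp (a * t) \<le> exp (a * T)" by simp
      have "(Y 0)\<^sup>2 \<le> (C * hr)\<^sup>2" using Y0 by (intro power_mono) (auto simp: Y_def L2_nrm_nonneg)
      moreover have "b * t \<le> b * T" using t b by (intro mult_left_mono) auto
      ultimately show "(Y 0)\<^sup>2 + b * t \<le> (C * hr)\<^sup>2 + b * T" by linarith
      show "0 \<le> (Y 0)\<^sup>2 + b * t" using b t by simp
    qed simp
    also have "\<dots> = (exp (a * T) * (C\<^sup>2 + 4 * C\<^sup>2 * T)) * hr\<^sup>2"
      by (simp add: b_def power_mult_distrib algebra_simps)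
    also have "exp (a * T) * (C\<^sup>2 + 4 * C\<^sup>2 * T) = E\<^sup>2"
      unfolding E a_def using T by simp
    also have "E\<^sup>2 * hr\<^sup>2 = (E * hr)\<^sup>2" by (simp add: power_mult_distrib)
    finally show "Y t \<le> E * hr"
      by (rule power2_le_imp_le) (use \<open>C \<le> E\<close> C hr in simp)
  qed
  then show ?thesis unfolding Y_def \<theta> hr_def .
qed

lemma semidiscrete_solution_coefficients:
  assumes N: "N \<ge> 1" and T: "T > 0" and sol: "semidiscrete_solution (Suc (Suc k)) N T u0 mh uh"
  shows "\<exists>c c'. \<forall>t\<in>{0..T}. periodic_seq N (c t) \<and> periodic_seq N (c' t) \<and> mh t = pspline (Suc k) N (c t) \<and>
     (\<forall>j. ((\<lambda>s. c s j) has_real_derivative c' t j) (at t within {0..T})) \<and>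
     (\<forall>\<phi>\<in>spline_space (Suc (Suc k)) N. L2_inner (pspline (Suc k) N (c' t)) \<phi> = conv_form (mh t) (elliptic k N (mh t)) \<phi>)"
proof -
  note sol' = sol[unfolded semidiscrete_solution_alt[OF N]]
  have "\<forall>t. \<exists>c. t \<in> {0..T} \<longrightarrow> periodic_seq N c \<and> mh t = pspline (Suc k) N c"
    using sol' spline_space_iff[OF N] by blast
  then obtain c where c0: "\<forall>t. t \<in> {0..T} \<longrightarrow> periodic_seq N (c t) \<and> mh t = pspline (Suc k) N (c t)"
    by (rule choice[THEN exE])
  then have c: "periodic_seq N (c t)" "mh t = pspline (Suc k) N (c t)" if "t \<in> {0..T}" for t using that by auto
  have "\<forall>t. \<exists>c'. t \<in> {0..T} \<longrightarrow> periodic_seq N c' \<and> (\<forall>j. ((\<lambda>s. c s j) has_real_derivative c' j) (at t within {0..T})) \<and>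
      time_deriv T mh t = pspline (Suc k) N c'"
  proof
    fix t
    show "\<exists>c'. t \<in> {0..T} \<longrightarrow> periodic_seq N c' \<and> (\<forall>j. ((\<lambda>s. c s j) has_real_derivative c' j) (at t within {0..T})) \<and>
      time_deriv T mh t = pspline (Suc k) N c'"
    proof (cases "t \<in> {0..T}")
      case True
      have "\<exists>c'. periodic_seq N c' \<and> (\<forall>j. ((\<lambda>s. c s j) has_real_derivative c' j) (at t within {0..T})) \<and>
        time_deriv T mh t = pspline (Suc k) N c'"
        by (rule pspline_time_derivative[OF N T c(1) c(2) _ True]) (use sol' True in auto)
      then show ?thesis by blast
    qed blast
  qed
  then obtain c' where c'0: "\<forall>t. t \<in> {0..T} \<longrightarrow> periodic_seq N (c' t) \<and> (\<forall>j. ((\<lambda>s. c s j) has_real_derivative c' t j) (at t within {0..T})) \<and>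
      time_deriv T mh t = pspline (Suc k) N (c' t)"
    by (rule choice[THEN exE])
  have "L2_inner (pspline (Suc k) N (c' t)) \<phi> = conv_form (mh t) (elliptic k N (mh t)) \<phi>"
    if "t \<in> {0..T}" "\<phi> \<in> spline_space (Suc (Suc k)) N" for t \<phi>
  proof -
    have "L2_inner (time_deriv T mh t) \<phi> = conv_form (mh t) (uh t) \<phi>" "uh t = elliptic k N (mh t)"
      using sol' that by blast+
    then show ?thesis using c'0 that by simp
  qed
  then show ?thesis using c c'0 by (intro exI[of _ c] exI[of _ c']) auto
qed

text \<open>For fixed \<open>N\<close> the constants may depend on \<open>N\<close> and on the two
  solutions, so inverse inequalities and boundedness on the compact time interval supply all
  pointwise bounds. \<open>conv_form_energy\<close> then applies with \<open>mh'\<close> in the role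
  of \<open>M\<close>, and Gronwall starts from a zero initial difference.\<close>

lemma semidiscrete_solution_unique:
  assumes N: "N \<ge> 1" and T: "T > 0" and sol1: "semidiscrete_solution (Suc (Suc k)) N T u0 mh uh"
    and sol2: "semidiscrete_solution (Suc (Suc k)) N T u0 mh' uh'" and t: "t \<in> {0..T}"
  shows "mh' t = mh t \<and> uh' t = uh t"
proof -
  let ?S = "spline_space (Suc (Suc k)) N"
  obtain I where I: "I \<ge> 1" "\<And>\<phi>. \<phi> \<in> ?S \<Longrightarrow> (\<forall>x. \<bar>\<phi> x\<bar> \<le> I * sqrt (real N) * L2_nrm \<phi>) \<and>
     (\<forall>x. \<bar>right_deriv \<phi> x\<bar> \<le> I * real N * sqrt (real N) * L2_nrm \<phi>)"
    using inverse_inequalities[of k] N by blast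
  define J where "J = I * real N * sqrt (real N)"
  have J: "J \<ge> 0" using I(1) by (simp add: J_def)
  have Jb: "\<bar>\<phi> x\<bar> \<le> J * L2_nrm \<phi>" "\<bar>right_deriv \<phi> x\<bar> \<le> J * L2_nrm \<phi>" if "\<phi> \<in> ?S" for \<phi> x
  proof -
    have "I * sqrt (real N) * 1 \<le> I * sqrt (real N) * real N" using N I(1) by (intro mult_left_mono) auto
    then have "I * sqrt (real N) * L2_nrm \<phi> \<le> J * L2_nrm \<phi>"
      by (intro mult_right_mono L2_nrm_nonneg) (simp add: J_def mult_ac)
    then show "\<bar>\<phi> x\<bar> \<le> J * L2_nrm \<phi>" using I(2)[OF that] order_trans by blast
    show "\<bar>right_deriv \<phi> x\<bar> \<le> J * L2_nrm \<phi>" using I(2)[OF that] unfolding J_def by blast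
  qed
  obtain c1 c1' where c1: "\<forall>t\<in>{0..T}. periodic_seq N (c1 t) \<and> periodic_seq N (c1' t) \<and> mh t = pspline (Suc k) N (c1 t) \<and>
     (\<forall>j. ((\<lambda>s. c1 s j) has_real_derivative c1' t j) (at t within {0..T})) \<and>
     (\<forall>\<phi>\<in>?S. L2_inner (pspline (Suc k) N (c1' t)) \<phi> = conv_form (mh t) (elliptic k N (mh t)) \<phi>)"
    using semidiscrete_solution_coefficients[OF N T sol1] by blast
  obtain c2 c2' where c2: "\<forall>t\<in>{0..T}. periodic_seq N (c2 t) \<and> periodic_seq N (c2' t) \<and> mh' t = pspline (Suc k) N (c2 t) \<and>
     (\<forall>j. ((\<lambda>s. c2 s j) has_real_derivative c2' t j) (at t within {0..T})) \<and>
     (\<forall>\<phi>\<in>?S. L2_inner (pspline (Suc k) N (c2' t)) \<phi> = conv_form (mh' t) (elliptic k N (mh' t)) \<phi>)"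
    using semidiscrete_solution_coefficients[OF N T sol2] by blast
  have bnd: "\<exists>A\<ge>0. \<forall>t\<in>{0..T}. L2_nrm (pspline (Suc k) N (c t)) \<le> A"
    if c: "\<forall>t\<in>{0..T}. periodic_seq N (c t) \<and> periodic_seq N (c' t) \<and>
     (\<forall>j. ((\<lambda>s. c s j) has_real_derivative c' t j) (at t within {0..T}))" for c c'
  proof -
    have "continuous_on {0..T} (\<lambda>s. L2_inner (pspline (Suc k) N (c s)) (pspline (Suc k) N (c s)))"
    proof (rule DERIV_continuous_on)
      fix t assume t: "t \<in> {0..T}"
      show "((\<lambda>s. L2_inner (pspline (Suc k) N (c s)) (pspline (Suc k) N (c s))) has_real_derivative
        2 * L2_inner (pspline (Suc k) N (c' t)) (pspline (Suc k) N (c t))) (at t within {0..T})"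
        by (rule L2_inner_pspline_has_derivative[OF N T t]) (use c t in auto)
    qed
    then have "continuous_on {0..T} (\<lambda>s. L2_nrm (pspline (Suc k) N (c s)))"
      unfolding L2_nrm_def by (rule continuous_on_real_sqrt)
    then obtain A where "\<And>s. s \<in> {0..T} \<Longrightarrow> \<bar>L2_nrm (pspline (Suc k) N (c s))\<bar> \<le> A"
      by (rule continuous_on_Icc_bounded) blast
    then have "\<forall>s\<in>{0..T}. L2_nrm (pspline (Suc k) N (c s)) \<le> max 0 A" by fastforce
    then show ?thesis by (intro exI[of _ "max 0 A"]) auto
  qed
  obtain A1 where A1: "A1 \<ge> 0" "\<And>t. t \<in> {0..T} \<Longrightarrow> L2_nrm (mh t) \<le> A1" using bnd[of c1 c1'] c1 by auto
  obtain A2 where A2: "A2 \<ge> 0" "\<And>t. t \<in> {0..T} \<Longrightarrow> L2_nrm (mh' t) \<le> A2" using bnd[of c2 c2'] c2 by auto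
  define q where "q = (\<lambda>t j. c1 t j - c2 t j)"
  define q' where "q' = (\<lambda>t j. c1' t j - c2' t j)"
  have q: "pspline (Suc k) N (q t) = (\<lambda>x. mh t x - mh' t x)" if "t \<in> {0..T}" for t
    unfolding q_def pspline_diff using c1 c2 that by simp
  have qp: "periodic_seq N (q t)" "periodic_seq N (q' t)" if "t \<in> {0..T}" for t
    using c1 c2 that by (simp_all add: q_def q'_def periodic_seq_def)
  have qd: "((\<lambda>s. q s j) has_real_derivative q' t j) (at t within {0..T})" if "t \<in> {0..T}" for t j
    unfolding q_def q'_def using c1 c2 that by (intro DERIV_diff) auto
  define Y where "Y = (\<lambda>t. L2_inner (pspline (Suc k) N (q t)) (pspline (Suc k) N (q t)))"
  have Yd: "(Y has_real_derivative 2 * L2_inner (pspline (Suc k) N (q' t)) (pspline (Suc k) N (q t))) (at t within {0..T})"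
    if t: "t \<in> {0..T}" for t
    unfolding Y_def by (rule L2_inner_pspline_has_derivative[OF N T t qp(1) qp(2)[OF t] qd[OF t]])
  \<comment> \<open>Twice the constant of \<open>conv_form_energy\<close>, with \<beta> =
    \<open>J * A1\<close> for the velocity of \<open>mh\<close> and \<mu> = \<open>J * A2\<close>
    for \<open>mh'\<close>.\<close>
  define a where "a = 3 * (J * A1) + 6 * (J * A2)"
  have a: "a \<ge> 0" using J A1(1) A2(1) by (simp add: a_def)
  have energy: "2 * L2_inner (pspline (Suc k) N (q' t)) (pspline (Suc k) N (q t)) \<le> a * Y t + 0" if t: "t \<in> {0..T}" for t
  proof -
    define d where "d = pspline (Suc k) N (q t)"
    have S: "mh t \<in> ?S" "mh' t \<in> ?S" "d \<in> ?S" "pspline (Suc k) N (c1' t) \<in> ?S" "pspline (Suc k) N (c2' t) \<in> ?S"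
      using c1 c2 t qp[OF t] pspline_in_spline_space[OF N] unfolding d_def by auto
    note bb = S[THEN spline_bounded_borel(1), OF N]
    define U where "U = elliptic k N (mh' t)"
    define \<xi> where "\<xi> = elliptic k N d"
    have US: "U \<in> ?S" "\<xi> \<in> ?S" unfolding U_def \<xi>_def by (intro elliptic(1)[OF N] bb)+
    have mh: "mh t = (\<lambda>x. mh' t x + d x)" unfolding d_def q[OF t] by simp
    have "elliptic k N (\<lambda>x. 1 * mh' t x + 1 * d x) = (\<lambda>x. 1 * elliptic k N (mh' t) x + 1 * elliptic k N d x)"
      by (rule elliptic_linear[OF N bb(2) bb(3)])
    then have uh: "elliptic k N (mh t) = (\<lambda>x. U x + \<xi> x)" unfolding mh U_def \<xi>_def by simp
    have eb: "L2_nrm (elliptic k N (mh t)) \<le> A1"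
      using elliptic_bound(1)[OF N bb(1), of k] A1(2)[OF t] by linarith
    have "conv_form (\<lambda>x. mh' t x + d x) (\<lambda>x. U x + \<xi> x) d - conv_form (mh' t) U d \<le> (3 / 2 * (J * A1) + 3 * (J * A2)) * (L2_nrm d)\<^sup>2"
    proof (rule conv_form_energy[OF N S(2) S(3) US])
      show "\<bar>right_deriv (\<lambda>x. U x + \<xi> x) x\<bar> \<le> J * A1" for x
        unfolding uh[symmetric]
        using Jb(2)[OF elliptic(1)[OF N bb(1)], of x] mult_left_mono[OF eb J] by linarith
      show "\<bar>mh' t x\<bar> \<le> J * A2" "\<bar>right_deriv (mh' t) x\<bar> \<le> J * A2" for x
        using Jb[OF S(2), of x] mult_left_mono[OF A2(2)[OF t] J] by linarith+
      show "L2_nrm \<xi> \<le> L2_nrm d" "L2_nrm (right_deriv \<xi>) \<le> L2_nrm d"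
        unfolding \<xi>_def by (rule elliptic_bound[OF N bb(3)])+
    qed
    moreover have "L2_inner (pspline (Suc k) N (q' t)) d = conv_form (mh t) (elliptic k N (mh t)) d - conv_form (mh' t) U d"
    proof -
      have "pspline (Suc k) N (q' t) = (\<lambda>x. pspline (Suc k) N (c1' t) x - pspline (Suc k) N (c2' t) x)"
        unfolding q'_def pspline_diff ..
      then have "L2_inner (pspline (Suc k) N (q' t)) d = L2_inner (pspline (Suc k) N (c1' t)) d - L2_inner (pspline (Suc k) N (c2' t)) d"
        using L2_inner_diff_left[OF bb(4) bb(5) bb(3)] by simp
      then show ?thesis using c1 c2 t S(3) unfolding U_def by simp
    qed
    ultimately have "L2_inner (pspline (Suc k) N (q' t)) d \<le> (3 / 2 * (J * A1) + 3 * (J * A2)) * L2_inner d d"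
      unfolding uh mh[symmetric] L2_nrm_square by simp
    then show ?thesis unfolding a_def Y_def d_def by (simp add: algebra_simps)
  qed
  have 0: "0 \<in> {0..T}" using T by simp
  have "Y 0 = 0"
  proof -
    have S: "mh 0 \<in> ?S" "mh' 0 \<in> ?S" using sol1 sol2 0 unfolding semidiscrete_solution_def by blast+
    have d: "(\<lambda>x. mh 0 x - mh' 0 x) \<in> ?S" by (rule spline_diff(1)[OF N S])
    have "L2_inner (mh 0) \<phi> = L2_inner (mh' 0) \<phi>" if "\<phi> \<in> ?S" for \<phi>
      using sol1 sol2 that unfolding semidiscrete_solution_def by simp
    from this[OF d] show ?thesis
      unfolding Y_def q[OF 0]
      using L2_inner_diff_left[OF spline_bounded_borel(1)[OF S(1) N] spline_bounded_borel(1)[OF S(2) N] spline_bounded_borel(1)[OF d N]]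
      by simp
  qed
  moreover have "Y t \<le> exp (a * t) * (Y 0 + 0 * t)"
    by (rule gronwall_linear[OF t Yd _ a]) (use energy t in auto)
  ultimately have "Y t \<le> 0" by simp
  have d: "pspline (Suc k) N (q t) \<in> ?S" by (intro pspline_in_spline_space N qp t)
  have "pspline (Suc k) N (q t) = (\<lambda>x. 0)"
    using spline_L2_pos[OF N d] \<open>Y t \<le> 0\<close> unfolding Y_def by fastforce
  then have "mh' t = mh t" unfolding q[OF t] by (auto simp: fun_eq_iff)
  moreover have "uh t = elliptic k N (mh t)" "uh' t = elliptic k N (mh' t)"
    using sol1 sol2 t unfolding semidiscrete_solution_alt[OF N] by blast+
  ultimately show ?thesis by simp
qed

section \<open>Smallness of the mesh, existence and convergence\<close>

lemma consistent_mono: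
  assumes "consistent k N C m u" "C \<le> C'" shows "consistent k N C' m u"
proof -
  have 1: "C * (1 / real N) ^ Suc (Suc k) \<le> C' * (1 / real N) ^ Suc (Suc k)"
    by (rule mult_right_mono[OF assms(2)]) simp
  then have "C * (1 / real N) ^ Suc (Suc k) * L2_nrm \<phi> \<le> C' * (1 / real N) ^ Suc (Suc k) * L2_nrm \<phi>" for \<phi>
    by (rule mult_right_mono) (rule L2_nrm_nonneg)
  then show ?thesis
    using assms 1 unfolding consistent_def Let_def by (meson order_trans)
qed

text \<open>Since r >= 2, the left side is at most \<open>(E * sqrt h)\<close> times
  \<open>h * sqrt h\<close>, and \<open>h\<close> is chosen to make \<open>E * sqrt h\<close> less
  than 1. Using \<open>E + 1\<close> avoids a division by zero and makes the inequality
  strict.\<close>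

lemma small_mesh:
  assumes N: "N \<ge> (1::nat)" and E: "E \<ge> 0" and h: "1 / real N \<le> (1 / (E + 1))\<^sup>2"
  shows "E * (1 / real N) ^ Suc (Suc k) < 1 / (real N * sqrt (real N))"
proof -
  define h where "h = 1 / real N"
  have h0: "h > 0" "h \<le> 1" using N by (simp_all add: h_def)
  define s where "s = sqrt h"
  have s: "s > 0" "h = s * s" using h0 by (simp_all add: s_def)
  have "s \<le> 1 / (E + 1)" unfolding s_def using h E by (intro real_le_lsqrt) (auto simp: h_def)
  then have "(E + 1) * s \<le> (E + 1) * (1 / (E + 1))" using E by (intro mult_left_mono) auto
  then have Es: "E * s < 1" using s(1) E by (simp add: distrib_right)
  have "E * h ^ Suc (Suc k) = E * (h * h) * h ^ k" by simp
  also have "\<dots> \<le> E * (h * h) * 1" using h0 E by (intro mult_left_mono power_le_one) auto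
  also have "\<dots> = (E * s) * (h * s)" by (simp add: s(2) mult_ac)
  also have "\<dots> < 1 * (h * s)" using Es h0 s(1) by (intro mult_strict_right_mono) auto
  also have "\<dots> = 1 / (real N * sqrt (real N))" by (simp add: h_def s_def real_sqrt_divide)
  finally show ?thesis by (simp add: h_def)
qed

lemma time_deriv_eq:
  assumes "T > 0" "t \<in> {0..T}" "((\<lambda>s. v s x) has_real_derivative D) (at t within {0..T})"
  shows "time_deriv T v t x = D"
  unfolding time_deriv_def
  using vector_derivative_within_cbox[of 0 T t "\<lambda>s. v s x" D] assms
  by (simp add: has_real_derivative_iff_has_vector_derivative)

theorem proposition4p2:
  fixes r :: nat
  assumes "r \<ge> 2"
  shows "\<exists>K::nat. \<forall>(T::real) (u0 :: real \<Rightarrow> real) (m :: real \<Rightarrow> real \<Rightarrow> real) (u :: real \<Rightarrow> real \<Rightarrow> real).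
    T > 0 \<longrightarrow> periodic_ivp_solution T u0 m u \<longrightarrow> smooth_upto T K m \<longrightarrow> smooth_upto T K u \<longrightarrow>
    (\<exists>h0>0. \<exists>C::real. \<forall>(N::nat) (h::real). N \<ge> 1 \<longrightarrow> h = 1 / real N \<longrightarrow> h \<le> h0 \<longrightarrow>
      (\<exists>mh uh.
        semidiscrete_solution r N T u0 mh uh \<and>
        (\<forall>mh' uh'. semidiscrete_solution r N T u0 mh' uh' \<longrightarrow>
           (\<forall>t\<in>{0..T}. mh' t = mh t \<and> uh' t = uh t)) \<and>
        (\<forall>t\<in>{0..T}. L2_nrm (\<lambda>x. m t x - mh t x) + L2_nrm (\<lambda>x. u t x - uh t x) \<le> C * h ^ r)))"
proof -
  define k where "k = r - 2"
  have r: "r = Suc (Suc k)" using assms by (simp add: k_def)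
  let ?n = "Suc (Suc (Suc k))"
  show ?thesis
    unfolding r
  proof (intro exI[of _ "Suc ?n"] allI impI)
    fix T :: real and u0 :: "real \<Rightarrow> real" and m u :: "real \<Rightarrow> real \<Rightarrow> real"
    assume T: "T > 0" and sol: "periodic_ivp_solution T u0 m u"
      and sm: "smooth_upto T (Suc ?n) m" and su: "smooth_upto T (Suc ?n) u"
    obtain B Dm Du Dt where D0: "Dm 0 = m" "Du 0 = u" "u0 = u 0" and data:
      "\<forall>t\<in>{0..T}. smooth_bound ?n B (\<lambda>j. Dm j t) \<and> smooth_bound ?n B (\<lambda>j. Du j t) \<and> smooth_bound ?n B (\<lambda>j. Dt j t) \<and>
       (\<forall>x. ((\<lambda>s. m s x) has_real_derivative Dt 0 t x) (at t within {0..T}) \<and>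
         m t x = Du 0 t x - Du (Suc (Suc 0)) t x) \<and>
       (\<forall>x\<in>{0..1}. Dt 0 t x + (Dm (Suc 0) t x * u t x + m t x * Du (Suc 0) t x) + m t x * Du (Suc 0) t x = 0)"
      using periodic_ivp_smooth_data[OF T sol sm su] by auto
    have Dmb: "smooth_bound ?n B (\<lambda>j. Dm j t)" and Dub: "smooth_bound ?n B (\<lambda>j. Du j t)" and Dtb: "smooth_bound ?n B (\<lambda>j. Dt j t)"
      if "t \<in> {0..T}" for t using data that by blast+
    have dm: "((\<lambda>s. m s x) has_real_derivative Dt 0 t x) (at t within {0..T})"
      and ell: "m t x = Du 0 t x - Du (Suc (Suc 0)) t x" if "t \<in> {0..T}" for t x using data that by blast+
    have per: "periodic1 (m t)" "periodic1 (Dt 0 t)" if "t \<in> {0..T}" for t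
      using Dmb[OF that] Dtb[OF that] D0 by (auto simp: smooth_bound_def)
    have pm: "pw_deriv (m t) (Dm (Suc 0) t)" and pu: "pw_deriv (u t) (Du (Suc 0) t)" and pt: "pw_deriv (Dt 0 t) (Dt (Suc 0) t)"
      if "t \<in> {0..T}" for t
      using smooth_bound_pw_deriv[OF Dmb[OF that], of 0] smooth_bound_pw_deriv[OF Dub[OF that], of 0]
        smooth_bound_pw_deriv[OF Dtb[OF that], of 0] D0 by simp_all
    note bm = pw_deriv_bounded_borel[OF pm] and bu = pw_deriv_bounded_borel[OF pu] and bt = pw_deriv_bounded_borel[OF pt]
    have t0: "0 \<in> {0..T}" using T by simp
    obtain C1 where C1: "C1 \<ge> 1" "\<And>N Dm Du. N \<ge> 1 \<Longrightarrow> smooth_bound ?n B Dm \<Longrightarrow> smooth_bound ?n B Du \<Longrightarrow>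
       (\<forall>x. Dm 0 x = Du 0 x - Du (Suc (Suc 0)) x) \<Longrightarrow> consistent k N C1 (Dm 0) (Du 0)"
      using consistency[of k B] by blast
    obtain K where K: "K \<ge> 1" "\<And>N D x. N \<ge> 1 \<Longrightarrow> smooth_bound ?n B D \<Longrightarrow>
       \<bar>D 0 x - quasi_spline k N (D 0) x\<bar> \<le> K * B * (1 / real N) ^ Suc (Suc k)"
      using quasi_spline_estimates[of k] by blast
    obtain I where I: "I \<ge> 1" "\<And>N \<phi> x. N \<ge> 1 \<Longrightarrow> \<phi> \<in> spline_space (Suc (Suc k)) N \<Longrightarrow>
       \<bar>right_deriv \<phi> x\<bar> \<le> I * real N * sqrt (real N) * L2_nrm \<phi>"
      using inverse_inequalities[of k] by blast
    have B: "B \<ge> 0" by (rule smooth_bound_nonneg[OF Dmb[OF t0]])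
    \<comment> \<open>\<open>C1\<close> covers the time slices of \<open>(m, u)\<close> and
      \<open>K * B\<close> the interpolation error of the time derivative.\<close>
    define C where "C = C1 + K * B"
    have "0 \<le> K * B" using K(1) B by simp
    then have C: "C \<ge> 1" "C1 \<le> C" "K * B \<le> C" using C1(1) unfolding C_def by linarith+
    define E where "E = sqrt (exp ((3 * (C + I) + 6 * C + 1) * T) * (C\<^sup>2 + 4 * C\<^sup>2 * T))"
    have E: "E \<ge> 0" unfolding E_def using T by simp
    have cons: "consistent k N C (m t) (u t)" if "N \<ge> 1" "t \<in> {0..T}" for N t
      using consistent_mono[OF C1(2)[OF that(1) Dmb[OF that(2)] Dub[OF that(2)]] C(2)] ell[OF that(2)] D0 by simp
    show "\<exists>h0>0. \<exists>C::real. \<forall>(N::nat) (h::real). N \<ge> 1 \<longrightarrow> h = 1 / real N \<longrightarrow> h \<le> h0 \<longrightarrow>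
      (\<exists>mh uh. semidiscrete_solution (Suc (Suc k)) N T u0 mh uh \<and>
        (\<forall>mh' uh'. semidiscrete_solution (Suc (Suc k)) N T u0 mh' uh' \<longrightarrow>
           (\<forall>t\<in>{0..T}. mh' t = mh t \<and> uh' t = uh t)) \<and>
        (\<forall>t\<in>{0..T}. L2_nrm (\<lambda>x. m t x - mh t x) + L2_nrm (\<lambda>x. u t x - uh t x) \<le> C * h ^ Suc (Suc k)))"
    proof (rule exI[of _ "(1 / (E + 1))\<^sup>2"], rule conjI, goal_cases)
      case 1
      show ?case using E by simp
    next
      case 2
      show ?case
      \<comment> \<open>A share \<open>C + E\<close> for each of the two norms: the comparison error
        plus \<theta>, which \<open>elliptic\<close> does not enlarge in L2.\<close>
      proof (rule exI[of _ "2 * C + 2 * E"], intro allI impI)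
        fix N :: nat and h :: real
        assume N: "N \<ge> 1" and h: "h = 1 / real N" and hs: "h \<le> (1 / (E + 1))\<^sup>2"
        let ?S = "spline_space (Suc (Suc k)) N"
        define \<delta> where "\<delta> = 1 / (real N * sqrt (real N))"
        have \<delta>1: "\<delta> \<le> 1"
        proof -
          have "1 * 1 \<le> real N * sqrt (real N)" using N by (intro mult_mono) auto
          then show ?thesis by (simp add: \<delta>_def)
        qed
        have small: "E * (1 / real N) ^ Suc (Suc k) < \<delta>"
          unfolding \<delta>_def by (rule small_mesh[OF N E]) (use h hs in simp)
        \<comment> \<open>Radius \<open>C + 1\<close> suffices for the truncation: \<open>M\<close>
          has norm at most \<open>C\<close>, and \<theta> contributes at most \<delta>, which is at
          most 1.\<close>
        obtain c c' where traj: "\<forall>t\<in>{0..T}. periodic_seq N (c t) \<and> periodic_seq N (c' t) \<and>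
            (\<forall>j. ((\<lambda>s. c s j) has_real_derivative c' t j) (at t within {0..T})) \<and>
            (L2_nrm (pspline (Suc k) N (c t)) \<le> C + 1 \<longrightarrow> (\<forall>\<phi>\<in>?S. L2_inner (pspline (Suc k) N (c' t)) \<phi> =
               conv_form (pspline (Suc k) N (c t)) (elliptic k N (pspline (Suc k) N (c t))) \<phi>))"
          and init: "\<forall>\<phi>\<in>?S. L2_inner (pspline (Suc k) N (c 0)) \<phi> = L2_inner (m 0) \<phi>"
          using galerkin_trajectory[OF N T _ bm[OF t0], of "C + 1" k] C(1) by auto
        define mh where "mh = (\<lambda>t. pspline (Suc k) N (c t))"
        define M where "M = (\<lambda>t. quasi_spline k N (m t))"
        have S: "mh t \<in> ?S" "M t \<in> ?S" if "t \<in> {0..T}" for t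
          unfolding mh_def M_def using traj that by (auto intro!: pspline_in_spline_space quasi_spline_in_space N per)
        have \<theta>S: "(\<lambda>x. mh t x - M t x) \<in> ?S" if "t \<in> {0..T}" for t by (rule spline_diff(1)[OF N S[OF that]])
        note bb = spline_bounded_borel(1)[OF S(1) N] spline_bounded_borel(1)[OF S(2) N] spline_bounded_borel(1)[OF \<theta>S N]
        have Mb: "L2_nrm (\<lambda>x. m t x - M t x) \<le> C * (1 / real N) ^ Suc (Suc k)" "\<bar>M t x\<bar> \<le> C"
           "L2_nrm (\<lambda>x. u t x - elliptic k N (M t) x) \<le> C * (1 / real N) ^ Suc (Suc k)"
          if "t \<in> {0..T}" for t x
          using cons[OF N that] unfolding consistent_def Let_def M_def by blast+
        have bound: "L2_nrm (mh t) \<le> C + 1" if t: "t \<in> {0..T}" and Y: "L2_nrm (\<lambda>x. mh t x - M t x) \<le> \<delta>" for t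
        proof -
          have "L2_nrm (\<lambda>x. (mh t x - M t x) + M t x) \<le> L2_nrm (\<lambda>x. mh t x - M t x) + L2_nrm (M t)"
            by (rule L2_nrm_triangle[OF bb(3)[OF t] bb(2)[OF t]])
          moreover have "L2_nrm (M t) \<le> C" by (rule L2_nrm_le_sup[OF bb(2)[OF t]]) (rule Mb(2)[OF t])
          ultimately show ?thesis using Y \<delta>1 by simp
        qed
        have scheme: "L2_inner (pspline (Suc k) N (c' t)) \<phi> = conv_form (mh t) (elliptic k N (mh t)) \<phi>"
          if "t \<in> {0..T}" "\<phi> \<in> ?S" "L2_nrm (\<lambda>x. mh t x - M t x) \<le> \<delta>" for t \<phi>
          using traj that bound[OF that(1,3)] unfolding mh_def by blast
        \<comment> \<open>\<open>mh 0\<close> has the same pairings with splines as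
          \<open>m 0\<close>, so testing the spline \<open>mh 0 - M 0\<close> with itself bounds it
          by the quasi-interpolation error.\<close>
        have Y0: "L2_nrm (\<lambda>x. mh 0 x - M 0 x) \<le> C * (1 / real N) ^ Suc (Suc k)"
        proof -
          define d where "d = (\<lambda>x. mh 0 x - M 0 x)"
          have "(L2_nrm d)\<^sup>2 = L2_inner (mh 0) d - L2_inner (M 0) d"
            unfolding L2_nrm_square d_def by (rule L2_inner_diff_left[OF bb(1)[OF t0] bb(2)[OF t0] bb(3)[OF t0]])
          also have "L2_inner (mh 0) d = L2_inner (m 0) d" using init \<theta>S[OF t0] unfolding mh_def d_def by blast
          also have "L2_inner (m 0) d - L2_inner (M 0) d = L2_inner (\<lambda>x. m 0 x - M 0 x) d"
            unfolding d_def by (rule L2_inner_diff_left[symmetric, OF bm[OF t0] bb(2)[OF t0] bb(3)[OF t0]])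
          also have "\<dots> \<le> L2_nrm (\<lambda>x. m 0 x - M 0 x) * L2_nrm d"
            using L2_inner_Cauchy_Schwarz[OF bounded_borel_diff[OF bm[OF t0] bb(2)[OF t0]] bb(3)[OF t0]] unfolding d_def by linarith
          also have "\<dots> \<le> C * (1 / real N) ^ Suc (Suc k) * L2_nrm d" by (intro mult_right_mono Mb(1)[OF t0] L2_nrm_nonneg)
          finally have "L2_nrm d * L2_nrm d \<le> C * (1 / real N) ^ Suc (Suc k) * L2_nrm d" by (simp only: power2_eq_square)
          moreover have "0 \<le> C * (1 / real N) ^ Suc (Suc k)" using C(1) by simp
          ultimately have "L2_nrm d \<le> C * (1 / real N) ^ Suc (Suc k)"
            using L2_nrm_nonneg[of d] by (cases "L2_nrm d = 0") (auto simp del: power_Suc)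
          then show ?thesis by (simp only: d_def)
        qed
        have err: "L2_nrm (\<lambda>x. mh t x - M t x) \<le> E * (1 / real N) ^ Suc (Suc k)" if t: "t \<in> {0..T}" for t
          unfolding mh_def M_def
        proof (rule galerkin_error[where mt = "Dt 0" and u = u and c' = c' and T = T and C = C and I = I])
          fix t assume t: "t \<in> {0..T}"
          show "L2_nrm (\<lambda>x. Dt 0 t x - quasi_spline k N (Dt 0 t) x) \<le> C * (1 / real N) ^ Suc (Suc k)"
          proof (rule L2_nrm_le_sup)
            show "bounded_borel (\<lambda>x. Dt 0 t x - quasi_spline k N (Dt 0 t) x)"
              by (intro bounded_borel_diff bt t spline_bounded_borel(1)[OF quasi_spline_in_space[OF N per(2)[OF t]] N])
            fix x
            have "\<bar>Dt 0 t x - quasi_spline k N (Dt 0 t) x\<bar> \<le> K * B * (1 / real N) ^ Suc (Suc k)"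
              by (rule K(2)[OF N Dtb[OF t]])
            also have "\<dots> \<le> C * (1 / real N) ^ Suc (Suc k)" by (intro mult_right_mono C(3)) simp
            finally show "\<bar>Dt 0 t x - quasi_spline k N (Dt 0 t) x\<bar> \<le> C * (1 / real N) ^ Suc (Suc k)" .
          qed
          show "L2_inner (Dt 0 t) \<phi> = conv_form (m t) (u t) \<phi>" if "\<phi> \<in> ?S" for \<phi>
          proof -
            have "\<forall>x\<in>{0..1}. Dt 0 t x + (Dm (Suc 0) t x * Du 0 t x + Dm 0 t x * Du (Suc 0) t x) + Dm 0 t x * Du (Suc 0) t x = 0"
              using data t unfolding D0 by blast
            from pde_weak_form[OF N Dmb[OF t] Dub[OF t] this that] show ?thesis unfolding D0 .
          qed
        qed (use N T C(1) I per bm bt cons dm traj scheme Y0 E_def small t in \<open>auto simp: mh_def M_def \<delta>_def\<close>)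
        have dmh: "((\<lambda>s. mh s x) has_real_derivative pspline (Suc k) N (c' t) x) (at t within {0..T})" if "t \<in> {0..T}" for t x
          unfolding mh_def pspline_def using traj that by (intro spl_has_derivative_param) blast
        have "semidiscrete_solution (Suc (Suc k)) N T u0 mh (\<lambda>t. elliptic k N (mh t))"
          unfolding semidiscrete_solution_alt[OF N]
        proof (intro conjI ballI allI)
          fix t assume t: "t \<in> {0..T}"
          show "mh t \<in> ?S" by (rule S(1)[OF t])
          show "(\<lambda>s. mh s x) differentiable (at t within {0..T})" for x
            using dmh[OF t] has_real_derivative_iff_has_vector_derivative differentiableI_vector by blast
          fix \<phi> assume \<phi>: "\<phi> \<in> ?S"
          have "time_deriv T mh t = pspline (Suc k) N (c' t)"
            by (rule ext) (rule time_deriv_eq[OF T t dmh[OF t]])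
          \<comment> \<open>The error bound keeps \<theta> below \<delta> at every time, so the
            truncation was never active and the trajectory solves the scheme itself.\<close>
          then show "L2_inner (time_deriv T mh t) \<phi> = conv_form (mh t) (elliptic k N (mh t)) \<phi>"
            using scheme[OF t \<phi>] err[OF t] small by simp
        next
          fix \<phi> assume \<phi>: "\<phi> \<in> ?S"
          have "L2_inner (mh 0) \<phi> = L2_inner (m 0) \<phi>" using init \<phi> unfolding mh_def by blast
          \<comment> \<open>The weak form of \<open>m = u - u_xx\<close> at time 0 identifies the
            prescribed initial functional with the pairing with \<open>m 0\<close> used in the
            construction.\<close>
          also have "\<dots> = L2_inner (u 0) \<phi> + L2_inner (Du (Suc 0) 0) (right_deriv \<phi>)"
            using smooth_h1_inner[OF N Dub[OF t0] ell[OF t0] \<phi>] D0 by simp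
          also have "L2_inner (Du (Suc 0) 0) (right_deriv \<phi>) = L2_inner (deriv (u 0)) (deriv \<phi>)"
            by (rule L2_inner_deriv_deriv_eq[symmetric, OF pu[OF t0] pw_deriv_spline[OF \<phi> N]])
          finally show "L2_inner (mh 0) \<phi> = L2_inner u0 \<phi> + L2_inner (deriv u0) (deriv \<phi>)" using D0 by simp
        qed simp
        moreover have "L2_nrm (\<lambda>x. m t x - mh t x) + L2_nrm (\<lambda>x. u t x - elliptic k N (mh t) x) \<le> (2 * C + 2 * E) * h ^ Suc (Suc k)"
          if t: "t \<in> {0..T}" for t
        proof -
          let ?\<theta> = "\<lambda>x. mh t x - M t x"
          have "L2_nrm (\<lambda>x. (m t x - M t x) - ?\<theta> x) \<le> L2_nrm (\<lambda>x. m t x - M t x) + L2_nrm ?\<theta>"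
            by (intro L2_nrm_diff_triangle bounded_borel_diff bm bb t)
          then have 1: "L2_nrm (\<lambda>x. m t x - mh t x) \<le> (C + E) * h ^ Suc (Suc k)"
            using Mb(1)[OF t] err[OF t] unfolding h by (simp add: distrib_right del: power_Suc)
          have "elliptic k N (\<lambda>x. 1 * M t x + 1 * ?\<theta> x) = (\<lambda>x. 1 * elliptic k N (M t) x + 1 * elliptic k N ?\<theta> x)"
            by (rule elliptic_linear[OF N bb(2)[OF t] bb(3)[OF t]])
          then have uh: "elliptic k N (mh t) = (\<lambda>x. elliptic k N (M t) x + elliptic k N ?\<theta> x)" by simp
          have be: "bounded_borel (elliptic k N (M t))" "bounded_borel (elliptic k N ?\<theta>)"
            by (rule spline_bounded_borel(1)[OF elliptic(1)[OF N] N], rule bb(2)[OF t],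
                rule spline_bounded_borel(1)[OF elliptic(1)[OF N] N], rule bb(3)[OF t])
          have "L2_nrm (\<lambda>x. (u t x - elliptic k N (M t) x) - elliptic k N ?\<theta> x)
             \<le> L2_nrm (\<lambda>x. u t x - elliptic k N (M t) x) + L2_nrm (elliptic k N ?\<theta>)"
            by (intro L2_nrm_diff_triangle bounded_borel_diff bu be t)
          also have "\<dots> \<le> C * h ^ Suc (Suc k) + E * h ^ Suc (Suc k)"
            using Mb(3)[OF t] elliptic_bound(1)[OF N bb(3)[OF t], of k] err[OF t] unfolding h by linarith
          finally have 2: "L2_nrm (\<lambda>x. u t x - elliptic k N (mh t) x) \<le> (C + E) * h ^ Suc (Suc k)"
            unfolding uh by (simp add: distrib_right diff_diff_eq del: power_Suc)
          have "(2 * C + 2 * E) * h ^ Suc (Suc k) = (C + E) * h ^ Suc (Suc k) + (C + E) * h ^ Suc (Suc k)"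
            by (simp add: distrib_right del: power_Suc)
          then show ?thesis using 1 2 by linarith
        qed
        ultimately show "\<exists>mh uh. semidiscrete_solution (Suc (Suc k)) N T u0 mh uh \<and>
          (\<forall>mh' uh'. semidiscrete_solution (Suc (Suc k)) N T u0 mh' uh' \<longrightarrow>
             (\<forall>t\<in>{0..T}. mh' t = mh t \<and> uh' t = uh t)) \<and>
          (\<forall>t\<in>{0..T}. L2_nrm (\<lambda>x. m t x - mh t x) + L2_nrm (\<lambda>x. u t x - uh t x) \<le> (2 * C + 2 * E) * h ^ Suc (Suc k))"
          using semidiscrete_solution_unique[OF N T]
          by (intro exI[of _ mh] exI[of _ "\<lambda>t. elliptic k N (mh t)"]) blast
      qed
    qed
  qed
qed

end
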